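(* Let $r\in\mathbb{Z}_{>0}$, $p,q\in\mathbb{C}^*$ with $|p|,|q|<1$, $\epsilon\in\{0,1\}$, and let $n_1,\ldots,n_8\in\mathbb{Z}$ satisfy $\sum_{a=1}^8n_a+4\epsilon=0$. For $t_1,\ldots,t_8\in\mathbb{C}^*$ with $\prod_{a=1}^8t_a=(pq)^2$ define $$U_\epsilon(t_a,n_a)=\frac{V_\epsilon^{(r)}(t_a,n_a;p,q)}{\prod_{k=1}^2\Gamma^{(r)}(t_kt_3,n_k+n_3+\epsilon)\,\Gamma^{(r)}(t_kt_3^{-1},n_k-n_3)}$$ and $$\mathcal{A}(t_1,\ldots,t_8,p;q^r)=\frac{\theta\left(\frac{t_1}{pq^{1-r}t_3},\,t_3t_1,\,\frac{t_3}{t_1};q^r\right)}{\theta\left(\frac{t_1}{t_2},\,\frac{t_2}{pq^{1-r}t_1},\,\frac{t_1t_2}{pq^{1-r}};q^r\right)}\prod_{a=4}^8\frac{\theta\left(\frac{t_2t_a}{pq^{1-r}};q^r\right)}{\theta(t_3t_a;q^r)} .$$ Then, as an identity of meromorphic functions of $t_1,\ldots,t_8$ on $\prod_{a=1}^8t_a=(pq)^2$, $$\mathcal{A}\Big(\tfrac{t_1}{q^{n_1+\epsilon/2}},\tfrac{t_2}{q^{n_2+\epsilon/2}},\tfrac{t_3}{q^{n_3+\epsilon/2}},\ldots,\tfrac{t_8}{q^{n_8+\epsilon/2}},p;q^r\Big)\Big(U_\epsilon(pt_1,p^{-1}t_2,n_1-1,n_2+1)-U_\epsilon(t_a,n_a)\Big)$$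 $$+\mathcal{A}\Big(\tfrac{t_2}{q^{n_2+\epsilon/2}},\tfrac{t_1}{q^{n_1+\epsilon/2}},\tfrac{t_3}{q^{n_3+\epsilon/2}},\ldots,\tfrac{t_8}{q^{n_8+\epsilon/2}},p;q^r\Big)\Big(U_\epsilon(p^{-1}t_1,pt_2,n_1+1,n_2-1)-U_\epsilon(t_a,n_a)\Big)+U_\epsilon(t_a,n_a)=0,$$ where $U_\epsilon(pt_1,p^{-1}t_2,n_1-1,n_2+1)$ denotes $U_\epsilon$ with $(t_1,t_2,n_1,n_2)$ replaced by $(pt_1,p^{-1}t_2,n_1-1,n_2+1)$ and all other parameters unchanged, and similarly for $U_\epsilon(p^{-1}t_1,pt_2,n_1+1,n_2-1)$.
   Context: Notation: $(z;p)_\infty=\prod_{j\ge0}(1-zp^j)$ for $|p|<1$; $\theta(z;p)=(z;p)_\infty(pz^{-1};p)_\infty$ for $z\in\mathbb{C}^*$; $\theta(x_1,\ldots,x_k;p)=\prod_{j=1}^k\theta(x_j;p)$. The elliptic gamma function is $\Gamma(z;p,q)=\prod_{j,k=0}^\infty\frac{1-z^{-1}p^{j+1}q^{k+1}}{1-zp^jq^k}$ for $|p|,|q|<1$, $z\in\mathbb{C}^*$. For $r\in\mathbb{Z}_{>0}$, $m\in\mathbb{Z}$, nonzero $p,q$ with $|p|,|q|<1$, the rarefied elliptic gamma function is the meromorphic function of $z\in\mathbb{C}^*$ $$\Gamma^{(r)}(z,m)=\Gamma^{(r)}(z,m;p,q)=(-z)^{\frac{m(m-1)}{2}}p^{\frac{m(m-1)(m-2)}{6}}q^{-\frac{m(m^2-1)}{6}}\;\Gamma(zp^m;p^r,pq)\,\Gamma(zq^{r-m};q^r,pq)$$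 (all exponents are integers). Products and quotients of these functions are understood as meromorphic functions. For $\epsilon\in\{0,1\}$, $t_a\in\mathbb{C}^*$ with $|t_a|<1$, $n_a\in\mathbb{Z}$ ($a=1,\ldots,8$) satisfying $\prod_{a=1}^8t_a=(pq)^2$ and $\sum_{a=1}^8n_a+4\epsilon=0$, the rarefied elliptic hypergeometric function is $$V_\epsilon^{(r)}(t_a,n_a;p,q)=\frac{(p^r;p^r)_\infty(q^r;q^r)_\infty}{4\pi\mathrm{i}}\sum_{m=0}^{r-1}\int_{\mathbb{T}}\frac{\prod_{a=1}^8\Gamma^{(r)}(t_az,n_a+\epsilon+m)\,\Gamma^{(r)}(t_az^{-1},n_a-m)}{\Gamma^{(r)}(z^2,2m+\epsilon)\,\Gamma^{(r)}(z^{-2},-2m-\epsilon)}\frac{dz}{z},$$ with $\mathbb{T}$ the positively oriented unit circle; for other values of $t_a$ (with $\prod_a t_a=(pq)^2$) it is defined by analytic (meromorphic) continuation in the $t_a$. A square root $q^{1/2}$ is fixed; only ratios and pairwise products of the arguments $t_aq^{-n_a-\epsilon/2}$ enter $\mathcal{A}$, so its choice is immaterial. *)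

theory Defs
  imports "HOL-Complex_Analysis.Complex_Analysis"
begin

no_notation fps_nth (infixl \<open>$\<close> 75)

section \<open>Meromorphic functions on a hypersurface in several complex variables\<close>

definition holo_several :: "(complex ^ 'n \<Rightarrow> complex) \<Rightarrow> (complex ^ 'n) set \<Rightarrow> bool" where
  "holo_several f U \<longleftrightarrow>
     (\<forall>t\<in>U. \<exists>D. (f has_derivative D) (at t) \<and> (\<forall>c v. D (c *s v) = c * D v))"

text \<open>
  \<open>S\<close> is meant to be a complex submanifold of \<open>\<complex>\<^sup>n\<close>. Holomorphic functions on \<open>S\<close> extend
  locally to the ambient space, so \<open>f\<close> is meromorphic on \<open>S\<close> iff, near each point of \<open>S\<close>, it is
  a quotient of two ambient holomorphic functions whose denominator does not vanish identically
  on any nonempty relatively open piece of \<open>S\<close>. The value of \<open>f\<close> at a zero of the denominator is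
  irrelevant.
\<close>

definition mero_several :: "(complex ^ 'n \<Rightarrow> complex) \<Rightarrow> (complex ^ 'n) set \<Rightarrow> bool" where
  "mero_several f S \<longleftrightarrow>
     (\<forall>t\<in>S. \<exists>U g h. open U \<and> t \<in> U \<and> holo_several g U \<and> holo_several h U \<and>
        S \<inter> U \<subseteq> closure {s \<in> S \<inter> U. h s \<noteq> 0} \<and>
        (\<forall>s\<in>S \<inter> U. h s \<noteq> 0 \<longrightarrow> f s = g s / h s))"

text \<open>
  Equality of meromorphic functions on \<open>S\<close>: agreement on a dense relatively open subset. Values
  on the thin set where some term has a pole or an indeterminacy carry no meaning.
\<close>

definition mero_eq_on :: "(complex ^ 'n) set \<Rightarrow> (complex ^ 'n \<Rightarrow> complex) \<Rightarrow> (complex ^ 'n \<Rightarrow> complex) \<Rightarrow> bool" where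
  "mero_eq_on S f g \<longleftrightarrow>
     (\<exists>D. openin (top_of_set S) D \<and> S \<subseteq> closure D \<and> (\<forall>t\<in>D. f t = g t))"


section \<open>Theta and gamma functions\<close>

definition qpoch_inf :: "complex \<Rightarrow> complex \<Rightarrow> complex" where
  "qpoch_inf z p = (\<Prod>j. 1 - z * p ^ j)"

definition theta :: "complex \<Rightarrow> complex \<Rightarrow> complex" where
  "theta z p = qpoch_inf z p * qpoch_inf (p / z) p"

definition ell_gamma :: "complex \<Rightarrow> complex \<Rightarrow> complex \<Rightarrow> complex" where
  "ell_gamma z p q =
     (\<Prod>j. \<Prod>k. (1 - inverse z * p ^ (j + 1) * q ^ (k + 1)) / (1 - z * p ^ j * q ^ k))"

text \<open>
  For \<open>m\<close> outside \<open>{0..r}\<close>, poles of one of the two elliptic gamma factors cancel against zeros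
  of the other. Applying \<^const>\<open>remove_sings\<close> gives the meromorphic function its correct value
  at such points (and the value 0 at genuine poles). The integer divisions are exact.
\<close>

definition rgamma :: "nat \<Rightarrow> complex \<Rightarrow> complex \<Rightarrow> complex \<Rightarrow> int \<Rightarrow> complex" where
  "rgamma r p q z m =
     remove_sings (\<lambda>w. (- w) powi (m * (m - 1) div 2)
        * p powi (m * (m - 1) * (m - 2) div 6)
        * q powi (- (m * (m\<^sup>2 - 1) div 6))
        * ell_gamma (w * p powi m) (p ^ r) (p * q)
        * ell_gamma (w * q powi (int r - m)) (q ^ r) (p * q)) z"


section \<open>The rarefied elliptic hypergeometric function\<close>

text \<open>
  Parameters are indexed by the eight-element type \<open>8\<close>, whose elements are written \<open>1, \<dots>, 8\<close>.
  Since \<open>8 = 0\<close> in this type, its order is not the expected one and intervals are avoided.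
\<close>

definition balanced :: "complex \<Rightarrow> complex \<Rightarrow> (complex ^ 8) set" where
  "balanced p q = {t. (\<Prod>a\<in>UNIV. t $ a) = (p * q)\<^sup>2}"

definition V_integrand ::
  "nat \<Rightarrow> complex \<Rightarrow> complex \<Rightarrow> int \<Rightarrow> int ^ 8 \<Rightarrow> complex ^ 8 \<Rightarrow> int \<Rightarrow> complex \<Rightarrow> complex" where
  "V_integrand r p q \<epsilon> n t m z =
     (\<Prod>a\<in>UNIV. rgamma r p q (t $ a * z) (n $ a + \<epsilon> + m) * rgamma r p q (t $ a * inverse z) (n $ a - m))
     / (rgamma r p q (z\<^sup>2) (2 * m + \<epsilon>) * rgamma r p q (inverse (z\<^sup>2)) (- 2 * m - \<epsilon>))"

definition V_integral ::
  "nat \<Rightarrow> complex \<Rightarrow> complex \<Rightarrow> int \<Rightarrow> int ^ 8 \<Rightarrow> complex ^ 8 \<Rightarrow> complex" where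
  "V_integral r p q \<epsilon> n t =
     qpoch_inf (p ^ r) (p ^ r) * qpoch_inf (q ^ r) (q ^ r) / (4 * of_real pi * \<i>)
     * (\<Sum>m<r. contour_integral (circlepath 0 1) (\<lambda>z. V_integrand r p q \<epsilon> n t (int m) z / z))"

definition V_continuation ::
  "nat \<Rightarrow> complex \<Rightarrow> complex \<Rightarrow> int \<Rightarrow> int ^ 8 \<Rightarrow> (complex ^ 8 \<Rightarrow> complex) \<Rightarrow> bool" where
  "V_continuation r p q \<epsilon> n W \<longleftrightarrow>
     mero_several W (balanced p q) \<and>
     (\<forall>t\<in>balanced p q. (\<forall>a. norm (t $ a) < 1) \<longrightarrow> W t = V_integral r p q \<epsilon> n t)"

text \<open>
  The hypersurface is connected and contains points with all \<open>norm (t $ a) < 1\<close>, so the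
  continuation is unique as a meromorphic function; the choice below only selects its values
  on a thin set.
\<close>

definition V_fun ::
  "nat \<Rightarrow> complex \<Rightarrow> complex \<Rightarrow> int \<Rightarrow> int ^ 8 \<Rightarrow> complex ^ 8 \<Rightarrow> complex" where
  "V_fun r p q \<epsilon> n = (SOME W. V_continuation r p q \<epsilon> n W)"

definition U_fun ::
  "nat \<Rightarrow> complex \<Rightarrow> complex \<Rightarrow> int \<Rightarrow> int ^ 8 \<Rightarrow> complex ^ 8 \<Rightarrow> complex" where
  "U_fun r p q \<epsilon> n t =
     V_fun r p q \<epsilon> n t /
     (\<Prod>k\<in>{1, 2}. rgamma r p q (t $ k * t $ 3) (n $ k + n $ 3 + \<epsilon>)
                * rgamma r p q (t $ k / t $ 3) (n $ k - n $ 3))"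

definition A_fun :: "nat \<Rightarrow> complex \<Rightarrow> complex \<Rightarrow> complex ^ 8 \<Rightarrow> complex" where
  "A_fun r p q x =
     (let c = p * q powi (1 - int r); Q = q ^ r in
        (theta (x $ 1 / (c * x $ 3)) Q * theta (x $ 3 * x $ 1) Q * theta (x $ 3 / x $ 1) Q)
      / (theta (x $ 1 / x $ 2) Q * theta (x $ 2 / (c * x $ 1)) Q * theta (x $ 1 * x $ 2 / c) Q)
      * (\<Prod>a\<in>{4, 5, 6, 7, 8}. theta (x $ 2 * x $ a / c) Q / theta (x $ 3 * x $ a) Q))"

text \<open>The rescaled arguments \<open>t\<^sub>a / q^(n\<^sub>a + \<epsilon>/2)\<close>, for a chosen square root \<open>qh\<close> of \<open>q\<close>.\<close>

definition A_args :: "complex \<Rightarrow> int \<Rightarrow> int ^ 8 \<Rightarrow> complex ^ 8 \<Rightarrow> complex ^ 8" where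
  "A_args qh \<epsilon> n t = (\<chi> a. t $ a / qh powi (2 * n $ a + \<epsilon>))"

definition upd12 :: "'a \<Rightarrow> 'a \<Rightarrow> 'a ^ 8 \<Rightarrow> 'a ^ 8" where
  "upd12 u v x = (\<chi> a. if a = 1 then u else if a = 2 then v else x $ a)"

end

theory Submission
  imports Defs
begin

text \<open>
  With \<open>u = (t\<^sub>1/p, t\<^sub>2/p, t\<^sub>3, \<dots>, t\<^sub>8)\<close>, whose product is \<open>q\<^sup>2\<close>, the
  equation relates the three integrals obtained from \<open>u\<close> by multiplying two of
  \<open>u\<^sub>1, u\<^sub>2, u\<^sub>3\<close> by \<open>p\<close>; this turns the integrand for \<open>u\<close> into itself times two products
  \<open>\<theta>(\<tau>x) \<theta>(\<tau>/x)\<close>. A theta identity, proved by counting zeros, combines the three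
  integrands into \<open>h(z) + h(1/z)\<close>, where \<open>h\<close> is antisymmetric under \<open>z \<mapsto> 1/(pz)\<close>. Moving
  the contour from \<open>\<bar>z\<bar> = 1\<close> to \<open>\<bar>z\<bar> = 1/\<bar>p\<bar>\<close> crosses no pole and shows that the integral
  of \<open>h\<close> vanishes. The differences of \<open>U\<close> in the theorem arise from the three
  integrals by the addition formula for \<open>\<theta>\<close>. All this happens on an open set of
  parameters; the general case follows by the identity theorem on the connected hypersurface.
\<close>

section \<open>Infinite products\<close>

text \<open>Why a shift by \<open>p\<close> comes with a shift of \<open>n\<close>: multiplying
  \<open>t\<close> by \<open>p\<close> and lowering \<open>n\<close> by 1 fixes the argument of the
  elliptic gamma factor of base \<open>p ^ r\<close> and multiplies that of base
  \<open>q ^ r\<close> by \<open>p * q\<close>. So only theta functions of base \<open>q ^ r\<close>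
  appear, and \<open>t / q^(n + \<epsilon>/2)\<close>, the arguments of \<open>A_fun\<close>, are
  the natural variables. Two obstacles shape the proof. \<open>V_fun\<close> is a chosen
  continuation, about which nothing is known until one is shown to exist: once some parameters leave
  the unit disc, poles cross the circle and may pinch it, so the integral is continued as a quotient
  of ambient holomorphic functions on ever larger polydiscs. Moreover, values at poles are
  conventional (0), so identities between gamma functions are proved in punctured neighbourhoods and
  extended by continuity where both sides are regular. The open set has to be exhibited as well:
  besides norms below 1 it asks that \<open>u $ 1\<close> and \<open>u $ 2\<close> be smaller in
  norm than \<open>u $ 3\<close>, which keeps the quotients in the denominator of
  \<open>U_fun\<close> inside the unit disc.\<close>

context
  fixes f :: "complex \<Rightarrow> complex" and p :: complex
  assumes f: "f holomorphic_on UNIV" and f0: "f 0 = 1" and p: "norm p < 1"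
begin

text \<open>This bound makes the products converge: \<open>f (z * p ^ j) - 1\<close> is dominated by
  a geometric series, uniformly for bounded \<open>z\<close>. The context is used twice, with
  \<open>f\<close> a linear factor and with \<open>f\<close> itself a q-Pochhammer symbol.\<close>

lemma eprod_bound: "\<exists>C\<ge>0. \<forall>w. norm w \<le> R \<longrightarrow> norm (f w - 1) \<le> C * norm w"
proof (cases "R \<ge> 0")
  case True
  have "continuous_on (cball 0 R) (deriv f)"
    by (intro holomorphic_on_imp_continuous_on holomorphic_on_subset[OF holomorphic_deriv[OF f]]) auto
  then have "bounded (deriv f ` cball 0 R)"
    by (intro compact_imp_bounded compact_continuous_image) auto
  then obtain B where "\<forall>x\<in>deriv f ` cball 0 R. norm x \<le> B" unfolding bounded_iff by blast
  then have B: "norm (deriv f w) \<le> B" if "norm w \<le> R" for w using that by auto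
  have "norm (f w - f 0) \<le> B * norm (w - 0)" if "norm w \<le> R" for w
  proof (rule field_differentiable_bound[of "cball 0 R" f "deriv f"])
    show "(f has_field_derivative deriv f z) (at z within cball 0 R)" for z
      by (rule has_field_derivative_at_within[OF holomorphic_derivI[OF f]]) auto
  qed (use B that True in auto)
  moreover have "0 \<le> B" using B[of 0] True norm_ge_zero order_trans by (metis norm_zero)
  ultimately show ?thesis using f0 by auto
next
  case False
  then have "\<And>w::complex. \<not> norm w \<le> R" using norm_ge_zero order_trans by blast
  then show ?thesis by (intro exI[of _ 0]) auto
qed

lemma eprod_abs_conv: "abs_convergent_prod (\<lambda>j. f (z * p ^ j))"
proof -
  obtain C where C: "C \<ge> 0" "\<And>w. norm w \<le> norm z \<Longrightarrow> norm (f w - 1) \<le> C * norm w"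
    using eprod_bound by blast
  have "summable (\<lambda>j. norm (f (z * p ^ j) - 1))"
  proof (rule summable_comparison_test')
    show "summable (\<lambda>j. C * norm z * norm p ^ j)" using p by (intro summable_mult summable_geometric) auto
    fix j :: nat
    have "norm (z * p ^ j) \<le> norm z" using p
      by (simp add: norm_mult norm_power mult_left_le power_le_one)
    from C(2)[OF this] show "norm (norm (f (z * p ^ j) - 1)) \<le> C * norm z * norm p ^ j"
      by (simp add: norm_mult norm_power mult.assoc)
  qed
  then show ?thesis by (simp add: abs_convergent_prod_conv_summable)
qed

lemma eprod_conv: "convergent_prod (\<lambda>j. f (z * p ^ j))"
  by (rule abs_convergent_prod_imp_convergent_prod[OF eprod_abs_conv])

lemma eprod_holo: "(\<lambda>z. \<Prod>j. f (z * p ^ j)) holomorphic_on A"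
proof -
  let ?F = "\<lambda>z. \<Prod>j. f (z * p ^ j)"
  have ul: "uniform_limit (cball 0 R) (\<lambda>N z. \<Prod>n<N. f (z * p ^ n)) ?F sequentially" if "R > 0" for R
  proof -
    obtain C where C: "C \<ge> 0" "\<And>w. norm w \<le> R \<Longrightarrow> norm (f w - 1) \<le> C * norm w"
      using eprod_bound by blast
    have cf: "continuous_on UNIV f" using f holomorphic_on_imp_continuous_on by blast
    have "uniformly_convergent_on (cball 0 R) (\<lambda>N z. \<Prod>n<N. f (z * p ^ n))"
    proof (rule uniformly_convergent_on_prod')
      show "continuous_on (cball 0 R) (\<lambda>z. f (z * p ^ n))" for n
        by (intro continuous_on_compose2[OF cf] continuous_intros) auto
      show "uniformly_convergent_on (cball 0 R) (\<lambda>N x. \<Sum>n<N. norm (f (x * p ^ n) - 1))"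
      proof (rule Weierstrass_m_test'[where M = "\<lambda>n. C * R * norm p ^ n"])
        show "summable (\<lambda>j. C * R * norm p ^ j)" using p by (intro summable_mult summable_geometric) auto
        fix j :: nat and z :: complex assume "z \<in> cball 0 R"
        then have z: "norm z \<le> R" by auto
        then have "norm (z * p ^ j) \<le> R" using p
          by (smt (verit, best) norm_mult norm_power mult_left_le norm_ge_zero power_le_one)
        from C(2)[OF this] have "norm (f (z * p ^ j) - 1) \<le> C * (norm z * norm p ^ j)"
          by (simp add: norm_mult norm_power)
        also have "\<dots> \<le> C * (R * norm p ^ j)"
          using z C(1) by (intro mult_left_mono mult_right_mono) auto
        finally show "norm (norm (f (z * p ^ j) - 1)) \<le> C * R * norm p ^ j" by simp
      qed
    qed auto
    then obtain l where l: "uniform_limit (cball 0 R) (\<lambda>N z. \<Prod>n<N. f (z * p ^ n)) l sequentially"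
      by (auto simp: uniformly_convergent_on_def)
    have "l z = ?F z" if "z \<in> cball 0 R" for z
    proof -
      have "(\<lambda>N. \<Prod>n<N. f (z * p ^ n)) \<longlonglongrightarrow> l z" by (rule tendsto_uniform_limitI[OF l that])
      moreover have "(\<lambda>N. \<Prod>n<N. f (z * p ^ n)) \<longlonglongrightarrow> ?F z"
        using convergent_prod_LIMSEQ[OF eprod_conv[of z]] by (simp add: LIMSEQ_lessThan_iff_atMost)
      ultimately show ?thesis by (rule LIMSEQ_unique)
    qed
    then show ?thesis using l by (metis (mono_tags, lifting) uniform_limit_cong')
  qed
  have "?F holomorphic_on UNIV"
  proof (rule holomorphic_uniform_sequence[of _ "\<lambda>N z. \<Prod>n<N. f (z * p ^ n)"])
    show "(\<lambda>z. \<Prod>n<N. f (z * p ^ n)) holomorphic_on UNIV" for N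
      by (intro holomorphic_on_prod holomorphic_on_compose_gen[OF _ f, unfolded o_def] holomorphic_intros) auto
    fix x :: complex
    show "\<exists>d>0. cball x d \<subseteq> UNIV \<and>
      uniform_limit (cball x d) (\<lambda>N z. \<Prod>n<N. f (z * p ^ n)) ?F sequentially"
    proof (intro exI[of _ 1] conjI)
      have "cball x 1 \<subseteq> cball 0 (norm x + 1)"
        by (smt (verit) dist_0_norm dist_norm mem_cball norm_triangle_sub subsetI norm_minus_commute)
      then show "uniform_limit (cball x 1) (\<lambda>N z. \<Prod>n<N. f (z * p ^ n)) ?F sequentially"
        by (intro uniform_limit_on_subset[OF ul[of "norm x + 1"]]) (auto intro: add_nonneg_pos)
    qed auto
  qed auto
  then show ?thesis by (rule holomorphic_on_subset) auto
qed

lemma eprod_rec: "(\<Prod>j. f (z * p ^ j)) = f z * (\<Prod>j. f (z * p * p ^ j))"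
proof -
  have "(\<lambda>j. f (z * p * p ^ j)) has_prod (\<Prod>j. f (z * p * p ^ j))"
    by (rule convergent_prod_has_prod[OF eprod_conv])
  then have c: "convergent_prod (\<lambda>j. f (z * p ^ j))" using eprod_conv by blast
  show ?thesis
  \<comment> \<open>Splitting off the first factor with \<open>has_prod_Suc_iff\<close> needs it to
    be nonzero; if it vanishes, both sides are 0.\<close>
  proof (cases "f z = 0")
    case True
    then have "(\<lambda>j. f (z * p ^ j)) has_prod 0"
    proof -
      have "f (z * p ^ 0) = 0" using True by simp
      then have "0 \<in> range (\<lambda>j. f (z * p ^ j))" by (metis rangeI)
      then have "(\<Prod>j. f (z * p ^ j)) = 0"
        by (simp only: has_prod_eq_0_iff[OF convergent_prod_has_prod[OF c]])
      then show ?thesis using convergent_prod_has_prod[OF c] by simp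
    qed
    then show ?thesis using True by (simp add: has_prod_iff)
  next
    case False
    have "(\<lambda>j. f (z * p ^ Suc j)) has_prod (\<Prod>j. f (z * p * p ^ j))"
      using convergent_prod_has_prod[OF eprod_conv[of "z * p"]] by (simp add: mult.assoc)
    then have "(\<lambda>j. f (z * p ^ j)) has_prod ((\<Prod>j. f (z * p * p ^ j)) * f (z * p ^ 0))"
      using False by (subst has_prod_Suc_iff[symmetric]) auto
    then have "(\<Prod>j. f (z * p ^ j)) = (\<Prod>j. f (z * p * p ^ j)) * f (z * p ^ 0)"
      by (simp add: has_prod_iff)
    then show ?thesis by (simp add: mult.assoc)
  qed
qed

lemma eprod_eq_0_iff: "(\<Prod>j. f (z * p ^ j)) = 0 \<longleftrightarrow> (\<exists>j. f (z * p ^ j) = 0)"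
proof -
  have "(\<Prod>j. f (z * p ^ j)) = 0 \<longleftrightarrow> 0 \<in> range (\<lambda>j. f (z * p ^ j))"
    by (rule has_prod_eq_0_iff[OF convergent_prod_has_prod[OF eprod_conv]])
  then show ?thesis by (metis (no_types, lifting) imageE rangeI)
qed

end

section \<open>Single and double q-Pochhammer products\<close>

definition dpoch :: "complex \<Rightarrow> complex \<Rightarrow> complex \<Rightarrow> complex" where
  "dpoch z p q = (\<Prod>j. qpoch_inf (z * p ^ j) q)"

lemma qpoch_holo: "norm q < 1 \<Longrightarrow> (\<lambda>z. qpoch_inf z q) holomorphic_on A"
  unfolding qpoch_inf_def by (rule eprod_holo) (auto intro!: holomorphic_intros)

lemma qpoch_conv: "norm (q::complex) < 1 \<Longrightarrow> convergent_prod (\<lambda>j. 1 - z * q ^ j)"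
  using eprod_conv[of "\<lambda>z. 1 - z" q z] holomorphic_on_diff[OF holomorphic_on_const holomorphic_on_ident, of 1 UNIV]
  by simp

lemma qpoch_rec: "norm q < 1 \<Longrightarrow> qpoch_inf z q = (1 - z) * qpoch_inf (z * q) q"
  unfolding qpoch_inf_def by (rule eprod_rec) (auto intro!: holomorphic_intros)

lemma qpoch_0 [simp]: "qpoch_inf 0 q = 1"
  by (simp add: qpoch_inf_def)

lemma qpoch_eq_0_iff: "norm q < 1 \<Longrightarrow> qpoch_inf z q = 0 \<longleftrightarrow> (\<exists>j. z * q ^ j = 1)"
  unfolding qpoch_inf_def by (subst eprod_eq_0_iff) (auto intro!: holomorphic_intros)

lemma qpoch_nz: "norm q < 1 \<Longrightarrow> norm z < 1 \<Longrightarrow> qpoch_inf z q \<noteq> 0"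
proof
  assume *: "norm q < 1" "norm z < 1" "qpoch_inf z q = 0"
  then obtain j where "z * q ^ j = 1" using qpoch_eq_0_iff by blast
  then have "norm z * norm q ^ j = 1" by (metis norm_mult norm_one norm_power)
  moreover have "norm z * norm q ^ j \<le> norm z" using * by (simp add: mult_left_le power_le_one)
  ultimately show False using * by simp
qed

text \<open>Iterating the products lets the context apply again, now with the entire function
  \<open>\<lambda>z. qpoch_inf z q\<close>, whose value at 0 is 1.\<close>

lemma dpoch_holo: "norm p < 1 \<Longrightarrow> norm q < 1 \<Longrightarrow> (\<lambda>z. dpoch z p q) holomorphic_on A"
  unfolding dpoch_def by (rule eprod_holo) (auto intro!: qpoch_holo)

lemma dpoch_rec1: "norm p < 1 \<Longrightarrow> norm q < 1 \<Longrightarrow> dpoch z p q = qpoch_inf z q * dpoch (z * p) p q"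
  unfolding dpoch_def by (rule eprod_rec) (auto intro!: qpoch_holo)

lemma dpoch_conv: "norm p < 1 \<Longrightarrow> norm q < 1 \<Longrightarrow> convergent_prod (\<lambda>j. qpoch_inf (z * p ^ j) q)"
  by (rule eprod_conv) (auto intro!: qpoch_holo)

text \<open>\<open>dpoch\<close> is not visibly symmetric in \<open>p\<close> and \<open>q\<close>.
  The recursion in \<open>q\<close> comes from splitting off the first factor of every inner
  product.\<close>

lemma dpoch_rec2:
  assumes "norm p < 1" "norm q < 1"
  shows "dpoch z p q = qpoch_inf z p * dpoch (z * q) p q"
proof -
  have "dpoch z p q = (\<Prod>j. (1 - z * p ^ j) * qpoch_inf (z * q * p ^ j) q)"
    unfolding dpoch_def by (subst qpoch_rec[OF assms(2)]) (simp add: mult_ac)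
  also have "\<dots> = qpoch_inf z p * dpoch (z * q) p q"
    unfolding dpoch_def qpoch_inf_def[of z]
    using assms by (intro prodinf_mult[symmetric] qpoch_conv dpoch_conv)
  finally show ?thesis .
qed

lemma dpoch_0 [simp]: "dpoch 0 p q = 1"
  by (simp add: dpoch_def)

lemma dpoch_nz: "norm p < 1 \<Longrightarrow> norm q < 1 \<Longrightarrow> norm z < 1 \<Longrightarrow> dpoch z p q \<noteq> 0"
  unfolding dpoch_def
proof (subst eprod_eq_0_iff)
  assume *: "norm p < 1" "norm q < 1" "norm z < 1"
  have "norm (z * p ^ j) \<le> norm z" for j
    using * by (simp add: norm_mult norm_power mult_left_le power_le_one)
  then have "norm (z * p ^ j) < 1" for j using * order.strict_trans1 by blast
  then show "\<not> (\<exists>j. qpoch_inf (z * p ^ j) q = 0)" using * qpoch_nz by blast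
qed (auto intro!: qpoch_holo)

text \<open>Holds at poles too: where the denominator vanishes, both sides are 0 because
  \<open>x / 0 = 0\<close>.\<close>

lemma ell_gamma_eq:
  assumes "norm p < 1" "norm q < 1"
  shows "ell_gamma z p q = dpoch (p * q / z) p q / dpoch z p q"
proof -
  have "(\<Prod>k. (1 - inverse z * p ^ (j + 1) * q ^ (k + 1)) / (1 - z * p ^ j * q ^ k))
        = qpoch_inf (p * q / z * p ^ j) q / qpoch_inf (z * p ^ j) q" for j
    unfolding qpoch_inf_def
    using assms by (subst prodinf_divide[OF qpoch_conv qpoch_conv]) (auto simp: field_simps)
  then have "ell_gamma z p q = (\<Prod>j. qpoch_inf (p * q / z * p ^ j) q / qpoch_inf (z * p ^ j) q)"
    by (simp add: ell_gamma_def)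
  also have "\<dots> = dpoch (p * q / z) p q / dpoch z p q"
    unfolding dpoch_def using assms by (intro prodinf_divide[symmetric] dpoch_conv)
  finally show ?thesis .
qed

section \<open>Theta functions\<close>

lemma theta_holo: "norm Q < 1 \<Longrightarrow> 0 \<notin> A \<Longrightarrow> (\<lambda>z. theta z Q) holomorphic_on A"
  unfolding theta_def
  by (intro holomorphic_intros qpoch_holo holomorphic_on_compose_gen[OF _ qpoch_holo[of Q UNIV], unfolded o_def]) auto

lemma theta_inv: "Q \<noteq> 0 \<Longrightarrow> theta (Q / z) Q = theta z Q"
  by (cases "z = 0") (auto simp: theta_def mult.commute)

lemma theta_shift:
  assumes "norm Q < 1" "Q \<noteq> 0" "z \<noteq> 0"
  shows "theta (Q * z) Q = - theta z Q / z"
proof -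
  have "qpoch_inf z Q = (1 - z) * qpoch_inf (Q * z) Q" using qpoch_rec[OF assms(1), of z] by (simp add: mult.commute)
  moreover have "qpoch_inf (1 / z) Q = (1 - 1 / z) * qpoch_inf (Q / z) Q"
    using qpoch_rec[OF assms(1), of "1/z"] by (simp add: mult.commute)
  moreover have "Q / (Q * z) = 1 / z" using assms by simp
  ultimately show ?thesis using assms by (simp add: theta_def) (simp add: field_simps)
qed

lemma theta_recip:
  assumes "norm Q < 1" "Q \<noteq> 0" "z \<noteq> 0"
  shows "theta (1 / z) Q = - theta z Q / z"
proof -
  have "theta (1 / z) Q = theta (Q / (1 / z)) Q" by (rule theta_inv[OF assms(2), symmetric])
  also have "\<dots> = theta (Q * z) Q" by simp
  finally show ?thesis using theta_shift assms by simp
qed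

lemma theta_one [simp]: "norm Q < 1 \<Longrightarrow> theta 1 Q = 0"
  using qpoch_eq_0_iff[of Q 1] by (auto simp: theta_def intro: exI[of _ 0])

text \<open>Both sides obey the same first-order recurrence in \<open>m\<close>, which is run
  upwards and downwards from 0.\<close>

lemma theta_shift_powi:
  assumes "norm Q < 1" "Q \<noteq> 0" "z \<noteq> 0"
  shows "theta (z * Q powi m) Q = (- z) powi (- m) * Q powi (- (m * (m - 1) div 2)) * theta z Q"
proof -
  define c where "c = (\<lambda>m. (- z) powi (- m) * Q powi (- (m * (m - 1) div 2)))"
  have c: "c (i + 1) = - c i / (z * Q powi i)" for i
  proof -
    have "(i + 1) * (i + 1 - 1) = i * (i - 1) + i * 2" by (simp add: algebra_simps)
    then have e: "(i + 1) * (i + 1 - 1) div 2 = i * (i - 1) div 2 + i" by simp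
    have "(- z) powi (- (i + 1)) = (- z) powi (- i) / (- z)"
      using power_int_diff[of "- z" "- i" 1] assms by simp
    moreover have "Q powi (- (i * (i - 1) div 2 + i)) = Q powi (- (i * (i - 1) div 2)) / Q powi i"
    proof -
      have "- (i * (i - 1) div 2 + i) = - (i * (i - 1) div 2) - i" by linarith
      then show ?thesis using power_int_diff[of Q "- (i * (i - 1) div 2)" i] assms by metis
    qed
    ultimately show ?thesis unfolding c_def e by simp
  qed
  have t: "theta (z * Q powi (i + 1)) Q = - theta (z * Q powi i) Q / (z * Q powi i)" for i
  proof -
    have "theta (z * Q powi (i + 1)) Q = theta (Q * (z * Q powi i)) Q"
      using assms by (simp add: power_int_add mult_ac)
    then show ?thesis using assms by (simp add: theta_shift)
  qed
  have nz: "z * Q powi i \<noteq> 0" for i using assms by simp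
  have "theta (z * Q powi m) Q = c m * theta z Q"
  proof (induction m rule: int_induct[where k = 0])
    case base
    then show ?case by (simp add: c_def)
  next
    case (step1 i)
    then show ?case unfolding t c by simp
  next
    case (step2 i)
    then show ?case using t[of "i - 1"] c[of "i - 1"] nz[of "i - 1"] by (simp add: divide_eq_eq)
  qed
  then show ?thesis by (simp add: c_def)
qed

lemma theta_eq_0_iff:
  assumes "norm Q < 1" "Q \<noteq> 0" "z \<noteq> 0"
  shows "theta z Q = 0 \<longleftrightarrow> (\<exists>j. z = Q powi j)"
proof
  assume "theta z Q = 0"
  then consider j where "z * Q ^ j = 1" | j where "Q / z * Q ^ j = 1"
    using qpoch_eq_0_iff[OF assms(1)] by (auto simp: theta_def)
  then show "\<exists>j. z = Q powi j"
  proof cases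
    case (1 j)
    then have "z = Q powi (- int j)" using assms by (simp add: power_int_minus field_simps)
    then show ?thesis by blast
  next
    case (2 j)
    then have "z = Q powi (int j + 1)" using assms by (simp add: power_int_add field_simps)
    then show ?thesis by blast
  qed
next
  assume "\<exists>j. z = Q powi j"
  then obtain j where "z = Q powi j" by blast
  then show "theta z Q = 0" using theta_shift_powi[of Q 1 j] assms by simp
qed

lemma theta_ev_nz:
  assumes "norm Q < 1" "Q \<noteq> 0" "c \<noteq> 0" "z \<noteq> 0"
  shows "eventually (\<lambda>w. theta (c * w) Q \<noteq> 0) (at z)"
proof -
  have "\<exists>b. b \<noteq> 0 \<and> theta b Q \<noteq> 0"
  proof -
    \<comment> \<open>For \<open>norm Q < s < 1\<close> both factors of theta have their arguments
      inside the unit disc, so \<open>s\<close> is a point where theta does not vanish.\<close>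
    have "\<exists>s. norm Q < s \<and> s < 1" using assms dense by blast
    then obtain s where s: "norm Q < s" "s < 1" by blast
    then have "0 < s" using norm_ge_zero[of Q] by linarith
    moreover from this have "theta (of_real s) Q \<noteq> 0"
      using s assms \<open>0 < s\<close> qpoch_nz[of Q "of_real s"] qpoch_nz[of Q "Q / of_real s"]
      by (simp add: theta_def norm_divide)
    ultimately show ?thesis by (intro exI[of _ "of_real s"]) auto
  qed
  then obtain b where b: "b \<noteq> 0" "theta b Q \<noteq> 0" by blast
  have "eventually (\<lambda>w. theta (c * w) Q \<noteq> 0 \<and> w \<in> - {0}) (at z)"
    using assms b
    by (intro non_zero_neighbour_alt[where \<beta> = "b / c"] connected_punctured_universe
         holomorphic_on_compose_gen[OF _ theta_holo[of Q "- {0}"], unfolded o_def] holomorphic_intros) auto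
  then show ?thesis by (rule eventually_mono) auto
qed

lemma qpoch_ev_nz:
  assumes "norm Q < 1" "c \<noteq> 0" "z \<noteq> 0"
  shows "eventually (\<lambda>w. qpoch_inf (c * w) Q \<noteq> 0) (at z)" "eventually (\<lambda>w. qpoch_inf (c / w) Q \<noteq> 0) (at z)"
proof -
  have "eventually (\<lambda>w. qpoch_inf (c * w) Q \<noteq> 0 \<and> w \<in> UNIV) (at z)"
    using assms
    by (intro non_zero_neighbour_alt[where \<beta> = 0] 
         holomorphic_on_compose_gen[OF _ qpoch_holo[of Q UNIV], unfolded o_def] holomorphic_intros) auto
  then show "eventually (\<lambda>w. qpoch_inf (c * w) Q \<noteq> 0) (at z)" by (rule eventually_mono) auto
  \<comment> \<open>The witness is \<open>w = 2 * c\<close>, where the argument is 1/2 and lies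
    inside the unit disc.\<close>
  have "eventually (\<lambda>w. qpoch_inf (c / w) Q \<noteq> 0 \<and> w \<in> - {0}) (at z)"
    using assms
    by (intro non_zero_neighbour_alt[where \<beta> = "2 * c"] connected_punctured_universe qpoch_nz
         holomorphic_on_compose_gen[OF _ qpoch_holo[of Q UNIV], unfolded o_def] holomorphic_intros) auto
  then show "eventually (\<lambda>w. qpoch_inf (c / w) Q \<noteq> 0) (at z)" by (rule eventually_mono) auto
qed

lemma dpoch_ev_nz:
  assumes "norm p < 1" "norm q < 1"
  shows "eventually (\<lambda>w. dpoch (c * w) p q \<noteq> 0) (at z)"
proof -
  have "eventually (\<lambda>w. dpoch (c * w) p q \<noteq> 0 \<and> w \<in> UNIV) (at z)"
    using assms
    by (intro non_zero_neighbour_alt[where \<beta> = 0]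
         holomorphic_on_compose_gen[OF _ dpoch_holo[of p q UNIV], unfolded o_def] holomorphic_intros) auto
  then show ?thesis by (rule eventually_mono) auto
qed

lemma eventually_at_mult:
  fixes c z :: complex
  assumes "c \<noteq> 0" "eventually P (at (c * z))"
  shows "eventually (\<lambda>w. P (c * w)) (at z)"
proof -
  have "filterlim (\<lambda>w. c * w) (at (c * z)) (at z)"
    using assms(1) by (auto simp: filterlim_at eventually_at_filter intro!: tendsto_intros)
  then show ?thesis using assms(2) by (auto simp: filterlim_iff)
qed

lemma eventually_at_inverse:
  fixes z :: complex
  assumes "z \<noteq> 0" "eventually P (at (1 / z))"
  shows "eventually (\<lambda>w. P (1 / w)) (at z)"
proof -
  have "((\<lambda>w. 1 / w) \<longlongrightarrow> 1 / z) (at z)" using assms(1) by (intro tendsto_intros)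
  then have "filterlim (\<lambda>w. 1 / w) (at (1 / z)) (at z)"
    by (auto simp: filterlim_at eventually_at_filter)
  then show ?thesis using assms(2) by (auto simp: filterlim_iff)
qed

text \<open>The way identities reach points where an intermediate denominator vanishes: algebra in a
  punctured neighbourhood, continuity at the point itself.\<close>

lemma eventually_at_eq_imp_eq:
  fixes f g :: "complex \<Rightarrow> complex"
  assumes "eventually (\<lambda>w. f w = g w) (at z)" "isCont f z" "isCont g z"
  shows "f z = g z"
proof -
  have "(g \<longlongrightarrow> f z) (at z)"
    using assms(1,2) by (metis (mono_tags, lifting) isContD tendsto_cong)
  then show ?thesis using assms(3) isContD LIM_unique by blast
qed

text \<open>Peeling one layer in \<open>p\<close> and one in \<open>q\<close> off each denominator
  leaves exactly the numerator of the other gamma factor; the peeled layers combine to the two theta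
  functions.\<close>

lemma ell_gamma_reflect:
  assumes "norm p < 1" "norm q < 1" "p \<noteq> 0" "q \<noteq> 0" "y \<noteq> 0"
    and "dpoch y p q \<noteq> 0" "dpoch (1 / y) p q \<noteq> 0"
  shows "ell_gamma y p q * ell_gamma (1 / y) p q * (theta y q * theta (1 / y) p) = 1"
proof -
  have 1: "dpoch y p q = qpoch_inf y q * qpoch_inf (p * y) p * dpoch (p * q * y) p q"
    using dpoch_rec1[of p q y] dpoch_rec2[of p q "y * p"] assms by (simp add: mult_ac)
  have 2: "dpoch (1 / y) p q = qpoch_inf (1 / y) p * qpoch_inf (q / y) q * dpoch (p * q / y) p q"
    using dpoch_rec2[of p q "1 / y"] dpoch_rec1[of p q "q / y"] assms by (simp add: mult_ac)
  show ?thesis using assms(5-)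
    unfolding ell_gamma_eq[OF assms(1,2)] 1 2 theta_def by (simp add: field_simps)
qed

lemma ell_gamma_shift1:
  assumes "norm p < 1" "norm q < 1" "p \<noteq> 0" "q \<noteq> 0" "z \<noteq> 0" "qpoch_inf z q \<noteq> 0"
  shows "ell_gamma (p * z) p q = theta z q * ell_gamma z p q"
proof -
  have 1: "dpoch z p q = qpoch_inf z q * dpoch (p * z) p q" using dpoch_rec1[of p q z] assms by (simp add: mult_ac)
  have 2: "dpoch (q / z) p q = qpoch_inf (q / z) q * dpoch (p * q / z) p q"
    using dpoch_rec1[of p q "q / z"] assms by (simp add: mult_ac)
  show ?thesis using assms by (simp add: ell_gamma_eq 1 2 theta_def)
qed

lemma ell_gamma_shift2:
  assumes "norm p < 1" "norm q < 1" "p \<noteq> 0" "q \<noteq> 0" "z \<noteq> 0" "qpoch_inf z p \<noteq> 0"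
  shows "ell_gamma (q * z) p q = theta z p * ell_gamma z p q"
proof -
  have 1: "dpoch z p q = qpoch_inf z p * dpoch (q * z) p q" using dpoch_rec2[of p q z] assms by (simp add: mult_ac)
  have 2: "dpoch (p / z) p q = qpoch_inf (p / z) p * dpoch (p * q / z) p q"
    using dpoch_rec2[of p q "p / z"] assms by (simp add: mult_ac)
  have 3: "p * q / (q * z) = p / z" using assms by simp
  show ?thesis using assms by (simp add: ell_gamma_eq 1 2 3 theta_def)
qed

section \<open>The rarefied gamma function\<close>

lemma tendsto_eventually_eq:
  assumes "eventually (\<lambda>w. f w = g w) F" "(g \<longlongrightarrow> c) F"
  shows "(f \<longlongrightarrow> c) F"
  by (rule Lim_transform_eventually[OF assms(2)]) (use assms(1) in \<open>auto elim: eventually_mono\<close>)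

text \<open>Covers poles as well: \<open>f\<close> has a limit iff \<open>h\<close> has one, and
  without a limit \<open>remove_sings\<close> gives 0 on both sides.\<close>

lemma remove_sings_mult:
  assumes "eventually (\<lambda>w. f w = g w * h w) (at z)" "isCont g z" "g z \<noteq> 0"
  shows "remove_sings f z = g z * remove_sings h z"
proof (cases "\<exists>c. h \<midarrow>z\<rightarrow> c")
  case True
  then obtain c where c: "h \<midarrow>z\<rightarrow> c" by blast
  have "(\<lambda>w. g w * h w) \<midarrow>z\<rightarrow> g z * c" using c assms(2) isContD by (intro tendsto_mult) auto
  then have "f \<midarrow>z\<rightarrow> g z * c" by (rule tendsto_eventually_eq[OF assms(1)])
  then show ?thesis using c remove_sings_eqI by metis
next
  case False
  have "\<not> (\<exists>c. f \<midarrow>z\<rightarrow> c)"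
  proof
    assume "\<exists>c. f \<midarrow>z\<rightarrow> c"
    then obtain c where c: "f \<midarrow>z\<rightarrow> c" by blast
    have "(\<lambda>w. f w / g w) \<midarrow>z\<rightarrow> c / g z" using c assms(2,3) isContD by (intro tendsto_divide) auto
    moreover have "eventually (\<lambda>w. g w \<noteq> 0) (at z)"
      using assms(2,3) isContD tendsto_imp_eventually_ne by blast
    then have "eventually (\<lambda>w. h w = f w / g w) (at z)"
      using assms(1) by eventually_elim auto
    ultimately have "h \<midarrow>z\<rightarrow> c / g z" by (rule tendsto_eventually_eq[rotated])
    then show False using False by blast
  qed
  then show ?thesis using False by (simp add: remove_sings_def)
qed

section \<open>Exactness of the integer divisions in the exponents\<close>

lemma two_dvd_prod: "(2::int) dvd m * (m - 1)"
  by simp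

lemma six_dvd_prod: "(6::int) dvd m * (m - 1) * (m - 2)"
proof -
  have "m mod 6 = 0 \<or> m mod 6 = 1 \<or> m mod 6 = 2 \<or> m mod 6 = 3 \<or> m mod 6 = 4 \<or> m mod 6 = 5" by presburger
  then have "(m * (m - 1) * (m - 2)) mod 6 = 0"
    by (elim disjE) (simp_all add: mod_mult_eq[symmetric] mod_diff_eq[symmetric] mod_mult_left_eq[symmetric] mod_mult_right_eq[symmetric], (simp add: mod_simps)?)
  then show ?thesis by presburger
qed

text \<open>Again a product of three consecutive integers, the largest being
  \<open>m + 1\<close>.\<close>

lemma six_dvd_prod': "(6::int) dvd m * (m\<^sup>2 - 1)"
proof -
  have "m * (m\<^sup>2 - 1) = (m + 1) * ((m + 1) - 1) * ((m + 1) - 2)" by (simp add: algebra_simps power2_eq_square)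
  then show ?thesis using six_dvd_prod[of "m + 1"] by (simp only:)
qed

lemma of_int_div_complex: "(b::int) dvd a \<Longrightarrow> b \<noteq> 0 \<Longrightarrow> (of_int (a div b) :: complex) = of_int a / of_int b"
  by (elim dvdE) simp

lemma isCont_theta:
  assumes "norm Q < 1" "z \<noteq> 0"
  shows "isCont (\<lambda>z. theta z Q) z"
proof -
  have "open (- {0::complex})" by (simp add: open_Compl)
  then show ?thesis
    using holomorphic_on_imp_continuous_on[OF theta_holo[OF assms(1), of "- {0}"]] assms(2)
      continuous_on_eq_continuous_at[of "- {0::complex}" "\<lambda>z. theta z Q"] by auto
qed

lemma of_int_choose2: "complex_of_int (m * (m - 1) div 2) = of_int m * (of_int m - 1) / 2"
  using of_int_div_complex[OF two_dvd_prod[of m]] by simp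

lemma of_int_choose2': "complex_of_int (m * (m + 1) div 2) = of_int m * (of_int m + 1) / 2"
  using of_int_div_complex[of 2 "m * (m + 1)"] by simp

lemma of_int_choose3: "complex_of_int (m * (m - 1) * (m - 2) div 6) = of_int m * (of_int m - 1) * (of_int m - 2) / 6"
  using of_int_div_complex[OF six_dvd_prod[of m]] by simp

lemma of_int_choose3': "complex_of_int (m * (m\<^sup>2 - 1) div 6) = of_int m * (of_int m ^ 2 - 1) / 6"
  using of_int_div_complex[OF six_dvd_prod'[of m]] by simp

section \<open>The rarefied gamma function with fixed logarithms of p and q\<close>

locale rarefied =
  fixes r :: nat and p q qh :: complex
  assumes r_pos: "r > 0" and p_nz: "p \<noteq> 0" and p_lt: "norm p < 1" and q_nz: "q \<noteq> 0" and q_lt: "norm q < 1"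
    and qh: "qh\<^sup>2 = q"
begin

abbreviation "Gp y \<equiv> ell_gamma y (p ^ r) (p * q)"
abbreviation "Gq y \<equiv> ell_gamma y (q ^ r) (p * q)"
abbreviation "Dp y \<equiv> dpoch y (p ^ r) (p * q)"
abbreviation "Dq y \<equiv> dpoch y (q ^ r) (p * q)"
abbreviation "rg \<equiv> rgamma r p q"

definition LP where "LP = Ln p"
text \<open>Twice the logarithm of the given root instead of \<open>Ln q\<close>, so that
  half-integral powers of \<open>q\<close> agree with \<open>qh\<close>
  (\<open>exp_half_LQ\<close>).\<close>

definition LQ where "LQ = 2 * Ln qh"

lemma exp_LP: "exp LP = p" and exp_LQ: "exp LQ = q" and exp_half_LQ: "exp (LQ / 2) = qh"
proof -
  have "qh \<noteq> 0" using q_nz qh by auto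
  then show "exp LQ = q" "exp (LQ / 2) = qh" using exp_double[of "Ln qh"] qh by (auto simp: LQ_def)
qed (use p_nz in \<open>simp add: LP_def\<close>)

lemma pq_lt: "norm (p * q) < 1" and pr_lt: "norm (p ^ r) < 1" and qr_lt: "norm (q ^ r) < 1"
  and pq_nz: "p * q \<noteq> 0" and pr_nz: "p ^ r \<noteq> 0" and qr_nz: "q ^ r \<noteq> 0"
proof -
  show "norm (p * q) < 1" using p_lt q_lt mult_strict_mono[of "norm p" 1 "norm q" 1] by (simp add: norm_mult)
  show "norm (p ^ r) < 1" "norm (q ^ r) < 1" using p_lt q_lt r_pos by (auto simp: norm_power power_less_one_iff)
qed (use p_nz q_nz in auto)

lemma powi_p: "p powi k = exp (of_int k * LP)" and powi_q: "q powi k = exp (of_int k * LQ)"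
  and pow_p: "p ^ j = exp (of_nat j * LP)" and pow_q: "q ^ j = exp (of_nat j * LQ)"
  using exp_power_int[of LP k] exp_power_int[of LQ k] exp_of_nat_mult[of j LP] exp_of_nat_mult[of j LQ]
  by (auto simp: exp_LP exp_LQ mult.commute)

definition rmono :: "complex \<Rightarrow> int \<Rightarrow> complex" where
  "rmono w m = (- w) powi (m * (m - 1) div 2) * p powi (m * (m - 1) * (m - 2) div 6)
        * q powi (- (m * (m\<^sup>2 - 1) div 6))"

definition raw :: "int \<Rightarrow> complex \<Rightarrow> complex" where
  "raw m w = rmono w m * Gp (w * p powi m) * Gq (w * q powi (int r - m))"

lemma rg_raw: "rg z m = remove_sings (raw m) z"
  unfolding rgamma_def raw_def[abs_def] rmono_def by simp

lemma rmono_nz: "w \<noteq> 0 \<Longrightarrow> rmono w m \<noteq> 0"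
  using p_nz q_nz by (simp add: rmono_def)

text \<open>Monomials are rewritten as exponentials of forms in \<open>L\<close>, \<open>LP\<close>,
  \<open>LQ\<close>: exact integer divisions become fractions, and comparing monomials becomes
  polynomial algebra under \<open>exp\<close>. Any logarithm \<open>L\<close> of \<open>- w\<close>
  will do.\<close>

lemma rmono_exp:
  assumes "- w = exp L"
  shows "rmono w m = exp (of_int m * (of_int m - 1) / 2 * L + of_int m * (of_int m - 1) * (of_int m - 2) / 6 * LP
      - of_int m * (of_int m ^ 2 - 1) / 6 * LQ)"
  unfolding rmono_def assms powi_p powi_q exp_power_int
  of_int_minus of_int_choose2 of_int_choose3 of_int_choose3' exp_add[symmetric]
  by (simp add: algebra_simps)

text \<open>\<open>remove_sings\<close> changes nothing where \<open>raw m\<close> is analytic, and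
  the zeros of its two denominators are isolated.\<close>

lemma raw_generic:
  assumes "z \<noteq> 0"
  shows "eventually (\<lambda>w. w \<noteq> 0 \<and> rg w m = raw m w) (at z)"
proof -
  have "eventually (\<lambda>w. w \<noteq> 0) (at z)" using assms tendsto_ident_at tendsto_imp_eventually_ne by blast
  moreover have "eventually (\<lambda>w. Dp (p powi m * w) \<noteq> 0) (at z)" "eventually (\<lambda>w. Dq (q powi (int r - m) * w) \<noteq> 0) (at z)"
    using dpoch_ev_nz pr_lt qr_lt pq_lt by blast+
  ultimately show ?thesis
  proof eventually_elim
    case (elim w)
    have op: "open {w. w \<noteq> 0 \<and> Dp (p powi m * w) \<noteq> 0 \<and> Dq (q powi (int r - m) * w) \<noteq> 0}"
    proof -
      have "continuous_on UNIV (\<lambda>w. Dp (p powi m * w))" "continuous_on UNIV (\<lambda>w. Dq (q powi (int r - m) * w))"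
        using pr_lt qr_lt pq_lt
        by (auto intro!: holomorphic_on_imp_continuous_on holomorphic_on_compose_gen[OF _ dpoch_holo[of _ _ UNIV], unfolded o_def] holomorphic_intros)
      then have "open ((\<lambda>w. Dp (p powi m * w)) -` (- {0}))" "open ((\<lambda>w. Dq (q powi (int r - m) * w)) -` (- {0}))"
        by (auto intro!: open_vimage)
      moreover have "open (- {0::complex})" by auto
      ultimately have "open (- {0::complex} \<inter> (\<lambda>w. Dp (p powi m * w)) -` (- {0}) \<inter> (\<lambda>w. Dq (q powi (int r - m) * w)) -` (- {0}))"
        by (intro open_Int)
      then show ?thesis by (rule back_subst[where P = "open"]) auto
    qed
    have "raw m holomorphic_on {w. w \<noteq> 0 \<and> Dp (p powi m * w) \<noteq> 0 \<and> Dq (q powi (int r - m) * w) \<noteq> 0}"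
      unfolding raw_def[abs_def] rmono_def ell_gamma_eq[OF pr_lt pq_lt] ell_gamma_eq[OF qr_lt pq_lt]
      by (intro holomorphic_intros holomorphic_on_compose_gen[OF _ dpoch_holo[OF pr_lt pq_lt, of UNIV], unfolded o_def]
         holomorphic_on_compose_gen[OF _ dpoch_holo[OF qr_lt pq_lt, of UNIV], unfolded o_def])
       (auto simp: p_nz q_nz mult.commute)
    then have "raw m analytic_on {w}" using op elim analytic_at by fastforce
    then show ?case using elim by (simp add: rg_raw)
  qed
qed

definition qmono :: "int \<Rightarrow> complex \<Rightarrow> complex" where
  "qmono m w = rmono w (m + int r) / rmono w m * ((- (w * q powi (- m))) powi (- m) * (p * q) powi (- (m * (m - 1) div 2)))"

text \<open>The step multiplies the argument of \<open>Gp\<close> by \<open>p ^ r\<close> and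
  divides that of \<open>Gq\<close> by \<open>q ^ r\<close>. The two theta functions of base
  \<open>p * q\<close> produced in this way have arguments that differ by
  \<open>(p * q) powi m\<close>, so their quotient is a monomial, which is collected in
  \<open>qmono\<close>.\<close>

lemma rg_quasi:
  assumes "z \<noteq> 0"
  shows "rg z (m + int r) = qmono m z * rg z m"
  unfolding rg_raw
proof (rule remove_sings_mult)
  show "qmono m z \<noteq> 0" unfolding qmono_def using assms p_nz q_nz by (simp add: rmono_nz)
  show "isCont (qmono m) z" unfolding qmono_def[abs_def] rmono_def
    using assms p_nz q_nz by (intro continuous_intros) auto
  have "eventually (\<lambda>w. w \<noteq> 0) (at z)" using assms tendsto_ident_at tendsto_imp_eventually_ne by blast
  moreover have "eventually (\<lambda>w. qpoch_inf (p powi m * w) (p * q) \<noteq> 0) (at z)"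
     "eventually (\<lambda>w. qpoch_inf (q powi (- m) * w) (p * q) \<noteq> 0) (at z)"
     "eventually (\<lambda>w. theta (q powi (- m) * w) (p * q) \<noteq> 0) (at z)"
    using assms p_nz q_nz pq_lt by (auto intro!: qpoch_ev_nz theta_ev_nz)
  ultimately show "eventually (\<lambda>w. raw (m + int r) w = qmono m w * raw m w) (at z)"
  proof eventually_elim
    case (elim w)
    let ?b = "p * q"
    have 1: "Gp (w * p powi (m + int r)) = theta (w * p powi m) ?b * Gp (w * p powi m)"
      using ell_gamma_shift1[of "p ^ r" ?b "w * p powi m"] elim pr_lt pq_lt pr_nz p_nz q_nz
      by (simp add: power_int_add mult_ac)
    have 2: "Gq (w * q powi (int r - m)) = theta (w * q powi (- m)) ?b * Gq (w * q powi (int r - (m + int r)))"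
      using ell_gamma_shift1[of "q ^ r" ?b "w * q powi (- m)"] elim qr_lt pq_lt qr_nz p_nz q_nz
      by (simp add: power_int_diff power_int_minus field_simps)
    have "w * p powi m = w * q powi (- m) * (p * q) powi m"
      using q_nz by (simp add: power_int_mult_distrib power_int_minus)
    then have 3: "theta (w * p powi m) ?b = (- (w * q powi (- m))) powi (- m) * ?b powi (- (m * (m - 1) div 2)) * theta (w * q powi (- m)) ?b"
      using theta_shift_powi[OF pq_lt pq_nz, of "w * q powi (- m)" m] elim q_nz by (simp only:) simp
    show ?case unfolding raw_def 1 2 3 qmono_def using rmono_nz[OF elim(1)] by simp
  qed
qed

text \<open>For \<open>m \<le> r\<close> this is the denominator of the rarefied gamma function, and
  \<open>EE (r - m)\<close> at \<open>p * q / y\<close> is its numerator. So one family of entire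
  functions, without zeros in the unit disc, describes all zeros and poles.\<close>

definition EE :: "nat \<Rightarrow> complex \<Rightarrow> complex" where
  "EE m y = Dp (y * p ^ m) * Dq (y * q ^ (r - m))"

lemma EE_holo: "EE m holomorphic_on A"
  unfolding EE_def[abs_def] using pr_lt qr_lt pq_lt
  by (intro holomorphic_intros holomorphic_on_compose_gen[OF _ dpoch_holo[of _ _ UNIV], unfolded o_def]) auto

lemma EE_0: "EE m 0 = 1" by (simp add: EE_def)

lemma EE_nz: "norm y < 1 \<Longrightarrow> EE m y \<noteq> 0"
proof -
  assume y: "norm y < 1"
  have "norm (y * p ^ m) \<le> norm y" "norm (y * q ^ (r - m)) \<le> norm y"
    using p_lt q_lt by (auto simp: norm_mult norm_power mult_left_le power_le_one)
  then have "norm (y * p ^ m) < 1" "norm (y * q ^ (r - m)) < 1" using y by linarith+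
  then show ?thesis unfolding EE_def using dpoch_nz pr_lt qr_lt pq_lt by simp
qed

lemma isCont_EE: "isCont (EE m) y"
  using holomorphic_on_imp_continuous_on[OF EE_holo[of m UNIV]] continuous_on_eq_continuous_at open_UNIV by blast

text \<open>Zeros of \<open>EE m\<close> have \<open>norm z \<ge> 1\<close>, where the numerator is
  nonzero because \<open>norm (p * q / z) < 1\<close>. Hence nothing cancels for these
  \<open>m\<close>, and at a pole both sides are 0 by convention.\<close>

lemma rg_canonical0:
  assumes "z \<noteq> 0" "m \<le> r"
  shows "rg z (int m) = rmono z (int m) * EE (r - m) (p * q / z) / EE m z"
proof -
  define N where "N = (\<lambda>w. rmono w (int m) * EE (r - m) (p * q / w))"
  have raw: "raw (int m) w = N w / EE m w" if "w \<noteq> 0" for w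
  proof -
    have 1: "p ^ r * (p * q) / (w * p powi int m) = p * q / w * p ^ (r - m)"
      using assms(2) that p_nz by (simp add: power_diff field_simps)
    have 2: "w * q powi (int r - int m) = w * q ^ (r - m)"
      using assms(2) by (metis of_nat_diff power_int_of_nat)
    have 3: "q ^ r * (p * q) / (w * q ^ (r - m)) = p * q / w * q ^ (r - (r - m))"
      using assms(2) that q_nz by (simp add: power_diff field_simps)
    show ?thesis unfolding raw_def N_def EE_def 2 ell_gamma_eq[OF pr_lt pq_lt] ell_gamma_eq[OF qr_lt pq_lt] 1 3
      by (simp add: mult_ac)
  qed
  have ev: "eventually (\<lambda>w. raw (int m) w = N w / EE m w) (at z)"
    using assms(1) raw tendsto_ident_at tendsto_imp_eventually_ne[of "\<lambda>x. x" z "at z" 0] by (auto elim: eventually_mono)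
  have contN: "isCont N z" unfolding N_def rmono_def using assms p_nz q_nz
    by (intro continuous_intros isCont_o2[OF _ isCont_EE]) auto
  have "rg z (int m) = N z / EE m z"
  proof (cases "EE m z = 0")
    case False
    have "(\<lambda>w. N w / EE m w) \<midarrow>z\<rightarrow> N z / EE m z"
      using False contN isCont_EE isContD by (intro tendsto_divide) auto
    then have "raw (int m) \<midarrow>z\<rightarrow> N z / EE m z" by (rule tendsto_eventually_eq[OF ev])
    then show ?thesis unfolding rg_raw by blast
  next
    case True
    have "\<not> (\<exists>c. raw (int m) \<midarrow>z\<rightarrow> c)"
    proof
      assume "\<exists>c. raw (int m) \<midarrow>z\<rightarrow> c"
      then obtain c where c: "raw (int m) \<midarrow>z\<rightarrow> c" by blast
      have "(\<lambda>w. raw (int m) w * EE m w) \<midarrow>z\<rightarrow> c * EE m z"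
        using c isCont_EE isContD by (intro tendsto_mult) auto
      moreover have "eventually (\<lambda>w. EE m w \<noteq> 0 \<and> w \<in> UNIV) (at z)"
        by (rule non_zero_neighbour_alt[where \<beta> = 0]) (auto simp: EE_holo EE_0)
      then have "eventually (\<lambda>w. N w = raw (int m) w * EE m w) (at z)"
        using ev by eventually_elim auto
      ultimately have "N \<midarrow>z\<rightarrow> c * EE m z" by (rule tendsto_eventually_eq[rotated])
      then have "N z = 0" using True contN isContD LIM_unique by fastforce
      moreover have "norm z \<ge> 1" using True EE_nz by force
      then have "norm (p * q / z) < 1" using pq_lt by (simp add: norm_divide divide_less_eq)
      then have "N z \<noteq> 0" unfolding N_def using EE_nz rmono_nz assms(1) by simp
      ultimately show False by blast
    qed
    then have "rg z (int m) = 0" unfolding rg_raw remove_sings_def by simp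
    then show ?thesis using True by simp
  qed
  then show ?thesis by (simp add: N_def)
qed

lemma rmono_powi: "\<exists>C k. C \<noteq> 0 \<and> (\<forall>z. rmono z m = C * z powi k)"
proof (intro exI conjI allI)
  show "rmono z m = ((-1) powi (m * (m - 1) div 2) * p powi (m * (m - 1) * (m - 2) div 6)
        * q powi (- (m * (m\<^sup>2 - 1) div 6))) * z powi (m * (m - 1) div 2)" for z
    unfolding rmono_def using power_int_mult_distrib[of "-1" z] by simp
qed (use p_nz q_nz in simp)

lemma qmono_powi: "\<exists>C k. C \<noteq> 0 \<and> (\<forall>z. z \<noteq> 0 \<longrightarrow> qmono m z = C * z powi k)"
proof -
  obtain C1 k1 where 1: "C1 \<noteq> 0" "\<And>z. rmono z (m + int r) = C1 * z powi k1" using rmono_powi by blast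
  obtain C2 k2 where 2: "C2 \<noteq> 0" "\<And>z. rmono z m = C2 * z powi k2" using rmono_powi by blast
  have 3: "(- (z * q powi (- m))) powi (- m) = (- (q powi (- m))) powi (- m) * z powi (- m)" for z
    using power_int_mult_distrib[of z "- (q powi (- m))" "- m"] by simp
  show ?thesis
  proof (intro exI conjI allI impI)
    fix z :: complex assume z: "z \<noteq> 0"
    have "z powi (k1 - k2 - m) = z powi k1 / z powi k2 * z powi (- m)"
      using z by (simp add: power_int_diff power_int_minus power_int_add field_simps)
    then show "qmono m z = (C1 / C2 * ((- (q powi (- m))) powi (- m) * (p * q) powi (- (m * (m - 1) div 2)))) * z powi (k1 - k2 - m)"
      unfolding qmono_def 1 2 3 by simp
  qed (use 1 2 p_nz q_nz in auto)
qed

text \<open>\<open>rg_quasi\<close> reduces any \<open>m\<close> modulo \<open>r\<close> at the cost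
  of monomials, so only the cases without cancellation remain. The formula is valid at every nonzero
  point, poles included.\<close>

lemma rg_canonical:
  "\<exists>C k m0. C \<noteq> 0 \<and> m0 \<le> r \<and> (\<forall>z. z \<noteq> 0 \<longrightarrow> rg z m = C * z powi k * EE (r - m0) (p * q / z) / EE m0 z)"
proof -
  define m0 where "m0 = nat (m mod int r)"
  have m0: "m0 \<le> r" "int m0 = m mod int r"
    using r_pos by (auto simp: m0_def nat_le_iff less_imp_le)
  have "\<exists>C k. C \<noteq> 0 \<and> (\<forall>z. z \<noteq> 0 \<longrightarrow> rg z (int m0 + l * int r) = C * z powi k * EE (r - m0) (p * q / z) / EE m0 z)" for l
  proof (induction l rule: int_induct[where k = 0])
    case base
    show ?case using rg_canonical0[OF _ m0(1)] rmono_powi[of "int m0"] by auto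
  next
    case (step1 l)
    then obtain C k where 1: "C \<noteq> 0" "\<And>z. z \<noteq> 0 \<Longrightarrow> rg z (int m0 + l * int r) = C * z powi k * EE (r - m0) (p * q / z) / EE m0 z"
      by blast
    obtain C' k' where 2: "C' \<noteq> 0" "\<And>z. z \<noteq> 0 \<Longrightarrow> qmono (int m0 + l * int r) z = C' * z powi k'" using qmono_powi by blast
    have "rg z (int m0 + (l + 1) * int r) = (C' * C) * z powi (k' + k) * EE (r - m0) (p * q / z) / EE m0 z" if "z \<noteq> 0" for z
      using rg_quasi[OF that, of "int m0 + l * int r"] 1(2)[OF that] 2(2)[OF that] that
      by (simp add: power_int_add algebra_simps)
    then show ?case using 1 2 by (metis mult_eq_0_iff)
  next
    case (step2 l)
    then obtain C k where 1: "C \<noteq> 0" "\<And>z. z \<noteq> 0 \<Longrightarrow> rg z (int m0 + l * int r) = C * z powi k * EE (r - m0) (p * q / z) / EE m0 z"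
      by blast
    obtain C' k' where 2: "C' \<noteq> 0" "\<And>z. z \<noteq> 0 \<Longrightarrow> qmono (int m0 + (l - 1) * int r) z = C' * z powi k'" using qmono_powi by blast
    have "rg z (int m0 + (l - 1) * int r) = (C / C') * z powi (k - k') * EE (r - m0) (p * q / z) / EE m0 z" if "z \<noteq> 0" for z
    proof -
      have e: "int m0 + (l - 1) * int r + int r = int m0 + l * int r" by (simp add: algebra_simps)
      have "C * z powi k * EE (r - m0) (p * q / z) / EE m0 z = C' * z powi k' * rg z (int m0 + (l - 1) * int r)"
        using rg_quasi[OF that, of "int m0 + (l - 1) * int r"] 1(2)[OF that] 2(2)[OF that] unfolding e by simp
      then have "rg z (int m0 + (l - 1) * int r) = C * z powi k * EE (r - m0) (p * q / z) / EE m0 z / (C' * z powi k')"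
        using 2(1) that by simp
      then show ?thesis using that by (simp add: power_int_diff)
    qed
    then show ?case using 1 2 by (metis divide_eq_0_iff)
  qed
  from this[of "m div int r"] show ?thesis
    using m0 by (metis add.commute div_mult_mod_eq)
qed

lemma rg_holo: "(\<lambda>z. rg z m) holomorphic_on {z. 0 < norm z \<and> norm z < 1}"
proof -
  obtain C k m0 where *: "m0 \<le> r" "\<And>z. z \<noteq> 0 \<Longrightarrow> rg z m = C * z powi k * EE (r - m0) (p * q / z) / EE m0 z"
    using rg_canonical by metis
  have "(\<lambda>z. C * z powi k * EE (r - m0) (p * q / z) / EE m0 z) holomorphic_on {z. 0 < norm z \<and> norm z < 1}"
    by (intro holomorphic_intros EE_holo holomorphic_on_compose_gen[OF _ EE_holo[of _ UNIV], unfolded o_def])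
       (auto simp: EE_nz)
  then show ?thesis by (rule holomorphic_transform) (use * in auto)
qed

lemma isCont_rg: "0 < norm z \<Longrightarrow> norm z < 1 \<Longrightarrow> isCont (\<lambda>z. rg z m) z"
proof -
  assume z: "0 < norm z" "norm z < 1"
  have "open {z::complex. 0 < norm z \<and> norm z < 1}"
    by (intro open_Collect_conj open_Collect_less continuous_intros)
  then show ?thesis
    using holomorphic_on_imp_continuous_on[OF rg_holo[of m]] z continuous_on_eq_continuous_at by blast
qed

text \<open>The argument of \<open>Gp\<close> stays fixed and that of \<open>Gq\<close> is
  multiplied by \<open>p * q\<close>, hence a single theta function of base \<open>q ^ r\<close>
  appears. All contiguous relations below rest on this. In the punctured unit disc both sides are
  free of poles, so they can be compared by continuity.\<close>

lemma rg_shift: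
  assumes z: "0 < norm z" "norm z < 1" and L: "- z = exp L"
  shows "rg (p * z) (m - 1) = exp (- of_int m * L + of_int m * (of_int m + 1) / 2 * LQ) * theta (z * q powi (- m)) (q ^ r) * rg z m"
proof -
  \<comment> \<open>The factor written with powers instead of logarithms, so that it is visibly
    continuous near \<open>z\<close>.\<close>
  define g where "g = (\<lambda>w. (- w) powi (- m) * q powi (m * (m + 1) div 2))"
  have "z \<noteq> 0" using z by auto
  have "rg (p * z) (m - 1) = g z * theta (z * q powi (- m)) (q ^ r) * rg z m"
  proof (rule eventually_at_eq_imp_eq[where f = "\<lambda>z. rg (p * z) (m - 1)" and g = "\<lambda>z. g z * theta (z * q powi (- m)) (q ^ r) * rg z m"])
    have "norm (p * z) < 1" using p_lt z mult_strict_mono[of "norm p" 1 "norm z" 1] by (simp add: norm_mult)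
    then show "isCont (\<lambda>z. rg (p * z) (m - 1)) z"
      using z p_nz by (intro isCont_o2[OF _ isCont_rg] continuous_intros) auto
    have "isCont (\<lambda>z. theta z (q ^ r)) (z * q powi (- m))"
      using \<open>z \<noteq> 0\<close> q_nz by (intro isCont_theta qr_lt) auto
    then have c2: "isCont (\<lambda>z. theta (z * q powi (- m)) (q ^ r)) z"
      by (rule isCont_o2[rotated]) (intro continuous_intros)
    show "isCont (\<lambda>z. g z * theta (z * q powi (- m)) (q ^ r) * rg z m) z"
      unfolding g_def using z q_nz by (intro continuous_intros isCont_rg c2) auto
    have "eventually (\<lambda>w. p * w \<noteq> 0 \<and> rg (p * w) (m - 1) = raw (m - 1) (p * w)) (at z)"
      by (rule eventually_at_mult[OF p_nz raw_generic]) (use z p_nz in auto)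
    moreover have "eventually (\<lambda>w. qpoch_inf (q powi (int r - m) * w) (q ^ r) \<noteq> 0) (at z)"
      using \<open>z \<noteq> 0\<close> q_nz qr_lt by (auto intro!: qpoch_ev_nz)
    ultimately show "eventually (\<lambda>z. rg (p * z) (m - 1) = g z * theta (z * q powi (- m)) (q ^ r) * rg z m) (at z)"
      using raw_generic[OF \<open>z \<noteq> 0\<close>, of m]
    proof eventually_elim
      case (elim w)
      have w: "w \<noteq> 0" using elim by auto
      have 1: "p * w * p powi (m - 1) = w * p powi m" using p_nz by (simp add: power_int_diff)
      have "Gq (p * w * q powi (int r - (m - 1))) = Gq ((p * q) * (w * q powi (int r - m)))"
      proof -
        have "q powi (int r - (m - 1)) = q * q powi (int r - m)" using q_nz power_int_add[of q 1 "int r - m"] by (simp add: algebra_simps)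
        then show ?thesis by (simp add: mult_ac)
      qed
      also have "\<dots> = theta (w * q powi (int r - m)) (q ^ r) * Gq (w * q powi (int r - m))"
        using elim w qr_lt pq_lt p_nz q_nz by (intro ell_gamma_shift2) (auto simp: mult.commute)
      also have "w * q powi (int r - m) = q ^ r * (w * q powi (- m))"
        using q_nz power_int_add[of q "int r" "- m"] by simp
      also have "theta (q ^ r * (w * q powi (- m))) (q ^ r) = - theta (w * q powi (- m)) (q ^ r) / (w * q powi (- m))"
        using w q_nz by (intro theta_shift qr_lt qr_nz) auto
      also have "q ^ r * (w * q powi (- m)) = w * q powi (int r - m)"
        using q_nz power_int_add[of q "int r" "- m"] by simp
      finally have 2: "Gq (p * w * q powi (int r - (m - 1))) = - theta (w * q powi (- m)) (q ^ r) / (w * q powi (- m)) * Gq (w * q powi (int r - m))" .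
      define L where "L = Ln (- w)"
      have L: "- w = exp L" using w by (simp add: L_def)
      have Lp: "- (p * w) = exp (LP + L)" by (simp add: exp_add exp_LP L[symmetric])
      have gm: "g w * rmono w m = rmono (p * w) (m - 1) * (- 1 / (w * q powi (- m)))"
      proof -
        have "- 1 / (w * q powi (- m)) = exp (- L + of_int m * LQ)"
          using L[symmetric] by (simp add: powi_q exp_diff exp_minus divide_inverse)
        moreover have "g w = exp (- of_int m * L + of_int m * (of_int m + 1) / 2 * LQ)"
          unfolding g_def L powi_q exp_power_int of_int_choose2'
          by (simp add: exp_add[symmetric])
        ultimately show ?thesis
          unfolding rmono_exp[OF L] rmono_exp[OF Lp]
          unfolding exp_add[symmetric]
          by (simp only: exp_add[symmetric]) (rule arg_cong[where f = exp], simp add: field_simps power2_eq_square)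
      qed
      have "g w * theta (w * q powi (- m)) (q ^ r) * raw m w
          = (g w * rmono w m) * theta (w * q powi (- m)) (q ^ r) * (Gp (w * p powi m) * Gq (w * q powi (int r - m)))"
        by (simp add: raw_def)
      also have "\<dots> = raw (m - 1) (p * w)" unfolding gm raw_def 1 2 by simp
      finally show ?case using elim by simp
    qed
  qed
  moreover have "g z = exp (- of_int m * L + of_int m * (of_int m + 1) / 2 * LQ)"
    unfolding g_def L powi_q exp_power_int of_int_choose2'
    by (simp add: exp_add[symmetric])
  ultimately show ?thesis by simp
qed

lemma rg_quasi_exp:
  assumes "- z = exp L"
  shows "rg z (m + int r) = exp ((of_nat r - 1) * (2 * of_int m + of_nat r) / 2 * L
     + (of_nat r - 1) / 2 * (of_int m * (of_int m - 1) + of_int m * of_nat r + of_nat r * (of_nat r - 2) / 3) * LP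
     - (of_nat r - 1) / 2 * (of_int m * (of_int m + 1) + (of_int m + 1) * of_nat r + of_nat r * (of_nat r - 2) / 3) * LQ) * rg z m"
proof -
  have z: "z \<noteq> 0" using assms by auto
  have 1: "(- (z * q powi (- m))) powi (- m) = exp (- of_int m * (L - of_int m * LQ))"
  proof -
    have "- (z * q powi (- m)) = exp (L - of_int m * LQ)" unfolding powi_q exp_diff assms[symmetric] by (simp add: exp_minus field_simps)
    then show ?thesis by (simp only: exp_power_int of_int_minus)
  qed
  have 2: "(p * q) powi (- (m * (m - 1) div 2)) = exp (- (of_int m * (of_int m - 1) / 2) * (LP + LQ))"
  proof -
    have "p * q = exp (LP + LQ)" by (simp add: exp_add exp_LP exp_LQ)
    then show ?thesis
      by (simp only: exp_power_int of_int_minus of_int_choose2)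
  qed
  have "qmono m z = exp ((of_nat r - 1) * (2 * of_int m + of_nat r) / 2 * L
     + (of_nat r - 1) / 2 * (of_int m * (of_int m - 1) + of_int m * of_nat r + of_nat r * (of_nat r - 2) / 3) * LP
     - (of_nat r - 1) / 2 * (of_int m * (of_int m + 1) + (of_int m + 1) * of_nat r + of_nat r * (of_nat r - 2) / 3) * LQ)"
    unfolding qmono_def 1 2 rmono_exp[OF assms] exp_diff[symmetric] exp_add[symmetric]
    by (rule arg_cong[where f = exp]) (simp add: field_simps power2_eq_square power3_eq_cube)
  then show ?thesis using rg_quasi[OF z, of m] by simp
qed

text \<open>Reflection gives one theta function each of the bases \<open>p ^ r\<close> and
  \<open>q ^ r\<close> and two of base \<open>p * q\<close>. The latter cancel, up to the monomial
  \<open>\<kappa>\<close>, against those that arise when the arguments of \<open>Gq\<close> are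
  moved by \<open>q ^ r\<close>.\<close>

lemma raw_recip:
  assumes "v \<noteq> 0" and L: "- v = exp L"
    and "Dp (v * p powi X) \<noteq> 0" "Dp (1 / (v * p powi X)) \<noteq> 0" "Dq (v * q powi (- X)) \<noteq> 0" "Dq (1 / (v * q powi (- X))) \<noteq> 0"
    "qpoch_inf (v * q powi (- X)) (p * q) \<noteq> 0" "qpoch_inf (1 / (v * q powi (- X))) (p * q) \<noteq> 0"
  shows "1 / (raw X v * raw (- X) (1 / v)) = exp (- L + of_int X * (of_int X - 1) / 2 * LP + of_int X * (of_int X + 1) / 2 * LQ)
     * theta (v * p powi X) (p ^ r) * theta (v * q powi (- X)) (q ^ r)"
proof -
  define y where "y = v * p powi X"
  define y' where "y' = v * q powi (- X)"
  have nz: "y \<noteq> 0" "y' \<noteq> 0" using assms(1) p_nz q_nz by (auto simp: y_def y'_def)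
  define S where "S = theta y' (p * q)"
  define \<kappa> where "\<kappa> = (- y') powi (- X) * (p * q) powi (- (X * (X - 1) div 2))"
  define a1 where "a1 = theta y (p ^ r)"
  define a2 where "a2 = theta y' (q ^ r)"
  have \<kappa>: "theta y (p * q) = \<kappa> * S"
  proof -
    have "y = y' * (p * q) powi X"
      using q_nz by (simp add: y_def y'_def power_int_mult_distrib power_int_minus)
    then show ?thesis using theta_shift_powi[OF pq_lt pq_nz nz(2), of X] by (simp add: S_def \<kappa>_def)
  qed
  have A1: "Gp y * Gp (1 / y) * (\<kappa> * S * (- a1 / y)) = 1"
    using ell_gamma_reflect[OF pr_lt pq_lt pr_nz pq_nz nz(1)] assms(3,4) theta_recip[OF pr_lt pr_nz nz(1)] \<kappa>
    by (simp add: y_def[symmetric] a1_def)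
  have A2: "Gq y' * Gq (1 / y') * (S * (- a2 / y')) = 1"
    using ell_gamma_reflect[OF qr_lt pq_lt qr_nz pq_nz nz(2)] assms(5,6) theta_recip[OF qr_lt qr_nz nz(2)]
    by (simp add: y'_def[symmetric] a2_def S_def)
  have B1: "Gq (v * q powi (int r - X)) = S * Gq y'"
  proof -
    have "v * q powi (int r - X) = q ^ r * y'" unfolding y'_def using q_nz power_int_add[of q "int r" "- X"] by simp
    then show ?thesis using ell_gamma_shift1[OF qr_lt pq_lt qr_nz pq_nz nz(2)] assms(7) by (simp add: y'_def[symmetric] S_def)
  qed
  have B2: "Gq (1 / v * q powi (int r - - X)) = - S / y' * Gq (1 / y')"
  proof -
    have "1 / v * q powi (int r - - X) = q ^ r * (1 / y')" unfolding y'_def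
      using q_nz power_int_add[of q "int r" "X"] by (simp add: power_int_minus field_simps)
    moreover have "1 / y' \<noteq> 0" using nz by simp
    ultimately show ?thesis using ell_gamma_shift1[OF qr_lt pq_lt qr_nz pq_nz, of "1 / y'"] assms(8) theta_recip[OF pq_lt pq_nz nz(2)]
      by (simp add: y'_def[symmetric] S_def)
  qed
  have B3: "1 / v * p powi (- X) = 1 / y" by (simp add: y_def power_int_minus field_simps)
  have "Sn": "S \<noteq> 0" using A2 by auto
  have \<kappa>n: "\<kappa> \<noteq> 0" and a1n: "a1 \<noteq> 0" and a2n: "a2 \<noteq> 0" using A1 A2 by auto
  define M where "M = rmono v X * rmono (1 / v) (- X)"
  have Mn: "M \<noteq> 0" unfolding M_def using rmono_nz assms(1) by simp
  have "raw X v * raw (- X) (1 / v) = M * (Gp y * Gp (1 / y)) * (- (S * S) / y' * (Gq y' * Gq (1 / y')))"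
    unfolding raw_def B1 B2 B3 y_def[symmetric] M_def by (simp add: mult_ac)
  also have "Gp y * Gp (1 / y) = - y / (\<kappa> * S * a1)"
    using A1 \<kappa>n "Sn" a1n nz by (simp add: field_simps) (metis add.inverse_inverse mult_minus_right)
  also have "Gq y' * Gq (1 / y') = - y' / (S * a2)"
    using A2 a2n "Sn" nz by (simp add: field_simps) (metis add.inverse_inverse mult_minus_right)
  finally have raw: "raw X v * raw (- X) (1 / v) = M * (- y) / \<kappa> / (a1 * a2)"
    using nz "Sn" by (simp add: field_simps)
  have "- (1 / v) = exp (- L)" using L by (metis exp_minus inverse_eq_divide minus_divide_right)
  then have 1: "M = exp (- of_int X * L - of_int X * of_int X * LP)"
    unfolding M_def rmono_exp[OF L]
    by (simp only: rmono_exp[of "1 / v" "- L" "- X"] exp_add[symmetric])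
      (rule arg_cong[where f = exp], simp add: field_simps power2_eq_square)
  have 2: "- y = exp (L + of_int X * LP)"
    unfolding y_def by (simp add: exp_add L[symmetric] powi_p)
  have 3: "\<kappa> = exp (- of_int X * (L - of_int X * LQ) - of_int X * (of_int X - 1) / 2 * (LP + LQ))"
  proof -
    have "- y' = exp (L - of_int X * LQ)" unfolding y'_def powi_q exp_diff L[symmetric] by (simp add: exp_minus field_simps)
    moreover have "p * q = exp (LP + LQ)" by (simp add: exp_add exp_LP exp_LQ)
    ultimately show ?thesis unfolding \<kappa>_def
      by (simp only: exp_power_int of_int_minus of_int_choose2 exp_add[symmetric])
        (rule arg_cong[where f = exp], simp add: algebra_simps)
  qed
  have "M * (- y) / \<kappa> = exp (L - of_int X * (of_int X - 1) / 2 * LP - of_int X * (of_int X + 1) / 2 * LQ)"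
    unfolding 1 2 3 exp_add[symmetric] exp_diff[symmetric]
    by (rule arg_cong[where f = exp]) (simp add: field_simps power2_eq_square)
  also have "\<dots> = 1 / exp (- L + of_int X * (of_int X - 1) / 2 * LP + of_int X * (of_int X + 1) / 2 * LQ)"
    by (simp add: exp_minus[symmetric] inverse_eq_divide[symmetric] algebra_simps)
  finally show ?thesis unfolding raw y_def[symmetric] y'_def[symmetric] a1_def[symmetric] a2_def[symmetric] by simp
qed

text \<open>Consequently the gamma factors in the denominator of the integrand contribute no poles.
  At a pole of \<open>rg\<close> on the circle the left side is 0 by \<open>1 / 0 = 0\<close>, which
  meets a zero of theta on the right.\<close>

lemma rg_recip:
  assumes w: "norm w = 1" and L: "- w = exp L"
  shows "1 / (rg w X * rg (1 / w) (- X)) = exp (- L + of_int X * (of_int X - 1) / 2 * LP + of_int X * (of_int X + 1) / 2 * LQ)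
     * theta (w * p powi X) (p ^ r) * theta (w * q powi (- X)) (q ^ r)"
proof -
  have w0: "w \<noteq> 0" using w by auto
  define F where "F = (\<lambda>v. 1 / (rg v X * rg (1 / v) (- X)))"
  define G where "G = (\<lambda>v. (- 1 / v) * (p powi (X * (X - 1) div 2) * q powi (X * (X + 1) div 2)) * theta (v * p powi X) (p ^ r) * theta (v * q powi (- X)) (q ^ r))"
  have G: "G v = exp (- L + (of_int X * (of_int X - 1) / 2 * LP + of_int X * (of_int X + 1) / 2 * LQ))
     * theta (v * p powi X) (p ^ r) * theta (v * q powi (- X)) (q ^ r)" if "- v = exp L" for v L
  proof -
    have "- 1 / v = exp (- L)" using that by (metis exp_minus inverse_eq_divide minus_divide_left minus_divide_right)
    then show ?thesis unfolding G_def powi_p powi_q of_int_choose2 of_int_choose2' by (simp only: exp_add[symmetric])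
  qed
  have "F w = G w"
  proof (rule eventually_at_eq_imp_eq[where f = F and g = G])
    obtain C1 k1 m1 where 1: "C1 \<noteq> 0" "\<And>z. z \<noteq> 0 \<Longrightarrow> rg z X = C1 * z powi k1 * EE (r - m1) (p * q / z) / EE m1 z"
      using rg_canonical by metis
    obtain C2 k2 m2 where 2: "C2 \<noteq> 0" "\<And>z. z \<noteq> 0 \<Longrightarrow> rg z (- X) = C2 * z powi k2 * EE (r - m2) (p * q / z) / EE m2 z"
      using rg_canonical by metis
    \<comment> \<open>\<open>F\<close> with its polar factors moved to the numerator. On the circle
      the remaining denominators are nonzero, since their arguments have norm
      \<open>norm (p * q)\<close>.\<close>
    define H where "H = (\<lambda>v. EE m1 v * EE m2 (1 / v) / (C1 * v powi k1 * EE (r - m1) (p * q / v) * (C2 * (1 / v) powi k2 * EE (r - m2) (p * q / (1 / v)))))"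
    have FH: "F v = H v" if "v \<noteq> 0" for v
      unfolding F_def H_def 1(2)[OF that] using 2(2)[of "1 / v"] that by (simp add: field_simps)
    have "norm (p * q / w) < 1" "norm (p * q / (1 / w)) < 1" using w pq_lt by (auto simp: norm_divide norm_mult)
    then have "isCont H w" unfolding H_def using 1(1) 2(1) w0 EE_nz
      by (intro continuous_intros isCont_o2[OF _ isCont_EE]) auto
    moreover have "eventually (\<lambda>v. v \<noteq> 0) (nhds w)" using w0 t1_space_nhds by blast
    then have "eventually (\<lambda>v. F v = H v) (nhds w)" by eventually_elim (rule FH)
    ultimately show "isCont F w" using isCont_cong by metis
    show "isCont G w" unfolding G_def using w0 p_nz q_nz
      by (intro continuous_intros isCont_o2[OF _ isCont_theta] pr_lt qr_lt) auto
    have ei: "eventually (\<lambda>v. P (1 / v)) (at w)" if "\<And>z. eventually P (at z)" for P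
      by (rule eventually_at_inverse[OF w0 that])
    have c1: "(1 / p powi X) * (1 / v) = 1 / (v * p powi X)" "(1 / q powi (- X)) * (1 / v) = 1 / (v * q powi (- X))" for v
      by (auto simp: field_simps)
    have i1: "eventually (\<lambda>v. Dp (1 / (v * p powi X)) \<noteq> 0) (at w)"
      using ei[of "\<lambda>v. Dp ((1 / p powi X) * v) \<noteq> 0", OF dpoch_ev_nz[OF pr_lt pq_lt]] unfolding c1 .
    have i2: "eventually (\<lambda>v. Dq (1 / (v * q powi (- X))) \<noteq> 0) (at w)"
      using ei[of "\<lambda>v. Dq ((1 / q powi (- X)) * v) \<noteq> 0", OF dpoch_ev_nz[OF qr_lt pq_lt]] unfolding c1 .
    have i3: "eventually (\<lambda>v. qpoch_inf (1 / (v * q powi (- X))) (p * q) \<noteq> 0) (at w)"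
      using qpoch_ev_nz(2)[OF pq_lt, of "1 / q powi (- X)" w] w0 q_nz by (simp add: mult.commute)
    have i4: "eventually (\<lambda>v. qpoch_inf (v * q powi (- X)) (p * q) \<noteq> 0) (at w)"
      using qpoch_ev_nz(1)[OF pq_lt, of "q powi (- X)" w] w0 q_nz by (simp add: mult.commute)
    have i5: "eventually (\<lambda>v. Dp (v * p powi X) \<noteq> 0) (at w)" "eventually (\<lambda>v. Dq (v * q powi (- X)) \<noteq> 0) (at w)"
      using dpoch_ev_nz[OF pr_lt pq_lt, of "p powi X" w] dpoch_ev_nz[OF qr_lt pq_lt, of "q powi (- X)" w]
      by (simp_all add: mult.commute)
    have i6: "eventually (\<lambda>v. 1 / v \<noteq> 0 \<and> rg (1 / v) (- X) = raw (- X) (1 / v)) (at w)"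
      by (rule eventually_at_inverse[OF w0 raw_generic]) (use w0 in auto)
    show "eventually (\<lambda>v. F v = G v) (at w)"
      using raw_generic[OF w0, of X] i1 i2 i3 i4 i5 i6
    proof eventually_elim
      case (elim v)
      have Lv: "- v = exp (Ln (- v))" using elim by simp
      have "F v = 1 / (raw X v * raw (- X) (1 / v))" using elim by (simp add: F_def)
      also have "\<dots> = exp (- Ln (- v) + of_int X * (of_int X - 1) / 2 * LP + of_int X * (of_int X + 1) / 2 * LQ)
         * theta (v * p powi X) (p ^ r) * theta (v * q powi (- X)) (q ^ r)"
        using elim by (intro raw_recip[OF _ Lv]) auto
      finally show ?case unfolding G[OF Lv] by (simp only: add.assoc)
    qed
  qed
  then show ?thesis unfolding F_def G[OF L] add.assoc .
qed

end

section \<open>Theta function identities\<close>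

text \<open>Every zero of \<open>h\<close> is simple, with cofactor \<open>k\<close>, and is also a
  zero of \<open>f\<close>; the quotient then tends to \<open>deriv f z / k z\<close>.\<close>

lemma remove_sings_divide:
  assumes f: "f holomorphic_on - {0}" and h: "h holomorphic_on - {0}"
    and ev: "\<And>z. z \<noteq> 0 \<Longrightarrow> eventually (\<lambda>w. h w \<noteq> 0) (at z)"
    and zero: "\<And>z. z \<noteq> 0 \<Longrightarrow> h z = 0 \<Longrightarrow>
        f z = 0 \<and> (\<exists>k. isCont k z \<and> k z \<noteq> 0 \<and> (\<forall>w. w \<noteq> 0 \<longrightarrow> h w = (w - z) * k w))"
  shows "\<exists>g. g holomorphic_on - {0} \<and> (\<forall>z. z \<noteq> 0 \<longrightarrow> f z = h z * g z)"
proof -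
  define g where "g = remove_sings (\<lambda>w. f w / h w)"
  have an: "f analytic_on {z}" "h analytic_on {z}" if "z \<noteq> 0" for z
    using f h that analytic_at[of f z] analytic_at[of h z] by (auto intro!: exI[of _ "- {0}"])
  have "g analytic_on {z}" if znz: "z \<noteq> 0" for z
  proof -
    have iso: "isolated_singularity_at (\<lambda>w. f w / h w) z"
      using an[OF that]
      by (intro isolated_singularity_at_divide isolated_singularity_at_analytic not_essential_analytic)
    have "\<exists>c. (\<lambda>w. f w / h w) \<midarrow>z\<rightarrow> c"
    proof (cases "h z = 0")
      case False
      have "(\<lambda>w. f w / h w) \<midarrow>z\<rightarrow> f z / h z"
        using an[OF that] False analytic_at_imp_isCont isContD by (intro tendsto_divide) blast+
      then show ?thesis ..
    next
      case True
      then obtain k where k: "isCont k z" "k z \<noteq> 0" "\<And>w. w \<noteq> 0 \<Longrightarrow> h w = (w - z) * k w" and fz: "f z = 0"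
        using zero[OF znz True] by blast
      have "(f has_field_derivative deriv f z) (at z)"
        using f that by (intro holomorphic_derivI[of f "- {0}"]) auto
      then have "(\<lambda>w. (f w - f z) / (w - z)) \<midarrow>z\<rightarrow> deriv f z"
        by (simp add: has_field_derivative_iff)
      then have "(\<lambda>w. (f w - f z) / (w - z) / k w) \<midarrow>z\<rightarrow> deriv f z / k z"
        using k isContD by (intro tendsto_divide) auto
      moreover have "eventually (\<lambda>w. w \<noteq> 0) (at z)" using that tendsto_ident_at tendsto_imp_eventually_ne by blast
      then have "eventually (\<lambda>w. f w / h w = (f w - f z) / (w - z) / k w) (at z)"
        by eventually_elim (simp add: k(3) fz)
      ultimately have "(\<lambda>w. f w / h w) \<midarrow>z\<rightarrow> deriv f z / k z" by (rule tendsto_eventually_eq[rotated])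
      then show ?thesis ..
    qed
    then show ?thesis unfolding g_def using iso remove_sings_analytic_at by blast
  qed
  then have "g holomorphic_on - {0}"
    by (metis ComplD analytic_imp_holomorphic analytic_on_analytic_at insertCI)
  moreover have "f z = h z * g z" if "z \<noteq> 0" for z
  proof (cases "h z = 0")
    case True
    then show ?thesis using zero that by auto
  next
    case False
    then have "(\<lambda>w. f w / h w) analytic_on {z}" using an[OF that] by (intro analytic_on_divide) auto
    then show ?thesis using False by (simp add: g_def)
  qed
  ultimately show ?thesis by blast
qed

text \<open>Quasi-periodicity moves the zero to 1, where the leading factor of the product is
  \<open>1 - w / z\<close>; the cofactor is all the rest.\<close>

lemma theta_simple_zero:
  assumes Q: "norm Q < 1" "Q \<noteq> 0" and z: "z \<noteq> 0" "theta z Q = 0"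
  shows "\<exists>k. isCont k z \<and> k z \<noteq> 0 \<and> (\<forall>w. w \<noteq> 0 \<longrightarrow> theta w Q = (w - z) * k w)"
proof -
  obtain j where j: "z = Q powi j" using theta_eq_0_iff Q z by blast
  define k where "k = (\<lambda>w. - inverse z * ((- (w / z)) powi (- j) * Q powi (- (j * (j - 1) div 2)))
     * (qpoch_inf (Q * (w / z)) Q * qpoch_inf (Q / (w / z)) Q))"
  have c: "isCont (\<lambda>z. qpoch_inf z Q) y" for y
    using holomorphic_on_imp_continuous_on[OF qpoch_holo[OF Q(1), of UNIV]] continuous_on_eq_continuous_at open_UNIV by blast
  have "isCont k z" unfolding k_def using z
    by (intro continuous_intros isCont_o2[OF _ c]) auto
  moreover have "k z \<noteq> 0" unfolding k_def using z Q qpoch_nz[of Q Q] by simp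
  moreover have "theta w Q = (w - z) * k w" if "w \<noteq> 0" for w
  proof -
    have "theta w Q = (- (w / z)) powi (- j) * Q powi (- (j * (j - 1) div 2)) * theta (w / z) Q"
      using theta_shift_powi[OF Q, of "w / z" j] that z j by simp
    moreover have "theta (w / z) Q = (1 - w / z) * (qpoch_inf (Q * (w / z)) Q * qpoch_inf (Q / (w / z)) Q)"
      unfolding theta_def by (subst qpoch_rec[OF Q(1)]) (simp add: mult_ac)
    moreover have "1 - w / z = (w - z) * (- inverse z)" using z by (simp add: field_simps)
    ultimately show ?thesis unfolding k_def by simp
  qed
  ultimately show ?thesis by blast
qed

text \<open>Quasi-periodicity spreads the zero \<open>1 / a\<close> of \<open>f\<close> over all
  \<open>Q powi j / a\<close>, which are exactly the simple zeros of \<open>theta (a * z) Q\<close>.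
  Division raises the exponent \<open>k\<close> by 1, so a multiplier of exponent \<open>- n\<close>
  becomes constant after \<open>n\<close> divisions.\<close>

lemma theta_divide:
  assumes Q: "norm Q < 1" "Q \<noteq> 0" and f: "f holomorphic_on - {0}" and a: "a \<noteq> 0" and c: "c \<noteq> 0"
    and quasi: "\<And>z. z \<noteq> 0 \<Longrightarrow> f (Q * z) = c * z powi k * f z" and f0: "f (1 / a) = 0"
  shows "\<exists>g. g holomorphic_on - {0} \<and> (\<forall>z. z \<noteq> 0 \<longrightarrow> f z = theta (a * z) Q * g z) \<and>
      (\<forall>z. z \<noteq> 0 \<longrightarrow> g (Q * z) = (- c * a) * z powi (k + 1) * g z)"
proof -
  have th: "(\<lambda>z. theta (a * z) Q) holomorphic_on - {0}"
    using a Q by (intro holomorphic_on_compose_gen[OF _ theta_holo[of Q "- {0}"], unfolded o_def] holomorphic_intros) auto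
  have fz: "f (Q powi j / a) = 0" for j
  proof (induction j rule: int_induct[where k = 0])
    case base then show ?case using f0 by simp
  next
    case (step1 i)
    have "f (Q powi (i + 1) / a) = f (Q * (Q powi i / a))" using Q by (simp add: power_int_add mult.commute)
    then show ?case using quasi[of "Q powi i / a"] step1 Q a by simp
  next
    case (step2 i)
    have "f (Q powi i / a) = f (Q * (Q powi (i - 1) / a))" using Q by (simp add: power_int_diff)
    then show ?case using quasi[of "Q powi (i - 1) / a"] step2 Q a c by simp
  qed
  have "\<exists>g. g holomorphic_on - {0} \<and> (\<forall>z. z \<noteq> 0 \<longrightarrow> f z = theta (a * z) Q * g z)"
  proof (rule remove_sings_divide[OF f th])
    show "eventually (\<lambda>w. theta (a * w) Q \<noteq> 0) (at z)" if "z \<noteq> 0" for z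
      using theta_ev_nz[OF Q a that] .
    fix z :: complex assume z: "z \<noteq> 0" "theta (a * z) Q = 0"
    then obtain j where "a * z = Q powi j" using theta_eq_0_iff[OF Q, of "a * z"] a by auto
    then have "f z = 0" using fz[of j] a by (metis nonzero_mult_div_cancel_left)
    moreover obtain k where k: "isCont k (a * z)" "k (a * z) \<noteq> 0" "\<And>w. w \<noteq> 0 \<Longrightarrow> theta w Q = (w - a * z) * k w"
      using theta_simple_zero[OF Q _ z(2)] a z by auto
    have "isCont (\<lambda>w. a * k (a * w)) z"
      using k(1) by (intro continuous_intros isCont_o2[of z "\<lambda>w. a * w" k]) auto
    moreover have "theta (a * w) Q = (w - z) * (a * k (a * w))" if "w \<noteq> 0" for w
      using k(3)[of "a * w"] that a by (simp add: algebra_simps)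
    ultimately show "f z = 0 \<and> (\<exists>k. isCont k z \<and> k z \<noteq> 0 \<and> (\<forall>w. w \<noteq> 0 \<longrightarrow> theta (a * w) Q = (w - z) * k w))"
      using k(2) a by (intro conjI exI[of _ "\<lambda>w. a * k (a * w)"]) auto
  qed
  then obtain g where g: "g holomorphic_on - {0}" "\<And>z. z \<noteq> 0 \<Longrightarrow> f z = theta (a * z) Q * g z" by blast
  have gc: "isCont g z" if "z \<noteq> 0" for z
    using holomorphic_on_imp_continuous_on[OF g(1)] that continuous_on_eq_continuous_at[OF open_Compl[OF closed_singleton[of "0::complex"]], of g] by auto
  have "g (Q * z) = (- c * a) * z powi (k + 1) * g z" if z: "z \<noteq> 0" for z
  proof (rule eventually_at_eq_imp_eq[where f = "\<lambda>z. g (Q * z)" and g = "\<lambda>z. (- c * a) * z powi (k + 1) * g z"])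
    have "eventually (\<lambda>w. w \<noteq> 0) (at z)" using z tendsto_ident_at tendsto_imp_eventually_ne by blast
    then show "eventually (\<lambda>z. g (Q * z) = (- c * a) * z powi (k + 1) * g z) (at z)"
      using theta_ev_nz[OF Q a z]
    proof eventually_elim
      case (elim w)
      have "theta (a * (Q * w)) Q = - theta (a * w) Q / (a * w)"
        using theta_shift[OF Q, of "a * w"] a elim by (simp add: mult_ac)
      then have "- theta (a * w) Q / (a * w) * g (Q * w) = c * w powi k * (theta (a * w) Q * g w)"
        using quasi[of w] g(2)[of w] g(2)[of "Q * w"] elim Q by simp
      then have "theta (a * w) Q * g (Q * w) = theta (a * w) Q * ((- c * a) * (w powi k * w) * g w)"
      proof -
        have "theta (a * w) Q * g (Q * w) = - (a * w) * (- theta (a * w) Q / (a * w) * g (Q * w))" using a elim by simp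
        then show ?thesis unfolding \<open>- theta (a * w) Q / (a * w) * g (Q * w) = _\<close> by (simp add: mult_ac)
      qed
      then have "theta (a * w) Q * g (Q * w) = theta (a * w) Q * ((- c * a) * w powi (k + 1) * g w)"
        using elim by (simp add: power_int_add)
      then show ?case using elim mult_left_cancel by blast
    qed
  qed (use z Q gc in \<open>auto intro!: continuous_intros isCont_o2[OF _ gc]\<close>)
  then show ?thesis using g by blast
qed

text \<open>The condition on pairs separates the zeros modulo powers of \<open>Q\<close>, so that
  each of them survives division by the theta functions of the others.\<close>

lemma theta_divide_list:
  assumes Q: "norm Q < 1" "Q \<noteq> 0" and "f holomorphic_on - {0}" "c \<noteq> 0"
    and "\<And>z. z \<noteq> 0 \<Longrightarrow> f (Q * z) = c * z powi k * f z"
    and "\<And>a. a \<in> set as \<Longrightarrow> a \<noteq> 0 \<and> f (1 / a) = 0"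
    and "sorted_wrt (\<lambda>a b. theta (a / b) Q \<noteq> 0) as"
  shows "\<exists>g. g holomorphic_on - {0} \<and> (\<forall>z. z \<noteq> 0 \<longrightarrow> f z = (\<Prod>a\<leftarrow>as. theta (a * z) Q) * g z) \<and>
      (\<forall>z. z \<noteq> 0 \<longrightarrow> g (Q * z) = (c * (\<Prod>a\<leftarrow>as. - a)) * z powi (k + int (length as)) * g z)"
  using assms(3-)
proof (induction as arbitrary: f c k)
  case Nil
  then show ?case by (intro exI[of _ f]) auto
next
  case (Cons a as)
  obtain f1 where f1: "f1 holomorphic_on - {0}" "\<And>z. z \<noteq> 0 \<Longrightarrow> f z = theta (a * z) Q * f1 z"
      "\<And>z. z \<noteq> 0 \<Longrightarrow> f1 (Q * z) = (- c * a) * z powi (k + 1) * f1 z"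
    using theta_divide[OF Q Cons.prems(1) _ Cons.prems(2,3), of a] Cons.prems(4)[of a] by auto
  have "b \<noteq> 0 \<and> f1 (1 / b) = 0" if "b \<in> set as" for b
  proof -
    have "theta (a / b) Q \<noteq> 0" "b \<noteq> 0" "f (1 / b) = 0" using Cons.prems(4,5) that by auto
    then show ?thesis using f1(2)[of "1 / b"] by auto
  qed
  moreover have "- c * a \<noteq> 0" using Cons.prems by auto
  ultimately obtain g where g: "g holomorphic_on - {0}" "\<And>z. z \<noteq> 0 \<Longrightarrow> f1 z = (\<Prod>a\<leftarrow>as. theta (a * z) Q) * g z"
      "\<And>z. z \<noteq> 0 \<Longrightarrow> g (Q * z) = ((- c * a) * (\<Prod>a\<leftarrow>as. - a)) * z powi (k + 1 + int (length as)) * g z"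
    using Cons.IH[of f1 "- c * a" "k + 1"] f1(1,3) Cons.prems(5) by auto
  show ?case
    by (rule exI[of _ g]) (use g f1(2) in \<open>auto simp: mult_ac add_ac\<close>)
qed

text \<open>Substituting \<open>z = exp x\<close> gives an entire function. Periodicity reduces its
  values to those on the compact annulus \<open>norm Q \<le> norm z \<le> 1\<close>, so Liouville
  applies.\<close>

lemma periodic_constant:
  assumes Q: "norm Q < 1" "Q \<noteq> 0" and g: "g holomorphic_on - {0}" and per: "\<And>z. z \<noteq> 0 \<Longrightarrow> g (Q * z) = g z"
    and zw: "z \<noteq> 0" "w \<noteq> 0"
  shows "g z = g w"
proof -
  have pj: "g (Q powi j * z) = g z" if "z \<noteq> 0" for z j
  proof (induction j rule: int_induct[where k = 0])
    case (step1 i)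
    then show ?case using per[of "Q powi i * z"] that Q by (simp add: power_int_add mult_ac)
  next
    case (step2 i)
    then show ?case using per[of "Q powi (i - 1) * z"] that Q by (simp add: power_int_diff)
  qed simp
  have lnQ: "ln (norm Q) < 0" using Q by simp
  have red: "\<exists>j. norm Q \<le> norm (Q powi j * z) \<and> norm (Q powi j * z) \<le> 1" if "z \<noteq> 0" for z
  proof -
    define j where "j = \<lceil>- ln (norm z) / ln (norm Q)\<rceil>"
    have "- ln (norm z) / ln (norm Q) \<le> of_int j" "of_int j < - ln (norm z) / ln (norm Q) + 1" unfolding j_def by linarith+
    then have "of_int j * ln (norm Q) \<le> - ln (norm z)" "- ln (norm z) + ln (norm Q) \<le> of_int j * ln (norm Q)"
      using lnQ by (auto simp: field_simps)
    moreover have "norm (Q powi j * z) = exp (of_int j * ln (norm Q) + ln (norm z))"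
    proof -
      have "norm Q powi j = exp (of_int j * ln (norm Q))"
        using exp_power_int[of "ln (norm Q)" j] Q by simp
      then show ?thesis using that by (simp add: norm_mult norm_power_int exp_add)
    qed
    ultimately have "norm (Q powi j * z) \<le> exp 0" "exp (ln (norm Q)) \<le> norm (Q powi j * z)" by auto
    then show ?thesis using Q by auto
  qed
  define K where "K = cball (0::complex) 1 - ball 0 (norm Q)"
  have "compact K" unfolding K_def by (intro compact_diff) auto
  moreover have "continuous_on K g"
    by (rule continuous_on_subset[OF holomorphic_on_imp_continuous_on[OF g]]) (use Q in \<open>auto simp: K_def\<close>)
  ultimately have "bounded (g ` K)" by (intro compact_imp_bounded compact_continuous_image)
  moreover have "range (\<lambda>x. g (exp x)) \<subseteq> g ` K"
  proof
    fix y assume "y \<in> range (\<lambda>x. g (exp x))"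
    then obtain x where x: "y = g (exp x)" by blast
    obtain j where j: "norm Q \<le> norm (Q powi j * exp x)" "norm (Q powi j * exp x) \<le> 1" using red[of "exp x"] by auto
    have "y = g (Q powi j * exp x)" using pj[of "exp x" j] x by simp
    moreover have "Q powi j * exp x \<in> K" using j by (auto simp: K_def)
    ultimately show "y \<in> g ` K" by blast
  qed
  ultimately have "bounded (range (\<lambda>x. g (exp x)))" using bounded_subset by blast
  moreover have "(\<lambda>x. g (exp x)) holomorphic_on UNIV"
    by (intro holomorphic_on_compose_gen[OF _ g, unfolded o_def] holomorphic_intros) auto
  ultimately have "(\<lambda>x. g (exp x)) constant_on UNIV" by (intro Liouville_theorem)
  then obtain y where "\<And>x. g (exp x) = y" unfolding constant_on_def by blast
  then have "g (exp (Ln z)) = g (exp (Ln w))" by simp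
  then show ?thesis using zw by simp
qed

text \<open>Zero counting: a theta function of degree \<open>n\<close> with \<open>n\<close>
  separate prescribed zeros is determined up to a constant, and one further zero forces it to
  vanish. The condition on \<open>c\<close> makes the multiplier of the quotient a power of
  \<open>Q\<close>, which \<open>z powi (- j)\<close> compensates.\<close>

lemma theta_vanish:
  assumes Q: "norm Q < 1" "Q \<noteq> 0" and f: "f holomorphic_on - {0}" and c: "c * (\<Prod>a\<leftarrow>as. - a) = Q powi j"
    and quasi: "\<And>z. z \<noteq> 0 \<Longrightarrow> f (Q * z) = c * z powi (- int (length as)) * f z"
    and zeros: "\<And>a. a \<in> set as \<Longrightarrow> a \<noteq> 0 \<and> f (1 / a) = 0"
    and dis: "sorted_wrt (\<lambda>a b. theta (a / b) Q \<noteq> 0) as"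
    and w: "w \<noteq> 0" "f w = 0" "\<And>a. a \<in> set as \<Longrightarrow> theta (a * w) Q \<noteq> 0" and z: "z \<noteq> 0"
  shows "f z = 0"
proof -
  have "c \<noteq> 0" using c Q by auto
  then obtain g where g: "g holomorphic_on - {0}" "\<And>z. z \<noteq> 0 \<Longrightarrow> f z = (\<Prod>a\<leftarrow>as. theta (a * z) Q) * g z"
      "\<And>z. z \<noteq> 0 \<Longrightarrow> g (Q * z) = Q powi j * g z"
    using theta_divide_list[OF Q f _ quasi zeros dis] c by auto
  define h where "h = (\<lambda>z. g z * z powi (- j))"
  have "h z = h w"
  proof (rule periodic_constant[OF Q, where g = h])
    show "h holomorphic_on - {0}" unfolding h_def using g(1) by (intro holomorphic_intros) auto
    show "h (Q * z) = h z" if "z \<noteq> 0" for z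
      using g(3)[OF that] Q that by (simp add: h_def power_int_mult_distrib power_int_minus)
  qed (use z w in auto)
  moreover have "(\<Prod>a\<leftarrow>as. theta (a * w) Q) \<noteq> 0" using w(3) by (auto simp: prod_list_zero_iff)
  then have "g w = 0" using g(2)[OF w(1)] w(2) by auto
  ultimately have "g z = 0" using z by (simp add: h_def)
  then show ?thesis using g(2)[OF z] by simp
qed

section \<open>The addition formula and its eight-parameter analogue\<close>

definition th2 :: "complex \<Rightarrow> complex \<Rightarrow> complex \<Rightarrow> complex" where
  "th2 Q u x = theta (u * x) Q * theta (u / x) Q"

lemma th2_holo: "norm Q < 1 \<Longrightarrow> u \<noteq> 0 \<Longrightarrow> (\<lambda>x. th2 Q u x) holomorphic_on - {0}"
  unfolding th2_def
  by (intro holomorphic_intros holomorphic_on_compose_gen[OF _ theta_holo[of Q "- {0}"], unfolded o_def]) auto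

lemma theta_div_shift:
  assumes "norm Q < 1" "Q \<noteq> 0" "y \<noteq> 0"
  shows "theta (y / Q) Q = - (y / Q) * theta y Q"
  using theta_shift[OF assms(1,2), of "y / Q"] assms by (simp add: field_simps)

text \<open>The multiplier does not involve \<open>u\<close>, so linear combinations over different
  \<open>u\<close> share it and zero counting applies to them.\<close>

lemma th2_shift:
  assumes "norm Q < 1" "Q \<noteq> 0" "u \<noteq> 0" "x \<noteq> 0"
  shows "th2 Q u (Q * x) = th2 Q u x / (Q * x\<^sup>2)"
proof -
  have 1: "theta (u * (Q * x)) Q = - theta (u * x) Q / (u * x)"
    using theta_shift[OF assms(1,2), of "u * x"] assms by (simp add: mult_ac)
  have 2: "theta (u / (Q * x)) Q = - (u / x / Q) * theta (u / x) Q"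
    using theta_div_shift[OF assms(1,2), of "u / x"] assms by (simp add: mult_ac)
  show ?thesis unfolding th2_def 1 2 using assms by (simp add: field_simps power2_eq_square)
qed

lemma th2_recip: "th2 Q u (1 / x) = th2 Q u x"
  by (simp add: th2_def)

lemma th2_swap:
  assumes "norm Q < 1" "Q \<noteq> 0" "u \<noteq> 0" "x \<noteq> 0"
  shows "th2 Q u x = - (u / x) * th2 Q x u"
proof -
  have "theta (u / x) Q = - theta (x / u) Q / (x / u)" using theta_recip[OF assms(1,2), of "x / u"] assms by simp
  then show ?thesis using assms by (simp add: th2_def mult_ac)
qed

lemma theta_nz_iff_recip: "norm Q < 1 \<Longrightarrow> Q \<noteq> 0 \<Longrightarrow> z \<noteq> 0 \<Longrightarrow> theta (1 / z) Q = 0 \<longleftrightarrow> theta z Q = 0"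
  by (simp add: theta_recip)

lemma theta_Q_zero: "norm Q < 1 \<Longrightarrow> Q \<noteq> 0 \<Longrightarrow> theta Q Q = 0"
  using theta_inv[of Q 1] theta_one[of Q] by simp

text \<open>In \<open>x\<close> the difference of the two sides has degree 2, the zeros
  \<open>c\<close> and \<open>1 / c\<close>, and a third zero \<open>b\<close>. The nonvanishing
  hypotheses separate these three points modulo powers of \<open>Q\<close>.\<close>

lemma theta_addition:
  assumes Q: "norm Q < 1" "Q \<noteq> 0" and nz: "a \<noteq> 0" "b \<noteq> 0" "c \<noteq> 0" "x \<noteq> 0"
    and gen: "theta (c\<^sup>2) Q \<noteq> 0" "theta (c * b) Q \<noteq> 0" "theta (c / b) Q \<noteq> 0"
  shows "th2 Q a x * th2 Q b c - th2 Q b x * th2 Q a c = - (b / c) * th2 Q a b * th2 Q c x"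
proof -
  define f where "f = (\<lambda>x. th2 Q a x * th2 Q b c - th2 Q b x * th2 Q a c + (b / c) * th2 Q a b * th2 Q c x)"
  have "f x = 0"
  proof (rule theta_vanish[OF Q, where f = f and as = "[c, 1 / c]" and c = "1 / Q" and j = "-1" and w = b])
    show "f holomorphic_on - {0}" unfolding f_def using Q nz th2_holo by (intro holomorphic_intros) auto
    show "f (Q * z) = 1 / Q * z powi (- int (length [c, 1 / c])) * f z" if "z \<noteq> 0" for z
      using that Q nz by (simp add: f_def th2_shift power_int_minus field_simps)
    have swap: "th2 Q b c = - (b / c) * th2 Q c b" by (rule th2_swap) (use Q nz in auto)
    have 0: "th2 Q u u = 0" if "u \<noteq> 0" for u using Q that by (simp add: th2_def)
    have "f c = 0" using 0[of c] nz by (simp add: f_def)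
    moreover have "f (1 / c) = f c" by (simp add: f_def th2_recip)
    ultimately show "u \<noteq> 0 \<and> f (1 / u) = 0" if "u \<in> set [c, 1 / c]" for u using that nz by auto
    show "f b = 0" using 0[of b] nz unfolding f_def swap by simp
    show "theta (u * b) Q \<noteq> 0" if "u \<in> set [c, 1 / c]" for u
      using that gen nz theta_nz_iff_recip[OF Q, of "c / b"] by auto
    show "sorted_wrt (\<lambda>a b. theta (a / b) Q \<noteq> 0) [c, 1 / c]" using gen nz by (simp add: power2_eq_square)
  qed (use Q nz in \<open>auto simp: power_int_minus field_simps\<close>)
  then show ?thesis by (simp add: f_def algebra_simps)
qed

lemma UNIV_8: "(UNIV :: 8 set) = {1, 2, 3, 4, 5, 6, 7, 8}"
proof -
  have "card {1::8,2,3,4,5,6,7,8} = CARD(8)" by simp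
  then show ?thesis by (metis card_subset_eq finite subset_UNIV)
qed

lemma prod_8: "(\<Prod>a\<in>(UNIV :: 8 set). f a) = f 1 * f 2 * f 3 * (\<Prod>a\<in>{4,5,6,7,8}. f a)"
  unfolding UNIV_8 by (simp add: mult_ac)

lemma prod_8_const: "(\<Prod>a\<in>(UNIV :: 8 set). c) = (c ^ 8 :: complex)"
  by simp

text \<open>If \<open>y\<^sup>2\<close> is no power of \<open>Q\<close>, then \<open>y\<close>
  differs modulo powers of \<open>Q\<close> from 1, -1, \<open>s\<close> and \<open>- s\<close>, the
  fixed points of \<open>x \<mapsto> 1 / x\<close>.\<close>

lemma theta_nz_of_square:
  assumes Q: "norm Q < 1" "Q \<noteq> 0" and "s\<^sup>2 = Q" "theta (y\<^sup>2) Q \<noteq> 0" and y: "y \<noteq> 0"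
  shows "theta y Q \<noteq> 0" "theta (- y) Q \<noteq> 0" "theta (y * s) Q \<noteq> 0" "theta (- y * s) Q \<noteq> 0"
    "theta (y / s) Q \<noteq> 0" "theta (- y / s) Q \<noteq> 0"
proof -
  have s: "s \<noteq> 0" using assms by auto
  have n: "False" if "y\<^sup>2 = Q powi j" for j
    using that assms(4) theta_eq_0_iff[OF Q, of "y\<^sup>2"] y by (metis power_not_zero)
  have 1: "theta x Q \<noteq> 0" if x: "x\<^sup>2 = y\<^sup>2 * Q powi i" "x \<noteq> 0" for x i
  proof
    assume "theta x Q = 0"
    then obtain j where "x = Q powi j" using theta_eq_0_iff[OF Q x(2)] by blast
    then have "(Q powi j)\<^sup>2 = y\<^sup>2 * Q powi i" using x by simp
    moreover have "Q powi (j + j - i) = (Q powi j)\<^sup>2 / Q powi i"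
      using Q power_int_add[of Q j j] power_int_diff[of Q "j + j" i] by (simp add: power2_eq_square)
    ultimately have "y\<^sup>2 = Q powi (j + j - i)" using Q by simp
    then show False using n by blast
  qed
  show "theta y Q \<noteq> 0" "theta (- y) Q \<noteq> 0" using 1[of _ 0] y by auto
  show "theta (y * s) Q \<noteq> 0" "theta (- y * s) Q \<noteq> 0" using 1[of _ 1] y s assms(3) by (auto simp: power_mult_distrib)
  show "theta (y / s) Q \<noteq> 0" "theta (- y / s) Q \<noteq> 0"
  proof -
    have "(y / s)\<^sup>2 = y\<^sup>2 * Q powi (-1)" "(- y / s)\<^sup>2 = y\<^sup>2 * Q powi (-1)"
      using assms(3) by (auto simp: power_divide power_int_minus divide_inverse power_mult_distrib power_inverse)
    then show "theta (y / s) Q \<noteq> 0" "theta (- y / s) Q \<noteq> 0" using 1[of "y / s" "-1"] 1[of "- y / s" "-1"] y s by auto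
  qed
qed

text \<open>An interpolation coefficient: at \<open>x = u $ i\<close> the other two terms of
  \<open>theta_eight\<close> vanish, which determines this one. The factors with
  \<open>u $ j\<close> and \<open>u $ k\<close> of the product over all eight parameters have been
  cancelled against \<open>th2\<close>.\<close>

definition theta_coeff :: "complex \<Rightarrow> complex ^ 8 \<Rightarrow> 8 \<Rightarrow> 8 \<Rightarrow> 8 \<Rightarrow> complex" where
  "theta_coeff Q u i j k = (u $ i) powi (-3) * (\<Prod>a\<in>{4,5,6,7,8}. theta (u $ a * u $ i) Q)
      / (theta (u $ j / u $ i) Q * theta (u $ k / u $ i) Q)"

text \<open>The difference of the two sides has degree 8, because the parameters have product 1. Up
  to a monomial it is odd under \<open>x \<mapsto> 1 / x\<close>. It vanishes at the four fixed
  points of inversion modulo powers of \<open>Q\<close>, and by the choice of coefficients at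
  \<open>u $ 1\<close>, \<open>u $ 2\<close>, \<open>u $ 3\<close>, hence at their reciprocals too.
  The fixed points with the first two parameters and their reciprocals make up the eight prescribed
  zeros; \<open>u $ 3\<close> is the surplus one.\<close>

lemma theta_eight:
  fixes u :: "complex ^ 8"
  assumes Q: "norm Q < 1" "Q \<noteq> 0" and u: "(\<Prod>a\<in>UNIV. u $ a) = 1" and x: "x \<noteq> 0"
    and gen: "\<And>i. i \<in> {1,2,3} \<Longrightarrow> theta ((u $ i)\<^sup>2) Q \<noteq> 0"
       "\<And>i j. i \<in> {1,2,3} \<Longrightarrow> j \<in> {1,2,3} \<Longrightarrow> i \<noteq> j \<Longrightarrow> theta (u $ i * u $ j) Q \<noteq> 0 \<and> theta (u $ i / u $ j) Q \<noteq> 0"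
  shows "x powi (-3) * (\<Prod>a\<in>UNIV. theta (u $ a * x) Q) - x ^ 5 * (\<Prod>a\<in>UNIV. theta (u $ a / x) Q)
    = theta (x\<^sup>2) Q * (theta_coeff Q u 1 2 3 * (th2 Q (u $ 2) x * th2 Q (u $ 3) x)
      + theta_coeff Q u 2 1 3 * (th2 Q (u $ 1) x * th2 Q (u $ 3) x)
      + theta_coeff Q u 3 1 2 * (th2 Q (u $ 1) x * th2 Q (u $ 2) x))"
proof -
  define T1 where "T1 = (\<lambda>x. x powi (-3) * (\<Prod>a\<in>UNIV. theta (u $ a * x) Q))"
  define T2 where "T2 = (\<lambda>x. x ^ 5 * (\<Prod>a\<in>UNIV. theta (u $ a / x) Q))"
  define B where "B = (\<lambda>x. theta_coeff Q u 1 2 3 * (th2 Q (u $ 2) x * th2 Q (u $ 3) x)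
      + theta_coeff Q u 2 1 3 * (th2 Q (u $ 1) x * th2 Q (u $ 3) x)
      + theta_coeff Q u 3 1 2 * (th2 Q (u $ 1) x * th2 Q (u $ 2) x))"
  define f where "f = (\<lambda>x. T1 x - T2 x - theta (x\<^sup>2) Q * B x)"
  have unz: "u $ a \<noteq> 0" for a using u by (metis UNIV_I finite prod_zero_iff zero_neq_one)
  obtain s where s: "s\<^sup>2 = Q" by (metis power2_csqrt)
  have snz: "s \<noteq> 0" using s Q by auto
  have th2_0: "th2 Q y y = 0" if "y \<noteq> 0" for y using that Q by (simp add: th2_def)
  have T1_shift: "T1 (Q * x) = Q powi (-3) * x powi (-8) * T1 x" if "x \<noteq> 0" for x
  proof -
    have "(\<Prod>a\<in>UNIV. theta (u $ a * (Q * x)) Q) = (\<Prod>a\<in>UNIV. theta (u $ a * x) Q * (- 1 / x) / u $ a)"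
    proof (rule prod.cong)
      fix a show "theta (u $ a * (Q * x)) Q = theta (u $ a * x) Q * (- 1 / x) / u $ a"
        using theta_shift[OF Q, of "u $ a * x"] that unz by (simp add: mult_ac)
    qed auto
    also have "\<dots> = (\<Prod>a\<in>UNIV. theta (u $ a * x) Q) * (- 1 / x) ^ 8 / (\<Prod>a\<in>UNIV. u $ a)"
      by (simp only: prod.distrib prod_dividef prod_8_const) (simp add: power_divide)
    finally show ?thesis unfolding T1_def u
      by (simp add: power_int_mult_distrib power_int_minus power_divide field_simps)
  qed
  have T2_shift: "T2 (Q * x) = Q powi (-3) * x powi (-8) * T2 x" if "x \<noteq> 0" for x
  proof -
    have "(\<Prod>a\<in>UNIV. theta (u $ a / (Q * x)) Q) = (\<Prod>a\<in>UNIV. theta (u $ a / x) Q * (- 1 / (x * Q)) * u $ a)"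
    proof (rule prod.cong)
      fix a show "theta (u $ a / (Q * x)) Q = theta (u $ a / x) Q * (- 1 / (x * Q)) * u $ a"
        using theta_div_shift[OF Q, of "u $ a / x"] that unz by (simp add: mult_ac)
    qed auto
    also have "\<dots> = (\<Prod>a\<in>UNIV. theta (u $ a / x) Q) * (- 1 / (x * Q)) ^ 8 * (\<Prod>a\<in>UNIV. u $ a)"
      by (simp only: prod.distrib prod_8_const)
    finally have "T2 (Q * x) = ((Q * x) ^ 5 * (- 1 / (x * Q)) ^ 8) * (\<Prod>a\<in>UNIV. theta (u $ a / x) Q)"
      unfolding T2_def u by (simp only: mult_1 mult.right_neutral mult_ac)
    moreover have "(Q * x) ^ 5 * (- 1 / (x * Q)) ^ 8 = Q powi (-3) * x powi (-8) * x ^ 5"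
      using that Q by (simp add: power_int_minus power_mult_distrib power_divide field_simps)
    ultimately show ?thesis unfolding T2_def by (simp only: mult.assoc)
  qed
  have B_shift: "theta ((Q * x)\<^sup>2) Q * B (Q * x) = Q powi (-3) * x powi (-8) * (theta (x\<^sup>2) Q * B x)" if "x \<noteq> 0" for x
  proof -
    have "theta ((Q * x)\<^sup>2) Q = theta (Q * (Q * x\<^sup>2)) Q" by (simp add: power2_eq_square mult_ac)
    also have "\<dots> = theta (x\<^sup>2) Q / (Q * x\<^sup>2 * x\<^sup>2)"
      using theta_shift[OF Q, of "Q * x\<^sup>2"] theta_shift[OF Q, of "x\<^sup>2"] that Q by simp
    finally have 1: "theta ((Q * x)\<^sup>2) Q = theta (x\<^sup>2) Q / (Q * x\<^sup>2 * x\<^sup>2)" .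
    have 2: "th2 Q (u $ a) (Q * x) = th2 Q (u $ a) x * (1 / (Q * x\<^sup>2))" for a
      using th2_shift[OF Q unz that] by simp
    have 3: "B (Q * x) = B x * (1 / (Q * x\<^sup>2))\<^sup>2"
      unfolding B_def 2 by (simp add: algebra_simps power2_eq_square)
    have 4: "1 / (Q * x\<^sup>2 * x\<^sup>2) * (1 / (Q * x\<^sup>2))\<^sup>2 = Q powi (-3) * x powi (-8)"
      using that Q by (simp add: power_int_minus field_simps power2_eq_square) (simp add: power_numeral_reduce)
    show ?thesis unfolding 1 3 4[symmetric] by simp
  qed
  have B_recip: "B (1 / x) = B x" for x unfolding B_def th2_recip ..
  have T1_recip: "T1 (1 / x) = x ^ 3 * (\<Prod>a\<in>UNIV. theta (u $ a / x) Q)" if "x \<noteq> 0" for x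
    using that by (simp add: T1_def power_int_minus power_divide)
  have f_recip: "f (1 / x) = - (1 / x\<^sup>2) * f x" if "x \<noteq> 0" for x
  proof -
    have "theta ((1 / x)\<^sup>2) Q = - theta (x\<^sup>2) Q / x\<^sup>2"
      using theta_recip[OF Q, of "x\<^sup>2"] that by (simp add: power_divide)
    moreover have "T1 (1 / x) = T2 x / x\<^sup>2" unfolding T1_recip[OF that] T2_def
      using that by (simp add: field_simps power_add[symmetric])
    moreover have "T2 (1 / x) = T1 x / x\<^sup>2" unfolding T1_def T2_def
      using that by (simp add: power_int_minus power_divide field_simps power_add[symmetric])
    ultimately show ?thesis unfolding f_def B_recip using that by (simp add: field_simps)
  qed
  have sp: "f (u $ i) = 0" if ijk: "{i, j, k} = {1, 2, 3}" "i \<noteq> j" "i \<noteq> k" "j \<noteq> k"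
     and B: "B (u $ i) = theta_coeff Q u i j k * (th2 Q (u $ j) (u $ i) * th2 Q (u $ k) (u $ i))" for i j k
  proof -
    have "T2 (u $ i) = 0" unfolding T2_def using unz[of i] Q by (simp add: prod_zero_iff) (metis UNIV_I divide_self theta_one)
    moreover have "T1 (u $ i) = theta ((u $ i)\<^sup>2) Q * B (u $ i)"
    proof -
      have n: "theta (u $ j / u $ i) Q \<noteq> 0" "theta (u $ k / u $ i) Q \<noteq> 0" using gen(2) ijk by (metis insertCI)+
      define P where "P = (\<Prod>a\<in>{4,5,6,7,8}. theta (u $ a * u $ i) Q)"
      have "(\<Prod>a\<in>UNIV. theta (u $ a * u $ i) Q) = (\<Prod>a\<in>{1,2,3}. theta (u $ a * u $ i) Q) * P"
        using prod_8[of "\<lambda>a. theta (u $ a * u $ i) Q"] unfolding P_def[symmetric] by (simp add: mult_ac)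
      also have "{1,2,3} = {i,j,k}" using ijk by simp
      finally have "(\<Prod>a\<in>UNIV. theta (u $ a * u $ i) Q) = theta (u $ i * u $ i) Q * theta (u $ j * u $ i) Q * theta (u $ k * u $ i) Q * P"
        using ijk(2-4) by (simp add: mult_ac)
      then show ?thesis unfolding T1_def B theta_coeff_def th2_def power2_eq_square P_def[symmetric] using n by simp
    qed
    ultimately show ?thesis by (simp add: f_def)
  qed
  have f1: "f (u $ 1) = 0" by (rule sp[of 1 2 3]) (auto simp: B_def th2_0 unz)
  have f2: "f (u $ 2) = 0" by (rule sp[of 2 1 3]) (auto simp: B_def th2_0 unz)
  have f3: "f (u $ 3) = 0" by (rule sp[of 3 1 2]) (auto simp: B_def th2_0 unz)
  have fpm: "f e = 0" if "e = 1 \<or> e = -1" for e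
    using that Q by (auto simp: f_def T1_def T2_def power_int_minus)
  \<comment> \<open>As \<open>e * e = Q\<close>, one period leads from \<open>u $ a / e\<close> to
    \<open>u $ a * e\<close>, so the two products agree up to a monomial, while the right side
    vanishes by \<open>theta_Q_zero\<close>.\<close>
  have fs: "f e = 0" if "e = s \<or> e = - s" for e
  proof -
    have e: "e \<noteq> 0" "e\<^sup>2 = Q" using that snz s by auto
    have "(\<Prod>a\<in>UNIV. theta (u $ a * e) Q) = (\<Prod>a\<in>UNIV. theta (u $ a / e) Q * (- e) / u $ a)"
    proof (rule prod.cong)
      fix a
      have "u $ a * e = Q * (u $ a / e)" using e by (simp add: power2_eq_square field_simps)
      then show "theta (u $ a * e) Q = theta (u $ a / e) Q * (- e) / u $ a"
        using theta_shift[OF Q, of "u $ a / e"] unz e by simp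
    qed auto
    also have "\<dots> = (\<Prod>a\<in>UNIV. theta (u $ a / e) Q) * (- e) ^ 8 / (\<Prod>a\<in>UNIV. u $ a)"
      by (simp only: prod.distrib prod_dividef prod_8_const)
    finally have "T1 e = T2 e" unfolding T1_def T2_def u using e(1) by (simp add: power_int_minus field_simps power_add[symmetric])
    then show ?thesis using Q e theta_Q_zero by (simp add: f_def)
  qed
  have "f x = 0"
  \<comment> \<open>The eight entries of the list have product \<open>1 / s\<^sup>2 = 1 / Q\<close>,
    which turns \<open>Q powi (-3)\<close> into \<open>Q powi (-4)\<close>.\<close>
  proof (rule theta_vanish[OF Q, where f = f and as = "[1, -1, 1 / s, - 1 / s, u $ 1, 1 / u $ 1, u $ 2, 1 / u $ 2]" and c = "Q powi (-3)" and j = "-4" and w = "u $ 3"])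
    show "f holomorphic_on - {0}" unfolding f_def T1_def T2_def B_def using Q unz
      by (intro holomorphic_intros th2_holo holomorphic_on_compose_gen[OF _ theta_holo[of Q "- {0}"], unfolded o_def]) auto
    show "Q powi (-3) * prod_list (map uminus [1, -1, 1 / s, - 1 / s, u $ 1, 1 / u $ 1, u $ 2, 1 / u $ 2]) = Q powi (-4)"
      using s[symmetric] snz unz[of 1] unz[of 2]
      by (simp add: power_int_minus field_simps power2_eq_square) (simp add: eval_nat_numeral)
    show "f (Q * z) = Q powi (-3) * z powi (- int (length [1, -1, 1 / s, - 1 / s, u $ 1, 1 / u $ 1, u $ 2, 1 / u $ 2])) * f z" if "z \<noteq> 0" for z
      using T1_shift[OF that] T2_shift[OF that] B_shift[OF that] by (simp add: f_def algebra_simps)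
    show "a \<noteq> 0 \<and> f (1 / a) = 0" if "a \<in> set [1, -1, 1 / s, - 1 / s, u $ 1, 1 / u $ 1, u $ 2, 1 / u $ 2]" for a
      using that f1 f2 fpm fs f_recip[OF unz[of 1]] f_recip[OF unz[of 2]] snz unz[of 1] unz[of 2] by auto
    show "u $ 3 \<noteq> 0" "f (u $ 3) = 0" "x \<noteq> 0" using unz f3 x by auto
    have g1: "theta ((u $ 1)\<^sup>2) Q \<noteq> 0" "theta ((u $ 2)\<^sup>2) Q \<noteq> 0" "theta ((u $ 3)\<^sup>2) Q \<noteq> 0" using gen(1) by auto
    have g2: "theta (u $ 1 * u $ 2) Q \<noteq> 0" "theta (u $ 1 / u $ 2) Q \<noteq> 0" "theta (u $ 2 / u $ 1) Q \<noteq> 0"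
       "theta (u $ 1 * u $ 3) Q \<noteq> 0" "theta (u $ 1 / u $ 3) Q \<noteq> 0" "theta (u $ 3 / u $ 1) Q \<noteq> 0"
       "theta (u $ 2 * u $ 3) Q \<noteq> 0" "theta (u $ 2 / u $ 3) Q \<noteq> 0" "theta (u $ 3 / u $ 2) Q \<noteq> 0"
      using gen(2) by auto
    show "theta (a * u $ 3) Q \<noteq> 0" if "a \<in> set [1, -1, 1 / s, - 1 / s, u $ 1, 1 / u $ 1, u $ 2, 1 / u $ 2]" for a
      using that theta_nz_of_square[OF Q s g1(3) unz] g2 by auto
    have sg: "theta 1 Q = 0" by (simp add: Q)
    have r: "theta (1 / z) Q \<noteq> 0" if "theta z Q \<noteq> 0" "z \<noteq> 0" for z using that theta_nz_iff_recip[OF Q] by blast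
    \<comment> \<open>Absolute values decide: \<open>y = Q powi i\<close> gives
      \<open>i + i = j\<close>, so \<open>i = 0\<close> and \<open>y = 1\<close>.\<close>
    have nQ: "theta y Q \<noteq> 0" if "y\<^sup>2 = Q powi j" "y \<noteq> 1" "odd j \<or> j = 0" for y j
    proof
      assume "theta y Q = 0"
      moreover have "y \<noteq> 0" using that(1) Q by auto
      ultimately obtain i where i: "y = Q powi i" using theta_eq_0_iff[OF Q] by blast
      then have "Q powi (i + i) = Q powi j" using that(1) Q power_int_add[of Q i i] by (simp add: power2_eq_square)
      then have "norm Q powi (i + i) = norm Q powi j" by (metis norm_power_int)
      then have "exp (of_int (i + i) * ln (norm Q)) = exp (of_int j * ln (norm Q))"
        using exp_power_int[of "ln (norm Q)"] Q by (metis exp_ln zero_less_norm_iff)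
      moreover have "ln (norm Q) \<noteq> 0" using Q by simp
      ultimately have "i + i = j" by (simp only: exp_inj_iff mult_cancel_right of_int_eq_iff simp_thms)
      then have "i = 0" using that(3) by presburger
      then show False using i that(2) by simp
    qed
    have ss: "theta (-1) Q \<noteq> 0" "theta s Q \<noteq> 0" "theta (- s) Q \<noteq> 0"
    proof -
      have "s \<noteq> 1" "- s \<noteq> 1" using s Q by (auto simp: minus_equation_iff[of s])
      then show "theta (-1) Q \<noteq> 0" "theta s Q \<noteq> 0" "theta (- s) Q \<noteq> 0"
        using nQ[of "-1" 0] nQ[of s 1] nQ[of "-s" 1] s by auto
    qed
    note q1 = theta_nz_of_square[OF Q s g1(1) unz] and q2 = theta_nz_of_square[OF Q s g1(2) unz]
    show "sorted_wrt (\<lambda>a b. theta (a / b) Q \<noteq> 0) [1, -1, 1 / s, - 1 / s, u $ 1, 1 / u $ 1, u $ 2, 1 / u $ 2]"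
      using ss q1 q2 g1 g2 r[OF q1(1)] r[OF q1(2)] r[OF q2(1)] r[OF q2(2)] r[OF q1(3)] r[OF q1(4)] r[OF q2(3)] r[OF q2(4)]
        r[OF g2(1)] unz[of 1] unz[of 2] snz
      by (simp add: power2_eq_square mult.commute)
  qed
  then show ?thesis by (simp add: f_def T1_def T2_def B_def)
qed

section \<open>Holomorphic functions of several variables\<close>

lemma has_derivative_vec:
  fixes f :: "'a::real_normed_vector \<Rightarrow> complex ^ 'n"
  assumes "\<And>a. ((\<lambda>x. f x $ a) has_derivative (\<lambda>h. D h $ a)) (at x within S)"
  shows "(f has_derivative D) (at x within S)"
proof (subst has_derivative_componentwise_within, intro ballI)
  fix i :: "complex ^ 'n" assume "i \<in> Basis"
  then obtain a b where i: "i = axis a b" by (auto simp: Basis_vec_def)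
  have "((\<lambda>x. f x $ a \<bullet> b) has_derivative (\<lambda>h. D h $ a \<bullet> b)) (at x within S)"
    by (intro derivative_intros assms)
  then show "((\<lambda>x. f x \<bullet> i) has_derivative (\<lambda>h. D h \<bullet> i)) (at x within S)"
    unfolding i by (simp add: inner_axis)
qed

lemma holo_several_subset: "holo_several f U \<Longrightarrow> V \<subseteq> U \<Longrightarrow> holo_several f V"
  by (auto simp: holo_several_def)

lemma holo_several_isCont: "holo_several f U \<Longrightarrow> t \<in> U \<Longrightarrow> isCont f t"
  unfolding holo_several_def using has_derivative_continuous by blast

lemma holo_several_continuous_on: "holo_several f U \<Longrightarrow> continuous_on U f"
  by (meson continuous_at_imp_continuous_on holo_several_isCont)

lemma holo_several_const: "holo_several (\<lambda>_. c) U"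
  unfolding holo_several_def by (intro ballI exI[of _ "\<lambda>_. 0"]) auto

lemma holo_several_nth: "holo_several (\<lambda>t. t $ a) U"
  unfolding holo_several_def
  by (intro ballI exI[of _ "\<lambda>v. v $ a"]) (auto intro: bounded_linear_imp_has_derivative)

lemma holo_several_add:
  assumes "holo_several f U" "holo_several g U" shows "holo_several (\<lambda>t. f t + g t) U"
  unfolding holo_several_def
proof
  fix t assume "t \<in> U"
  then obtain D E where "(f has_derivative D) (at t)" "\<forall>c v. D (c *s v) = c * D v"
     "(g has_derivative E) (at t)" "\<forall>c v. E (c *s v) = c * E v"
    using assms unfolding holo_several_def by blast
  then show "\<exists>D. ((\<lambda>t. f t + g t) has_derivative D) (at t) \<and> (\<forall>c v. D (c *s v) = c * D v)"
    by (intro exI[of _ "\<lambda>v. D v + E v"]) (auto intro!: derivative_eq_intros simp: algebra_simps)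
qed

lemma holo_several_mult:
  assumes "holo_several f U" "holo_several g U" shows "holo_several (\<lambda>t. f t * g t) U"
  unfolding holo_several_def
proof
  fix t assume "t \<in> U"
  then obtain D E where "(f has_derivative D) (at t)" "\<forall>c v. D (c *s v) = c * D v"
     "(g has_derivative E) (at t)" "\<forall>c v. E (c *s v) = c * E v"
    using assms unfolding holo_several_def by blast
  then show "\<exists>D. ((\<lambda>t. f t * g t) has_derivative D) (at t) \<and> (\<forall>c v. D (c *s v) = c * D v)"
    by (intro exI[of _ "\<lambda>v. f t * E v + D v * g t"] conjI has_derivative_mult) (auto simp: algebra_simps)
qed

lemma holo_several_comp:
  assumes f: "holo_several f U" and F: "F holomorphic_on V" "open V" and "\<And>t. t \<in> U \<Longrightarrow> f t \<in> V"
  shows "holo_several (\<lambda>t. F (f t)) U"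
  unfolding holo_several_def
proof
  fix t assume t: "t \<in> U"
  then obtain D where D: "(f has_derivative D) (at t)" "\<forall>c v. D (c *s v) = c * D v"
    using assms unfolding holo_several_def by blast
  have "(F has_derivative (\<lambda>h. deriv F (f t) * h)) (at (f t))"
    using holomorphic_derivI[OF F, of "f t"] assms(4)[OF t] by (simp add: has_field_derivative_def)
  from has_derivative_compose[OF D(1) this]
  show "\<exists>D. ((\<lambda>t. F (f t)) has_derivative D) (at t) \<and> (\<forall>c v. D (c *s v) = c * D v)"
    using D(2) by (intro exI[of _ "\<lambda>v. deriv F (f t) * D v"]) auto
qed

lemma holo_several_divide:
  assumes "holo_several f U" "holo_several g U" "\<And>t. t \<in> U \<Longrightarrow> g t \<noteq> 0"
  shows "holo_several (\<lambda>t. f t / g t) U"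
proof -
  have "open (- {0::complex})" by (simp add: open_Compl)
  then have "holo_several (\<lambda>t. inverse (g t)) U"
    using assms by (intro holo_several_comp[OF assms(2), where V = "- {0}"] holomorphic_intros) auto
  from holo_several_mult[OF assms(1) this] show ?thesis by (simp add: divide_inverse)
qed

lemma holo_several_diff:
  assumes "holo_several f U" "holo_several g U" shows "holo_several (\<lambda>t. f t - g t) U"
  using holo_several_add[OF assms(1) holo_several_mult[OF holo_several_const[of "-1"] assms(2)]] by simp

lemma holo_several_prod:
  "finite A \<Longrightarrow> (\<And>i. i \<in> A \<Longrightarrow> holo_several (f i) U) \<Longrightarrow> holo_several (\<lambda>t. \<Prod>i\<in>A. f i t) U"
  by (induction A rule: finite_induct) (auto intro: holo_several_const holo_several_mult)

lemma holo_several_sum: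
  "finite A \<Longrightarrow> (\<And>i. i \<in> A \<Longrightarrow> holo_several (f i) U) \<Longrightarrow> holo_several (\<lambda>t. \<Sum>i\<in>A. f i t) U"
  by (induction A rule: finite_induct) (auto intro: holo_several_const holo_several_add)

text \<open>Restriction to holomorphic curves is how theorems about one complex variable are brought
  to bear on functions of several.\<close>

lemma holo_several_along:
  assumes f: "holo_several f U" and V: "open V" and "\<And>\<zeta>. \<zeta> \<in> V \<Longrightarrow> \<gamma> \<zeta> \<in> U"
    and \<gamma>: "\<And>a. (\<lambda>\<zeta>. \<gamma> \<zeta> $ a) holomorphic_on V"
  shows "(\<lambda>\<zeta>. f (\<gamma> \<zeta>)) holomorphic_on V"
proof -
  have "(\<lambda>\<zeta>. f (\<gamma> \<zeta>)) field_differentiable (at \<zeta>)" if \<zeta>: "\<zeta> \<in> V" for \<zeta>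
  proof -
    define d where "d = (\<chi> a. deriv (\<lambda>\<zeta>. \<gamma> \<zeta> $ a) \<zeta>)"
    obtain D where D: "(f has_derivative D) (at (\<gamma> \<zeta>))" "\<forall>c v. D (c *s v) = c * D v"
      using assms \<zeta> unfolding holo_several_def by blast
    have "(\<gamma> has_derivative (\<lambda>h. h *s d)) (at \<zeta>)"
    proof (rule has_derivative_vec)
      fix a
      show "((\<lambda>\<zeta>. \<gamma> \<zeta> $ a) has_derivative (\<lambda>h. (h *s d) $ a)) (at \<zeta>)"
        using holomorphic_derivI[OF \<gamma> V \<zeta>] by (simp add: has_field_derivative_def d_def mult.commute[of _ "deriv _ _"])
    qed
    from has_derivative_compose[OF this D(1)]
    have "((\<lambda>\<zeta>. f (\<gamma> \<zeta>)) has_field_derivative D d) (at \<zeta>)"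
      using D(2) by (simp add: has_field_derivative_def mult.commute[of _ "D d"])
    then show ?thesis by (auto simp: field_differentiable_def)
  qed
  then show ?thesis using V by (auto simp: holomorphic_on_open field_differentiable_def)
qed

section \<open>Meromorphic functions on a torus\<close>

definition surf :: "complex \<Rightarrow> (complex ^ 'n) set" where
  "surf \<kappa> = {t. (\<Prod>a\<in>UNIV. t $ a) = \<kappa>}"

definition Exv :: "complex ^ 'n \<Rightarrow> complex ^ 'n" where
  "Exv x = (\<chi> a. exp (x $ a))"

text \<open>\<open>Exv\<close> maps this affine hyperplane onto the hypersurface. Its convexity
  supplies connectedness and the complex lines along which zeros are propagated.\<close>

definition hyp :: "complex \<Rightarrow> (complex ^ 'n) set" where
  "hyp L = {x. (\<Sum>a\<in>UNIV. x $ a) = L}"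

lemma Exv_nth [simp]: "Exv x $ a = exp (x $ a)" by (simp add: Exv_def)

lemma Exv_surf: "x \<in> hyp L \<Longrightarrow> Exv x \<in> surf (exp L)"
  by (auto simp: hyp_def surf_def exp_sum[symmetric])

lemma isCont_Exv: "isCont Exv x"
  unfolding isCont_def by (rule vec_tendstoI) (auto intro!: tendsto_intros)

text \<open>The principal logarithms of the coordinates add up to \<open>L\<close> only modulo
  multiples of \<open>2 * pi * \<i>\<close>; the error is moved into one arbitrary coordinate
  \<open>b\<close>.\<close>

lemma Exv_onto:
  fixes t :: "complex ^ 'n"
  assumes "t \<in> surf (exp L)"
  shows "\<exists>x\<in>hyp L. Exv x = t"
proof -
  have nz: "t $ a \<noteq> 0" for a using assms by (auto simp: surf_def) (metis UNIV_I exp_not_eq_zero finite prod_zero_iff)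
  have "exp (\<Sum>a\<in>UNIV. Ln (t $ a)) = exp L"
    using assms nz by (simp add: exp_sum surf_def)
  then obtain k :: int where k: "(\<Sum>a\<in>UNIV. Ln (t $ a)) = L + (of_int (2 * k) * pi) * \<i>" unfolding exp_eq by blast
  obtain b :: 'n where True by blast
  define x where "x = (\<chi> a. Ln (t $ a) - (if a = b then (of_int (2 * k) * pi) * \<i> else 0))"
  have "(\<Sum>a\<in>UNIV. x $ a) = L" unfolding x_def by (simp add: sum_subtractf k)
  moreover have "exp ((of_int (2 * k) * pi) * \<i>) = 1" using exp_eq[of "(of_int (2 * k) * pi) * \<i>" 0] by auto
  then have "Exv x = t" using nz by (simp add: Exv_def x_def vec_eq_iff exp_diff)
  ultimately show ?thesis by (auto simp: hyp_def)
qed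

text \<open>A parametrisation by a convex set. It covers a whole neighbourhood because near
  \<open>t\<close> the sum \<open>\<sigma>\<close> of the logarithms of the ratios is a multiple of
  \<open>2 * pi * \<i>\<close> and has norm below 1, hence is 0.\<close>

lemma surf_chart:
  fixes t :: "complex ^ 'n"
  assumes t: "t \<in> surf (exp L)" and U: "open U" "t \<in> U"
  obtains C N where "open C" "convex C" "Exv ` C \<subseteq> U" "open N" "t \<in> N" "N \<subseteq> U" "surf (exp L) \<inter> N \<subseteq> Exv ` (C \<inter> hyp L)"
proof -
  obtain x where x: "x \<in> hyp L" "Exv x = t" using Exv_onto[OF t] by blast
  have nz: "t $ a \<noteq> 0" for a unfolding x(2)[symmetric] by simp
  have "open (Exv -` U)" using U(1) isCont_Exv by (metis continuous_at_imp_continuous_on open_vimage)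
  moreover have "x \<in> Exv -` U" using x U by simp
  ultimately obtain d where d: "d > 0" "ball x d \<subseteq> Exv -` U" by (meson open_contains_ball)
  define Y where "Y = (\<lambda>s. \<chi> a. x $ a + Ln (s $ a / t $ a))"
  define \<sigma> where "\<sigma> = (\<lambda>s::complex^'n. \<Sum>a\<in>UNIV. Ln (s $ a / t $ a))"
  have Lc: "((\<lambda>s. Ln (s $ a / t $ a)) \<longlongrightarrow> 0) (nhds t)" for a
  proof -
    have "((\<lambda>s. s $ a / t $ a) \<longlongrightarrow> t $ a / t $ a) (nhds t)"
      using nz by (intro tendsto_divide tendsto_vec_nth filterlim_ident tendsto_const)
    then have "((\<lambda>s. Ln (s $ a / t $ a)) \<longlongrightarrow> Ln (t $ a / t $ a)) (nhds t)"
      using nz by (intro tendsto_Ln) auto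
    then show ?thesis using nz by simp
  qed
  have "(Y \<longlongrightarrow> x) (nhds t)"
    unfolding Y_def by (rule vec_tendstoI) (use tendsto_add[OF tendsto_const Lc] in simp)
  then have e1: "eventually (\<lambda>s. Y s \<in> ball x d) (nhds t)"
    using d(1) by (intro topological_tendstoD) auto
  have "(\<sigma> \<longlongrightarrow> 0) (nhds t)" unfolding \<sigma>_def using tendsto_sum[of UNIV "\<lambda>a s. Ln (s $ a / t $ a)" "\<lambda>_. 0" "nhds t"] Lc by simp
  then have e2: "eventually (\<lambda>s. \<sigma> s \<in> ball 0 1) (nhds t)" by (intro topological_tendstoD) auto
  have e3: "eventually (\<lambda>s. s \<in> U) (nhds t)" using U by (rule eventually_nhds_in_open)
  have "eventually (\<lambda>s. Y s \<in> ball x d \<and> \<sigma> s \<in> ball 0 1 \<and> s \<in> U) (nhds t)"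
    using e1 e2 e3 by eventually_elim auto
  then obtain N where N: "open N" "t \<in> N" "\<And>s. s \<in> N \<Longrightarrow> Y s \<in> ball x d \<and> \<sigma> s \<in> ball 0 1 \<and> s \<in> U"
    unfolding eventually_nhds by blast
  show ?thesis
  proof (rule that[of "ball x d" N])
    show "surf (exp L) \<inter> N \<subseteq> Exv ` (ball x d \<inter> hyp L)"
    proof
      fix s assume s: "s \<in> surf (exp L) \<inter> N"
      have snz: "s $ a \<noteq> 0" for a using s by (auto simp: surf_def) (metis UNIV_I exp_not_eq_zero finite prod_zero_iff)
      have "exp (\<sigma> s) = (\<Prod>a\<in>UNIV. s $ a) / (\<Prod>a\<in>UNIV. t $ a)"
        unfolding \<sigma>_def using snz nz by (simp add: exp_sum prod_dividef)
      also have "\<dots> = exp 0" using s t by (simp add: surf_def)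
      finally obtain k :: int where k: "\<sigma> s = 0 + (of_int (2 * k) * pi) * \<i>" unfolding exp_eq by blast
      have "norm (\<sigma> s) < 1" using N(3)[of s] s by auto
      then have "\<bar>2 * of_int k * pi\<bar> < 1" unfolding k by (simp add: norm_mult abs_mult)
      moreover have "k = 0 \<or> \<bar>2 * of_int k * pi\<bar> \<ge> 2 * pi"
      proof (cases "k = 0")
        case False
        then have "1 \<le> \<bar>real_of_int k\<bar>" by linarith
        then have "2 * pi * 1 \<le> 2 * pi * \<bar>real_of_int k\<bar>" by (intro mult_left_mono) auto
        then show ?thesis by (simp add: abs_mult mult_ac)
      qed auto
      ultimately have "k = 0" using pi_gt3 by linarith
      then have "\<sigma> s = 0" using k by simp
      then have "Y s \<in> hyp L" using x(1) by (simp add: hyp_def Y_def \<sigma>_def sum.distrib)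
      moreover have "Exv (Y s) = s"
        using snz nz x(2) by (auto simp: vec_eq_iff Y_def exp_add)
      ultimately show "s \<in> Exv ` (ball x d \<inter> hyp L)" using N(3)[of s] s by force
    qed
  qed (use d N in auto)
qed

text \<open>Two points of \<open>C\<close> span a complex line inside the hyperplane. The part of
  the line in \<open>C\<close> is convex, hence connected, and the identity theorem in one variable
  carries the zeros near one point to the other.\<close>

lemma holo_identity:
  fixes f :: "complex ^ 'n \<Rightarrow> complex"
  assumes C: "open C" "convex C" and f: "holo_several f U" and CU: "\<And>x. x \<in> C \<inter> hyp L \<Longrightarrow> Exv x \<in> U" "open U"
    and x0: "x0 \<in> C \<inter> hyp L" and N: "open N" "Exv x0 \<in> N" "\<And>s. s \<in> surf (exp L) \<inter> N \<Longrightarrow> f s = 0"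
    and x: "x \<in> C \<inter> hyp L"
  shows "f (Exv x) = 0"
proof -
  define l where "l = (\<lambda>\<zeta>::complex. x0 + \<zeta> *s (x - x0))"
  have lc: "isCont l \<zeta>" for \<zeta>
    unfolding l_def isCont_def by (rule vec_tendstoI) (auto intro!: tendsto_intros)
  have lh: "l \<zeta> \<in> hyp L" for \<zeta>
    using x x0 by (simp add: hyp_def l_def sum.distrib sum_distrib_left[symmetric] sum_subtractf)
  define V where "V = l -` C"
  have V: "open V" unfolding V_def using lc C(1) by (metis continuous_at_imp_continuous_on open_vimage)
  have "convex V"
  proof (rule convexI)
    fix a b :: complex and u v :: real assume *: "a \<in> V" "b \<in> V" "0 \<le> u" "0 \<le> v" "u + v = 1"
    have "u *\<^sub>R l a + v *\<^sub>R l b \<in> C" using * C(2) unfolding V_def by (auto intro!: convexD)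
    moreover have "u *\<^sub>R l a + v *\<^sub>R l b = l (u *\<^sub>R a + v *\<^sub>R b)"
    proof -
      have "of_real u + of_real v = (1::complex)" using *(5) by (metis of_real_1 of_real_add)
      then have v: "of_real v = (1 - of_real u :: complex)" by (simp add: eq_diff_eq add.commute)
      show ?thesis
        by (simp add: l_def vec_eq_iff) (simp add: scaleR_conv_of_real v algebra_simps)
    qed
    ultimately show "u *\<^sub>R a + v *\<^sub>R b \<in> V" by (simp add: V_def)
  qed
  have g: "(\<lambda>\<zeta>. f (Exv (l \<zeta>))) holomorphic_on V"
  proof (rule holo_several_along[OF f V])
    show "Exv (l \<zeta>) \<in> U" if "\<zeta> \<in> V" for \<zeta> using that CU lh by (auto simp: V_def)
    show "(\<lambda>\<zeta>. Exv (l \<zeta>) $ a) holomorphic_on V" for a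
      unfolding l_def by (simp, intro holomorphic_intros)
  qed
  define M where "M = V \<inter> (\<lambda>\<zeta>. Exv (l \<zeta>)) -` N"
  have l0: "l 0 = x0" "l 1 = x" by (auto simp: l_def)
  have "open ((\<lambda>\<zeta>. Exv (l \<zeta>)) -` N)"
    using isCont_o2[OF lc isCont_Exv] N(1) by (metis continuous_at_imp_continuous_on open_vimage)
  then have M: "open M" "0 \<in> M" "M \<subseteq> V" using V x0 N(2) by (auto simp: M_def V_def l0)
  have "f (Exv (l 1)) = 0"
  proof (rule analytic_continuation[OF g V _ M(3)])
    show "connected V" using \<open>convex V\<close> convex_connected by blast
    show "0 \<in> V" using M by auto
    show "0 islimpt M" using M(1,2) by (simp add: interior_limit_point interior_open)
    show "1 \<in> V" using x by (simp add: V_def l0)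
    fix \<zeta> assume "\<zeta> \<in> M"
    then show "f (Exv (l \<zeta>)) = 0" using N(3) Exv_surf[OF lh] by (auto simp: M_def)
  qed
  then show ?thesis by (simp add: l0)
qed

section \<open>Algebra of meromorphic functions\<close>

lemma dense_iff:
  "S \<inter> U \<subseteq> closure {s \<in> S \<inter> U. P s} \<longleftrightarrow> (\<forall>s\<in>S \<inter> U. \<forall>N. open N \<longrightarrow> s \<in> N \<longrightarrow> (\<exists>s'\<in>S \<inter> U \<inter> N. P s'))"
  unfolding closure_iff_nhds_not_empty subset_iff by blast

lemma dense_subset:
  assumes "S \<inter> U \<subseteq> closure {s \<in> S \<inter> U. P s}" "open V" "V \<subseteq> U"
  shows "S \<inter> V \<subseteq> closure {s \<in> S \<inter> V. P s}"
  unfolding dense_iff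
proof (intro ballI allI impI)
  fix s N assume *: "s \<in> S \<inter> V" "open N" "s \<in> N"
  then have "\<exists>s'\<in>S \<inter> U \<inter> (N \<inter> V). P s'" using assms unfolding dense_iff by blast
  then show "\<exists>s'\<in>S \<inter> V \<inter> N. P s'" by blast
qed

text \<open>Continuity makes \<open>h1 s \<noteq> 0\<close> an open condition, and inside this open
  set the density for \<open>h2\<close> is applied.\<close>

lemma dense_mult:
  fixes h1 h2 :: "complex ^ 'n \<Rightarrow> complex"
  assumes "S \<inter> U \<subseteq> closure {s \<in> S \<inter> U. h1 s \<noteq> 0}" "S \<inter> U \<subseteq> closure {s \<in> S \<inter> U. h2 s \<noteq> 0}"
    and "open U" "continuous_on U h1"
  shows "S \<inter> U \<subseteq> closure {s \<in> S \<inter> U. h1 s * h2 s \<noteq> 0}"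
  unfolding dense_iff
proof (intro ballI allI impI)
  fix s N assume *: "s \<in> S \<inter> U" "open N" "s \<in> N"
  then obtain s1 where s1: "s1 \<in> S \<inter> U \<inter> N" "h1 s1 \<noteq> 0" using assms(1) unfolding dense_iff by blast
  have "open (U \<inter> h1 -` (- {0}))" using continuous_open_preimage[OF assms(4,3)] by (simp add: open_Compl)
  then have o: "open (U \<inter> h1 -` (- {0}) \<inter> N)" using *(2) by blast
  have "\<exists>s'\<in>S \<inter> U \<inter> (U \<inter> h1 -` (- {0}) \<inter> N). h2 s' \<noteq> 0"
    using assms(2) s1 o unfolding dense_iff by auto
  then show "\<exists>s'\<in>S \<inter> U \<inter> N. h1 s' * h2 s' \<noteq> 0" by auto
qed

lemma mero_severalE:
  assumes "mero_several f S" "t \<in> S"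
  obtains U g h where "open U" "t \<in> U" "holo_several g U" "holo_several h U"
    "S \<inter> U \<subseteq> closure {s \<in> S \<inter> U. h s \<noteq> 0}" "\<forall>s\<in>S \<inter> U. h s \<noteq> 0 \<longrightarrow> f s = g s / h s"
proof -
  have "\<exists>U g h. open U \<and> t \<in> U \<and> holo_several g U \<and> holo_several h U \<and>
        S \<inter> U \<subseteq> closure {s \<in> S \<inter> U. h s \<noteq> 0} \<and> (\<forall>s\<in>S \<inter> U. h s \<noteq> 0 \<longrightarrow> f s = g s / h s)"
    using assms unfolding mero_several_def by (rule bspec)
  then show ?thesis using that by blast
qed

lemma mero_severalI:
  assumes "\<And>t. t \<in> S \<Longrightarrow> \<exists>U g h. open U \<and> t \<in> U \<and> holo_several g U \<and> holo_several h U \<and>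
        S \<inter> U \<subseteq> closure {s \<in> S \<inter> U. h s \<noteq> 0} \<and> (\<forall>s\<in>S \<inter> U. h s \<noteq> 0 \<longrightarrow> f s = g s / h s)"
  shows "mero_several f S"
  using assms unfolding mero_several_def by blast

lemma mero_several_holo:
  assumes "holo_several f U" "open U" "S \<subseteq> U"
  shows "mero_several f S"
proof (rule mero_severalI)
  fix t assume "t \<in> S"
  show "\<exists>U g h. open U \<and> t \<in> U \<and> holo_several g U \<and> holo_several h U \<and>
        S \<inter> U \<subseteq> closure {s \<in> S \<inter> U. h s \<noteq> 0} \<and> (\<forall>s\<in>S \<inter> U. h s \<noteq> 0 \<longrightarrow> f s = g s / h s)"
  proof (intro exI conjI)
    show "open U" "t \<in> U" "holo_several f U" using assms \<open>t \<in> S\<close> by auto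
    show "holo_several (\<lambda>_. 1) U" by (rule holo_several_const)
    show "S \<inter> U \<subseteq> closure {s \<in> S \<inter> U. (1::complex) \<noteq> 0}" using closure_subset[of "S \<inter> U"] by (simp add: Int_def)
  qed auto
qed

lemma mero_several_const: "mero_several (\<lambda>_. c) S"
  by (rule mero_several_holo[OF holo_several_const, of UNIV]) auto

text \<open>\<open>G\<close> is the numerator over the common denominator; product, sum and
  difference are its instances.\<close>

lemma mero_several_binary:
  fixes f1 f2 :: "complex ^ 'n \<Rightarrow> complex"
  assumes "mero_several f1 S" "mero_several f2 S"
    and op: "\<And>(U :: (complex ^ 'n) set) g1 h1 g2 h2. holo_several g1 U \<Longrightarrow> holo_several h1 U \<Longrightarrow> holo_several g2 U \<Longrightarrow> holo_several h2 U \<Longrightarrow>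
       holo_several (\<lambda>s. G (g1 s) (h1 s) (g2 s) (h2 s)) U"
    and eq: "\<And>a b c d :: complex. b \<noteq> 0 \<Longrightarrow> d \<noteq> 0 \<Longrightarrow> F (a / b) (c / d) = G a b c d / (b * d)"
  shows "mero_several (\<lambda>t. F (f1 t) (f2 t)) S"
proof (rule mero_severalI)
  fix t assume t: "t \<in> S"
  obtain U1 g1 h1 where 1: "open U1" "t \<in> U1" "holo_several g1 U1" "holo_several h1 U1"
    "S \<inter> U1 \<subseteq> closure {s \<in> S \<inter> U1. h1 s \<noteq> 0}" "\<forall>s\<in>S \<inter> U1. h1 s \<noteq> 0 \<longrightarrow> f1 s = g1 s / h1 s"
    by (rule mero_severalE[OF assms(1) t])
  obtain U2 g2 h2 where 2: "open U2" "t \<in> U2" "holo_several g2 U2" "holo_several h2 U2"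
    "S \<inter> U2 \<subseteq> closure {s \<in> S \<inter> U2. h2 s \<noteq> 0}" "\<forall>s\<in>S \<inter> U2. h2 s \<noteq> 0 \<longrightarrow> f2 s = g2 s / h2 s"
    by (rule mero_severalE[OF assms(2) t])
  let ?U = "U1 \<inter> U2"
  have o: "open ?U" using 1 2 by blast
  have h: "holo_several g1 ?U" "holo_several h1 ?U" "holo_several g2 ?U" "holo_several h2 ?U"
    using 1 2 holo_several_subset by blast+
  have d1: "S \<inter> ?U \<subseteq> closure {s \<in> S \<inter> ?U. h1 s \<noteq> 0}" by (rule dense_subset[OF 1(5) o]) auto
  have d2: "S \<inter> ?U \<subseteq> closure {s \<in> S \<inter> ?U. h2 s \<noteq> 0}" by (rule dense_subset[OF 2(5) o]) auto
  show "\<exists>U g h. open U \<and> t \<in> U \<and> holo_several g U \<and> holo_several h U \<and>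
        S \<inter> U \<subseteq> closure {s \<in> S \<inter> U. h s \<noteq> 0} \<and> (\<forall>s\<in>S \<inter> U. h s \<noteq> 0 \<longrightarrow> F (f1 s) (f2 s) = g s / h s)"
  proof (intro exI conjI)
    show "holo_several (\<lambda>s. G (g1 s) (h1 s) (g2 s) (h2 s)) ?U" by (intro op h)
    show "holo_several (\<lambda>s. h1 s * h2 s) ?U" by (intro holo_several_mult h)
    show "S \<inter> ?U \<subseteq> closure {s \<in> S \<inter> ?U. h1 s * h2 s \<noteq> 0}"
      by (rule dense_mult[OF d1 d2 o holo_several_continuous_on[OF h(2)]])
    show "\<forall>s\<in>S \<inter> ?U. h1 s * h2 s \<noteq> 0 \<longrightarrow> F (f1 s) (f2 s) = G (g1 s) (h1 s) (g2 s) (h2 s) / (h1 s * h2 s)"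
      using 1(6) 2(6) eq by auto
  qed (use o 1 2 in auto)
qed

lemma mero_several_mult: "mero_several f1 S \<Longrightarrow> mero_several f2 S \<Longrightarrow> mero_several (\<lambda>t. f1 t * f2 t) S"
  by (rule mero_several_binary[where F = "(*)" and G = "\<lambda>a b c d. a * c"]) (auto intro: holo_several_mult)

lemma mero_several_add: "mero_several f1 S \<Longrightarrow> mero_several f2 S \<Longrightarrow> mero_several (\<lambda>t. f1 t + f2 t) S"
  by (rule mero_several_binary[where F = "(+)" and G = "\<lambda>a b c d. a * d + c * b"])
     (auto intro: holo_several_mult holo_several_add simp: field_simps)

lemma mero_several_diff: "mero_several f1 S \<Longrightarrow> mero_several f2 S \<Longrightarrow> mero_several (\<lambda>t. f1 t - f2 t) S"
  by (rule mero_several_binary[where F = "(-)" and G = "\<lambda>a b c d. a * d - c * b"])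
     (auto intro: holo_several_mult holo_several_diff simp: field_simps)

lemma mero_several_prod:
  "finite A \<Longrightarrow> (\<And>i. i \<in> A \<Longrightarrow> mero_several (f i) S) \<Longrightarrow> mero_several (\<lambda>t. \<Prod>i\<in>A. f i t) S"
  by (induction A rule: finite_induct) (auto intro: mero_several_const mero_several_mult)

text \<open>Unlike sums and products, this needs the identity theorem: near each point the numerator
  vanishes identically on the hypersurface or on a set without relative interior.\<close>

lemma mero_several_inverse:
  fixes f :: "complex ^ 'n \<Rightarrow> complex"
  assumes f: "mero_several f (surf (exp L))"
  shows "mero_several (\<lambda>t. inverse (f t)) (surf (exp L))"
proof (rule mero_severalI)
  let ?S = "surf (exp L) :: (complex ^ 'n) set"
  fix t assume t: "t \<in> ?S"
  obtain U g h where U: "open U" "t \<in> U" "holo_several g U" "holo_several h U"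
    "?S \<inter> U \<subseteq> closure {s \<in> ?S \<inter> U. h s \<noteq> 0}" "\<forall>s\<in>?S \<inter> U. h s \<noteq> 0 \<longrightarrow> f s = g s / h s"
    by (rule mero_severalE[OF f t])
  obtain C N where C: "open C" "convex C" "Exv ` C \<subseteq> U" "open N" "t \<in> N" "N \<subseteq> U" "?S \<inter> N \<subseteq> Exv ` (C \<inter> hyp L)"
    by (rule surf_chart[OF t U(1,2)])
  have hN: "holo_several g N" "holo_several h N" using U C holo_several_subset by blast+
  have dN: "?S \<inter> N \<subseteq> closure {s \<in> ?S \<inter> N. h s \<noteq> 0}" by (rule dense_subset[OF U(5) C(4,6)])
  show "\<exists>U g h. open U \<and> t \<in> U \<and> holo_several g U \<and> holo_several h U \<and>
        ?S \<inter> U \<subseteq> closure {s \<in> ?S \<inter> U. h s \<noteq> 0} \<and> (\<forall>s\<in>?S \<inter> U. h s \<noteq> 0 \<longrightarrow> inverse (f s) = g s / h s)"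
  proof (cases "\<exists>s0\<in>?S \<inter> N. \<exists>M. open M \<and> s0 \<in> M \<and> (\<forall>s\<in>?S \<inter> M. g s = 0)")
    \<comment> \<open>Here the numerator vanishes throughout the chart, and since
      \<open>inverse 0 = 0\<close> the inverse is represented by 0 over \<open>h\<close>.\<close>
    case True
    then obtain s0 M where s0: "s0 \<in> ?S \<inter> N" "open M" "s0 \<in> M" "\<And>s. s \<in> ?S \<inter> M \<Longrightarrow> g s = 0" by blast
    obtain x0 where x0: "x0 \<in> C \<inter> hyp L" "s0 = Exv x0" using s0(1) C(7) by blast
    have "g s = 0" if s: "s \<in> ?S \<inter> N" for s
    proof -
      obtain x where x: "x \<in> C \<inter> hyp L" "s = Exv x" using s C(7) by blast
      have "g (Exv x) = 0"
        by (rule holo_identity[OF C(1,2) U(3) _ U(1) x0(1) s0(2) _ s0(4) x(1)]) (use C(3) s0 x0 in auto)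
      then show ?thesis using x by simp
    qed
    then show ?thesis using C U dN hN
      by (intro exI[of _ N] exI[of _ "\<lambda>_. 0"] exI[of _ h]) (auto intro: holo_several_const)
  next
    case False
    have dg: "?S \<inter> N \<subseteq> closure {s \<in> ?S \<inter> N. g s \<noteq> 0}"
      unfolding dense_iff
    proof (intro ballI allI impI)
      fix s M assume s: "s \<in> ?S \<inter> N" "open M" "s \<in> M"
      have "open (M \<inter> N)" using s C by blast
      then have "\<not> (\<forall>s\<in>?S \<inter> (M \<inter> N). g s = 0)" using False s by blast
      then show "\<exists>s'\<in>?S \<inter> N \<inter> M. g s' \<noteq> 0" by blast
    qed
    show ?thesis
    proof (intro exI conjI)
      \<comment> \<open>\<open>h * h / (g * h)\<close> rather than \<open>h / g\<close>: the new
        denominator has to vanish wherever \<open>h\<close> does, as nothing is known about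
        \<open>f\<close> there.\<close>
      show "holo_several (\<lambda>s. h s * h s) N" by (intro holo_several_mult hN)
      show "holo_several (\<lambda>s. g s * h s) N" by (intro holo_several_mult hN)
      show "?S \<inter> N \<subseteq> closure {s \<in> ?S \<inter> N. g s * h s \<noteq> 0}"
        by (rule dense_mult[OF dg dN C(4) holo_several_continuous_on[OF hN(1)]])
      show "\<forall>s\<in>?S \<inter> N. g s * h s \<noteq> 0 \<longrightarrow> inverse (f s) = h s * h s / (g s * h s)"
        using U(6) C(6) by auto
    qed (use C in auto)
  qed
qed

lemma mero_several_divide:
  "mero_several f1 (surf (exp L)) \<Longrightarrow> mero_several f2 (surf (exp L)) \<Longrightarrow> mero_several (\<lambda>t. f1 t / f2 t) (surf (exp L))"
  unfolding divide_inverse by (intro mero_several_mult mero_several_inverse)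

section \<open>Connectedness and the identity theorem for meromorphic functions\<close>

lemma surf_connected: "connected (surf (exp L) :: (complex ^ 'n) set)"
proof -
  have "surf (exp L) = Exv ` (hyp L :: (complex ^ 'n) set)" using Exv_onto Exv_surf by blast
  moreover have "convex (hyp L :: (complex ^ 'n) set)"
  proof (rule convexI)
    fix x y :: "complex ^ 'n" and u v :: real
    assume *: "x \<in> hyp L" "y \<in> hyp L" "0 \<le> u" "0 \<le> v" "u + v = 1"
    have "(\<Sum>a\<in>UNIV. (u *\<^sub>R x + v *\<^sub>R y) $ a) = u *\<^sub>R L + v *\<^sub>R L"
      using * by (simp add: hyp_def sum.distrib scaleR_right.sum[symmetric])
    then show "u *\<^sub>R x + v *\<^sub>R y \<in> hyp L" using * by (simp add: hyp_def scaleR_left_distrib[symmetric])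
  qed
  ultimately show ?thesis
    by (metis connected_continuous_image continuous_at_imp_continuous_on convex_connected isCont_Exv)
qed

text \<open>\<open>D\<close> collects the points near which \<open>f\<close> vanishes. Its relative
  closure is open: in a chart around a point of the closure, the numerator vanishes near some point
  of \<open>D\<close>, hence on the whole chart by \<open>holo_identity\<close>. Connectedness does
  the rest.\<close>

lemma mero_eq_on_identity:
  fixes f :: "complex ^ 'n \<Rightarrow> complex"
  assumes f: "mero_several f (surf (exp L))"
    and O: "open M" "t0 \<in> surf (exp L) \<inter> M" "\<And>s. s \<in> surf (exp L) \<inter> M \<Longrightarrow> f s = 0"
  shows "mero_eq_on (surf (exp L)) f (\<lambda>_. 0)"
proof -
  let ?S = "surf (exp L) :: (complex ^ 'n) set"
  define D where "D = {t \<in> ?S. \<exists>N. open N \<and> t \<in> N \<and> (\<forall>s\<in>?S \<inter> N. f s = 0)}"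
  have "D = ?S \<inter> \<Union>{N. open N \<and> (\<forall>s\<in>?S \<inter> N. f s = 0)}" unfolding D_def by blast
  then have oD: "openin (top_of_set ?S) D" by (metis (mono_tags, lifting) mem_Collect_eq open_Union openin_open_Int)
  have DS: "D \<subseteq> ?S" by (auto simp: D_def)
  have t0: "t0 \<in> D" using O by (auto simp: D_def)
  let ?Z = "?S \<inter> closure D"
  have "openin (top_of_set ?S) ?Z"
  proof (subst openin_subopen, intro ballI)
    fix t assume t: "t \<in> ?Z"
    obtain U g h where U: "open U" "t \<in> U" "holo_several g U" "holo_several h U"
      "?S \<inter> U \<subseteq> closure {s \<in> ?S \<inter> U. h s \<noteq> 0}" "\<forall>s\<in>?S \<inter> U. h s \<noteq> 0 \<longrightarrow> f s = g s / h s"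
      by (rule mero_severalE[OF f]) (use t in auto)
    obtain C N where C: "open C" "convex C" "Exv ` C \<subseteq> U" "open N" "t \<in> N" "N \<subseteq> U" "?S \<inter> N \<subseteq> Exv ` (C \<inter> hyp L)"
      by (rule surf_chart[OF _ U(1,2), of L]) (use t in auto)
    have dN: "?S \<inter> N \<subseteq> closure {s \<in> ?S \<inter> N. h s \<noteq> 0}" by (rule dense_subset[OF U(5) C(4,6)])
    have "D \<inter> N \<noteq> {}" using t C(4,5) by (metis IntD2 closure_iff_nhds_not_empty open_contains_ball subset_refl Int_commute)
    then obtain s1 where s1: "s1 \<in> D" "s1 \<in> N" by blast
    then obtain K where K: "open K" "s1 \<in> K" "\<And>s. s \<in> ?S \<inter> K \<Longrightarrow> f s = 0" unfolding D_def by blast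
    \<comment> \<open>Points with \<open>h s = 0\<close> are included: \<open>g\<close> is
      continuous, and \<open>h\<close> is nonzero at nearby points of the hypersurface.\<close>
    have gK: "g s = 0" if s: "s \<in> ?S \<inter> (K \<inter> N)" for s
    proof (rule ccontr)
      assume "g s \<noteq> 0"
      have "continuous_on N g" using U C holo_several_subset holo_several_continuous_on by blast
      then have "open (N \<inter> g -` (- {0}))" using C(4) by (intro continuous_open_preimage) (auto simp: open_Compl)
      then have "open (N \<inter> g -` (- {0}) \<inter> K)" "s \<in> N \<inter> g -` (- {0}) \<inter> K" using K s \<open>g s \<noteq> 0\<close> by auto
      then obtain s' where "s' \<in> ?S \<inter> N \<inter> (N \<inter> g -` (- {0}) \<inter> K)" "h s' \<noteq> 0"
        using dN s unfolding dense_iff by (metis IntD1 IntD2 IntI)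
      then show False using K(3)[of s'] U(6)[rule_format, of s'] C(6) by auto
    qed
    obtain x1 where x1: "x1 \<in> C \<inter> hyp L" "s1 = Exv x1" using s1 DS C(7) by blast
    have g0: "g s = 0" if s: "s \<in> ?S \<inter> N" for s
    proof -
      obtain x where x: "x \<in> C \<inter> hyp L" "s = Exv x" using s C(7) by blast
      have "g (Exv x) = 0"
        by (rule holo_identity[OF C(1,2) U(3) _ U(1) x1(1), where N = "K \<inter> N"]) (use C K s1 x1 x gK in auto)
      then show ?thesis using x by simp
    qed
    have "{s \<in> ?S \<inter> N. h s \<noteq> 0} \<subseteq> D"
    proof
      fix s assume s: "s \<in> {s \<in> ?S \<inter> N. h s \<noteq> 0}"
      have "continuous_on N h" using U C holo_several_subset holo_several_continuous_on by blast
      then have "open (N \<inter> h -` (- {0}))" using C(4) by (intro continuous_open_preimage) (auto simp: open_Compl)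
      moreover have "s \<in> N \<inter> h -` (- {0})" using s by auto
      moreover have "f s' = 0" if "s' \<in> ?S \<inter> (N \<inter> h -` (- {0}))" for s'
        using that g0[of s'] U(6)[rule_format, of s'] C(6) by auto
      ultimately show "s \<in> D" unfolding D_def using s by blast
    qed
    then have "?S \<inter> N \<subseteq> closure D" using dN closure_mono by blast
    then show "\<exists>T. openin (top_of_set ?S) T \<and> t \<in> T \<and> T \<subseteq> ?Z"
      using C(4,5) t by (intro exI[of _ "?S \<inter> N"]) (auto simp: openin_open_Int)
  qed
  moreover have "closedin (top_of_set ?S) ?Z" by (simp add: closedin_closed_Int)
  moreover have "?Z \<noteq> {}" using t0 DS closure_subset by blast
  ultimately have "?Z = ?S" using surf_connected[of L] connected_clopen by metis
  then show ?thesis unfolding mero_eq_on_def using oD by (intro exI[of _ D]) (auto simp: D_def)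
qed

text \<open>The shifted terms of the equation evaluate a meromorphic function after
  \<open>t $ 1\<close> and \<open>t $ 2\<close> have been scaled by reciprocal factors, which is a
  linear automorphism of the hypersurface.\<close>

lemma mero_several_scale:
  fixes f :: "complex ^ 'n \<Rightarrow> complex" and c :: "complex ^ 'n"
  assumes f: "mero_several f (surf \<kappa>)" and c: "(\<Prod>a\<in>UNIV. c $ a) = 1"
  shows "mero_several (\<lambda>t. f (\<chi> a. c $ a * t $ a)) (surf \<kappa>)"
proof (rule mero_severalI)
  let ?S = "surf \<kappa> :: (complex ^ 'n) set"
  let ?l = "\<lambda>t::complex^'n. (\<chi> a. c $ a * t $ a)"
  let ?k = "\<lambda>t::complex^'n. (\<chi> a. t $ a / c $ a)"
  have cnz: "c $ a \<noteq> 0" for a using c by (metis UNIV_I finite prod_zero_iff zero_neq_one)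
  have kl: "?k (?l t) = t" and lk: "?l (?k t) = t" for t using cnz by (auto simp: vec_eq_iff)
  have lS: "?l t \<in> ?S \<longleftrightarrow> t \<in> ?S" and kS: "?k t \<in> ?S \<longleftrightarrow> t \<in> ?S" for t
    using c by (auto simp: surf_def prod.distrib prod_dividef)
  have lc: "isCont ?l t" and kc: "isCont ?k t" for t
    unfolding isCont_def using cnz by (auto intro!: vec_tendstoI tendsto_intros)
  have ov: "open (?l -` N)" "open (?k -` N)" if "open N" for N
    using lc kc by (auto intro!: open_vimage[OF that] continuous_at_imp_continuous_on)
  have hl: "holo_several (\<lambda>t. g (?l t)) (?l -` U)" if g: "holo_several g U" for g U
    unfolding holo_several_def
  proof
    fix t assume "t \<in> ?l -` U"
    then obtain D where D: "(g has_derivative D) (at (?l t))" "\<forall>c v. D (c *s v) = c * D v"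
      using g unfolding holo_several_def by blast
    have "(?l has_derivative ?l) (at t)"
      by (rule has_derivative_vec)
        (simp, rule has_derivative_mult_right, rule bounded_linear_imp_has_derivative, rule bounded_linear_vec_nth)
    from has_derivative_compose[OF this D(1)]
    show "\<exists>D. ((\<lambda>t. g (?l t)) has_derivative D) (at t) \<and> (\<forall>c v. D (c *s v) = c * D v)"
    proof (intro exI conjI allI)
      fix b v
      have "?l (b *s v) = b *s ?l v" by (simp add: vec_eq_iff mult_ac)
      then show "D (?l (b *s v)) = b * D (?l v)" using D(2) by simp
    qed
  qed
  fix t assume t: "t \<in> ?S"
  obtain U g h where U: "open U" "?l t \<in> U" "holo_several g U" "holo_several h U"
    "?S \<inter> U \<subseteq> closure {s \<in> ?S \<inter> U. h s \<noteq> 0}" "\<forall>s\<in>?S \<inter> U. h s \<noteq> 0 \<longrightarrow> f s = g s / h s"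
    by (rule mero_severalE[OF f, of "?l t"]) (use t lS in auto)
  show "\<exists>U g h. open U \<and> t \<in> U \<and> holo_several g U \<and> holo_several h U \<and>
        ?S \<inter> U \<subseteq> closure {s \<in> ?S \<inter> U. h s \<noteq> 0} \<and> (\<forall>s\<in>?S \<inter> U. h s \<noteq> 0 \<longrightarrow> f (?l s) = g s / h s)"
  proof (intro exI conjI)
    show "holo_several (\<lambda>t. g (?l t)) (?l -` U)" "holo_several (\<lambda>t. h (?l t)) (?l -` U)" using hl U by blast+
    show "open (?l -` U)" "t \<in> ?l -` U" using ov U by auto
    show "\<forall>s\<in>?S \<inter> (?l -` U). h (?l s) \<noteq> 0 \<longrightarrow> f (?l s) = g (?l s) / h (?l s)" using U(6) lS by auto
    show "?S \<inter> (?l -` U) \<subseteq> closure {s \<in> ?S \<inter> (?l -` U). h (?l s) \<noteq> 0}"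
      unfolding dense_iff
    proof (intro ballI allI impI)
      fix s N assume s: "s \<in> ?S \<inter> ?l -` U" "open N" "s \<in> N"
      have "?l s \<in> ?S \<inter> U" "open (?k -` N)" "?l s \<in> ?k -` N" using s lS ov kl by auto
      then obtain s' where s': "s' \<in> ?S \<inter> U \<inter> (?k -` N)" "h s' \<noteq> 0" using U(5) unfolding dense_iff by blast
      then show "\<exists>s'\<in>?S \<inter> (?l -` U) \<inter> N. h (?l s') \<noteq> 0"
        using kS lk by (intro bexI[of _ "?k s'"]) auto
    qed
  qed
qed

section \<open>Circle integrals depending on parameters\<close>

text \<open>Integration against \<open>dz / z\<close>, the Haar measure of the circle up to a
  constant. Inversion therefore preserves the value, and so does dilation as long as no pole is
  crossed.\<close>

definition CM :: "(complex \<Rightarrow> complex) \<Rightarrow> complex" where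
  "CM f = contour_integral (circlepath 0 1) (\<lambda>z. f z / z)"

definition ee :: "real \<Rightarrow> complex" where
  "ee x = exp (2 * of_real pi * \<i> * of_real x)"

lemma norm_ee [simp]: "norm (ee x) = 1"
  by (simp add: ee_def)

lemma ee_nz [simp]: "ee x \<noteq> 0" by (simp add: ee_def)

lemma continuous_on_ee: "continuous_on X ee"
  unfolding ee_def[abs_def] by (intro continuous_intros)

lemma CM_eq: "CM f = 2 * of_real pi * \<i> * integral {0..1} (\<lambda>x. f (ee x))"
proof -
  have "CM f = integral {0..1} (\<lambda>x. f (circlepath 0 1 x) / circlepath 0 1 x * vector_derivative (circlepath 0 1) (at x))"
    unfolding CM_def contour_integral_integral ..
  also have "\<dots> = integral {0..1} (\<lambda>x. 2 * of_real pi * \<i> * f (ee x))"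
  proof (rule integral_cong)
    fix x :: real
    have "circlepath 0 1 x = ee x" by (simp add: circlepath ee_def mult_ac)
    moreover have "vector_derivative (circlepath 0 1) (at x) = 2 * of_real pi * \<i> * ee x"
      by (simp add: vector_derivative_circlepath ee_def mult_ac)
    ultimately show "f (circlepath 0 1 x) / circlepath 0 1 x * vector_derivative (circlepath 0 1) (at x) = 2 * of_real pi * \<i> * f (ee x)"
      by simp
  qed
  finally show ?thesis by simp
qed

lemma CM_cong: "(\<And>z. norm z = 1 \<Longrightarrow> f z = g z) \<Longrightarrow> CM f = CM g"
  unfolding CM_eq by (simp cong: integral_cong)

lemma CM_cmult: "CM (\<lambda>z. c * f z) = c * CM f"
  unfolding CM_eq by simp

lemma circle_integrable:
  fixes f :: "complex \<Rightarrow> complex"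
  shows "continuous_on (sphere 0 1) f \<Longrightarrow> (\<lambda>x. f (ee x)) integrable_on {0..1}"
  by (rule integrable_continuous_real, rule continuous_on_compose2[where g = f, OF _ continuous_on_ee]) auto

lemma CM_add: "continuous_on (sphere 0 1) f \<Longrightarrow> continuous_on (sphere 0 1) g \<Longrightarrow> CM (\<lambda>z. f z + g z) = CM f + CM g"
  unfolding CM_eq by (simp add: integral_add circle_integrable algebra_simps)

lemma CM_inverse:
  assumes "continuous_on (sphere 0 1) f"
  shows "CM (\<lambda>z. f (1 / z)) = CM f"
proof -
  have "((\<lambda>x. f (ee x)) has_integral integral {0..1} (\<lambda>x. f (ee x))) (cbox 0 1)"
    using circle_integrable[OF assms] by (simp add: has_integral_integral)
  from has_integral_affinity[OF this, of "-1" 1]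
  have "((\<lambda>x. f (ee (1 - x))) has_integral integral {0..1} (\<lambda>x. f (ee x))) ((\<lambda>x. 1 - x) ` {0..1})"
    by (simp add: algebra_simps)
  moreover have "(\<lambda>x. 1 - x) ` {0..1} = {0..1::real}" by (auto simp: image_def intro!: exI bexI[of _ "1 - _"])
  moreover have "ee (1 - x) = 1 / ee x" for x
  proof -
    have "ee (1 - x) = exp (2 * of_real pi * \<i> - 2 * of_real pi * \<i> * of_real x)" by (simp add: ee_def algebra_simps)
    also have "\<dots> = 1 / ee x" unfolding exp_diff ee_def by simp
    finally show ?thesis .
  qed
  ultimately have "((\<lambda>x. f (1 / ee x)) has_integral integral {0..1} (\<lambda>x. f (ee x))) {0..1}" by simp
  then show ?thesis unfolding CM_eq by (simp add: integral_unique)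
qed

text \<open>Cauchy's theorem for concentric circles without homotopies: for \<open>\<zeta>\<close>
  on the segment from 0 to \<open>Ln c\<close>, the derivative of
  \<open>f (exp \<zeta> * ee x)\<close> in \<open>\<zeta>\<close> is, up to a constant, its
  derivative in the angle \<open>x\<close>, which integrates to 0 over a period.\<close>

lemma CM_dilate:
  assumes A: "open A" and f: "f holomorphic_on A" and c: "c \<noteq> 0"
    and ann: "\<And>z. min 1 (norm c) \<le> norm z \<Longrightarrow> norm z \<le> max 1 (norm c) \<Longrightarrow> z \<in> A"
  shows "CM (\<lambda>z. f (c * z)) = CM f"
proof -
  define U where "U = closed_segment 0 (Ln c)"
  have inA: "exp \<zeta> * ee x \<in> A" if \<zeta>: "\<zeta> \<in> U" for \<zeta> x
  proof -
    obtain u where u: "0 \<le> u" "u \<le> 1" "\<zeta> = of_real u * Ln c"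
      using \<zeta> unfolding U_def in_segment by (auto simp: scaleR_conv_of_real)
    have n: "norm (exp \<zeta> * ee x) = exp (u * ln (norm c))"
      using c by (simp add: norm_mult u(3))
    have "min 1 (norm c) \<le> exp (u * ln (norm c)) \<and> exp (u * ln (norm c)) \<le> max 1 (norm c)"
    proof (cases "norm c \<ge> 1")
      case True
      then have "u * ln (norm c) \<le> 1 * ln (norm c)" using u by (intro mult_right_mono) auto
      then have "exp (u * ln (norm c)) \<le> exp (ln (norm c))" by simp
      moreover have "exp 0 \<le> exp (u * ln (norm c))" using True u by simp
      ultimately show ?thesis using True c by simp
    next
      case False
      then have l: "ln (norm c) \<le> 0" using c by simp
      then have "1 * ln (norm c) \<le> u * ln (norm c)" using u by (intro mult_right_mono_neg) auto
      then have "exp (ln (norm c)) \<le> exp (u * ln (norm c))" by simp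
      moreover have "exp (u * ln (norm c)) \<le> exp 0" using l u by (simp add: mult_nonneg_nonpos)
      ultimately show ?thesis using False c by simp
    qed
    then show ?thesis using ann n by metis
  qed
  define G where "G = (\<lambda>\<zeta>. integral (cbox 0 1) (\<lambda>x. f (exp \<zeta> * ee x)))"
  have fc: "continuous_on A f" "continuous_on A (deriv f)"
    using f A by (auto intro!: holomorphic_on_imp_continuous_on holomorphic_deriv)
  have G0: "(G has_field_derivative 0) (at \<zeta>0 within U)" if \<zeta>0: "\<zeta>0 \<in> U" for \<zeta>0
  proof -
    have "(G has_field_derivative integral (cbox 0 1) (\<lambda>x. deriv f (exp \<zeta>0 * ee x) * (exp \<zeta>0 * ee x))) (at \<zeta>0 within U)"
      unfolding G_def
    proof (rule leibniz_rule_field_derivative[where fx = "\<lambda>\<zeta> x. deriv f (exp \<zeta> * ee x) * (exp \<zeta> * ee x)"])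
      fix \<zeta> and x :: real assume \<zeta>: "\<zeta> \<in> U"
      have "(f has_field_derivative deriv f (exp \<zeta> * ee x)) (at (exp \<zeta> * ee x))"
        by (rule holomorphic_derivI[OF f A inA[OF \<zeta>]])
      then show "((\<lambda>\<zeta>. f (exp \<zeta> * ee x)) has_field_derivative deriv f (exp \<zeta> * ee x) * (exp \<zeta> * ee x)) (at \<zeta> within U)"
        by (rule DERIV_chain2) (auto intro!: derivative_eq_intros)
    next
      fix \<zeta> assume \<zeta>: "\<zeta> \<in> U"
      show "(\<lambda>x. f (exp \<zeta> * ee x)) integrable_on cbox 0 1"
        by (intro integrable_continuous continuous_on_compose2[OF fc(1)] continuous_intros continuous_on_compose2[OF continuous_on_ee])
           (use inA[OF \<zeta>] in auto)
    next
      show "continuous_on (U \<times> cbox 0 1) (\<lambda>(\<zeta>, x). deriv f (exp \<zeta> * ee x) * (exp \<zeta> * ee x))"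
        unfolding split_beta
        by (intro continuous_intros continuous_on_compose2[OF fc(2)] continuous_on_compose2[OF continuous_on_ee[of UNIV]])
           (use inA in auto)
      show "\<zeta>0 \<in> U" "convex U" using \<zeta>0 by (auto simp: U_def)
    qed
    moreover have "((\<lambda>x. 2 * of_real pi * \<i> * (deriv f (exp \<zeta>0 * ee x) * (exp \<zeta>0 * ee x))) has_integral
        f (exp \<zeta>0 * ee 1) - f (exp \<zeta>0 * ee 0)) {0..1}"
    proof (rule fundamental_theorem_of_calculus)
      fix x :: real
      have "(f has_field_derivative deriv f (exp \<zeta>0 * ee x)) (at (exp \<zeta>0 * ee x))"
        by (rule holomorphic_derivI[OF f A inA[OF \<zeta>0]])
      moreover have "((\<lambda>x. exp \<zeta>0 * ee x) has_vector_derivative exp \<zeta>0 * (2 * of_real pi * \<i> * ee x)) (at x within {0..1})"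
      proof -
        have "((\<lambda>z. exp \<zeta>0 * exp (2 * of_real pi * \<i> * z)) has_field_derivative exp \<zeta>0 * (2 * of_real pi * \<i> * ee x)) (at (of_real x))"
          unfolding ee_def by (auto intro!: derivative_eq_intros)
        then show ?thesis unfolding ee_def[abs_def] by (rule has_vector_derivative_real_field)
      qed
      ultimately have "((f \<circ> (\<lambda>x. exp \<zeta>0 * ee x)) has_vector_derivative (exp \<zeta>0 * (2 * of_real pi * \<i> * ee x)) * deriv f (exp \<zeta>0 * ee x)) (at x within {0..1})"
        by (intro field_vector_diff_chain_within[where f' = _]) (auto intro: has_field_derivative_at_within)
      then show "((\<lambda>x. f (exp \<zeta>0 * ee x)) has_vector_derivative 2 * of_real pi * \<i> * (deriv f (exp \<zeta>0 * ee x) * (exp \<zeta>0 * ee x))) (at x within {0..1})"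
        by (simp add: o_def mult_ac)
    qed auto
    then have "2 * of_real pi * \<i> * integral {0..1} (\<lambda>x. deriv f (exp \<zeta>0 * ee x) * (exp \<zeta>0 * ee x)) = 0"
      by (simp add: ee_def has_integral_iff)
    ultimately show ?thesis by (simp add: cbox_interval)
  qed
  obtain y where "\<And>\<zeta>. \<zeta> \<in> U \<Longrightarrow> G \<zeta> = y"
    using has_field_derivative_zero_constant[OF _ G0] by (metis U_def convex_closed_segment)
  then have "G 0 = G (Ln c)" by (simp add: U_def)
  then show ?thesis unfolding CM_eq G_def using c by (simp add: cbox_interval)
qed

text \<open>What differentiation under the integral sign needs: complex-linear derivatives in
  \<open>t\<close> whose coefficients are jointly continuous in \<open>t\<close> and
  \<open>z\<close>. Holomorphy in \<open>z\<close> is carried along for moving the contour.\<close>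

definition pholo :: "(complex ^ 'n \<Rightarrow> complex \<Rightarrow> complex) \<Rightarrow> (complex ^ 'n) set \<Rightarrow> complex set \<Rightarrow> bool" where
  "pholo \<Phi> U Z \<longleftrightarrow> (\<exists>\<Phi>'. (\<forall>t\<in>U. \<forall>z\<in>Z. ((\<lambda>t. \<Phi> t z) has_derivative (\<lambda>v. \<Sum>a\<in>UNIV. \<Phi>' a t z * v $ a)) (at t)) \<and>
      (\<forall>a. continuous_on (U \<times> Z) (\<lambda>x. \<Phi>' a (fst x) (snd x)))) \<and>
      continuous_on (U \<times> Z) (\<lambda>x. \<Phi> (fst x) (snd x)) \<and> (\<forall>t\<in>U. \<Phi> t holomorphic_on Z)"

lemma pholoI:
  assumes "\<And>t z. t \<in> U \<Longrightarrow> z \<in> Z \<Longrightarrow> ((\<lambda>t. \<Phi> t z) has_derivative (\<lambda>v. \<Sum>a\<in>UNIV. \<Phi>' a t z * v $ a)) (at t)"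
    and "\<And>a. continuous_on (U \<times> Z) (\<lambda>x. \<Phi>' a (fst x) (snd x))"
    and "continuous_on (U \<times> Z) (\<lambda>x. \<Phi> (fst x) (snd x))" "\<And>t. t \<in> U \<Longrightarrow> \<Phi> t holomorphic_on Z"
  shows "pholo \<Phi> U Z"
  using assms unfolding pholo_def by blast

lemma pholoE:
  assumes "pholo \<Phi> U Z"
  obtains \<Phi>' where "\<forall>t z. t \<in> U \<longrightarrow> z \<in> Z \<longrightarrow> ((\<lambda>t. \<Phi> t z) has_derivative (\<lambda>v. \<Sum>a\<in>UNIV. \<Phi>' a t z * v $ a)) (at t)"
      "\<forall>a. continuous_on (U \<times> Z) (\<lambda>x. \<Phi>' a (fst x) (snd x))" "continuous_on (U \<times> Z) (\<lambda>x. \<Phi> (fst x) (snd x))"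
      "\<forall>t. t \<in> U \<longrightarrow> \<Phi> t holomorphic_on Z"
  using assms unfolding pholo_def by (elim conjE exE, intro that) (simp_all add: Ball_def)

lemma pholo_subset:
  assumes "pholo \<Phi> U Z" "V \<subseteq> U" "Y \<subseteq> Z"
  shows "pholo \<Phi> V Y"
proof -
  obtain \<Phi>' where "\<forall>t z. t \<in> U \<longrightarrow> z \<in> Z \<longrightarrow> ((\<lambda>t. \<Phi> t z) has_derivative (\<lambda>v. \<Sum>a\<in>UNIV. \<Phi>' a t z * v $ a)) (at t)"
      "\<forall>a. continuous_on (U \<times> Z) (\<lambda>x. \<Phi>' a (fst x) (snd x))" "continuous_on (U \<times> Z) (\<lambda>x. \<Phi> (fst x) (snd x))"
      "\<forall>t. t \<in> U \<longrightarrow> \<Phi> t holomorphic_on Z"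
    by (rule pholoE[OF assms(1)])
  note 1 = this[rule_format]
  have sub: "V \<times> Y \<subseteq> U \<times> Z" using assms by blast
  show ?thesis
  proof (rule pholoI[where \<Phi>' = \<Phi>'])
    fix t z assume "t \<in> V" "z \<in> Y"
    then show "((\<lambda>t. \<Phi> t z) has_derivative (\<lambda>v. \<Sum>a\<in>UNIV. \<Phi>' a t z * v $ a)) (at t)"
      using assms by (intro 1(1)) auto
  next
    fix t assume "t \<in> V"
    then show "\<Phi> t holomorphic_on Y" using assms by (intro holomorphic_on_subset[OF 1(4)]) auto
  qed (rule continuous_on_subset[OF 1(2) sub] continuous_on_subset[OF 1(3) sub])+
qed

lemma pholo_holo: "pholo \<Phi> U Z \<Longrightarrow> t \<in> U \<Longrightarrow> \<Phi> t holomorphic_on Z"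
  unfolding pholo_def by blast

lemma pholo_nth: "pholo (\<lambda>t z. t $ a) (U :: (complex ^ 'n) set) Z"
proof (rule pholoI[where \<Phi>' = "\<lambda>b t z. if b = a then 1 else 0"])
  fix t :: "complex ^ 'n" and z :: complex
  have "(\<lambda>v. \<Sum>b\<in>UNIV. (if b = a then 1 else 0) * v $ b) = (\<lambda>v::complex^_. v $ a)"
    by (simp add: if_distrib[where f = "\<lambda>x. x * _"] cong: if_cong)
  then show "((\<lambda>t. t $ a) has_derivative (\<lambda>v. \<Sum>b\<in>UNIV. (if b = a then 1 else 0) * v $ b)) (at t)"
    by (simp only: bounded_linear_imp_has_derivative[OF bounded_linear_vec_nth])
qed (auto intro!: continuous_intros)

lemma pholo_z:
  assumes "h holomorphic_on Z"
  shows "pholo (\<lambda>t z. h z) U Z"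
proof (rule pholoI[where \<Phi>' = "\<lambda>b t z. 0"])
  show "continuous_on (U \<times> Z) (\<lambda>x. h (snd x))"
    by (rule continuous_on_compose2[OF holomorphic_on_imp_continuous_on[OF assms] continuous_on_snd]) auto
qed (use assms in auto)

lemma pholo_mult:
  assumes "pholo \<Phi> U Z" "pholo \<Psi> U Z"
  shows "pholo (\<lambda>t z. \<Phi> t z * \<Psi> t z) U Z"
proof -
  obtain \<Phi>' where "\<forall>t z. t \<in> U \<longrightarrow> z \<in> Z \<longrightarrow> ((\<lambda>t. \<Phi> t z) has_derivative (\<lambda>v. \<Sum>a\<in>UNIV. \<Phi>' a t z * v $ a)) (at t)"
      "\<forall>a. continuous_on (U \<times> Z) (\<lambda>x. \<Phi>' a (fst x) (snd x))" "continuous_on (U \<times> Z) (\<lambda>x. \<Phi> (fst x) (snd x))"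
      "\<forall>t. t \<in> U \<longrightarrow> \<Phi> t holomorphic_on Z"
    by (rule pholoE[OF assms(1)])
  note 1 = this[rule_format]
  obtain \<Psi>' where "\<forall>t z. t \<in> U \<longrightarrow> z \<in> Z \<longrightarrow> ((\<lambda>t. \<Psi> t z) has_derivative (\<lambda>v. \<Sum>a\<in>UNIV. \<Psi>' a t z * v $ a)) (at t)"
      "\<forall>a. continuous_on (U \<times> Z) (\<lambda>x. \<Psi>' a (fst x) (snd x))" "continuous_on (U \<times> Z) (\<lambda>x. \<Psi> (fst x) (snd x))"
      "\<forall>t. t \<in> U \<longrightarrow> \<Psi> t holomorphic_on Z"
    by (rule pholoE[OF assms(2)])
  note 2 = this[rule_format]
  show ?thesis
  proof (rule pholoI[where \<Phi>' = "\<lambda>a t z. \<Phi> t z * \<Psi>' a t z + \<Phi>' a t z * \<Psi> t z"])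
    fix t z assume tz: "t \<in> U" "z \<in> Z"
    have "(\<lambda>v. \<Sum>a\<in>UNIV. (\<Phi> t z * \<Psi>' a t z + \<Phi>' a t z * \<Psi> t z) * v $ a)
      = (\<lambda>v. \<Phi> t z * (\<Sum>a\<in>UNIV. \<Psi>' a t z * v $ a) + (\<Sum>a\<in>UNIV. \<Phi>' a t z * v $ a) * \<Psi> t z)"
      by (rule ext) (simp add: algebra_simps sum.distrib sum_distrib_left)
    then show "((\<lambda>t. \<Phi> t z * \<Psi> t z) has_derivative (\<lambda>v. \<Sum>a\<in>UNIV. (\<Phi> t z * \<Psi>' a t z + \<Phi>' a t z * \<Psi> t z) * v $ a)) (at t)"
      using has_derivative_mult[OF 1(1)[OF tz] 2(1)[OF tz]] by simp
  next
    fix t assume "t \<in> U"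
    then show "(\<lambda>z. \<Phi> t z * \<Psi> t z) holomorphic_on Z" using 1(4) 2(4) by (intro holomorphic_intros) auto
  qed (intro continuous_intros 1 2)+
qed

lemma pholo_comp:
  assumes "pholo \<Phi> U Z" and F: "F holomorphic_on V" "open V" and V: "\<And>t z. t \<in> U \<Longrightarrow> z \<in> Z \<Longrightarrow> \<Phi> t z \<in> V"
  shows "pholo (\<lambda>t z. F (\<Phi> t z)) U Z"
proof -
  obtain \<Phi>' where "\<forall>t z. t \<in> U \<longrightarrow> z \<in> Z \<longrightarrow> ((\<lambda>t. \<Phi> t z) has_derivative (\<lambda>v. \<Sum>a\<in>UNIV. \<Phi>' a t z * v $ a)) (at t)"
      "\<forall>a. continuous_on (U \<times> Z) (\<lambda>x. \<Phi>' a (fst x) (snd x))" "continuous_on (U \<times> Z) (\<lambda>x. \<Phi> (fst x) (snd x))"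
      "\<forall>t. t \<in> U \<longrightarrow> \<Phi> t holomorphic_on Z"
    by (rule pholoE[OF assms(1)])
  note 1 = this[rule_format]
  have dc: "continuous_on V (deriv F)" "continuous_on V F"
    using F by (auto intro!: holomorphic_on_imp_continuous_on holomorphic_deriv)
  show ?thesis
  proof (rule pholoI[where \<Phi>' = "\<lambda>a t z. deriv F (\<Phi> t z) * \<Phi>' a t z"])
    fix t z assume tz: "t \<in> U" "z \<in> Z"
    have "(F has_derivative (\<lambda>h. deriv F (\<Phi> t z) * h)) (at (\<Phi> t z))"
      using holomorphic_derivI[OF F V[OF tz]] by (simp add: has_field_derivative_def)
    from has_derivative_compose[OF 1(1)[OF tz] this]
    show "((\<lambda>t. F (\<Phi> t z)) has_derivative (\<lambda>v. \<Sum>a\<in>UNIV. deriv F (\<Phi> t z) * \<Phi>' a t z * v $ a)) (at t)"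
      by (simp add: sum_distrib_left mult_ac)
  next
    fix a
    show "continuous_on (U \<times> Z) (\<lambda>x. deriv F (\<Phi> (fst x) (snd x)) * \<Phi>' a (fst x) (snd x))"
      by (intro continuous_intros 1(2) continuous_on_compose2[OF dc(1) 1(3)]) (use V in auto)
  next
    show "continuous_on (U \<times> Z) (\<lambda>x. F (\<Phi> (fst x) (snd x)))"
      by (intro continuous_on_compose2[OF dc(2) 1(3)]) (use V in auto)
  next
    fix t assume "t \<in> U"
    then show "(\<lambda>z. F (\<Phi> t z)) holomorphic_on Z"
      using holomorphic_on_compose_gen[OF 1(4) F(1)] V by (auto simp: o_def)
  qed
qed

lemma pholo_divide:
  assumes "pholo \<Phi> U Z" "pholo \<Psi> U Z" "\<And>t z. t \<in> U \<Longrightarrow> z \<in> Z \<Longrightarrow> \<Psi> t z \<noteq> 0"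
  shows "pholo (\<lambda>t z. \<Phi> t z / \<Psi> t z) U Z"
proof -
  have "open (- {0::complex})" by (simp add: open_Compl)
  then have "pholo (\<lambda>t z. inverse (\<Psi> t z)) U Z"
    using assms by (intro pholo_comp[OF assms(2), where V = "- {0}"] holomorphic_intros) auto
  from pholo_mult[OF assms(1) this] show ?thesis by (simp add: divide_inverse)
qed

lemma pholo_prod:
  "finite A \<Longrightarrow> (\<And>i. i \<in> A \<Longrightarrow> pholo (f i) U Z) \<Longrightarrow> pholo (\<lambda>t z. \<Prod>i\<in>A. f i t z) U Z"
  by (induction A rule: finite_induct) (auto intro: pholo_mult pholo_z holomorphic_on_const)

lemma pholo_prod_list:
  "(\<And>i. i \<in> set xs \<Longrightarrow> pholo (f i) U Z) \<Longrightarrow> pholo (\<lambda>t z. \<Prod>i\<leftarrow>xs. f i t z) U Z"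
  by (induction xs) (auto intro: pholo_mult pholo_z holomorphic_on_const)

text \<open>The radius is a parameter because the continuation integrates over the circles of radius
  \<open>R\<close> and \<open>1 / R\<close>.\<close>

lemma pholo_CM:
  assumes \<Phi>: "pholo \<Phi> U Z" and U: "open U" and \<rho>: "\<And>z. norm z = \<rho> \<Longrightarrow> z \<in> Z" "\<rho> > 0"
  shows "holo_several (\<lambda>t. CM (\<lambda>z. \<Phi> t (of_real \<rho> * z))) U"
proof -
  obtain \<Phi>' where "\<forall>t z. t \<in> U \<longrightarrow> z \<in> Z \<longrightarrow> ((\<lambda>t. \<Phi> t z) has_derivative (\<lambda>v. \<Sum>a\<in>UNIV. \<Phi>' a t z * v $ a)) (at t)"
      "\<forall>a. continuous_on (U \<times> Z) (\<lambda>x. \<Phi>' a (fst x) (snd x))" "continuous_on (U \<times> Z) (\<lambda>x. \<Phi> (fst x) (snd x))"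
      "\<forall>t. t \<in> U \<longrightarrow> \<Phi> t holomorphic_on Z"
    by (rule pholoE[OF assms(1)])
  note 1 = this[rule_format]
  have inZ: "of_real \<rho> * ee x \<in> Z" for x by (rule \<rho>) (use \<rho>(2) in \<open>simp add: norm_mult\<close>)
  define nv :: "'a \<Rightarrow> (complex ^ 'a) \<Rightarrow>\<^sub>L complex" where "nv = (\<lambda>a. Blinfun (\<lambda>v. v $ a))"
  have nv: "blinfun_apply (nv a) v = v $ a" for a v
    unfolding nv_def by (simp add: bounded_linear_Blinfun_apply bounded_linear_vec_nth)
  define fx where "fx = (\<lambda>t x. \<Sum>a\<in>UNIV. blinfun_mult_right (\<Phi>' a t (of_real \<rho> * ee x)) o\<^sub>L nv a)"
  have fx: "blinfun_apply (fx t x) v = (\<Sum>a\<in>UNIV. \<Phi>' a t (of_real \<rho> * ee x) * v $ a)" for t x v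
    unfolding fx_def by (simp add: blinfun.sum_left nv)
  have cfx: "continuous_on (U \<times> cbox 0 1) (\<lambda>y. fx (fst y) (snd y))"
    unfolding fx_def
  proof (intro continuous_intros bounded_linear.continuous_on[OF bounded_linear_blinfun_mult_right])
    fix a
    have "continuous_on (U \<times> cbox 0 1) (\<lambda>y. (fst y, of_real \<rho> * ee (snd y)))"
      by (intro continuous_intros continuous_on_compose2[OF continuous_on_ee[of UNIV]]) auto
    moreover have "(\<lambda>y. (fst y, of_real \<rho> * ee (snd y))) ` (U \<times> cbox 0 1) \<subseteq> U \<times> Z" using inZ by auto
    ultimately show "continuous_on (U \<times> cbox 0 1) (\<lambda>y. \<Phi>' a (fst y) (of_real \<rho> * ee (snd y)))"
      using continuous_on_compose2[OF 1(2)[of a]] by fastforce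
  qed
  have cf: "continuous_on (cbox 0 1) (\<lambda>x. \<Phi> t (of_real \<rho> * ee x))" if "t \<in> U" for t
  proof -
    have "continuous_on (cbox 0 1) (\<lambda>y. (t, of_real \<rho> * ee y))"
      by (intro continuous_intros continuous_on_compose2[OF continuous_on_ee[of UNIV]]) auto
    moreover have "(\<lambda>y. (t, of_real \<rho> * ee y)) ` cbox 0 1 \<subseteq> U \<times> Z" using inZ that by auto
    ultimately show ?thesis using continuous_on_compose2[OF 1(3)] by fastforce
  qed
  have "holo_several (\<lambda>t. integral (cbox 0 1) (\<lambda>x. \<Phi> t (of_real \<rho> * ee x))) U"
    unfolding holo_several_def
  proof
    fix t assume t: "t \<in> U"
    then obtain e where e: "e > 0" "ball t e \<subseteq> U" using U openE by blast
    let ?B = "ball t e"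
    have "((\<lambda>t. integral (cbox 0 1) (\<lambda>x. \<Phi> t (of_real \<rho> * ee x))) has_derivative
        blinfun_apply (integral (cbox 0 1) (fx t))) (at t within ?B)"
    proof (rule leibniz_rule[where fx = fx])
      fix s and x :: real assume s: "s \<in> ?B"
      have "blinfun_apply (fx s x) = (\<lambda>v. \<Sum>a\<in>UNIV. \<Phi>' a s (of_real \<rho> * ee x) * v $ a)" using fx by auto
      moreover have "s \<in> U" using s e by auto
      ultimately show "((\<lambda>t. \<Phi> t (of_real \<rho> * ee x)) has_derivative blinfun_apply (fx s x)) (at s within ?B)"
        using has_derivative_at_withinI[OF 1(1)[OF _ inZ]] by simp
    next
      fix s assume "s \<in> ?B"
      then show "(\<lambda>x. \<Phi> s (of_real \<rho> * ee x)) integrable_on cbox 0 1" using cf e by (intro integrable_continuous) auto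
    next
      show "continuous_on (?B \<times> cbox 0 1) (\<lambda>(s, x). fx s x)"
        unfolding split_beta by (rule continuous_on_subset[OF cfx]) (use e in auto)
    qed (use e in auto)
    then have D: "((\<lambda>t. integral (cbox 0 1) (\<lambda>x. \<Phi> t (of_real \<rho> * ee x))) has_derivative
        blinfun_apply (integral (cbox 0 1) (fx t))) (at t)"
      using e by (simp add: at_within_open[of t ?B])
    have ci: "fx t integrable_on cbox 0 1"
    proof (rule integrable_continuous)
      have "continuous_on (cbox 0 1) (\<lambda>x::real. (t, x))" by (intro continuous_intros)
      from continuous_on_compose2[OF cfx this] show "continuous_on (cbox 0 1) (fx t)" using t by auto
    qed
    have ai: "blinfun_apply (integral (cbox 0 1) (fx t)) v = integral (cbox 0 1) (\<lambda>x. blinfun_apply (fx t x) v)" for v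
      using integral_linear[OF ci bounded_linear_apply_blinfun[of v]] by (simp add: o_def)
    have "blinfun_apply (integral (cbox 0 1) (fx t)) (c *s v) = c * blinfun_apply (integral (cbox 0 1) (fx t)) v" for c v
    proof -
      have "blinfun_apply (fx t x) (c *s v) = c * blinfun_apply (fx t x) v" for x
        unfolding fx by (simp add: sum_distrib_left mult_ac)
      then show ?thesis unfolding ai by simp
    qed
    with D show "\<exists>D. ((\<lambda>t. integral (cbox 0 1) (\<lambda>x. \<Phi> t (of_real \<rho> * ee x))) has_derivative D) (at t) \<and> (\<forall>c v. D (c *s v) = c * D v)"
      by blast
  qed
  then have "holo_several (\<lambda>t. 2 * of_real pi * \<i> * integral (cbox 0 1) (\<lambda>x. \<Phi> t (of_real \<rho> * ee x))) U"
    by (intro holo_several_mult holo_several_const)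
  then show ?thesis unfolding CM_eq by (simp add: cbox_interval)
qed

section \<open>Continuation of circle integrals across pinching poles\<close>

text \<open>Zero coordinates are excluded so that products \<open>t $ a * z\<close> stay in the
  punctured plane, where \<open>rgamma\<close> lives.\<close>

definition polydisc :: "real \<Rightarrow> (complex ^ 'n) set" where
  "polydisc R = {t. \<forall>a. 0 < norm (t $ a) \<and> norm (t $ a) < R}"

lemma open_polydisc: "open (polydisc R)"
proof -
  have eq: "polydisc R = (\<Inter>a. {t. 0 < norm (t $ a)} \<inter> {t. norm (t $ a) < R})" by (auto simp: polydisc_def)
  show ?thesis unfolding eq
    by (intro open_INT open_Int open_Collect_less continuous_intros ballI finite)
qed

definition annulus :: "real \<Rightarrow> complex set" where
  "annulus \<rho> = {z. 1 / \<rho> < norm z \<and> norm z < \<rho>}"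

lemma open_annulus: "open (annulus \<rho>)"
  unfolding annulus_def by (intro open_Collect_conj open_Collect_less continuous_intros)

text \<open>A pair \<open>(c, a)\<close> encodes the pole with \<open>c * t $ a * z = 1\<close>. For
  \<open>norm c \<le> 1\<close> and \<open>norm (t $ a) < 1\<close>, zeros of
  \<open>outf xs t z\<close> lie outside the unit circle and those of
  \<open>outf ys t (1 / z)\<close> inside.\<close>

definition outf :: "(complex \<times> 'n) list \<Rightarrow> complex ^ 'n \<Rightarrow> complex \<Rightarrow> complex" where
  "outf xs t z = (\<Prod>x\<leftarrow>xs. 1 - fst x * t $ snd x * z)"

text \<open>Vanishes exactly when a pole of the first kind coincides with one of the second kind,
  that is, when the contour is pinched.\<close>

definition pairf :: "(complex \<times> 'n) list \<Rightarrow> (complex \<times> 'n) list \<Rightarrow> complex ^ 'n \<Rightarrow> complex" where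
  "pairf xs ys t = (\<Prod>x\<leftarrow>xs. \<Prod>y\<leftarrow>ys. 1 - fst x * t $ snd x * (fst y * t $ snd y))"

lemma pairf_Cons: "pairf (x # xs) ys t = (\<Prod>y\<leftarrow>ys. 1 - fst x * t $ snd x * (fst y * t $ snd y)) * pairf xs ys t"
  by (simp add: pairf_def)

lemma pairf_Cons_right: "pairf xs (y # ys) t = (\<Prod>x\<leftarrow>xs. 1 - fst x * t $ snd x * (fst y * t $ snd y)) * pairf xs ys t"
  by (induction xs) (simp_all add: pairf_def mult_ac)

lemma pairf_Nil_right: "pairf xs [] t = 1"
  by (induction xs) (auto simp: pairf_def)

lemma holo_several_prod_list:
  "(\<And>i. i \<in> set xs \<Longrightarrow> holo_several (f i) U) \<Longrightarrow> holo_several (\<lambda>t. \<Prod>i\<leftarrow>xs. f i t) U"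
  by (induction xs) (auto intro: holo_several_const holo_several_mult)

lemma holo_several_linf: "holo_several (\<lambda>t. 1 - c * t $ a * (d * t $ b)) U"
  by (intro holo_several_diff holo_several_mult holo_several_const holo_several_nth)

lemma holo_several_pairf: "holo_several (pairf xs ys) U"
  unfolding pairf_def[abs_def] by (intro holo_several_prod_list holo_several_linf)

lemma pholo_linf: "h holomorphic_on Z \<Longrightarrow> pholo (\<lambda>t z. 1 - c * t $ a * h z) U Z"
  by (rule pholo_comp[where F = "\<lambda>w. 1 - w" and V = UNIV])
     (auto intro!: pholo_mult pholo_z pholo_nth holomorphic_intros)

lemma linf_nz:
  assumes "norm c \<le> 1" "norm (t $ a) * norm z < 1"
  shows "1 - c * t $ a * z \<noteq> (0::complex)"
proof
  assume "1 - c * t $ a * z = 0"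
  then have "norm (c * t $ a * z) = 1" by (metis eq_iff_diff_eq_0 norm_one)
  moreover have "norm (c * t $ a * z) \<le> 1 * (norm (t $ a) * norm z)"
    using assms(1) by (simp add: norm_mult mult.assoc mult_right_le_one_le mult_left_le_one_le)
  ultimately show False using assms by linarith
qed

lemma outf_nz:
  assumes "\<And>x. x \<in> set xs \<Longrightarrow> norm (fst x) \<le> 1" "\<And>a. norm (t $ a) * norm z < 1"
  shows "outf xs t z \<noteq> 0"
proof
  assume "outf xs t z = 0"
  then obtain x where "x \<in> set xs" "1 - fst x * t $ snd x * z = 0" unfolding outf_def by (auto simp: prod_list_zero_iff)
  then show False using linf_nz assms by blast
qed

lemma pholo_outf: "h holomorphic_on Z \<Longrightarrow> pholo (\<lambda>t z. outf xs t (h z)) U Z"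
  unfolding outf_def by (intro pholo_prod_list pholo_linf)

text \<open>
  The identity \<open>(1 - \<alpha> \<beta>) / ((1 - \<alpha> z) (1 - \<beta> / z)) = 1 / (1 - \<alpha> z) + (\<beta> / z) / (1 - \<beta> / z)\<close>
  removes one linear factor at the price of \<open>1 - \<alpha> \<beta>\<close>. Once all poles lie on one side of
  the circle, dilating it continues the integral.
\<close>

lemma CM_continuation:
  fixes M :: "complex ^ 'n \<Rightarrow> complex \<Rightarrow> complex"
  assumes R: "1 < R" "R < \<rho>" and M: "pholo M (polydisc R) (annulus \<rho>)"
    and xs: "\<And>x. x \<in> set xs \<Longrightarrow> norm (fst x) \<le> 1" and ys: "\<And>x. x \<in> set ys \<Longrightarrow> norm (fst x) \<le> 1"
  shows "\<exists>G. holo_several G (polydisc R) \<and>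
      (\<forall>t\<in>polydisc 1. pairf xs ys t * CM (\<lambda>z. M t z / (outf xs t z * outf ys t (1 / z))) = G t)"
  using M xs ys
proof (induction xs arbitrary: ys M)
  case Nil
  note M = Nil.prems(1) and ys = Nil.prems(3)
  \<comment> \<open>Only poles of the inner kind are left, and for \<open>t\<close> in
    \<open>polydisc R\<close> the circle of radius \<open>R\<close> encloses them all. For
    \<open>t\<close> in the unit polydisc, dilation to radius 1 crosses none of them.\<close>
  let ?Z = "{z \<in> annulus \<rho>. R \<le> norm z}"
  have nz: "outf ys t (1 / z) \<noteq> 0" if "t \<in> polydisc R" "R \<le> norm z" for t z
  proof (rule outf_nz[OF ys])
    fix a have "norm (t $ a) < R" using that by (auto simp: polydisc_def)
    moreover have "0 < norm z" using that R by linarith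
    ultimately show "norm (t $ a) * norm (1 / z) < 1" using that by (simp add: norm_divide divide_less_eq)
  qed
  have ph: "pholo (\<lambda>t z. M t z / outf ys t (1 / z)) (polydisc R) ?Z"
    using R by (intro pholo_divide nz pholo_outf holomorphic_intros pholo_subset[OF M]) auto
  have "1 / \<rho> < R" using R by (simp add: divide_less_eq less_1_mult)
  then have G: "holo_several (\<lambda>t. CM (\<lambda>z. M t (of_real R * z) / outf ys t (1 / (of_real R * z)))) (polydisc R)"
    using R by (intro pholo_CM[OF ph open_polydisc]) (auto simp: annulus_def)
  show ?case
  proof (intro exI conjI ballI)
    fix t :: "complex ^ 'n" assume t: "t \<in> polydisc 1"
    let ?A = "annulus \<rho> \<inter> (\<Inter>a. {z. norm (t $ a) < norm z})"
    have "open ?A"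
      by (intro open_Int open_annulus open_INT open_Collect_less continuous_intros ballI finite)
    moreover have "(\<lambda>z. M t z / outf ys t (1 / z)) holomorphic_on ?A"
    proof (intro holomorphic_intros)
      have "t \<in> polydisc R" using t R by (auto simp: polydisc_def intro: less_trans)
      then show "M t holomorphic_on ?A" using M unfolding pholo_def by (blast intro: holomorphic_on_subset)
      have z0: "z \<noteq> 0" if "z \<in> ?A" for z :: complex using that by (metis IntD2 INT_iff UNIV_I mem_Collect_eq norm_not_less_zero norm_zero)
      have h: "(\<lambda>z. 1 / z) holomorphic_on ?A" by (intro holomorphic_intros z0)
      show "(\<lambda>z. outf ys t (1 / z)) holomorphic_on ?A"
        by (rule pholo_holo[OF pholo_outf[OF h], of _ UNIV]) simp
      fix z :: complex assume z: "z \<in> ?A"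
      show "outf ys t (1 / z) \<noteq> 0"
      proof (rule outf_nz[OF ys])
        fix a have "norm (t $ a) < norm z" using z by auto
        then show "norm (t $ a) * norm (1 / z) < 1" using z0[OF z] by (simp add: norm_divide)
      qed
    qed
    ultimately have "CM (\<lambda>z. M t (of_real R * z) / outf ys t (1 / (of_real R * z))) = CM (\<lambda>z. M t z / outf ys t (1 / z))"
    proof (rule CM_dilate)
      show "complex_of_real R \<noteq> 0" using R by auto
      fix z :: complex assume "min 1 (norm (complex_of_real R)) \<le> norm z" "norm z \<le> max 1 (norm (complex_of_real R))"
      then have z: "1 \<le> norm z" "norm z \<le> R" using R by auto
      have "1 / \<rho> < 1" using R by simp
      then have "1 / \<rho> < norm z" "norm z < \<rho>" using z R by linarith+
      moreover have "norm (t $ a) < norm z" for a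
      proof -
        have "norm (t $ a) < 1" using t by (auto simp: polydisc_def)
        then show ?thesis using z by linarith
      qed
      ultimately show "z \<in> ?A" by (auto simp: annulus_def)
    qed
    then show "pairf [] ys t * CM (\<lambda>z. M t z / (outf [] t z * outf ys t (1 / z))) = CM (\<lambda>z. M t (of_real R * z) / outf ys t (1 / (of_real R * z)))"
      by (simp add: pairf_def outf_def)
  qed (rule G)
next
  case (Cons x xs)
  note IH = Cons.IH and xs = Cons.prems(2)
  show ?case using Cons.prems(1,3)
  proof (induction ys arbitrary: M)
    case Nil
    note M = Nil.prems(1)
    let ?xs = "x # xs"
    \<comment> \<open>The mirror image: all poles are of the outer kind and lie outside the circle
      of radius \<open>1 / R\<close>.\<close>
    let ?Z = "{z \<in> annulus \<rho>. norm z \<le> 1 / R}"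
    have nz: "outf ?xs t z \<noteq> 0" if "t \<in> polydisc R" "norm z \<le> 1 / R" for t z
    proof (rule outf_nz[OF xs])
      fix a have "norm (t $ a) < R" using that by (auto simp: polydisc_def)
      then have "norm (t $ a) * (1 / R) < 1" using R by simp
      moreover have "norm (t $ a) * norm z \<le> norm (t $ a) * (1 / R)"
        by (rule mult_left_mono[OF that(2)]) simp
      ultimately show "norm (t $ a) * norm z < 1" by linarith
    qed auto
    have ph: "pholo (\<lambda>t z. M t z / outf ?xs t z) (polydisc R) ?Z"
      using R by (intro pholo_divide nz pholo_outf[where h = "\<lambda>z. z"] holomorphic_intros pholo_subset[OF M]) auto
    have "1 / \<rho> < 1 / R" "1 / R < \<rho>" using R by (auto intro!: divide_strict_left_mono simp: divide_less_eq less_1_mult)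
    then have G: "holo_several (\<lambda>t. CM (\<lambda>z. M t (of_real (1 / R) * z) / outf ?xs t (of_real (1 / R) * z))) (polydisc R)"
      using R by (intro pholo_CM[OF ph open_polydisc]) (auto simp: annulus_def)
    show ?case
    proof (intro exI conjI ballI)
      fix t :: "complex ^ 'n" assume t: "t \<in> polydisc 1"
      let ?A = "annulus \<rho> \<inter> (\<Inter>a. {z. norm (t $ a) * norm z < 1})"
      have "open ?A"
        by (intro open_Int open_annulus open_INT open_Collect_less continuous_intros ballI finite)
      moreover have "(\<lambda>z. M t z / outf ?xs t z) holomorphic_on ?A"
      proof (intro holomorphic_intros)
        have "t \<in> polydisc R" using t R by (auto simp: polydisc_def intro: less_trans)
        then show "M t holomorphic_on ?A" using M unfolding pholo_def by (blast intro: holomorphic_on_subset)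
        show "outf ?xs t holomorphic_on ?A"
          using pholo_holo[OF pholo_outf[of "\<lambda>z. z" ?A ?xs UNIV], of t] by (auto intro!: holomorphic_intros)
        fix z :: complex assume z: "z \<in> ?A"
        show "outf ?xs t z \<noteq> 0" by (rule outf_nz[OF xs]) (use z in auto)
      qed
      ultimately have "CM (\<lambda>z. M t (of_real (1 / R) * z) / outf ?xs t (of_real (1 / R) * z)) = CM (\<lambda>z. M t z / outf ?xs t z)"
      proof (rule CM_dilate)
        show "complex_of_real (1 / R) \<noteq> 0" using R by auto
        fix z :: complex assume *: "min 1 (norm (complex_of_real (1 / R))) \<le> norm z" "norm z \<le> max 1 (norm (complex_of_real (1 / R)))"
        have "norm (complex_of_real (1 / R)) = 1 / R" "1 / R < 1" using R by (auto simp: norm_divide)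
        then have z: "1 / R \<le> norm z" "norm z \<le> 1" using * by auto
        moreover have "1 / \<rho> < 1 / R" using R by (intro divide_strict_left_mono) auto
        moreover have "norm (t $ a) * norm z < 1" for a
        proof -
          have "norm (t $ a) * norm z \<le> norm (t $ a) * 1" using z by (intro mult_left_mono) auto
          moreover have "norm (t $ a) < 1" using t by (auto simp: polydisc_def)
          ultimately show ?thesis by linarith
        qed
        ultimately show "z \<in> ?A" using R by (auto simp: annulus_def)
      qed
      then show "pairf ?xs [] t * CM (\<lambda>z. M t z / (outf ?xs t z * outf [] t (1 / z))) = CM (\<lambda>z. M t (of_real (1 / R) * z) / outf ?xs t (of_real (1 / R) * z))"
        by (simp add: pairf_Nil_right outf_def[of "[]"])
    qed (rule G)
  next
    case (Cons y ys)
    note M = Cons.prems(1) and ys = Cons.prems(2)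
    let ?\<beta> = "\<lambda>t. fst y * t $ snd y"
    let ?\<alpha> = "\<lambda>t. fst x * t $ snd x"
    have M': "pholo (\<lambda>t z. M t z * (?\<beta> t / z)) (polydisc R) (annulus \<rho>)"
      using R by (intro pholo_divide pholo_mult M pholo_z pholo_nth holomorphic_intros) (auto simp: annulus_def)
    \<comment> \<open>The term that has lost \<open>y\<close> falls under the inner induction. The
      term that has lost \<open>x\<close>, with a new numerator and the full list
      \<open>y # ys\<close>, falls under the outer one, which is general in \<open>ys\<close> and
      \<open>M\<close>.\<close>
    obtain G1 where G1: "holo_several G1 (polydisc R)"
        "\<And>t. t \<in> polydisc 1 \<Longrightarrow> pairf (x # xs) ys t * CM (\<lambda>z. M t z / (outf (x # xs) t z * outf ys t (1 / z))) = G1 t"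
      using Cons.IH[OF M] ys by auto
    obtain G2 where G2: "holo_several G2 (polydisc R)"
        "\<And>t. t \<in> polydisc 1 \<Longrightarrow> pairf xs (y # ys) t * CM (\<lambda>z. M t z * (?\<beta> t / z) / (outf xs t z * outf (y # ys) t (1 / z))) = G2 t"
      using IH[OF M', of "y # ys"] xs ys by auto
    \<comment> \<open>\<open>a1\<close> and \<open>a2\<close> are the factors which, besides the one
      for the pair of \<open>x\<close> and \<open>y\<close>, the full \<open>pairf\<close> has in
      excess of the two smaller problems.\<close>
    define a1 where "a1 = (\<lambda>t. \<Prod>x\<leftarrow>xs. 1 - fst x * t $ snd x * (fst y * t $ snd y))"
    define a2 where "a2 = (\<lambda>t. \<Prod>y\<leftarrow>ys. 1 - fst x * t $ snd x * (fst y * t $ snd y))"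
    show ?case
    proof (intro exI conjI ballI)
      show "holo_several (\<lambda>t. a1 t * G1 t + a2 t * G2 t) (polydisc R)"
        unfolding a1_def a2_def
        by (intro holo_several_add holo_several_mult holo_several_prod_list holo_several_linf G1 G2)
      fix t :: "complex ^ 'n" assume t: "t \<in> polydisc 1"
      have tR: "t \<in> polydisc R" using t R by (auto simp: polydisc_def intro: less_trans)
      have t1: "norm (t $ a) * norm z < 1" if "norm z = 1" for a and z :: complex using t that by (auto simp: polydisc_def)
      have n1: "outf zs t z \<noteq> 0" "outf zs t (1 / z) \<noteq> 0" if "\<And>x. x \<in> set zs \<Longrightarrow> norm (fst x) \<le> 1" "norm z = 1" for zs z
        using that(1) outf_nz[of zs t z] outf_nz[of zs t "1 / z"] t1[of z] t1[of "1 / z"] that(2) by (auto simp: norm_divide)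
      have cM: "continuous_on (sphere 0 1) (M t)"
      proof -
        have "M t holomorphic_on annulus \<rho>" using M tR unfolding pholo_def by blast
        then have "continuous_on (annulus \<rho>) (M t)" by (rule holomorphic_on_imp_continuous_on)
        then show ?thesis by (rule continuous_on_subset) (use R in \<open>auto simp: annulus_def\<close>)
      qed
      have co: "continuous_on (sphere 0 1) (outf zs t)" "continuous_on (sphere 0 1) (\<lambda>z. outf zs t (1 / z))" for zs
      proof -
        have h: "(\<lambda>z::complex. z) holomorphic_on sphere 0 1" "(\<lambda>z::complex. 1 / z) holomorphic_on sphere 0 1"
          by (auto intro!: holomorphic_intros)
        show "continuous_on (sphere 0 1) (outf zs t)" "continuous_on (sphere 0 1) (\<lambda>z. outf zs t (1 / z))"
          using pholo_holo[OF pholo_outf[OF h(1), of zs UNIV], of t] pholo_holo[OF pholo_outf[OF h(2), of zs UNIV], of t]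
          by (auto intro: holomorphic_on_imp_continuous_on)
      qed
      have nn: "outf (x # xs) t z \<noteq> 0" "outf xs t z \<noteq> 0" "outf (y # ys) t (1 / z) \<noteq> 0" "outf ys t (1 / z) \<noteq> 0"
        if "norm z = 1" for z
      proof -
        have zs: "norm (fst w) \<le> 1" if "w \<in> set xs" for w using xs[of w] that by simp
        have ws: "norm (fst w) \<le> 1" if "w \<in> set ys" for w using ys[of w] that by simp
        show "outf (x # xs) t z \<noteq> 0" "outf xs t z \<noteq> 0" "outf (y # ys) t (1 / z) \<noteq> 0" "outf ys t (1 / z) \<noteq> 0"
          by (rule n1(1)[OF xs that] n1(1)[OF zs that] n1(2)[OF ys that] n1(2)[OF ws that]; assumption)+
      qed
      have "pairf (x # xs) (y # ys) t = (1 - ?\<alpha> t * ?\<beta> t) * a2 t * a1 t * pairf xs ys t"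
        unfolding pairf_Cons pairf_Cons_right a1_def a2_def by simp
      moreover have "(1 - ?\<alpha> t * ?\<beta> t) * CM (\<lambda>z. M t z / (outf (x # xs) t z * outf (y # ys) t (1 / z)))
          = CM (\<lambda>z. M t z / (outf (x # xs) t z * outf ys t (1 / z))) + CM (\<lambda>z. M t z * (?\<beta> t / z) / (outf xs t z * outf (y # ys) t (1 / z)))"
        unfolding CM_cmult[symmetric]
      proof (subst CM_add[symmetric])
        show "CM (\<lambda>z. (1 - ?\<alpha> t * ?\<beta> t) * (M t z / (outf (x # xs) t z * outf (y # ys) t (1 / z))))
          = CM (\<lambda>z. M t z / (outf (x # xs) t z * outf ys t (1 / z)) + M t z * (?\<beta> t / z) / (outf xs t z * outf (y # ys) t (1 / z)))"
        proof (rule CM_cong)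
          fix z :: complex assume z: "norm z = 1"
          have nz: "z \<noteq> 0" "outf xs t z \<noteq> 0" "outf ys t (1 / z) \<noteq> 0" "1 - ?\<alpha> t * z \<noteq> 0" "1 - ?\<beta> t * (1 / z) \<noteq> 0"
            using z n1[of xs z] n1[of ys z] n1[of "[x]" z] n1[of "[y]" z] xs ys by (auto simp: outf_def)
          have o: "outf (x # xs) t z = (1 - ?\<alpha> t * z) * outf xs t z" "outf (y # ys) t (1 / z) = (1 - ?\<beta> t * (1 / z)) * outf ys t (1 / z)"
            by (auto simp: outf_def)
          define A where "A = 1 - ?\<alpha> t * z"
          define B where "B = 1 - ?\<beta> t * (1 / z)"
          have AB: "1 - ?\<alpha> t * ?\<beta> t = B + A * (?\<beta> t / z)" unfolding A_def B_def using nz(1) by (simp add: field_simps)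
          have "A \<noteq> 0" "B \<noteq> 0" using nz by (auto simp: A_def B_def)
          then show "(1 - ?\<alpha> t * ?\<beta> t) * (M t z / (outf (x # xs) t z * outf (y # ys) t (1 / z)))
            = M t z / (outf (x # xs) t z * outf ys t (1 / z)) + M t z * (?\<beta> t / z) / (outf xs t z * outf (y # ys) t (1 / z))"
            unfolding o A_def[symmetric] B_def[symmetric] AB using nz(2,3) by (simp add: add_divide_distrib distrib_right) (simp add: divide_simps mult_ac)?
        qed
        show "continuous_on (sphere 0 1) (\<lambda>z. M t z / (outf (x # xs) t z * outf ys t (1 / z)))"
          using nn by (intro continuous_intros cM co) auto
        show "continuous_on (sphere 0 1) (\<lambda>z. M t z * (?\<beta> t / z) / (outf xs t z * outf (y # ys) t (1 / z)))"
          using nn by (intro continuous_intros cM co) auto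
      qed
      ultimately have "pairf (x # xs) (y # ys) t * CM (\<lambda>z. M t z / (outf (x # xs) t z * outf (y # ys) t (1 / z)))
         = a2 t * a1 t * pairf xs ys t * (CM (\<lambda>z. M t z / (outf (x # xs) t z * outf ys t (1 / z))) + CM (\<lambda>z. M t z * (?\<beta> t / z) / (outf xs t z * outf (y # ys) t (1 / z))))"
        by (simp add: mult_ac)
      also have "\<dots> = a1 t * G1 t + a2 t * G2 t"
        unfolding G1(2)[OF t, symmetric] G2(2)[OF t, symmetric] pairf_Cons pairf_Cons_right a1_def a2_def
        by (simp only: distrib_left mult_ac)
      finally show "pairf (x # xs) (y # ys) t * CM (\<lambda>z. M t z / (outf (x # xs) t z * outf (y # ys) t (1 / z))) = a1 t * G1 t + a2 t * G2 t" .
    qed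
  qed
qed

section \<open>Analytic continuation of the rarefied elliptic hypergeometric function\<close>

text \<open>Zeros in the disc of radius \<open>\<rho>\<close> are split off as finitely many linear
  factors. The bound on \<open>c\<close> records that they lie outside the open unit disc, the form
  that \<open>CM_continuation\<close> asks for.\<close>

definition factorable :: "real \<Rightarrow> (complex \<Rightarrow> complex) \<Rightarrow> bool" where
  "factorable \<rho> e \<longleftrightarrow> (\<exists>cs T. (\<forall>c\<in>set cs. norm c \<le> 1) \<and> T holomorphic_on UNIV \<and> (\<forall>y. norm y < \<rho> \<longrightarrow> T y \<noteq> 0) \<and>
      (\<forall>y. e y = (\<Prod>c\<leftarrow>cs. 1 - c * y) * T y))"

lemma factorable_mult:
  assumes "factorable \<rho> e" "factorable \<rho> f" shows "factorable \<rho> (\<lambda>y. e y * f y)"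
proof -
  obtain cs T where 1: "\<forall>c\<in>set cs. norm c \<le> 1" "T holomorphic_on UNIV" "\<forall>y. norm y < \<rho> \<longrightarrow> T y \<noteq> 0"
      "\<forall>y. e y = (\<Prod>c\<leftarrow>cs. 1 - c * y) * T y" using assms(1) unfolding factorable_def by blast
  obtain ds S where 2: "\<forall>c\<in>set ds. norm c \<le> 1" "S holomorphic_on UNIV" "\<forall>y. norm y < \<rho> \<longrightarrow> S y \<noteq> 0"
      "\<forall>y. f y = (\<Prod>c\<leftarrow>ds. 1 - c * y) * S y" using assms(2) unfolding factorable_def by blast
  show ?thesis unfolding factorable_def
    by (rule exI[of _ "cs @ ds"], rule exI[of _ "\<lambda>y. T y * S y"])
       (use 1 2 in \<open>auto intro!: holomorphic_intros\<close>)
qed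

lemma factorable_nonzero:
  "e holomorphic_on UNIV \<Longrightarrow> (\<And>y. norm y < \<rho> \<Longrightarrow> e y \<noteq> 0) \<Longrightarrow> factorable \<rho> e"
  unfolding factorable_def by (rule exI[of _ "[]"], rule exI[of _ e]) auto

lemma factorable_linear: "norm c \<le> 1 \<Longrightarrow> factorable \<rho> (\<lambda>y. 1 - c * y)"
  unfolding factorable_def by (rule exI[of _ "[c]"], rule exI[of _ "\<lambda>_. 1"]) auto

text \<open>Factors are split off one at a time until the tail \<open>e J\<close>. In the
  applications \<open>J\<close> is so large that the tail has no zeros in the disc.\<close>

lemma factorable_down:
  assumes step: "\<And>j. factorable \<rho> (g j)" "\<And>j y. e j y = g j y * e (Suc j) y" and "factorable \<rho> (e J)"
  shows "factorable \<rho> (e 0)"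
proof -
  have "factorable \<rho> (e (J - k))" if "k \<le> J" for k
    using that
  proof (induction k)
    case (Suc k)
    then have "e (J - Suc k) = (\<lambda>y. g (J - Suc k) y * e (J - k) y)"
      using step(2)[of "J - Suc k"] by (auto simp: Suc_diff_Suc)
    then show ?case using Suc step(1) factorable_mult by simp
  qed (use assms in simp)
  from this[of J] show ?thesis by simp
qed

lemma pow_small:
  assumes "norm (q :: complex) < 1" shows "\<exists>J. norm q ^ J * \<rho> < 1"
proof -
  obtain J where "norm q ^ J < 1 / (\<bar>\<rho>\<bar> + 1)"
    using real_arch_pow_inv[of "1 / (\<bar>\<rho>\<bar> + 1)" "norm q"] assms by (auto simp: add_nonneg_pos)
  then have "norm q ^ J * (\<bar>\<rho>\<bar> + 1) < 1" by (simp add: pos_less_divide_eq add_nonneg_pos)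
  moreover have "norm q ^ J * \<rho> \<le> norm q ^ J * (\<bar>\<rho>\<bar> + 1)" by (intro mult_left_mono) auto
  ultimately show ?thesis by (intro exI[of _ J]) linarith
qed

lemma factorable_qpoch:
  assumes q: "norm q < 1" and c: "norm c \<le> 1"
  shows "factorable \<rho> (\<lambda>y. qpoch_inf (c * y) q)"
proof -
  obtain J where J: "norm q ^ J * \<rho> < 1" using pow_small[OF q] by blast
  have "factorable \<rho> ((\<lambda>j y. qpoch_inf (c * y * q ^ j) q) 0)"
  proof (rule factorable_down[where g = "\<lambda>j y. 1 - (c * q ^ j) * y" and J = J])
    fix j
    have "norm (c * q ^ j) \<le> 1" using q c by (simp add: norm_mult norm_power mult_le_one power_le_one)
    then show "factorable \<rho> (\<lambda>y. 1 - (c * q ^ j) * y)" by (rule factorable_linear)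
  next
    fix j y show "qpoch_inf (c * y * q ^ j) q = (1 - c * q ^ j * y) * qpoch_inf (c * y * q ^ Suc j) q"
      using qpoch_rec[OF q, of "c * y * q ^ j"] by (simp add: mult_ac)
  next
    show "factorable \<rho> (\<lambda>y. qpoch_inf (c * y * q ^ J) q)"
    proof (rule factorable_nonzero)
      show "(\<lambda>y. qpoch_inf (c * y * q ^ J) q) holomorphic_on UNIV"
        by (rule holomorphic_on_compose_gen[OF _ qpoch_holo[OF q, of UNIV], unfolded o_def]) (auto intro!: holomorphic_intros)
      fix y :: complex assume y: "norm y < \<rho>"
      have "norm (c * y * q ^ J) = norm c * (norm q ^ J * norm y)" by (simp add: norm_mult norm_power)
      also have "\<dots> \<le> 1 * (norm q ^ J * \<rho>)" using c y by (intro mult_mono) auto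
      finally have "norm (c * y * q ^ J) < 1" using J by simp
      then show "qpoch_inf (c * y * q ^ J) q \<noteq> 0" by (rule qpoch_nz[OF q])
    qed
  qed
  then show ?thesis by simp
qed

lemma factorable_dpoch:
  assumes p: "norm p < 1" and q: "norm q < 1" and c: "norm c \<le> 1"
  shows "factorable \<rho> (\<lambda>y. dpoch (c * y) p q)"
proof -
  obtain J where J: "norm p ^ J * \<rho> < 1" using pow_small[OF p] by blast
  have "factorable \<rho> ((\<lambda>j y. dpoch (c * y * p ^ j) p q) 0)"
  proof (rule factorable_down[where g = "\<lambda>j y. qpoch_inf ((c * p ^ j) * y) q" and J = J])
    fix j
    have "norm (c * p ^ j) \<le> 1" using p c by (simp add: norm_mult norm_power mult_le_one power_le_one)
    then show "factorable \<rho> (\<lambda>y. qpoch_inf ((c * p ^ j) * y) q)" by (rule factorable_qpoch[OF q])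
  next
    fix j y show "dpoch (c * y * p ^ j) p q = qpoch_inf (c * p ^ j * y) q * dpoch (c * y * p ^ Suc j) p q"
      using dpoch_rec1[OF p q, of "c * y * p ^ j"] by (simp add: mult_ac)
  next
    show "factorable \<rho> (\<lambda>y. dpoch (c * y * p ^ J) p q)"
    proof (rule factorable_nonzero)
      show "(\<lambda>y. dpoch (c * y * p ^ J) p q) holomorphic_on UNIV"
        by (rule holomorphic_on_compose_gen[OF _ dpoch_holo[OF p q, of UNIV], unfolded o_def]) (auto intro!: holomorphic_intros)
      fix y :: complex assume y: "norm y < \<rho>"
      have "norm (c * y * p ^ J) = norm c * (norm p ^ J * norm y)" by (simp add: norm_mult norm_power)
      also have "\<dots> \<le> 1 * (norm p ^ J * \<rho>)" using c y by (intro mult_mono) auto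
      finally have "norm (c * y * p ^ J) < 1" using J by simp
      then show "dpoch (c * y * p ^ J) p q \<noteq> 0" by (rule dpoch_nz[OF p q])
    qed
  qed
  then show ?thesis by simp
qed

text \<open>With a logarithm for \<open>R\<close>, this is the preimage of a polydisc under
  \<open>Exv\<close>; its convexity lets \<open>holo_identity\<close> act on an entire
  polydisc.\<close>

lemma exp_halfspace_convex:
  fixes R :: real
  shows "open {x :: complex ^ 'n. \<forall>a. Re (x $ a) < R}" "convex {x :: complex ^ 'n. \<forall>a. Re (x $ a) < R}"
proof -
  have eq: "{x :: complex ^ 'n. \<forall>a. Re (x $ a) < R} = (\<Inter>a. {x. Re (x $ a) < R})" by auto
  show "open {x :: complex ^ 'n. \<forall>a. Re (x $ a) < R}" unfolding eq
    by (intro open_INT open_Collect_less continuous_intros ballI finite)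
  show "convex {x :: complex ^ 'n. \<forall>a. Re (x $ a) < R}"
  proof (rule convexI, safe)
    fix x y :: "complex ^ 'n" and u v :: real and a
    assume *: "\<forall>a. Re (x $ a) < R" "\<forall>a. Re (y $ a) < R" "0 \<le> u" "0 \<le> v" "u + v = 1"
    then show "Re ((u *\<^sub>R x + v *\<^sub>R y) $ a) < R"
      using convex_bound_lt[of "Re (x $ a)" R "Re (y $ a)" u v] by simp
  qed
qed

section \<open>Poles of the integrand and continuation of the integral\<close>

context rarefied
begin

lemma rg_polar:
  "\<exists>B cs. B holomorphic_on {y. 0 < norm y \<and> norm y < \<rho>} \<and> (\<forall>c\<in>set cs. norm c \<le> 1) \<and>
     (\<forall>y. 0 < norm y \<longrightarrow> norm y < \<rho> \<longrightarrow> rg y m = B y / (\<Prod>c\<leftarrow>cs. 1 - c * y))"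
proof -
  obtain C k m0 where 1: "m0 \<le> r" "\<And>z. z \<noteq> 0 \<Longrightarrow> rg z m = C * z powi k * EE (r - m0) (p * q / z) / EE m0 z"
    using rg_canonical by metis
  have "factorable \<rho> (\<lambda>y. Dp ((p ^ m0) * y) * Dq ((q ^ (r - m0)) * y))"
    using p_lt q_lt by (intro factorable_mult factorable_dpoch pr_lt qr_lt pq_lt) (auto simp: norm_power power_le_one)
  then have "factorable \<rho> (EE m0)" unfolding EE_def[abs_def] by (simp add: mult.commute)
  then obtain cs T where 2: "\<forall>c\<in>set cs. norm c \<le> 1" "T holomorphic_on UNIV" "\<And>y. norm y < \<rho> \<Longrightarrow> T y \<noteq> 0"
      "\<And>y. EE m0 y = (\<Prod>c\<leftarrow>cs. 1 - c * y) * T y" unfolding factorable_def by blast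
  show ?thesis
  proof (rule exI[of _ "\<lambda>z. C * z powi k * EE (r - m0) (p * q / z) / T z"], rule exI[of _ cs], intro conjI allI impI)
    show "(\<lambda>z. C * z powi k * EE (r - m0) (p * q / z) / T z) holomorphic_on {y. 0 < norm y \<and> norm y < \<rho>}"
      by (intro holomorphic_intros holomorphic_on_compose_gen[OF _ EE_holo[of _ UNIV], unfolded o_def]
            holomorphic_on_subset[OF 2(2)]) (auto simp: 2(3))
    fix y :: complex assume "0 < norm y" "norm y < \<rho>"
    then show "rg y m = C * y powi k * EE (r - m0) (p * q / y) / T y / (\<Prod>c\<leftarrow>cs. 1 - c * y)"
      using 1(2)[of y] by (auto simp: 2(4) mult.commute)
  qed (use 2 in blast)
qed

text \<open>The closed form, taken from \<open>rg_recip\<close>, of the gamma factors in the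
  denominator of the integrand. It is manifestly holomorphic on the punctured plane.\<close>

definition RR :: "int \<Rightarrow> complex \<Rightarrow> complex" where
  "RR X w = - (1 / w) * exp (of_int X * (of_int X - 1) / 2 * LP + of_int X * (of_int X + 1) / 2 * LQ)
     * theta (w * p powi X) (p ^ r) * theta (w * q powi (- X)) (q ^ r)"

lemma RR_holo: "RR X holomorphic_on - {0}"
  unfolding RR_def[abs_def] using p_nz q_nz
  by (intro holomorphic_intros holomorphic_on_compose_gen[OF _ theta_holo[OF pr_lt, of "- {0}"], unfolded o_def]
       holomorphic_on_compose_gen[OF _ theta_holo[OF qr_lt, of "- {0}"], unfolded o_def]) auto

lemma rg_recip_RR: "norm w = 1 \<Longrightarrow> 1 / (rg w X * rg (1 / w) (- X)) = RR X w"
proof -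
  assume w: "norm w = 1"
  then have "w \<noteq> 0" by auto
  then have L: "- w = exp (Ln (- w))" by simp
  have "exp (- Ln (- w)) = - (1 / w)" using L by (simp add: exp_minus inverse_eq_divide)
  then show ?thesis unfolding rg_recip[OF w L] RR_def add.assoc exp_add[of "- Ln (- w)"] by simp
qed

lemma V_integrand_circle:
  assumes "norm z = 1"
  shows "V_integrand r p q \<epsilon> n t m z =
     (\<Prod>a\<in>UNIV. rg (t $ a * z) (n $ a + \<epsilon> + m) * rg (t $ a / z) (n $ a - m)) * RR (2 * m + \<epsilon>) (z\<^sup>2)"
proof -
  have z: "norm (z\<^sup>2) = 1" using assms by (simp add: norm_power)
  have "- 2 * m - \<epsilon> = - (2 * m + \<epsilon>)" by simp
  then show ?thesis
    unfolding V_integrand_def rg_recip_RR[OF z, symmetric] by (simp add: divide_inverse)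
qed

lemma V_integral_CM:
  "V_integral r p q \<epsilon> n t = qpoch_inf (p ^ r) (p ^ r) * qpoch_inf (q ^ r) (q ^ r) / (4 * of_real pi * \<i>)
     * (\<Sum>m<r. CM (\<lambda>z. (\<Prod>a\<in>UNIV. rg (t $ a * z) (n $ a + \<epsilon> + int m) * rg (t $ a / z) (n $ a - int m)) * RR (2 * int m + \<epsilon>) (z\<^sup>2)))"
proof -
  have "contour_integral (circlepath 0 1) (\<lambda>z. V_integrand r p q \<epsilon> n t (int m) z / z)
     = CM (\<lambda>z. (\<Prod>a\<in>UNIV. rg (t $ a * z) (n $ a + \<epsilon> + int m) * rg (t $ a / z) (n $ a - int m)) * RR (2 * int m + \<epsilon>) (z\<^sup>2))" for m
    unfolding CM_def[symmetric] by (rule CM_cong) (rule V_integrand_circle)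
  then show ?thesis unfolding V_integral_def by simp
qed

lemma outf_concat: "outf (concat xss) t z = (\<Prod>xs\<leftarrow>xss. outf xs t z)"
  by (induction xss) (auto simp: outf_def)

lemma outf_map_Pair: "outf (map (\<lambda>c. (c, a)) cs) t z = (\<Prod>c\<leftarrow>cs. 1 - c * (t $ a * z))"
  by (simp add: outf_def o_def mult.assoc)

lemma V_summand_extends:
  assumes R: "1 < R"
  shows "\<exists>G H. holo_several G (polydisc R) \<and> holo_several H UNIV \<and> (\<forall>t\<in>polydisc 1. H t \<noteq> 0 \<and>
      H t * CM (\<lambda>z. (\<Prod>a\<in>(UNIV::8 set). rg (t $ a * z) (n $ a + \<epsilon> + m) * rg (t $ a / z) (n $ a - m)) * RR (2 * m + \<epsilon>) (z\<^sup>2)) = G t)"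
proof -
  \<comment> \<open>With this annulus, \<open>t $ a * z\<close> and \<open>t $ a / z\<close> have
    norm below \<open>R * \<rho>\<close>, the radius up to which the poles of \<open>rg\<close> are
    split off.\<close>
  define \<rho> where "\<rho> = R + 1"
  have \<rho>: "R < \<rho>" "1 < \<rho>" using R by (auto simp: \<rho>_def)
  have "\<forall>k. \<exists>B cs. B holomorphic_on {y. 0 < norm y \<and> norm y < R * \<rho>} \<and> (\<forall>c\<in>set cs. norm c \<le> 1) \<and>
     (\<forall>y. 0 < norm y \<longrightarrow> norm y < R * \<rho> \<longrightarrow> rg y k = B y / (\<Prod>c\<leftarrow>cs. 1 - c * y))"
    using rg_polar by blast
  from this[THEN choice] obtain B where "\<forall>k. \<exists>cs. B k holomorphic_on {y. 0 < norm y \<and> norm y < R * \<rho>} \<and> (\<forall>c\<in>set cs. norm c \<le> 1) \<and>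
     (\<forall>y. 0 < norm y \<longrightarrow> norm y < R * \<rho> \<longrightarrow> rg y k = B k y / (\<Prod>c\<leftarrow>cs. 1 - c * y))" ..
  from this[THEN choice] obtain cs where "\<forall>k. B k holomorphic_on {y. 0 < norm y \<and> norm y < R * \<rho>} \<and> (\<forall>c\<in>set (cs k). norm c \<le> 1) \<and>
     (\<forall>y. 0 < norm y \<longrightarrow> norm y < R * \<rho> \<longrightarrow> rg y k = B k y / (\<Prod>c\<leftarrow>cs k. 1 - c * y))" ..
  then have B: "\<And>k. B k holomorphic_on {y. 0 < norm y \<and> norm y < R * \<rho>}"
     and cs: "\<And>k c. c \<in> set (cs k) \<Longrightarrow> norm c \<le> 1"
     and rgB: "\<And>k y. 0 < norm y \<Longrightarrow> norm y < R * \<rho> \<Longrightarrow> rg y k = B k y / (\<Prod>c\<leftarrow>cs k. 1 - c * y)"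
    by auto
  \<comment> \<open>A fixed enumeration of the index type, so that the poles of all eight parameters
    can be concatenated into lists.\<close>
  obtain al :: "8 list" where al: "set al = UNIV" "distinct al" using finite_distinct_list[OF finite] by metis
  define xs where "xs = concat (map (\<lambda>a. map (\<lambda>c. (c, a)) (cs (n $ a + \<epsilon> + m))) al)"
  define ys where "ys = concat (map (\<lambda>a. map (\<lambda>c. (c, a)) (cs (n $ a - m))) al)"
  define M where "M = (\<lambda>t z. (\<Prod>a\<in>UNIV. B (n $ a + \<epsilon> + m) (t $ a * z) * B (n $ a - m) (t $ a * (1 / z))) * RR (2 * m + \<epsilon>) (z\<^sup>2))"
  have oB: "open {y::complex. 0 < norm y \<and> norm y < R * \<rho>}"
    by (intro open_Collect_conj open_Collect_less continuous_intros)
  have M: "pholo M (polydisc R) (annulus \<rho>)"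
    unfolding M_def
  proof (intro pholo_mult pholo_prod)
    have z0: "z \<noteq> 0" if "z \<in> annulus \<rho>" for z using that \<rho> by (auto simp: annulus_def)
    then show "pholo (\<lambda>t z. RR (2 * m + \<epsilon>) (z\<^sup>2)) (polydisc R) (annulus \<rho>)"
      by (intro pholo_z holomorphic_on_compose_gen[OF _ RR_holo, unfolded o_def] holomorphic_intros) auto
    fix a :: 8
    show "pholo (\<lambda>t z. B (n $ a + \<epsilon> + m) (t $ a * z)) (polydisc R) (annulus \<rho>)"
    proof (rule pholo_comp[OF _ B oB])
      show "pholo (\<lambda>t z. t $ a * z) (polydisc R) (annulus \<rho>)"
        by (intro pholo_mult pholo_nth pholo_z holomorphic_intros)
      fix t :: "complex ^ 8" and z assume t: "t \<in> polydisc R" "z \<in> annulus \<rho>"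
      then show "t $ a * z \<in> {y. 0 < norm y \<and> norm y < R * \<rho>}"
        using z0[of z] R by (auto simp: polydisc_def annulus_def norm_mult intro!: mult_strict_mono)
    qed
    show "pholo (\<lambda>t z. B (n $ a - m) (t $ a * (1 / z))) (polydisc R) (annulus \<rho>)"
    proof (rule pholo_comp[OF _ B oB])
      show "pholo (\<lambda>t z. t $ a * (1 / z)) (polydisc R) (annulus \<rho>)"
        using z0 by (intro pholo_mult pholo_nth pholo_z holomorphic_intros) auto
      fix t :: "complex ^ 8" and z assume t: "t \<in> polydisc R" "z \<in> annulus \<rho>"
      have "0 < norm z" using z0 t by auto
      then have "norm (1 / z) < \<rho>" using t \<rho> by (simp add: annulus_def norm_divide field_simps)
      then have "norm (t $ a) * norm (1 / z) < R * \<rho>" using t \<rho> R by (intro mult_strict_mono) (auto simp: polydisc_def)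
      then show "t $ a * (1 / z) \<in> {y. 0 < norm y \<and> norm y < R * \<rho>}"
        using t z0[of z] by (auto simp: polydisc_def norm_mult norm_divide)
    qed
  qed auto
  have xs: "norm (fst x) \<le> 1" if "x \<in> set xs" for x using that cs by (auto simp: xs_def)
  have ys: "norm (fst x) \<le> 1" if "x \<in> set ys" for x using that cs by (auto simp: ys_def)
  obtain G where G: "holo_several G (polydisc R)"
      "\<And>t. t \<in> polydisc 1 \<Longrightarrow> pairf xs ys t * CM (\<lambda>z. M t z / (outf xs t z * outf ys t (1 / z))) = G t"
    using CM_continuation[OF R \<rho>(1) M xs ys] by blast
  show ?thesis
  proof (rule exI[of _ G], rule exI[of _ "pairf xs ys"], intro conjI ballI)
    fix t :: "complex ^ 8" assume t: "t \<in> polydisc 1"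
    have t1: "0 < norm (t $ a)" "norm (t $ a) < 1" for a using t by (auto simp: polydisc_def)
    show "pairf xs ys t \<noteq> 0"
    proof
      assume "pairf xs ys t = 0"
      then obtain x y where xy: "x \<in> set xs" "y \<in> set ys" "1 - fst x * t $ snd x * (fst y * t $ snd y) = 0"
        unfolding pairf_def by (auto simp: prod_list_zero_iff)
      have "norm (fst y * t $ snd y) \<le> 1 * norm (t $ snd y)" unfolding norm_mult using ys[OF xy(2)] by (intro mult_right_mono) auto
      then have "norm (t $ snd x) * norm (fst y * t $ snd y) < 1 * 1" using t1 by (intro mult_strict_mono) (auto intro: le_less_trans)
      then show False using linf_nz[OF xs[OF xy(1)], of t "snd x" "fst y * t $ snd y"] xy(3) by simp
    qed
    have "CM (\<lambda>z. M t z / (outf xs t z * outf ys t (1 / z))) =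
       CM (\<lambda>z. (\<Prod>a\<in>UNIV. rg (t $ a * z) (n $ a + \<epsilon> + m) * rg (t $ a / z) (n $ a - m)) * RR (2 * m + \<epsilon>) (z\<^sup>2))"
    proof (rule CM_cong)
      fix z :: complex assume z: "norm z = 1"
      have "1 * 1 < R * \<rho>" using R \<rho> by (intro mult_strict_mono) auto
      then have lt: "norm (t $ a) < R * \<rho>" for a using t1[of a] by linarith
      have o1: "outf xs t z = (\<Prod>a\<in>UNIV. \<Prod>c\<leftarrow>cs (n $ a + \<epsilon> + m). 1 - c * (t $ a * z))"
        unfolding xs_def outf_concat map_map o_def outf_map_Pair
        using prod.distinct_set_conv_list[OF al(2), of "\<lambda>a. \<Prod>c\<leftarrow>cs (n $ a + \<epsilon> + m). 1 - c * (t $ a * z)"] al(1) by simp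
      have o2: "outf ys t (1 / z) = (\<Prod>a\<in>UNIV. \<Prod>c\<leftarrow>cs (n $ a - m). 1 - c * (t $ a * (1 / z)))"
        unfolding ys_def outf_concat map_map o_def outf_map_Pair
        using prod.distinct_set_conv_list[OF al(2), of "\<lambda>a. \<Prod>c\<leftarrow>cs (n $ a - m). 1 - c * (t $ a * (1 / z))"] al(1) by simp
      have r1: "rg (t $ a * z) (n $ a + \<epsilon> + m) = B (n $ a + \<epsilon> + m) (t $ a * z) / (\<Prod>c\<leftarrow>cs (n $ a + \<epsilon> + m). 1 - c * (t $ a * z))" for a
        using t1 lt z by (intro rgB) (auto simp: norm_mult)
      have r2: "rg (t $ a / z) (n $ a - m) = B (n $ a - m) (t $ a * (1 / z)) / (\<Prod>c\<leftarrow>cs (n $ a - m). 1 - c * (t $ a * (1 / z)))" for a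
        using rgB[of "t $ a * (1 / z)" "n $ a - m"] t1[of a] lt[of a] z by (simp add: norm_mult norm_divide)
      show "M t z / (outf xs t z * outf ys t (1 / z)) =
        (\<Prod>a\<in>UNIV. rg (t $ a * z) (n $ a + \<epsilon> + m) * rg (t $ a / z) (n $ a - m)) * RR (2 * m + \<epsilon>) (z\<^sup>2)"
        unfolding M_def o1 o2 r1 r2 by (simp only: prod.distrib prod_dividef) (simp only: divide_inverse inverse_mult_distrib mult_ac)
    qed
    then show "pairf xs ys t * CM (\<lambda>z. (\<Prod>a\<in>UNIV. rg (t $ a * z) (n $ a + \<epsilon> + m) * rg (t $ a / z) (n $ a - m)) * RR (2 * m + \<epsilon>) (z\<^sup>2)) = G t"
      using G(2)[OF t] by simp
  qed (use G holo_several_pairf in auto)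
qed

lemma V_integral_extends:
  assumes R: "1 < R"
  shows "\<exists>G H. holo_several G (polydisc R) \<and> holo_several H UNIV \<and>
     (\<forall>t\<in>polydisc 1. H t \<noteq> 0 \<and> H t * V_integral r p q \<epsilon> n t = G t)"
proof -
  have "\<forall>m. \<exists>G H. holo_several G (polydisc R) \<and> holo_several H UNIV \<and> (\<forall>t\<in>polydisc 1. H t \<noteq> 0 \<and>
      H t * CM (\<lambda>z. (\<Prod>a\<in>(UNIV::8 set). rg (t $ a * z) (n $ a + \<epsilon> + int m) * rg (t $ a / z) (n $ a - int m)) * RR (2 * int m + \<epsilon>) (z\<^sup>2)) = G t)"
    using V_summand_extends[OF R] by blast
  from this[THEN choice] obtain G where "\<forall>m. \<exists>H. holo_several (G m) (polydisc R) \<and> holo_several H UNIV \<and> (\<forall>t\<in>polydisc 1. H t \<noteq> 0 \<and>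
      H t * CM (\<lambda>z. (\<Prod>a\<in>(UNIV::8 set). rg (t $ a * z) (n $ a + \<epsilon> + int m) * rg (t $ a / z) (n $ a - int m)) * RR (2 * int m + \<epsilon>) (z\<^sup>2)) = G m t)" ..
  from this[THEN choice] obtain H where "\<forall>m. holo_several (G m) (polydisc R) \<and> holo_several (H m) UNIV \<and> (\<forall>t\<in>polydisc 1. H m t \<noteq> 0 \<and>
      H m t * CM (\<lambda>z. (\<Prod>a\<in>(UNIV::8 set). rg (t $ a * z) (n $ a + \<epsilon> + int m) * rg (t $ a / z) (n $ a - int m)) * RR (2 * int m + \<epsilon>) (z\<^sup>2)) = G m t)" ..
  then have GH: "\<And>m. holo_several (G m) (polydisc R)" "\<And>m. holo_several (H m) UNIV"
     "\<And>m t. t \<in> polydisc 1 \<Longrightarrow> H m t \<noteq> 0"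
     "\<And>m t. t \<in> polydisc 1 \<Longrightarrow> H m t * CM (\<lambda>z. (\<Prod>a\<in>(UNIV::8 set). rg (t $ a * z) (n $ a + \<epsilon> + int m) * rg (t $ a / z) (n $ a - int m)) * RR (2 * int m + \<epsilon>) (z\<^sup>2)) = G m t"
    by blast+
  define c where "c = qpoch_inf (p ^ r) (p ^ r) * qpoch_inf (q ^ r) (q ^ r) / (4 * of_real pi * \<i>)"
  show ?thesis
  \<comment> \<open>The summands come with different denominators \<open>H m\<close>; the product of
    all of them serves for the sum.\<close>
  proof (rule exI[of _ "\<lambda>t. c * (\<Sum>m<r. G m t * (\<Prod>k\<in>{..<r} - {m}. H k t))"], rule exI[of _ "\<lambda>t. \<Prod>k<r. H k t"], intro conjI ballI)
    show "holo_several (\<lambda>t. c * (\<Sum>m<r. G m t * (\<Prod>k\<in>{..<r} - {m}. H k t))) (polydisc R)"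
      using GH(1,2) holo_several_subset[OF GH(2)]
      by (intro holo_several_mult holo_several_sum holo_several_prod holo_several_const) auto
    show "holo_several (\<lambda>t. \<Prod>k<r. H k t) UNIV" using GH(2) by (intro holo_several_prod) auto
    fix t :: "complex ^ 8" assume t: "t \<in> polydisc 1"
    show "(\<Prod>k<r. H k t) \<noteq> 0" using GH(3)[OF t] by simp
    have "(\<Prod>k<r. H k t) * CM (\<lambda>z. (\<Prod>a\<in>(UNIV::8 set). rg (t $ a * z) (n $ a + \<epsilon> + int m) * rg (t $ a / z) (n $ a - int m)) * RR (2 * int m + \<epsilon>) (z\<^sup>2))
        = G m t * (\<Prod>k\<in>{..<r} - {m}. H k t)" if "m < r" for m
      using GH(4)[OF t, of m] prod.remove[of "{..<r}" m "\<lambda>k. H k t"] that by (simp add: mult_ac)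
    then show "(\<Prod>k<r. H k t) * V_integral r p q \<epsilon> n t = c * (\<Sum>m<r. G m t * (\<Prod>k\<in>{..<r} - {m}. H k t))"
      unfolding V_integral_CM c_def[symmetric] by (simp add: sum_distrib_left mult.left_commute)
  qed
qed

section \<open>The continuation on the hypersurface\<close>

definition Lb where "Lb = 2 * (LP + LQ)"

lemma exp_Lb: "exp Lb = (p * q)\<^sup>2"
  unfolding Lb_def exp_double by (simp add: exp_add exp_LP exp_LQ)

lemma balanced_surf: "balanced p q = surf (exp Lb)"
  by (simp add: balanced_def surf_def exp_Lb)

lemma balanced_nz: "t \<in> balanced p q \<Longrightarrow> t $ a \<noteq> 0"
  using pq_nz by (auto simp: balanced_def) (metis UNIV_I finite power_eq_0_iff prod_zero_iff mult_eq_0_iff)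

text \<open>On the polydisc of radius \<open>k + 2\<close> the continuation is the quotient of
  \<open>G k\<close> by \<open>H k\<close>. These quotients agree by the identity theorem, as each
  equals the integral on the unit polydisc, and they are glued by taking the least admissible
  \<open>k\<close>.\<close>

lemma V_continuation_exists: "\<exists>W. V_continuation r p q \<epsilon> n W"
proof -
  let ?S = "balanced p q"
  define D where "D = (\<lambda>k::nat. polydisc (real k + 2) :: (complex ^ 8) set)"
  have "\<forall>k. \<exists>G H. holo_several G (D k) \<and> holo_several H UNIV \<and>
     (\<forall>t\<in>polydisc 1. H t \<noteq> 0 \<and> H t * V_integral r p q \<epsilon> n t = G t)"
    unfolding D_def by (intro allI V_integral_extends) auto
  from this[THEN choice] obtain G where "\<forall>k. \<exists>H. holo_several (G k) (D k) \<and> holo_several H UNIV \<and>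
     (\<forall>t\<in>polydisc 1. H t \<noteq> 0 \<and> H t * V_integral r p q \<epsilon> n t = G k t)" ..
  from this[THEN choice] obtain H where "\<forall>k. holo_several (G k) (D k) \<and> holo_several (H k) UNIV \<and>
     (\<forall>t\<in>polydisc 1. H k t \<noteq> 0 \<and> H k t * V_integral r p q \<epsilon> n t = G k t)" ..
  then have GH: "\<And>k. holo_several (G k) (D k)" "\<And>k. holo_several (H k) UNIV"
     "\<And>k t. t \<in> polydisc 1 \<Longrightarrow> H k t \<noteq> 0"
     "\<And>k t. t \<in> polydisc 1 \<Longrightarrow> H k t * V_integral r p q \<epsilon> n t = G k t"
    by blast+
  have pm: "polydisc a \<subseteq> (polydisc b :: (complex ^ 8) set)" if "a \<le> b" for a b
    using that by (auto simp: polydisc_def intro: less_le_trans)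
  have Dmono: "D j \<subseteq> D k" if "j \<le> k" for j k unfolding D_def using that by (intro pm) simp
  have oD: "open (D k)" for k unfolding D_def by (rule open_polydisc)
  \<comment> \<open>The point with eight equal logarithms. As \<open>Re Lb < 0\<close>, its image
    lies in the unit polydisc and can serve as base point for the identity theorem.\<close>
  define x0 :: "complex ^ 8" where "x0 = (\<chi> a. Lb / 8)"
  have x0h: "x0 \<in> hyp Lb" by (simp add: hyp_def x0_def)
  have ReLb: "Re Lb < 0"
  proof -
    have "norm ((p * q)\<^sup>2) < 1" using pq_lt by (simp add: norm_power power_less_one_iff)
    then have "exp (Re Lb) < exp 0" unfolding exp_Lb[symmetric] by simp
    then show ?thesis by simp
  qed
  have x01: "Exv x0 \<in> polydisc 1" using ReLb by (simp add: polydisc_def x0_def)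
  have one: "polydisc 1 \<subseteq> D k" for k unfolding D_def by (intro pm) simp
  define C where "C = (\<lambda>k::nat. {x :: complex ^ 8. \<forall>a. Re (x $ a) < ln (real k + 2)})"
  have C: "open (C k)" "convex (C k)" for k unfolding C_def by (rule exp_halfspace_convex)+
  have CD: "x \<in> C k \<longleftrightarrow> Exv x \<in> D k" for x k
  proof -
    have "Re y < ln (real k + 2) \<longleftrightarrow> exp (Re y) < real k + 2" for y :: complex
      by (metis add_nonneg_pos exp_less_cancel_iff exp_ln of_nat_0_le_iff zero_less_numeral)
    then show ?thesis by (simp add: C_def D_def polydisc_def)
  qed
  have ident: "f t = 0" if f: "holo_several f (D k)" and z: "\<And>s. s \<in> polydisc 1 \<inter> ?S \<Longrightarrow> f s = 0" and t: "t \<in> ?S \<inter> D k" for f k t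
  proof -
    obtain x where x: "x \<in> hyp Lb" "Exv x = t" using Exv_onto[of t Lb] t balanced_surf by auto
    have "f (Exv x) = 0"
    proof (rule holo_identity[OF C(1,2)[of k] f _ oD _ open_polydisc[of 1] x01])
      show "x0 \<in> C k \<inter> hyp Lb" using x0h x01 one CD by blast
      show "x \<in> C k \<inter> hyp Lb" using x t CD by auto
      show "Exv x \<in> D k" if "x \<in> C k \<inter> hyp Lb" for x using that CD by auto
      show "f s = 0" if "s \<in> surf (exp Lb) \<inter> polydisc 1" for s using that z balanced_surf by auto
    qed
    then show ?thesis using x by simp
  qed
  define K where "K = (\<lambda>t. LEAST k. t \<in> D k)"
  \<comment> \<open>The integral itself is used on the unit polydisc, because
    \<open>V_continuation\<close> prescribes the values there exactly and not just
    generically.\<close>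
  define W where "W = (\<lambda>t. if t \<in> polydisc 1 then V_integral r p q \<epsilon> n t else G (K t) t / H (K t) t)"
  have ex: "\<exists>k. t \<in> D k" if "t \<in> ?S" for t
  proof -
    obtain k :: nat where "Max (range (\<lambda>a. norm (t $ a))) < real k" using reals_Archimedean2 by blast
    then have lt: "norm (t $ a) < real k" for a by (simp add: Max_less_iff)
    have "norm (t $ a) < real k + 2" for a using lt[of a] by linarith
    then show ?thesis using balanced_nz[OF that] by (intro exI[of _ k]) (simp add: D_def polydisc_def)
  qed
  have GHk: "G j s * H k s = G k s * H j s" if "s \<in> ?S" "s \<in> D j" "j \<le> k" for j k s
  proof -
    have "G j s * H k s - G k s * H j s = 0"
    proof (rule ident[where k = j])
      show "holo_several (\<lambda>s. G j s * H k s - G k s * H j s) (D j)"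
        using GH(1,2) Dmono[OF that(3)] holo_several_subset
        by (intro holo_several_diff holo_several_mult) blast+
      fix s assume "s \<in> polydisc 1 \<inter> ?S"
      then show "G j s * H k s - G k s * H j s = 0"
        using GH(4)[of s j] GH(4)[of s k] by (simp add: mult_ac flip: GH(4))
    qed (use that in auto)
    then show ?thesis by simp
  qed
  have "mero_several W ?S"
  proof (rule mero_severalI)
    fix t assume t: "t \<in> ?S"
    then obtain k where k: "t \<in> D k" using ex by blast
    show "\<exists>U g h. open U \<and> t \<in> U \<and> holo_several g U \<and> holo_several h U \<and>
        ?S \<inter> U \<subseteq> closure {s \<in> ?S \<inter> U. h s \<noteq> 0} \<and> (\<forall>s\<in>?S \<inter> U. h s \<noteq> 0 \<longrightarrow> W s = g s / h s)"
    proof (intro exI conjI)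
      \<comment> \<open>At points of \<open>D k\<close> the value of \<open>W\<close> may come from
        any index up to \<open>k\<close>, so all these denominators enter.\<close>
      let ?h = "\<lambda>s. \<Prod>j\<le>k. H j s"
      let ?g = "\<lambda>s. G k s * (\<Prod>j<k. H j s)"
      show "open (D k)" "t \<in> D k" using oD k by auto
      show "holo_several ?g (D k)" using GH(1,2) holo_several_subset
        by (intro holo_several_mult holo_several_prod) blast+
      show hh: "holo_several ?h (D k)" using GH(2) holo_several_subset by (intro holo_several_prod) blast+
      show "?S \<inter> D k \<subseteq> closure {s \<in> ?S \<inter> D k. ?h s \<noteq> 0}"
        unfolding dense_iff
      proof (intro ballI allI impI)
        fix s N assume s: "s \<in> ?S \<inter> D k" "open N" "s \<in> N"
        show "\<exists>s'\<in>?S \<inter> D k \<inter> N. ?h s' \<noteq> 0"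
        proof (rule ccontr)
          assume "\<not> (\<exists>s'\<in>?S \<inter> D k \<inter> N. ?h s' \<noteq> 0)"
          then have z: "?h s' = 0" if "s' \<in> surf (exp Lb) \<inter> (N \<inter> D k)" for s' using that balanced_surf by blast
          obtain x where x: "x \<in> hyp Lb" "Exv x = s" using Exv_onto[of s Lb] s balanced_surf by auto
          have "?h (Exv x0) = 0"
          proof (rule holo_identity[OF C(1,2)[of k] hh _ oD, where N = "N \<inter> D k"])
            show "x \<in> C k \<inter> hyp Lb" using x s CD by auto
            show "x0 \<in> C k \<inter> hyp Lb" using x0h x01 one CD by blast
            show "Exv x \<in> D k" if "x \<in> C k \<inter> hyp Lb" for x using that CD by auto
            show "open (N \<inter> D k)" "Exv x \<in> N \<inter> D k" using s oD x by auto
          qed (rule z)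
          then show False using GH(3)[OF x01] by simp
        qed
      qed
      show "\<forall>s\<in>?S \<inter> D k. ?h s \<noteq> 0 \<longrightarrow> W s = ?g s / ?h s"
      proof (intro ballI impI)
        fix s assume s: "s \<in> ?S \<inter> D k" "?h s \<noteq> 0"
        have Hn: "H j s \<noteq> 0" if "j \<le> k" for j using s(2) that by auto
        have "?h s = (\<Prod>j<k. H j s) * H k s" by (simp add: lessThan_Suc_atMost[symmetric])
        moreover have "(\<Prod>j<k. H j s) \<noteq> 0" using Hn by auto
        ultimately have gh: "?g s / ?h s = G k s / H k s" by simp
        show "W s = ?g s / ?h s"
        proof (cases "s \<in> polydisc 1")
          case True
          then show ?thesis unfolding gh using GH(4)[OF True, of k] Hn[of k] by (simp add: W_def eq_divide_eq mult.commute)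
        next
          case False
          have Kk: "K s \<le> k" "s \<in> D (K s)" using s unfolding K_def by (auto intro: Least_le LeastI)
          then have "G (K s) s / H (K s) s = G k s / H k s"
            using GHk[of s "K s" k] s Hn[of k] Hn[of "K s"] by (simp add: frac_eq_eq mult.commute)
          then show ?thesis unfolding gh using False by (simp add: W_def)
        qed
      qed
    qed
  qed
  moreover have "W t = V_integral r p q \<epsilon> n t" if "t \<in> ?S" "\<forall>a. norm (t $ a) < 1" for t
    using that balanced_nz by (simp add: W_def polydisc_def)
  ultimately show ?thesis unfolding V_continuation_def by blast
qed

lemma V_fun_props:
  "mero_several (V_fun r p q \<epsilon> n) (balanced p q)"
  "t \<in> balanced p q \<Longrightarrow> (\<And>a. norm (t $ a) < 1) \<Longrightarrow> V_fun r p q \<epsilon> n t = V_integral r p q \<epsilon> n t"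
proof -
  have "V_continuation r p q \<epsilon> n (V_fun r p q \<epsilon> n)"
    unfolding V_fun_def by (rule someI_ex[OF V_continuation_exists])
  then show "mero_several (V_fun r p q \<epsilon> n) (balanced p q)"
    "t \<in> balanced p q \<Longrightarrow> (\<And>a. norm (t $ a) < 1) \<Longrightarrow> V_fun r p q \<epsilon> n t = V_integral r p q \<epsilon> n t"
    unfolding V_continuation_def by blast+
qed

end

section \<open>The contour integral identity\<close>

text \<open>By periodicity the sum runs over residues modulo \<open>r\<close>, and
  \<open>m \<mapsto> c - m\<close> is an involution of these.\<close>

lemma sum_mod_shift:
  fixes f :: "int \<Rightarrow> complex"
  assumes r: "r > 0" and per: "\<And>m. f (m + int r) = f m"
  shows "(\<Sum>m<r. f (c - int m)) = (\<Sum>m<r. f (int m))"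
proof -
  have perk: "f (m + k * int r) = f m" for m k
  proof (induction k rule: int_induct[where k = 0])
    case (step1 i)
    then show ?case using per[of "m + i * int r"] by (simp add: algebra_simps)
  next
    case (step2 i)
    then show ?case using per[of "m + (i - 1) * int r"] by (simp add: algebra_simps)
  qed simp
  have fm: "f (m mod int r) = f m" for m
    using perk[of "m mod int r" "m div int r"] by (metis add.commute div_mult_mod_eq)
  let ?i = "\<lambda>m. nat ((c - int m) mod int r)"
  have i: "?i (?i m) = m" "?i m < r" if "m < r" for m
  proof -
    have "(c - (c - int m) mod int r) mod int r = int m mod int r" by (simp add: mod_diff_right_eq)
    then show "?i (?i m) = m" "?i m < r" using that r by (auto simp: nat_less_iff)
  qed
  show ?thesis
  proof (rule sum.reindex_bij_witness[where i = ?i and j = ?i])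
    fix m assume "m \<in> {..<r}"
    then show "f (int (?i m)) = f (c - int m)" using r fm[of "c - int m"] by simp
  qed (use i in auto)
qed

lemma sum_8_linear:
  fixes A B C :: complex and x y :: "8 \<Rightarrow> complex"
  shows "(\<Sum>a\<in>UNIV. A + B * x a + C * y a) = 8 * A + B * (\<Sum>a\<in>UNIV. x a) + C * (\<Sum>a\<in>UNIV. y a)"
  by (simp add: sum.distrib sum_distrib_left)

text \<open>In the exponents below the nonlinear terms cancel. What is affine in
  \<open>\<nu> $ a\<close> and \<open>l $ a\<close> depends, after summation over \<open>a\<close>,
  only on the two balancing conditions.\<close>

lemma sum_8_affine:
  fixes F :: "complex \<Rightarrow> complex \<Rightarrow> complex" and x y :: "8 \<Rightarrow> complex"
  assumes "\<And>x y. F x y = F 0 0 + (F 1 0 - F 0 0) * x + (F 0 1 - F 0 0) * y"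
  shows "(\<Sum>a\<in>UNIV. F (x a) (y a)) = 8 * F 0 0 + (F 1 0 - F 0 0) * (\<Sum>a\<in>UNIV. x a) + (F 0 1 - F 0 0) * (\<Sum>a\<in>UNIV. y a)"
  by (subst assms) (simp add: sum.distrib sum_distrib_left)

section \<open>The integrand in theta variables\<close>

context rarefied
begin

definition pairg :: "complex \<Rightarrow> int \<Rightarrow> int \<Rightarrow> int \<Rightarrow> complex \<Rightarrow> complex" where
  "pairg t n \<epsilon> m z = rg (t * z) (n + \<epsilon> + m) * rg (t / z) (n - m)"

definition integrand :: "int \<Rightarrow> int ^ 8 \<Rightarrow> complex ^ 8 \<Rightarrow> int \<Rightarrow> complex \<Rightarrow> complex" where
  "integrand \<epsilon> n t m z = (\<Prod>a\<in>UNIV. pairg (t $ a) (n $ a) \<epsilon> m z) * RR (2 * m + \<epsilon>) (z\<^sup>2)"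

definition Vint :: "int \<Rightarrow> int ^ 8 \<Rightarrow> complex ^ 8 \<Rightarrow> complex" where
  "Vint \<epsilon> n t = (\<Sum>m<r. CM (integrand \<epsilon> n t (int m)))"

lemma V_integral_Vint:
  "V_integral r p q \<epsilon> n t = qpoch_inf (p ^ r) (p ^ r) * qpoch_inf (q ^ r) (q ^ r) / (4 * of_real pi * \<i>) * Vint \<epsilon> n t"
  unfolding V_integral_CM Vint_def integrand_def[abs_def] pairg_def ..

text \<open>
  \<open>tau \<epsilon> m z\<close> is \<open>z / q\<^bsup>m + \<epsilon>/2\<^esup>\<close>; in these variables the shift factors of
  \<open>pairg\<close> are theta functions of base \<open>q\<^sup>r\<close> depending only on \<open>tau \<epsilon> n t\<close> and \<open>tau \<epsilon> m z\<close>.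
\<close>

definition tau :: "int \<Rightarrow> int \<Rightarrow> complex \<Rightarrow> complex" where
  "tau \<epsilon> n t = t * exp (- (of_int n + of_int \<epsilon> / 2) * LQ)"

text \<open>The monomial of \<open>pairg_shift\<close> splits into \<open>kap\<close>, which depends
  only on the parameter, and \<open>YY\<close>, which depends only on the summation and integration
  variables. So \<open>kap\<close> can be taken out of the integral, while \<open>YY\<close> is
  common to all terms of a relation.\<close>

definition kap :: "int \<Rightarrow> int \<Rightarrow> complex \<Rightarrow> complex" where
  "kap \<epsilon> n t = (- t) powi (- (2 * n + \<epsilon>)) * exp (of_int (2 * n + \<epsilon>) ^ 2 / 4 * LQ + of_int (2 * n + \<epsilon>) / 2 * LQ)"

definition YY :: "int \<Rightarrow> int \<Rightarrow> complex \<Rightarrow> complex" where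
  "YY \<epsilon> m z = z powi (- (2 * m + \<epsilon>)) * exp (of_int (2 * m + \<epsilon>) ^ 2 / 4 * LQ)"

lemma tau_nz: "t \<noteq> 0 \<Longrightarrow> tau \<epsilon> n t \<noteq> 0" by (simp add: tau_def)
lemma kap_nz: "t \<noteq> 0 \<Longrightarrow> kap \<epsilon> n t \<noteq> 0" by (simp add: kap_def)
lemma YY_nz: "z \<noteq> 0 \<Longrightarrow> YY \<epsilon> m z \<noteq> 0" by (simp add: YY_def)

lemma kap_exp: "- t = exp l \<Longrightarrow> kap \<epsilon> n t = exp (- of_int (2 * n + \<epsilon>) * l + of_int (2 * n + \<epsilon>) ^ 2 / 4 * LQ + of_int (2 * n + \<epsilon>) / 2 * LQ)"
  unfolding kap_def by (simp only: exp_power_int of_int_minus exp_add[symmetric] add.assoc)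

lemma YY_exp: "z = exp \<zeta> \<Longrightarrow> YY \<epsilon> m z = exp (- of_int (2 * m + \<epsilon>) * \<zeta> + of_int (2 * m + \<epsilon>) ^ 2 / 4 * LQ)"
  unfolding YY_def by (simp only: exp_power_int of_int_minus exp_add[symmetric])

lemma tau_mult: "tau \<epsilon> n t * tau \<epsilon> m z = t * z * q powi (- (n + \<epsilon> + m))"
proof -
  have "exp (- (of_int n + of_int \<epsilon> / 2) * LQ) * exp (- (of_int m + of_int \<epsilon> / 2) * LQ) = exp (of_int (- (n + \<epsilon> + m)) * LQ)"
    unfolding exp_add[symmetric] by (rule arg_cong[where f = exp]) (simp add: field_simps)
  then show ?thesis unfolding tau_def powi_q by (simp add: mult_ac)
qed

lemma tau_div: "tau \<epsilon> n t / tau \<epsilon> m z = t / z * q powi (- (n - m))"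
proof -
  have "exp (- (of_int n + of_int \<epsilon> / 2) * LQ) / exp (- (of_int m + of_int \<epsilon> / 2) * LQ) = exp (of_int (- (n - m)) * LQ)"
    unfolding exp_diff[symmetric] by (rule arg_cong[where f = exp]) (simp add: field_simps)
  then show ?thesis unfolding tau_def powi_q by (simp add: field_simps)
qed

text \<open>The theta functions from the two members of a pair combine to \<open>th2\<close>, since
  their arguments are the product and the quotient of the \<open>tau\<close> variables.\<close>

lemma pairg_shift:
  assumes t: "t \<noteq> 0" and z: "z \<noteq> 0" and lt: "norm (t * z) < 1" "norm (t / z) < 1"
  shows "pairg (p * t) (n - 1) \<epsilon> m z = kap \<epsilon> n t * YY \<epsilon> m z * th2 (q ^ r) (tau \<epsilon> n t) (tau \<epsilon> m z) * pairg t n \<epsilon> m z"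
proof -
  define l where "l = Ln (- t)"
  define \<zeta> where "\<zeta> = Ln z"
  have l: "- t = exp l" and \<zeta>: "z = exp \<zeta>" using t z by (auto simp: l_def \<zeta>_def)
  let ?N = "n + \<epsilon> + m" and ?M = "n - m"
  have 1: "rg (p * (t * z)) (?N - 1) = exp (- of_int ?N * (l + \<zeta>) + of_int ?N * (of_int ?N + 1) / 2 * LQ)
      * theta (t * z * q powi (- ?N)) (q ^ r) * rg (t * z) ?N"
    by (rule rg_shift) (use lt t z in \<open>auto simp: exp_add l[symmetric] \<zeta>[symmetric]\<close>)
  have 2: "rg (p * (t / z)) (?M - 1) = exp (- of_int ?M * (l - \<zeta>) + of_int ?M * (of_int ?M + 1) / 2 * LQ)
      * theta (t / z * q powi (- ?M)) (q ^ r) * rg (t / z) ?M"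
    by (rule rg_shift) (use lt t z in \<open>auto simp: exp_diff l[symmetric] \<zeta>[symmetric]\<close>)
  have e1: "n - 1 + \<epsilon> + m = ?N - 1" and e2: "n - 1 - m = ?M - 1" by auto
  have "exp (- of_int ?N * (l + \<zeta>) + of_int ?N * (of_int ?N + 1) / 2 * LQ) * exp (- of_int ?M * (l - \<zeta>) + of_int ?M * (of_int ?M + 1) / 2 * LQ)
    = kap \<epsilon> n t * YY \<epsilon> m z"
    unfolding kap_exp[OF l] YY_exp[OF \<zeta>] exp_add[symmetric]
    by (rule arg_cong[where f = exp]) (simp add: field_simps power2_eq_square)
  then show ?thesis
    unfolding pairg_def e1 e2 th2_def tau_mult tau_div mult.assoc[of p] times_divide_eq_right[of p, symmetric] 1 2
    by (simp add: mult_ac)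
qed

lemma integrand_cont:
  assumes "\<And>a. 0 < norm (t $ a)" "\<And>a. norm (t $ a) < 1"
  shows "continuous_on (sphere 0 1) (integrand \<epsilon>' n t m)"
proof -
  have "(\<lambda>z. rg (t $ a * z) k) holomorphic_on sphere 0 1" "(\<lambda>z. rg (t $ a / z) k) holomorphic_on sphere 0 1" for a k
    using assms[of a] by (auto intro!: holomorphic_on_compose_gen[OF _ rg_holo, unfolded o_def] holomorphic_intros simp: norm_mult norm_divide)
  moreover have "(\<lambda>z. RR (2 * m + \<epsilon>') (z\<^sup>2)) holomorphic_on sphere 0 1"
    by (intro holomorphic_on_compose_gen[OF _ RR_holo, unfolded o_def] holomorphic_intros) auto
  ultimately show ?thesis unfolding integrand_def[abs_def] pairg_def
    by (intro holomorphic_on_imp_continuous_on holomorphic_intros) auto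
qed

end

text \<open>Dividing \<open>t $ 1\<close> and \<open>t $ 2\<close> by \<open>p\<close> and raising
  \<open>n $ 1\<close> and \<open>n $ 2\<close> by 1 turns the balancing conditions into product
  \<open>q\<^sup>2\<close> and sum 2. The logarithms are chosen to add up to \<open>2 * LQ\<close>
  exactly, so that no multiple of \<open>2 * pi * \<i>\<close> disturbs the exponents.\<close>

locale rarefied_shifted = rarefied +
  fixes u l :: "complex ^ 8" and \<nu> :: "int ^ 8" and \<epsilon> :: int
  assumes u: "\<And>a. u $ a = exp (l $ a)" and u_lt: "\<And>a. norm (u $ a) < 1"
    and l_sum: "(\<Sum>a\<in>UNIV. l $ a) = 2 * LQ" and nu_sum: "(\<Sum>a\<in>UNIV. \<nu> $ a) + 4 * \<epsilon> = 2"
begin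

lemma u_nz: "u $ a \<noteq> 0" by (simp add: u)

lemma nu_sum': "(\<Sum>a\<in>UNIV. complex_of_int (\<nu> $ a)) = 2 - 4 * of_int \<epsilon>"
proof -
  have "(\<Sum>a\<in>UNIV. \<nu> $ a) = 2 - 4 * \<epsilon>" using nu_sum by simp
  then have "complex_of_int (\<Sum>a\<in>UNIV. \<nu> $ a) = of_int (2 - 4 * \<epsilon>)" by simp
  then show ?thesis by simp
qed

text \<open>The sum over \<open>a\<close> cancels the exponents that \<open>rg_shift\<close>
  produces when the factors of \<open>hh\<close> are compared with \<open>pairg\<close>. The other
  terms are the exponents of \<open>RR (2 * m + \<epsilon>)\<close>, of
  \<open>(YY \<epsilon> m z)\<^sup>2\<close> and of \<open>tau \<epsilon> m z powi (-3)\<close>, the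
  weights that occur in \<open>hh_combination\<close> and \<open>theta_eight\<close>.\<close>

definition mu :: "int \<Rightarrow> complex" where
  "mu m = (\<Sum>a\<in>UNIV. of_int (\<nu> $ a + \<epsilon> + m) * l $ a - of_int (\<nu> $ a + \<epsilon> + m) * (of_int (\<nu> $ a + \<epsilon> + m) + 1) / 2 * LQ)
     + of_int (2 * m + \<epsilon>) * (of_int (2 * m + \<epsilon>) - 1) / 2 * LP + of_int (2 * m + \<epsilon>) * (of_int (2 * m + \<epsilon>) + 1) / 2 * LQ
     + of_int (2 * m + \<epsilon>) ^ 2 / 2 * LQ + 3 * of_int (2 * m + \<epsilon>) / 2 * LQ"

text \<open>
  Since \<open>hh\<close> is \<open>r\<close>-periodic in \<open>m\<close>, holomorphic for \<open>1 \<le> \<bar>z\<bar> \<le> 1 / \<bar>p\<bar>\<close> and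
  changes sign under \<open>m \<mapsto> 1 - m - \<epsilon>\<close>, \<open>z \<mapsto> 1 / (p z)\<close>, its circle integrals
  sum to \<open>0\<close> over \<open>m\<close>. The factor \<open>exp (mu m)\<close> is what makes both symmetries hold.
\<close>

definition hh :: "int \<Rightarrow> complex \<Rightarrow> complex" where
  "hh m z = (\<Prod>a\<in>UNIV. rg (p * u $ a * z) (\<nu> $ a + \<epsilon> + m - 1) * rg (u $ a / z) (\<nu> $ a - m))
     * theta (z\<^sup>2 * p powi (2 * m + \<epsilon>)) (p ^ r) * exp (mu m) * z powi (2 * (2 * m + \<epsilon>) - 3)"

text \<open>Each gamma factor changes by the exponential of a form that is quadratic in
  \<open>\<nu> $ a\<close> and \<open>l $ a\<close>, but within a pair the quadratic terms cancel
  (\<open>EE\<close>). The affine rest is summed by the balancing conditions and compensated by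
  theta, the power of \<open>z\<close> and \<open>mu\<close>.\<close>

lemma hh_periodic:
  assumes z: "z \<noteq> 0"
  shows "hh (m + int r) z = hh m z"
proof -
  define \<zeta> where "\<zeta> = Ln z"
  have \<zeta>: "z = exp \<zeta>" using z by (simp add: \<zeta>_def)
  define e where "e = complex_of_int \<epsilon>"
  define k where "k = complex_of_int m"
  define \<rho> where "\<rho> = complex_of_nat r"
  define X where "X = 2 * k + e"
  define s where "s = X + \<rho> - 1"
  define c where "c = (\<rho> - 1) / 2"
  define d where "d = \<rho> * (\<rho> - 2) / 3"
  define E where "E = (\<lambda>L k. c * ((2 * k + \<rho>) * L + (k * (k - 1) + k * \<rho> + d) * LP - (k * (k + 1) + (k + 1) * \<rho> + d) * LQ))"
  have qp: "rg y (k + int r) = exp (E L (of_int k)) * rg y k" if "- y = exp L" for y k L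
  proof -
    have "E L (of_int k) = (of_nat r - 1) * (2 * of_int k + of_nat r) / 2 * L
       + (of_nat r - 1) / 2 * (of_int k * (of_int k - 1) + of_int k * of_nat r + of_nat r * (of_nat r - 2) / 3) * LP
       - (of_nat r - 1) / 2 * (of_int k * (of_int k + 1) + (of_int k + 1) * of_nat r + of_nat r * (of_nat r - 2) / 3) * LQ"
      unfolding E_def c_def d_def \<rho>_def by (simp add: field_simps)
    then show ?thesis using rg_quasi_exp[OF that, of k] by (simp only:)
  qed
  \<comment> \<open>A logarithm of -1, needed because \<open>rg_quasi_exp\<close> refers to the
    logarithm of \<open>- y\<close>. Its total contribution turns out to be a multiple of
    \<open>2 * pi * \<i>\<close>.\<close>
  define I where "I = of_real pi * \<i>"
  have eI: "exp I = -1" by (simp add: I_def mult.commute)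
  define A where "A = c * (2 * s * I + (2 * e - 2) * \<zeta> + (e + X - 2 + \<rho>) * LP + s * (e - 2) * LP - s * e * LQ)"
  define B where "B = c * (4 * \<zeta> + 2 * LP + 2 * s * LP - 2 * s * LQ)"
  define C where "C = c * (2 * s)"
  have EE: "E (LP + l + \<zeta> + I) (n + e + k - 1) - E (l - \<zeta> + I) (n - k - \<rho>) = A + B * n + C * l" for n l
  proof -
    have "E (LP + l + \<zeta> + I) (n + e + k - 1) - E (l - \<zeta> + I) (n - k - \<rho>)
      = c * (((2 * (n + e + k - 1) + \<rho>) * (LP + l + \<zeta> + I) + ((n + e + k - 1) * (n + e + k - 1 - 1) + (n + e + k - 1) * \<rho> + d) * LP - ((n + e + k - 1) * (n + e + k - 1 + 1) + (n + e + k - 1 + 1) * \<rho> + d) * LQ)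
        - ((2 * (n - k - \<rho>) + \<rho>) * (l - \<zeta> + I) + ((n - k - \<rho>) * (n - k - \<rho> - 1) + (n - k - \<rho>) * \<rho> + d) * LP - ((n - k - \<rho>) * (n - k - \<rho> + 1) + (n - k - \<rho> + 1) * \<rho> + d) * LQ))"
      unfolding E_def by (simp only: right_diff_distrib)
    also have "\<dots> = c * ((2 * s * I + (2 * e - 2) * \<zeta> + (e + X - 2 + \<rho>) * LP + s * (e - 2) * LP - s * e * LQ) + (4 * \<zeta> + 2 * LP + 2 * s * LP - 2 * s * LQ) * n + 2 * s * l)"
      unfolding s_def X_def by (rule arg_cong[where f = "\<lambda>x. c * x"]) (simp add: algebra_simps)
    also have "\<dots> = A + B * n + C * l" unfolding A_def B_def C_def by (simp only: distrib_left mult.assoc)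
    finally show ?thesis .
  qed
  have 1: "rg (p * u $ a * z) (\<nu> $ a + \<epsilon> + (m + int r) - 1) = exp (E (LP + l $ a + \<zeta> + I) (of_int (\<nu> $ a) + e + k - 1)) * rg (p * u $ a * z) (\<nu> $ a + \<epsilon> + m - 1)" for a
  proof -
    have "- (p * u $ a * z) = exp (LP + l $ a + \<zeta> + I)" by (simp add: exp_add eI exp_LP u \<zeta>)
    from qp[OF this, of "\<nu> $ a + \<epsilon> + m - 1"] show ?thesis by (simp add: algebra_simps e_def k_def)
  qed
  have 2: "rg (u $ a / z) (\<nu> $ a - (m + int r)) = exp (- E (l $ a - \<zeta> + I) (of_int (\<nu> $ a) - k - \<rho>)) * rg (u $ a / z) (\<nu> $ a - m)" for a
  proof -
    have "- (u $ a / z) = exp (l $ a - \<zeta> + I)" by (simp add: exp_add exp_diff eI u \<zeta>)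
    from qp[OF this, of "\<nu> $ a - (m + int r)"]
    have "rg (u $ a / z) (\<nu> $ a - m) = exp (E (l $ a - \<zeta> + I) (of_int (\<nu> $ a) - k - \<rho>)) * rg (u $ a / z) (\<nu> $ a - (m + int r))"
      by (simp add: k_def \<rho>_def diff_diff_eq)
    then show ?thesis by (simp add: exp_minus)
  qed
  have nuS: "(\<Sum>a\<in>UNIV. complex_of_int (\<nu> $ a)) = 2 - 4 * e" using nu_sum' by (simp add: e_def)
  have pr: "(\<Prod>a\<in>UNIV. rg (p * u $ a * z) (\<nu> $ a + \<epsilon> + (m + int r) - 1) * rg (u $ a / z) (\<nu> $ a - (m + int r)))
     = exp (8 * A + B * (2 - 4 * e) + C * (2 * LQ)) * (\<Prod>a\<in>UNIV. rg (p * u $ a * z) (\<nu> $ a + \<epsilon> + m - 1) * rg (u $ a / z) (\<nu> $ a - m))"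
  proof -
    have "rg (p * u $ a * z) (\<nu> $ a + \<epsilon> + (m + int r) - 1) * rg (u $ a / z) (\<nu> $ a - (m + int r))
      = exp (A + B * of_int (\<nu> $ a) + C * l $ a) * (rg (p * u $ a * z) (\<nu> $ a + \<epsilon> + m - 1) * rg (u $ a / z) (\<nu> $ a - m))" for a
    proof -
      have "exp (A + B * of_int (\<nu> $ a) + C * l $ a) = exp (E (LP + l $ a + \<zeta> + I) (of_int (\<nu> $ a) + e + k - 1)) * exp (- E (l $ a - \<zeta> + I) (of_int (\<nu> $ a) - k - \<rho>))"
        unfolding exp_add[symmetric] EE[symmetric] by (rule arg_cong[where f = exp]) simp
      then show ?thesis unfolding 1 2 by (simp only: mult_ac)
    qed
    then have "(\<Prod>a\<in>UNIV. rg (p * u $ a * z) (\<nu> $ a + \<epsilon> + (m + int r) - 1) * rg (u $ a / z) (\<nu> $ a - (m + int r)))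
      = exp (\<Sum>a\<in>UNIV. A + B * of_int (\<nu> $ a) + C * l $ a) * (\<Prod>a\<in>UNIV. rg (p * u $ a * z) (\<nu> $ a + \<epsilon> + m - 1) * rg (u $ a / z) (\<nu> $ a - m))"
      by (simp only: exp_sum[OF finite] prod.distrib)
    then show ?thesis unfolding sum_8_linear nuS l_sum .
  qed
  have th: "theta (z\<^sup>2 * p powi (2 * (m + int r) + \<epsilon>)) (p ^ r) = exp (- 4 * \<zeta> - 2 * X * LP - \<rho> * LP) * theta (z\<^sup>2 * p powi (2 * m + \<epsilon>)) (p ^ r)"
  proof -
    have y: "z\<^sup>2 * p powi (2 * m + \<epsilon>) = exp (2 * \<zeta> + X * LP)"
      unfolding powi_p \<zeta> exp_double[symmetric] exp_add[symmetric] by (simp add: X_def e_def k_def)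
    have pr2: "(p ^ r) powi j = exp (of_int j * \<rho> * LP)" for j
      unfolding pow_p exp_power_int \<rho>_def by (simp add: mult.assoc)
    \<comment> \<open>Two periods of theta, since \<open>m\<close> enters with the factor 2.\<close>
    have "z\<^sup>2 * p powi (2 * (m + int r) + \<epsilon>) = (z\<^sup>2 * p powi (2 * m + \<epsilon>)) * (p ^ r) powi 2"
      unfolding y pr2 unfolding powi_p \<zeta> exp_double[symmetric] exp_add[symmetric]
      by (rule arg_cong[where f = exp]) (simp add: X_def e_def k_def \<rho>_def algebra_simps)
    moreover have "(- (z\<^sup>2 * p powi (2 * m + \<epsilon>))) powi (- 2) * (p ^ r) powi (- (2 * (2 - 1) div 2)) = exp (- 4 * \<zeta> - 2 * X * LP - \<rho> * LP)"
    proof -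
      have "(- (z\<^sup>2 * p powi (2 * m + \<epsilon>))) powi (- 2) = (z\<^sup>2 * p powi (2 * m + \<epsilon>)) powi (- 2)" by (simp add: power_int_minus)
      then show ?thesis unfolding y pr2
        by (simp only: exp_power_int exp_add[symmetric]) (rule arg_cong[where f = exp], simp add: algebra_simps)
    qed
    ultimately show ?thesis using theta_shift_powi[OF pr_lt pr_nz, of "z\<^sup>2 * p powi (2 * m + \<epsilon>)" 2] unfolding y by simp
  qed
  have zp: "z powi (2 * (2 * (m + int r) + \<epsilon>) - 3) = exp (4 * \<rho> * \<zeta>) * z powi (2 * (2 * m + \<epsilon>) - 3)"
    unfolding \<zeta> exp_power_int exp_add[symmetric] \<rho>_def by (rule arg_cong[where f = exp]) (simp add: algebra_simps)
  define A' where "A' = - (\<rho> * (e + X + \<rho> + 1) / 2) * LQ"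
  define B' where "B' = - \<rho> * LQ"
  have T: "of_int (\<nu> $ a + \<epsilon> + (m + int r)) * l $ a - of_int (\<nu> $ a + \<epsilon> + (m + int r)) * (of_int (\<nu> $ a + \<epsilon> + (m + int r)) + 1) / 2 * LQ
    = (of_int (\<nu> $ a + \<epsilon> + m) * l $ a - of_int (\<nu> $ a + \<epsilon> + m) * (of_int (\<nu> $ a + \<epsilon> + m) + 1) / 2 * LQ)
      + (A' + B' * of_int (\<nu> $ a) + \<rho> * l $ a)" for a
    unfolding A'_def B'_def X_def e_def k_def \<rho>_def by (simp add: field_simps)
  have mu: "mu (m + int r) = mu m + (8 * A' + B' * (2 - 4 * e) + \<rho> * (2 * LQ))
     + (2 * \<rho>) * (2 * X + 2 * \<rho> - 1) / 2 * LP + (2 * \<rho>) * (2 * X + 2 * \<rho> + 1) / 2 * LQ + (2 * \<rho>) * (2 * X + 2 * \<rho>) / 2 * LQ + 3 * \<rho> * LQ"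
  proof -
    define S where "S = (\<Sum>a\<in>UNIV. of_int (\<nu> $ a + \<epsilon> + m) * l $ a - of_int (\<nu> $ a + \<epsilon> + m) * (of_int (\<nu> $ a + \<epsilon> + m) + 1) / 2 * LQ)"
    have S': "(\<Sum>a\<in>UNIV. of_int (\<nu> $ a + \<epsilon> + (m + int r)) * l $ a - of_int (\<nu> $ a + \<epsilon> + (m + int r)) * (of_int (\<nu> $ a + \<epsilon> + (m + int r)) + 1) / 2 * LQ)
      = S + (8 * A' + B' * (2 - 4 * e) + \<rho> * (2 * LQ))"
      unfolding T sum.distrib[of _ "\<lambda>a. A' + B' * of_int (\<nu> $ a) + \<rho> * l $ a"] sum_8_linear nuS l_sum S_def ..
    have X1: "complex_of_int (2 * m + \<epsilon>) = X" "complex_of_int (2 * (m + int r) + \<epsilon>) = X + 2 * \<rho>"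
      by (simp_all add: X_def e_def k_def \<rho>_def)
    show ?thesis unfolding mu_def S' S_def[symmetric] X1
      by (simp add: field_simps power2_eq_square)
  qed
  have "exp (8 * A + B * (2 - 4 * e) + C * (2 * LQ)) * exp (- 4 * \<zeta> - 2 * X * LP - \<rho> * LP) * exp (mu (m + int r)) * exp (4 * \<rho> * \<zeta>)
    = exp (mu m) * exp (of_int (2 * (4 * (int r - 1) * (2 * m + \<epsilon> - 1 + int r))) * I)"
    unfolding mu exp_add[symmetric]
  proof (rule arg_cong[where f = exp])
    have i: "of_int (2 * (4 * (int r - 1) * (2 * m + \<epsilon> - 1 + int r))) * I = 8 * (\<rho> - 1) * s * I"
      by (simp add: s_def X_def e_def k_def \<rho>_def algebra_simps)
    show "8 * A + B * (2 - 4 * e) + C * (2 * LQ) + (- 4 * \<zeta> - 2 * X * LP - \<rho> * LP)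
       + (mu m + (8 * A' + B' * (2 - 4 * e) + \<rho> * (2 * LQ)) + (2 * \<rho>) * (2 * X + 2 * \<rho> - 1) / 2 * LP + (2 * \<rho>) * (2 * X + 2 * \<rho> + 1) / 2 * LQ + (2 * \<rho>) * (2 * X + 2 * \<rho>) / 2 * LQ + 3 * \<rho> * LQ)
       + 4 * \<rho> * \<zeta> = mu m + of_int (2 * (4 * (int r - 1) * (2 * m + \<epsilon> - 1 + int r))) * I"
      unfolding i A_def B_def C_def A'_def B'_def c_def s_def by (simp add: field_simps)
  qed
  also have "exp (of_int (2 * (4 * (int r - 1) * (2 * m + \<epsilon> - 1 + int r))) * I) = 1"
    unfolding exp_power_int[symmetric] eI by (simp add: power_int_mult)
  finally show ?thesis unfolding hh_def pr th zp by (simp add: mult_ac)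
qed

text \<open>The substitution swaps the two gamma factors of every pair, so their product is
  unchanged. The sign comes from \<open>theta_recip\<close>, and \<open>mu\<close> absorbs the
  monomials.\<close>

lemma hh_antisym:
  assumes z: "z \<noteq> 0"
  shows "hh (1 - m - \<epsilon>) (1 / (p * z)) = - hh m z"
proof -
  define \<zeta> where "\<zeta> = Ln z"
  have \<zeta>: "z = exp \<zeta>" using z by (simp add: \<zeta>_def)
  define X where "X = 2 * complex_of_int m + of_int \<epsilon>"
  let ?y = "z\<^sup>2 * p powi (2 * m + \<epsilon>)"
  have y: "?y \<noteq> 0" "?y = exp (2 * \<zeta> + X * LP)"
    using z p_nz unfolding powi_p \<zeta> exp_double[symmetric] exp_add[symmetric] by (auto simp: X_def)
  have pr: "rg (p * u $ a * (1 / (p * z))) (\<nu> $ a + \<epsilon> + (1 - m - \<epsilon>) - 1) * rg (u $ a / (1 / (p * z))) (\<nu> $ a - (1 - m - \<epsilon>))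
     = rg (p * u $ a * z) (\<nu> $ a + \<epsilon> + m - 1) * rg (u $ a / z) (\<nu> $ a - m)" for a
  proof -
    have "p * u $ a * (1 / (p * z)) = u $ a / z" "u $ a / (1 / (p * z)) = p * u $ a * z"
      "\<nu> $ a + \<epsilon> + (1 - m - \<epsilon>) - 1 = \<nu> $ a - m" "\<nu> $ a - (1 - m - \<epsilon>) = \<nu> $ a + \<epsilon> + m - 1"
      using p_nz by auto
    then show ?thesis by (simp only: mult.commute)
  qed
  have "(1 / (p * z))\<^sup>2 * p powi (2 * (1 - m - \<epsilon>) + \<epsilon>) = 1 / ?y"
  proof -
    have "p powi (2 * (1 - m - \<epsilon>) + \<epsilon>) = p\<^sup>2 / p powi (2 * m + \<epsilon>)"
      using p_nz power_int_diff[of p 2 "2 * m + \<epsilon>"] by (simp add: algebra_simps)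
    then show ?thesis using p_nz z by (simp add: field_simps power2_eq_square)
  qed
  then have th: "theta ((1 / (p * z))\<^sup>2 * p powi (2 * (1 - m - \<epsilon>) + \<epsilon>)) (p ^ r) = - (theta ?y (p ^ r) * exp (- 2 * \<zeta> - X * LP))"
    using theta_recip[OF pr_lt pr_nz y(1)] unfolding y(2) by (simp add: exp_minus[symmetric] divide_inverse)
  have zp: "(1 / (p * z)) powi (2 * (2 * (1 - m - \<epsilon>) + \<epsilon>) - 3) = exp ((2 * X - 1) * (LP + \<zeta>))"
  proof -
    have "1 / (p * z) = exp (- (LP + \<zeta>))" unfolding exp_minus exp_add exp_LP \<zeta>[symmetric] by (simp add: inverse_eq_divide)
    then show ?thesis by (simp only: exp_power_int) (rule arg_cong[where f = exp], simp add: X_def algebra_simps)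
  qed
  have zp': "z powi (2 * (2 * m + \<epsilon>) - 3) = exp ((2 * X - 3) * \<zeta>)"
    unfolding \<zeta> exp_power_int by (rule arg_cong[where f = exp]) (simp add: X_def algebra_simps)
  \<comment> \<open>The change of one summand of \<open>mu\<close> under
    \<open>m \<mapsto> 1 - m - \<epsilon>\<close>; its quadratic terms cancel.\<close>
  define F where "F = (\<lambda>n l. ((n + 1 - of_int m) * l - (n + 1 - of_int m) * (n + 1 - of_int m + 1) / 2 * LQ)
     - ((n + of_int \<epsilon> + of_int m) * l - (n + of_int \<epsilon> + of_int m) * (n + of_int \<epsilon> + of_int m + 1) / 2 * LQ))"
  have aff: "F n l = F 0 0 + (F 1 0 - F 0 0) * n + (F 0 1 - F 0 0) * l" for n l
    unfolding F_def by (simp add: field_simps)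
  have sumF: "(\<Sum>a\<in>UNIV. F (of_int (\<nu> $ a)) (l $ a)) = 8 * F 0 0 + (F 1 0 - F 0 0) * (2 - 4 * of_int \<epsilon>) + (F 0 1 - F 0 0) * (2 * LQ)"
    using sum_8_affine[of F "\<lambda>a. of_int (\<nu> $ a)" "\<lambda>a. l $ a", OF aff] unfolding nu_sum' l_sum .
  have "mu (1 - m - \<epsilon>) - mu m = (\<Sum>a\<in>UNIV. F (of_int (\<nu> $ a)) (l $ a))
      + ((2 - X) * (1 - X) - X * (X - 1)) / 2 * LP + ((2 - X) * (3 - X) - X * (X + 1)) / 2 * LQ + ((2 - X)^2 - X^2) / 2 * LQ + 3 * (2 - 2 * X) / 2 * LQ"
    unfolding mu_def F_def X_def by (simp add: sum_subtractf) (simp add: field_simps power2_eq_square)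
  then have "mu (1 - m - \<epsilon>) - mu m = (8 * F 0 0 + (F 1 0 - F 0 0) * (2 - 4 * of_int \<epsilon>) + (F 0 1 - F 0 0) * (2 * LQ))
      + ((2 - X) * (1 - X) - X * (X - 1)) / 2 * LP + ((2 - X) * (3 - X) - X * (X + 1)) / 2 * LQ + ((2 - X)^2 - X^2) / 2 * LQ + 3 * (2 - 2 * X) / 2 * LQ"
    unfolding sumF .
  also have "\<dots> = - (X - 1) * LP"
    unfolding F_def X_def by (simp add: field_simps power2_eq_square)
  finally have "mu (1 - m - \<epsilon>) - mu m = - (X - 1) * LP" .
  then have mu: "mu (1 - m - \<epsilon>) = mu m - (X - 1) * LP" by (simp add: algebra_simps)
  have "exp (- 2 * \<zeta> - X * LP) * exp (mu (1 - m - \<epsilon>)) * exp ((2 * X - 1) * (LP + \<zeta>)) = exp (mu m) * exp ((2 * X - 3) * \<zeta>)"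
    unfolding mu exp_add[symmetric] by (rule arg_cong[where f = exp]) (simp add: algebra_simps)
  then show ?thesis unfolding hh_def pr th zp zp' by (simp add: mult_ac)
qed

abbreviation "tv a \<equiv> tau \<epsilon> (\<nu> $ a) (u $ a)"
abbreviation "PP m z \<equiv> (\<Prod>a\<in>UNIV. pairg (u $ a) (\<nu> $ a) \<epsilon> m z)"

text \<open>On the circle \<open>rg_shift\<close> turns the factors at \<open>p * u $ a * z\<close>
  into those of \<open>pairg\<close>, and this produces the eight theta functions to which
  \<open>theta_eight\<close> applies.\<close>

lemma hh_circle:
  assumes z: "norm z = 1"
  shows "hh m z = ((\<Prod>a\<in>UNIV. theta (tv a * tau \<epsilon> m z) (q ^ r)) * PP m z) * theta (z\<^sup>2 * p powi (2 * m + \<epsilon>)) (p ^ r)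
     * exp (of_int (2 * m + \<epsilon>) * (of_int (2 * m + \<epsilon>) - 1) / 2 * LP + (of_int (2 * m + \<epsilon>) ^ 2 + 2 * of_int (2 * m + \<epsilon>)) * LQ)
     * z powi (- (2 * (2 * m + \<epsilon>) + 5))"
proof -
  have z0: "z \<noteq> 0" using z by auto
  define \<zeta> where "\<zeta> = Ln z"
  have \<zeta>: "z = exp \<zeta>" using z0 by (simp add: \<zeta>_def)
  define X where "X = 2 * complex_of_int m + of_int \<epsilon>"
  define I where "I = of_real pi * \<i>"
  have eI: "exp I = -1" by (simp add: I_def mult.commute)
  have 1: "rg (p * u $ a * z) (\<nu> $ a + \<epsilon> + m - 1) = exp (- of_int (\<nu> $ a + \<epsilon> + m) * (l $ a + \<zeta> + I) + of_int (\<nu> $ a + \<epsilon> + m) * (of_int (\<nu> $ a + \<epsilon> + m) + 1) / 2 * LQ)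
      * theta (tv a * tau \<epsilon> m z) (q ^ r) * rg (u $ a * z) (\<nu> $ a + \<epsilon> + m)" for a
  proof -
    have "- (u $ a * z) = exp (l $ a + \<zeta> + I)" by (simp add: exp_add eI u \<zeta>)
    from rg_shift[OF _ _ this, of "\<nu> $ a + \<epsilon> + m"] show ?thesis
      unfolding tau_mult using u_lt[of a] u_nz[of a] z z0 by (simp add: norm_mult mult.assoc)
  qed
  define Sg where "Sg = (\<Sum>a\<in>UNIV. - of_int (\<nu> $ a + \<epsilon> + m) * (l $ a + \<zeta> + I) + of_int (\<nu> $ a + \<epsilon> + m) * (of_int (\<nu> $ a + \<epsilon> + m) + 1) / 2 * LQ)"
  have pr: "(\<Prod>a\<in>UNIV. rg (p * u $ a * z) (\<nu> $ a + \<epsilon> + m - 1) * rg (u $ a / z) (\<nu> $ a - m))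
     = exp Sg
       * ((\<Prod>a\<in>UNIV. theta (tv a * tau \<epsilon> m z) (q ^ r)) * PP m z)"
    unfolding 1 pairg_def Sg_def exp_sum[OF finite] prod.distrib by (simp only: mult_ac)
  have sm: "Sg + mu m
     = - (2 + 4 * X) * (\<zeta> + I) + X * (X - 1) / 2 * LP + (X ^ 2 + 2 * X) * LQ"
  proof -
    have "(\<Sum>a\<in>UNIV. of_int (\<nu> $ a + \<epsilon> + m) * (\<zeta> + I)) = ((\<Sum>a\<in>UNIV. complex_of_int (\<nu> $ a)) + 8 * (of_int \<epsilon> + of_int m)) * (\<zeta> + I)"
      by (simp add: sum_distrib_right[symmetric] sum.distrib)
    then have s: "(\<Sum>a\<in>UNIV. of_int (\<nu> $ a + \<epsilon> + m) * (\<zeta> + I)) = (2 + 4 * X) * (\<zeta> + I)"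
      unfolding nu_sum' by (simp add: X_def algebra_simps)
    define S where "S = (\<Sum>a\<in>UNIV. of_int (\<nu> $ a + \<epsilon> + m) * l $ a - of_int (\<nu> $ a + \<epsilon> + m) * (of_int (\<nu> $ a + \<epsilon> + m) + 1) / 2 * LQ)"
    have S: "Sg
        = - S - (\<Sum>a\<in>UNIV. of_int (\<nu> $ a + \<epsilon> + m) * (\<zeta> + I))"
      unfolding Sg_def S_def sum_negf[symmetric] sum_subtractf[symmetric] by (rule sum.cong) (auto simp: algebra_simps)
    have mm: "mu m = S + X * (X - 1) / 2 * LP + X * (X + 1) / 2 * LQ + X ^ 2 / 2 * LQ + 3 * X / 2 * LQ"
      unfolding mu_def S_def X_def by simp
    show ?thesis unfolding S s mm by (simp add: field_simps power2_eq_square)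
  qed
  have z1: "z powi (2 * (2 * m + \<epsilon>) - 3) = exp ((2 * X - 3) * \<zeta>)"
    unfolding \<zeta> exp_power_int by (rule arg_cong[where f = exp]) (simp add: X_def algebra_simps)
  have z2: "z powi (- (2 * (2 * m + \<epsilon>) + 5)) = exp (- (2 * X + 5) * \<zeta>)"
    unfolding \<zeta> exp_power_int by (rule arg_cong[where f = exp]) (simp add: X_def algebra_simps)
  have ee: "exp (- (2 + 4 * X) * (\<zeta> + I) + X * (X - 1) / 2 * LP + (X ^ 2 + 2 * X) * LQ) * exp ((2 * X - 3) * \<zeta>)
     = exp (X * (X - 1) / 2 * LP + (X ^ 2 + 2 * X) * LQ) * exp (- (2 * X + 5) * \<zeta>)"
  proof -
    have "exp (- (2 + 4 * X) * I) = (exp I) powi (2 * (- (1 + 2 * (2 * m + \<epsilon>))))"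
      unfolding exp_power_int by (rule arg_cong[where f = exp]) (simp add: X_def algebra_simps)
    also have "\<dots> = 1" unfolding eI by (simp add: power_int_mult)
    finally have "exp (- (2 + 4 * X) * I) = 1" .
    then have "exp (- (2 + 4 * X) * (\<zeta> + I) + X * (X - 1) / 2 * LP + (X ^ 2 + 2 * X) * LQ) * exp ((2 * X - 3) * \<zeta>)
      = exp (- (2 + 4 * X) * \<zeta> + X * (X - 1) / 2 * LP + (X ^ 2 + 2 * X) * LQ) * exp ((2 * X - 3) * \<zeta>) * exp (- (2 + 4 * X) * I)"
      unfolding exp_add[symmetric] by (intro arg_cong[where f = exp]) (simp add: algebra_simps)
    also have "\<dots> = exp (X * (X - 1) / 2 * LP + (X ^ 2 + 2 * X) * LQ) * exp (- (2 * X + 5) * \<zeta>)"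
      unfolding \<open>exp (- (2 + 4 * X) * I) = 1\<close> mult_1_right exp_add[symmetric] by (intro arg_cong[where f = exp]) (simp add: algebra_simps)
    finally show ?thesis .
  qed
  have X1: "complex_of_int (2 * m + \<epsilon>) = X" by (simp add: X_def)
  let ?R = "(\<Prod>a\<in>UNIV. theta (tv a * tau \<epsilon> m z) (q ^ r)) * PP m z"
  have "hh m z = ?R * theta (z\<^sup>2 * p powi (2 * m + \<epsilon>)) (p ^ r) * (exp (Sg + mu m) * exp ((2 * X - 3) * \<zeta>))"
    unfolding hh_def pr z1 exp_add by (simp only: mult_ac)
  then show ?thesis unfolding sm ee z2 X1 by (simp only: mult_ac)
qed

text \<open>The balancing condition of \<open>theta_eight\<close>: by \<open>nu_sum\<close> the
  powers of \<open>q\<close> in the eight \<open>tau\<close> total -2, which cancels the product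
  \<open>q\<^sup>2\<close> of the \<open>u $ a\<close>.\<close>

lemma prod_tv: "(\<Prod>a\<in>UNIV. (\<chi> a. tv a) $ a) = 1"
proof -
  have "tv a = exp (l $ a - (of_int (\<nu> $ a) + of_int \<epsilon> / 2) * LQ)" for a
    unfolding tau_def u exp_add[symmetric] by (rule arg_cong[where f = exp]) (simp add: algebra_simps)
  then have "(\<Prod>a\<in>UNIV. tv a) = exp (\<Sum>a\<in>UNIV. l $ a - (of_int (\<nu> $ a) + of_int \<epsilon> / 2) * LQ)"
    by (simp only: exp_sum[OF finite])
  also have "(\<Sum>a\<in>UNIV. l $ a - (of_int (\<nu> $ a) + of_int \<epsilon> / 2) * LQ) = 2 * LQ - ((2 - 4 * of_int \<epsilon>) + 4 * of_int \<epsilon>) * LQ"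
    unfolding sum_subtractf l_sum sum_distrib_right[symmetric] sum.distrib nu_sum' by simp
  also have "\<dots> = 0" by simp
  finally show ?thesis by simp
qed

text \<open>\<open>PP\<close> and, up to sign and a monomial, the theta function of base
  \<open>p ^ r\<close> are invariant under
  \<open>(m, z) \<mapsto> (- m - \<epsilon>, 1 / z)\<close>. What differs in the two terms are the
  products of eight theta functions at \<open>x\<close> and at \<open>1 / x\<close>, the left side
  of \<open>theta_eight\<close>. Its factor \<open>theta (x\<^sup>2)\<close> and the theta function
  of base \<open>p ^ r\<close> make up \<open>RR\<close>.\<close>

lemma hh_combination:
  assumes z: "norm z = 1"
    and gen: "\<And>i. i \<in> {1,2,3} \<Longrightarrow> theta ((tv i)\<^sup>2) (q ^ r) \<noteq> 0"
       "\<And>i j. i \<in> {1,2,3} \<Longrightarrow> j \<in> {1,2,3} \<Longrightarrow> i \<noteq> j \<Longrightarrow> theta (tv i * tv j) (q ^ r) \<noteq> 0 \<and> theta (tv i / tv j) (q ^ r) \<noteq> 0"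
  shows "hh m z + hh (- m - \<epsilon>) (1 / z) = - (PP m z * RR (2 * m + \<epsilon>) (z\<^sup>2) * (YY \<epsilon> m z)\<^sup>2 *
     (theta_coeff (q ^ r) (\<chi> a. tv a) 1 2 3 * (th2 (q ^ r) (tv 2) (tau \<epsilon> m z) * th2 (q ^ r) (tv 3) (tau \<epsilon> m z))
      + theta_coeff (q ^ r) (\<chi> a. tv a) 2 1 3 * (th2 (q ^ r) (tv 1) (tau \<epsilon> m z) * th2 (q ^ r) (tv 3) (tau \<epsilon> m z))
      + theta_coeff (q ^ r) (\<chi> a. tv a) 3 1 2 * (th2 (q ^ r) (tv 1) (tau \<epsilon> m z) * th2 (q ^ r) (tv 2) (tau \<epsilon> m z))))"
proof -
  have z0: "z \<noteq> 0" using z by auto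
  define \<zeta> where "\<zeta> = Ln z"
  have \<zeta>: "z = exp \<zeta>" using z0 by (simp add: \<zeta>_def)
  define X where "X = 2 * complex_of_int m + of_int \<epsilon>"
  define x where "x = tau \<epsilon> m z"
  have x0: "x \<noteq> 0" using z0 by (simp add: x_def tau_nz)
  have xe: "x = exp (\<zeta> - X / 2 * LQ)"
  proof -
    have "exp (\<zeta> - X / 2 * LQ) = exp \<zeta> * exp (- (of_int m + of_int \<epsilon> / 2) * LQ)"
      unfolding exp_add[symmetric] X_def by (rule arg_cong[where f = exp]) (simp add: field_simps)
    then show ?thesis by (simp add: x_def tau_def \<zeta>[symmetric])
  qed
  define y where "y = z\<^sup>2 * p powi (2 * m + \<epsilon>)"
  have y: "y \<noteq> 0" "y = exp (2 * \<zeta> + X * LP)"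
    using z0 p_nz unfolding y_def powi_p \<zeta> exp_double[symmetric] exp_add[symmetric] by (auto simp: X_def)
  define Y where "Y = theta y (p ^ r)"
  define T1 where "T1 = (\<Prod>a\<in>UNIV. theta (tv a * x) (q ^ r))"
  define T2 where "T2 = (\<Prod>a\<in>UNIV. theta (tv a / x) (q ^ r))"
  have X1: "complex_of_int (2 * m + \<epsilon>) = X" "complex_of_int (2 * (- m - \<epsilon>) + \<epsilon>) = - X" by (simp_all add: X_def)
  have h1: "hh m z = T1 * PP m z * Y * exp (X * (X - 1) / 2 * LP + (X\<^sup>2 + 2 * X) * LQ - (2 * X + 5) * \<zeta>)"
  proof -
    have "z powi (- (2 * (2 * m + \<epsilon>) + 5)) = exp (- (2 * X + 5) * \<zeta>)"
      unfolding \<zeta> exp_power_int by (rule arg_cong[where f = exp]) (simp add: X_def algebra_simps)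
    moreover have "exp (X * (X - 1) / 2 * LP + (X\<^sup>2 + 2 * X) * LQ - (2 * X + 5) * \<zeta>)
      = exp (X * (X - 1) / 2 * LP + (X\<^sup>2 + 2 * X) * LQ) * exp (- (2 * X + 5) * \<zeta>)"
      unfolding exp_add[symmetric] by (rule arg_cong[where f = exp]) (simp add: algebra_simps)
    ultimately show ?thesis unfolding hh_circle[OF z] X1 T1_def x_def[symmetric] y_def[symmetric] Y_def[symmetric]
      by (simp only: mult_ac)
  qed
  have h2: "hh (- m - \<epsilon>) (1 / z) = - (T2 * PP m z * Y * exp (X * (X - 1) / 2 * LP + (X\<^sup>2 - 2 * X) * LQ + (3 - 2 * X) * \<zeta>))"
  proof -
    have z': "norm (1 / z) = 1" using z by (simp add: norm_divide)
    have x': "tau \<epsilon> (- m - \<epsilon>) (1 / z) = 1 / x"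
    proof -
      have "exp (- (of_int (- m - \<epsilon>) + of_int \<epsilon> / 2) * LQ) = 1 / exp (- (of_int m + of_int \<epsilon> / 2) * LQ)"
        unfolding inverse_eq_divide[symmetric] exp_minus[symmetric] by (rule arg_cong[where f = exp]) (simp add: field_simps)
      then show ?thesis by (simp add: x_def tau_def)
    qed
    have PP': "PP (- m - \<epsilon>) (1 / z) = PP m z"
    proof -
      have "k - (- m - \<epsilon>) = k + \<epsilon> + m" "k + \<epsilon> + (- m - \<epsilon>) = k - m" for k by simp_all
      moreover have "w * (1 / z) = w / z" "w / (1 / z) = w * z" for w by simp_all
      ultimately show ?thesis unfolding pairg_def by (simp only: mult.commute)
    qed
    have y': "(1 / z)\<^sup>2 * p powi (2 * (- m - \<epsilon>) + \<epsilon>) = 1 / y"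
    proof -
      have "2 * (- m - \<epsilon>) + \<epsilon> = - (2 * m + \<epsilon>)" by simp
      then show ?thesis by (simp only: power_int_minus y_def) (simp add: field_simps power_divide)
    qed
    have th: "theta (1 / y) (p ^ r) = - (Y * exp (- 2 * \<zeta> - X * LP))"
    proof -
      have "exp (- 2 * \<zeta> - X * LP) * y = exp 0"
        unfolding y(2) exp_add[symmetric] by (rule arg_cong[where f = exp]) simp
      then have "exp (- 2 * \<zeta> - X * LP) = 1 / y" using y(1) by (simp add: eq_divide_eq)
      then show ?thesis using theta_recip[OF pr_lt pr_nz y(1)] unfolding Y_def[symmetric] by simp
    qed
    have zp: "(1 / z) powi (- (2 * (2 * (- m - \<epsilon>) + \<epsilon>) + 5)) = exp ((5 - 2 * X) * \<zeta>)"
    proof -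
      have "1 / z = exp (- \<zeta>)" by (simp add: \<zeta> exp_minus inverse_eq_divide)
      then show ?thesis by (simp only: exp_power_int) (rule arg_cong[where f = exp], simp add: X_def algebra_simps)
    qed
    have E: "exp (- 2 * \<zeta> - X * LP) * exp (- X * (- X - 1) / 2 * LP + ((- X)\<^sup>2 + 2 * - X) * LQ) * exp ((5 - 2 * X) * \<zeta>)
       = exp (X * (X - 1) / 2 * LP + (X\<^sup>2 - 2 * X) * LQ + (3 - 2 * X) * \<zeta>)"
      unfolding exp_add[symmetric] by (rule arg_cong[where f = exp]) (simp add: field_simps power2_eq_square)
    have tx: "tv a * (1 / x) = tv a / x" for a by simp
    show ?thesis unfolding hh_circle[OF z'] x' PP' y' th zp X1 tx T2_def[symmetric] E[symmetric]
      by (simp only: mult_ac mult_minus_left mult_minus_right)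
  qed
  have RR: "RR (2 * m + \<epsilon>) (z\<^sup>2) = - (exp (- 2 * \<zeta> + X * (X - 1) / 2 * LP + X * (X + 1) / 2 * LQ) * Y * theta (x\<^sup>2) (q ^ r))"
  proof -
    have "z\<^sup>2 * q powi (- (2 * m + \<epsilon>)) = x\<^sup>2"
      unfolding xe powi_q \<zeta> exp_double[symmetric] exp_add[symmetric] by (rule arg_cong[where f = exp]) (simp add: X_def algebra_simps)
    moreover have "- (1 / z\<^sup>2) * exp (X * (X - 1) / 2 * LP + X * (X + 1) / 2 * LQ) = - exp (- 2 * \<zeta> + X * (X - 1) / 2 * LP + X * (X + 1) / 2 * LQ)"
      unfolding add.assoc exp_add[of "- 2 * \<zeta>"] by (simp add: \<zeta> exp_double[symmetric] exp_minus inverse_eq_divide)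
    ultimately show ?thesis unfolding RR_def X1 y_def[symmetric] Y_def[symmetric] by simp
  qed
  have Y2: "(YY \<epsilon> m z)\<^sup>2 = exp (- 2 * X * \<zeta> + X\<^sup>2 / 2 * LQ)"
    unfolding YY_exp[OF \<zeta>] X1 exp_double[symmetric] by (rule arg_cong[where f = exp]) (simp add: field_simps)
  \<comment> \<open>The common weight of both terms: multiplied by \<open>x powi (-3)\<close> and by
    \<open>x ^ 5\<close> it yields the prefactors found in \<open>h1\<close> and \<open>h2\<close>,
    up to sign.\<close>
  define W where "W = - (exp (- 2 * \<zeta> + X * (X - 1) / 2 * LP + X * (X + 1) / 2 * LQ) * Y) * exp (- 2 * X * \<zeta> + X\<^sup>2 / 2 * LQ)"
  have W1: "W * x powi (-3) = - (Y * exp (X * (X - 1) / 2 * LP + (X\<^sup>2 + 2 * X) * LQ - (2 * X + 5) * \<zeta>))"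
  proof -
    have X3: "x powi (-3) = exp (- 3 * (\<zeta> - X / 2 * LQ))" unfolding xe exp_power_int by simp
    have E: "exp (- 2 * \<zeta> + X * (X - 1) / 2 * LP + X * (X + 1) / 2 * LQ) * exp (- 2 * X * \<zeta> + X\<^sup>2 / 2 * LQ) * exp (- 3 * (\<zeta> - X / 2 * LQ))
      = exp (X * (X - 1) / 2 * LP + (X\<^sup>2 + 2 * X) * LQ - (2 * X + 5) * \<zeta>)"
      unfolding exp_add[symmetric] by (rule arg_cong[where f = exp]) (simp add: field_simps power2_eq_square)
    show ?thesis unfolding W_def X3 E[symmetric] by (simp only: mult_ac mult_minus_left mult_minus_right)
  qed
  have W2: "W * x ^ 5 = - (Y * exp (X * (X - 1) / 2 * LP + (X\<^sup>2 - 2 * X) * LQ + (3 - 2 * X) * \<zeta>))"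
  proof -
    have X3: "x ^ 5 = exp (5 * (\<zeta> - X / 2 * LQ))" unfolding xe exp_of_nat_mult[symmetric] by simp
    have E: "exp (- 2 * \<zeta> + X * (X - 1) / 2 * LP + X * (X + 1) / 2 * LQ) * exp (- 2 * X * \<zeta> + X\<^sup>2 / 2 * LQ) * exp (5 * (\<zeta> - X / 2 * LQ))
      = exp (X * (X - 1) / 2 * LP + (X\<^sup>2 - 2 * X) * LQ + (3 - 2 * X) * \<zeta>)"
      unfolding exp_add[symmetric] by (rule arg_cong[where f = exp]) (simp add: field_simps power2_eq_square)
    show ?thesis unfolding W_def X3 E[symmetric] by (simp only: mult_ac mult_minus_left mult_minus_right)
  qed
  have te: "x powi (-3) * T1 - x ^ 5 * T2 = theta (x\<^sup>2) (q ^ r) *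
     (theta_coeff (q ^ r) (\<chi> a. tv a) 1 2 3 * (th2 (q ^ r) (tv 2) x * th2 (q ^ r) (tv 3) x)
      + theta_coeff (q ^ r) (\<chi> a. tv a) 2 1 3 * (th2 (q ^ r) (tv 1) x * th2 (q ^ r) (tv 3) x)
      + theta_coeff (q ^ r) (\<chi> a. tv a) 3 1 2 * (th2 (q ^ r) (tv 1) x * th2 (q ^ r) (tv 2) x))"
    using theta_eight[OF qr_lt qr_nz prod_tv x0] gen unfolding T1_def T2_def by simp
  have "hh m z + hh (- m - \<epsilon>) (1 / z) = - (PP m z * (W * x powi (-3) * T1 - W * x ^ 5 * T2))"
    unfolding h1 h2 W1 W2 by (simp add: algebra_simps)
  also have "\<dots> = - (PP m z * W * (x powi (-3) * T1 - x ^ 5 * T2))" by (simp only: right_diff_distrib mult.assoc)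
  also have "\<dots> = - (PP m z * RR (2 * m + \<epsilon>) (z\<^sup>2) * (YY \<epsilon> m z)\<^sup>2 *
     (theta_coeff (q ^ r) (\<chi> a. tv a) 1 2 3 * (th2 (q ^ r) (tv 2) x * th2 (q ^ r) (tv 3) x)
      + theta_coeff (q ^ r) (\<chi> a. tv a) 2 1 3 * (th2 (q ^ r) (tv 1) x * th2 (q ^ r) (tv 3) x)
      + theta_coeff (q ^ r) (\<chi> a. tv a) 3 1 2 * (th2 (q ^ r) (tv 1) x * th2 (q ^ r) (tv 2) x)))"
    unfolding te RR Y2 W_def by (simp only: mult_ac mult_minus_left mult_minus_right)
  finally show ?thesis unfolding x_def .
qed

section \<open>Vanishing of the circle integrals\<close>

lemma hh_holo: "hh m holomorphic_on {z. z \<noteq> 0 \<and> (\<forall>a. norm (u $ a) < norm z \<and> norm (p * u $ a * z) < 1)}" (is "_ holomorphic_on ?A")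
proof -
  have 1: "(\<lambda>z. rg (p * u $ a * z) k) holomorphic_on ?A" for a k
    by (intro holomorphic_on_compose_gen[OF _ rg_holo, unfolded o_def] holomorphic_intros) (auto simp: p_nz u_nz)
  have 2: "(\<lambda>z. rg (u $ a / z) k) holomorphic_on ?A" for a k
    by (intro holomorphic_on_compose_gen[OF _ rg_holo, unfolded o_def] holomorphic_intros)
       (auto simp: u_nz norm_divide divide_less_eq)
  have 3: "(\<lambda>z. theta (z\<^sup>2 * p powi (2 * m + \<epsilon>)) (p ^ r)) holomorphic_on ?A"
    by (intro holomorphic_on_compose_gen[OF _ theta_holo[OF pr_lt, of "- {0}"], unfolded o_def] holomorphic_intros)
       (auto simp: p_nz)
  show ?thesis unfolding hh_def[abs_def] by (intro holomorphic_intros 1 2 3) auto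
qed

lemma hh_dom_open: "open {z. z \<noteq> 0 \<and> (\<forall>a. norm (u $ a) < norm z \<and> norm (p * u $ a * z) < 1)}"
proof -
  have eq: "{z. z \<noteq> 0 \<and> (\<forall>a. norm (u $ a) < norm z \<and> norm (p * u $ a * z) < 1)}
    = - {0} \<inter> (\<Inter>a. {z. norm (u $ a) < norm z} \<inter> {z. norm (p * u $ a * z) < 1})" by auto
  show ?thesis unfolding eq
    by (intro open_Int open_Compl closed_singleton open_INT open_Collect_less continuous_intros ballI finite)
qed

lemma hh_dom: "1 \<le> norm z \<Longrightarrow> norm z \<le> 1 / norm p \<Longrightarrow> z \<in> {z. z \<noteq> 0 \<and> (\<forall>a. norm (u $ a) < norm z \<and> norm (p * u $ a * z) < 1)}"
proof -
  assume z: "1 \<le> norm z" "norm z \<le> 1 / norm p"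
  have "norm p * norm z \<le> 1" using z p_nz by (simp add: field_simps)
  then have "norm (u $ a) * (norm p * norm z) \<le> norm (u $ a) * 1" for a by (intro mult_left_mono) auto
  then have "norm (p * u $ a * z) < 1" for a using u_lt[of a] by (auto simp: norm_mult mult_ac intro: le_less_trans)
  moreover have "norm (u $ a) < norm z" for a using u_lt[of a] z by linarith
  ultimately show ?thesis using z by auto
qed

lemma hh_cont: "continuous_on (sphere 0 1) (hh m)"
proof (rule continuous_on_subset[OF holomorphic_on_imp_continuous_on[OF hh_holo]])
  have "1 \<le> 1 / norm p" using p_nz p_lt by simp
  show "sphere 0 1 \<subseteq> {z. z \<noteq> 0 \<and> (\<forall>a. norm (u $ a) < norm z \<and> norm (p * u $ a * z) < 1)}"
  proof
    fix z :: complex assume "z \<in> sphere 0 1"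
    then have "norm z = 1" by simp
    then show "z \<in> {z. z \<noteq> 0 \<and> (\<forall>a. norm (u $ a) < norm z \<and> norm (p * u $ a * z) < 1)}"
      using \<open>1 \<le> 1 / norm p\<close> by (intro hh_dom) simp_all
  qed
qed

lemma CM_hh_antisym: "CM (hh m) = - CM (hh (1 - m - \<epsilon>))"
proof -
  have "1 / norm p \<ge> 1" using p_nz p_lt by simp
  then have "CM (\<lambda>z. hh m (1 / p * z)) = CM (hh m)"
    using p_nz hh_dom by (intro CM_dilate[OF hh_dom_open hh_holo]) (auto simp: norm_divide min_def max_def)
  moreover have "CM (\<lambda>z. hh m (1 / p * (1 / z))) = CM (\<lambda>z. hh m (1 / p * z))"
  proof (rule CM_inverse)
    have "continuous_on (sphere 0 1) (\<lambda>z. 1 / p * z)" by (intro continuous_intros)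
    moreover have "(\<lambda>z. 1 / p * z) ` sphere 0 1 \<subseteq> {z. z \<noteq> 0 \<and> (\<forall>a. norm (u $ a) < norm z \<and> norm (p * u $ a * z) < 1)}"
    proof
      fix w assume "w \<in> (\<lambda>z. 1 / p * z) ` sphere 0 1"
      then have "norm w = 1 / norm p" by (auto simp: norm_divide)
      then show "w \<in> {z. z \<noteq> 0 \<and> (\<forall>a. norm (u $ a) < norm z \<and> norm (p * u $ a * z) < 1)}"
        using \<open>1 / norm p \<ge> 1\<close> by (intro hh_dom) auto
    qed
    ultimately show "continuous_on (sphere 0 1) (\<lambda>z. hh m (1 / p * z))"
      by (rule continuous_on_compose2[OF holomorphic_on_imp_continuous_on[OF hh_holo]])
  qed
  moreover have "CM (\<lambda>z. hh m (1 / p * (1 / z))) = CM (\<lambda>z. (-1) * hh (1 - m - \<epsilon>) z)"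
  proof (rule CM_cong)
    fix z :: complex assume "norm z = 1"
    then have "z \<noteq> 0" by auto
    from hh_antisym[OF this, of "1 - m - \<epsilon>"] show "hh m (1 / p * (1 / z)) = (-1) * hh (1 - m - \<epsilon>) z" by simp
  qed
  ultimately show ?thesis unfolding CM_cmult by simp
qed

lemma sum_CM_hh_periodic: "(\<Sum>m<r. CM (hh (c - int m))) = (\<Sum>m<r. CM (hh (int m)))"
proof (rule sum_mod_shift[OF r_pos])
  fix m show "CM (hh (m + int r)) = CM (hh m)"
    by (rule CM_cong) (metis hh_periodic norm_zero zero_neq_one)
qed

text \<open>The antisymmetry pairs \<open>m\<close> with \<open>1 - \<epsilon> - m\<close>, so a
  single integral need not vanish. Summed over all residues, the total equals its own
  negative.\<close>

lemma sum_CM_hh: "(\<Sum>m<r. CM (hh (int m))) = 0"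
proof -
  have "(\<Sum>m<r. CM (hh (int m))) = - (\<Sum>m<r. CM (hh ((1 - \<epsilon>) - int m)))"
    by (subst CM_hh_antisym) (simp add: sum_negf algebra_simps)
  then have "(\<Sum>m<r. CM (hh (int m))) = - (\<Sum>m<r. CM (hh (int m)))" unfolding sum_CM_hh_periodic .
  then show ?thesis by simp
qed

definition shift2 :: "8 \<Rightarrow> 8 \<Rightarrow> complex ^ 8" where
  "shift2 i j = (\<chi> a. if a = i \<or> a = j then p * u $ a else u $ a)"

definition nshift2 :: "8 \<Rightarrow> 8 \<Rightarrow> int ^ 8" where
  "nshift2 i j = (\<chi> a. if a = i \<or> a = j then \<nu> $ a - 1 else \<nu> $ a)"

lemma integrand_shift2:
  assumes z: "norm z = 1" and "i \<noteq> j"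
  shows "integrand \<epsilon> (nshift2 i j) (shift2 i j) m z = kap \<epsilon> (\<nu> $ i) (u $ i) * kap \<epsilon> (\<nu> $ j) (u $ j) * (YY \<epsilon> m z)\<^sup>2 *
     (th2 (q ^ r) (tv i) (tau \<epsilon> m z) * th2 (q ^ r) (tv j) (tau \<epsilon> m z)) * (PP m z * RR (2 * m + \<epsilon>) (z\<^sup>2))"
proof -
  have z0: "z \<noteq> 0" using z by auto
  define g where "g = (\<lambda>a. kap \<epsilon> (\<nu> $ a) (u $ a) * YY \<epsilon> m z * th2 (q ^ r) (tv a) (tau \<epsilon> m z))"
  have sh: "pairg (p * u $ a) (\<nu> $ a - 1) \<epsilon> m z = g a * pairg (u $ a) (\<nu> $ a) \<epsilon> m z" for a
    unfolding g_def using u_lt[of a] u_nz[of a] z z0 by (intro pairg_shift) (auto simp: norm_mult norm_divide)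
  have "(\<Prod>a\<in>UNIV. pairg (shift2 i j $ a) (nshift2 i j $ a) \<epsilon> m z) = (\<Prod>a\<in>UNIV. (if a \<in> {i, j} then g a else 1) * pairg (u $ a) (\<nu> $ a) \<epsilon> m z)"
    by (rule prod.cong) (auto simp: shift2_def nshift2_def sh)
  also have "\<dots> = (\<Prod>a\<in>{i, j}. g a) * PP m z"
  proof -
    have "(\<Prod>a\<in>UNIV. if a \<in> {i, j} then g a else 1) = (\<Prod>a\<in>{i, j}. g a)"
      by (rule sym, rule prod.mono_neutral_cong_left) simp_all
    then show ?thesis by (simp only: prod.distrib)
  qed
  finally show ?thesis unfolding integrand_def g_def using assms(2) by (simp add: power2_eq_square mult_ac)
qed

text \<open>Integrating \<open>hh_combination\<close> leaves two sums of integrals of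
  \<open>hh\<close> over \<open>m\<close>; the second vanishes as well because
  \<open>- \<epsilon> - m\<close> also runs through all residues modulo \<open>r\<close>.\<close>

lemma three_term:
  assumes gen: "\<And>i. i \<in> {1,2,3} \<Longrightarrow> theta ((tv i)\<^sup>2) (q ^ r) \<noteq> 0"
       "\<And>i j. i \<in> {1,2,3} \<Longrightarrow> j \<in> {1,2,3} \<Longrightarrow> i \<noteq> j \<Longrightarrow> theta (tv i * tv j) (q ^ r) \<noteq> 0 \<and> theta (tv i / tv j) (q ^ r) \<noteq> 0"
  shows "theta_coeff (q ^ r) (\<chi> a. tv a) 1 2 3 / (kap \<epsilon> (\<nu> $ 2) (u $ 2) * kap \<epsilon> (\<nu> $ 3) (u $ 3)) * Vint \<epsilon> (nshift2 2 3) (shift2 2 3)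
      + theta_coeff (q ^ r) (\<chi> a. tv a) 2 1 3 / (kap \<epsilon> (\<nu> $ 1) (u $ 1) * kap \<epsilon> (\<nu> $ 3) (u $ 3)) * Vint \<epsilon> (nshift2 1 3) (shift2 1 3)
      + theta_coeff (q ^ r) (\<chi> a. tv a) 3 1 2 / (kap \<epsilon> (\<nu> $ 1) (u $ 1) * kap \<epsilon> (\<nu> $ 2) (u $ 2)) * Vint \<epsilon> (nshift2 1 2) (shift2 1 2) = 0"
proof -
  define C where "C = (\<lambda>i j k. theta_coeff (q ^ r) (\<chi> a. tv a) i j k / (kap \<epsilon> (\<nu> $ j) (u $ j) * kap \<epsilon> (\<nu> $ k) (u $ k)))"
  have kn: "kap \<epsilon> (\<nu> $ a) (u $ a) \<noteq> 0" for a using kap_nz u_nz by blast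
  let ?J = "\<lambda>i j m. integrand \<epsilon> (nshift2 i j) (shift2 i j) m"
  have cJ: "continuous_on (sphere 0 1) (?J i j m)" for i j m
  proof (rule integrand_cont)
    have "norm p * norm (u $ a) < 1" for a using p_lt u_lt[of a] mult_strict_mono[of "norm p" 1 "norm (u $ a)" 1] by simp
    then show "0 < norm (shift2 i j $ a)" "norm (shift2 i j $ a) < 1" for a
      using u_nz[of a] u_lt[of a] p_nz by (auto simp: shift2_def norm_mult)
  qed
  have pw: "C 1 2 3 * ?J 2 3 m z + C 2 1 3 * ?J 1 3 m z + C 3 1 2 * ?J 1 2 m z = - (hh m z + hh (- m - \<epsilon>) (1 / z))"
    if z: "norm z = 1" for m z
  proof -
    have i: "C i j k * ?J j k m z = theta_coeff (q ^ r) (\<chi> a. tv a) i j k * (th2 (q ^ r) (tv j) (tau \<epsilon> m z) * th2 (q ^ r) (tv k) (tau \<epsilon> m z)) * (PP m z * RR (2 * m + \<epsilon>) (z\<^sup>2) * (YY \<epsilon> m z)\<^sup>2)"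
      if "j \<noteq> k" for i j k
      unfolding integrand_shift2[OF z that] C_def using kn[of j] kn[of k] by simp
    have n: "2 \<noteq> (3::8)" "1 \<noteq> (3::8)" "1 \<noteq> (2::8)" by simp_all
    show ?thesis unfolding i[OF n(1)] i[OF n(2)] i[OF n(3)] hh_combination[OF z gen, simplified]
      by (simp add: algebra_simps)
  qed
  have ch: "continuous_on (sphere 0 1) (\<lambda>z. hh k (1 / z))" for k
    by (rule continuous_on_compose2[OF hh_cont]) (auto intro!: continuous_intros simp: norm_divide)
  have "C 1 2 3 * CM (?J 2 3 m) + C 2 1 3 * CM (?J 1 3 m) + C 3 1 2 * CM (?J 1 2 m) = - (CM (hh m) + CM (hh (- \<epsilon> - m)))" for m
  proof -
    have "C 1 2 3 * CM (?J 2 3 m) + C 2 1 3 * CM (?J 1 3 m) + C 3 1 2 * CM (?J 1 2 m)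
      = CM (\<lambda>z. C 1 2 3 * ?J 2 3 m z + C 2 1 3 * ?J 1 3 m z + C 3 1 2 * ?J 1 2 m z)"
      using cJ by (simp add: CM_add CM_cmult continuous_on_mult_const continuous_on_add continuous_on_mult_left)
    also have "\<dots> = CM (\<lambda>z. (-1) * (hh m z + hh (- m - \<epsilon>) (1 / z)))"
      by (rule CM_cong) (use pw in simp)
    also have "\<dots> = - (CM (hh m) + CM (\<lambda>z. hh (- m - \<epsilon>) (1 / z)))"
      unfolding CM_cmult using CM_add[OF hh_cont ch] by simp
    also have "CM (\<lambda>z. hh (- m - \<epsilon>) (1 / z)) = CM (hh (- \<epsilon> - m))"
    proof -
      have "- m - \<epsilon> = - \<epsilon> - m" by simp
      then show ?thesis using CM_inverse[OF hh_cont, of "- \<epsilon> - m"] by (simp only:)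
    qed
    finally show ?thesis .
  qed
  then have "(\<Sum>m<r. C 1 2 3 * CM (?J 2 3 (int m)) + C 2 1 3 * CM (?J 1 3 (int m)) + C 3 1 2 * CM (?J 1 2 (int m)))
     = - ((\<Sum>m<r. CM (hh (int m))) + (\<Sum>m<r. CM (hh (- \<epsilon> - int m))))"
    by (simp add: sum_negf sum.distrib sum_subtractf)
  also have "\<dots> = 0" unfolding sum_CM_hh_periodic sum_CM_hh by simp
  finally show ?thesis unfolding Vint_def C_def by (simp add: sum.distrib sum_distrib_left)
qed

end

section \<open>The equation on an open set\<close>

lemma upd12_nth: "upd12 u v x $ a = (if a = 1 then u else if a = 2 then v else x $ a)"
  by (simp add: upd12_def)

definition scale_at :: "complex \<Rightarrow> 8 \<Rightarrow> complex ^ 8 \<Rightarrow> complex ^ 8" where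
  "scale_at c i v = (\<chi> a. if a = i then c * v $ a else v $ a)"

definition dec_at :: "8 \<Rightarrow> int ^ 8 \<Rightarrow> int ^ 8" where
  "dec_at i n = (\<chi> a. if a = i then n $ a - 1 else n $ a)"

lemma prod_factor_at:
  fixes f :: "8 \<Rightarrow> complex"
  shows "(\<Prod>a\<in>UNIV. (if a = i then c else 1) * f a) = c * (\<Prod>a\<in>UNIV. f a)"
  by (simp add: prod.distrib)

context rarefied
begin

text \<open>The source of the factors \<open>p * q\<close> below: every shift multiplies the
  \<open>tau\<close> variable by \<open>p * q\<close>, so the arguments of \<open>A_fun\<close> at
  \<open>t\<close> are \<open>p * q\<close> times those at \<open>u\<close> in the first two
  places.\<close>

lemma tau_shift: "tau \<epsilon> (n - 1) (p * t) = p * q * tau \<epsilon> n t"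
proof -
  have "exp (- (of_int (n - 1) + of_int \<epsilon> / 2) * LQ) = exp LQ * exp (- (of_int n + of_int \<epsilon> / 2) * LQ)"
    unfolding exp_add[symmetric] by (rule arg_cong[where f = exp]) (simp add: field_simps)
  then show ?thesis by (simp add: tau_def exp_LQ)
qed

lemma tau_qh: "tau \<epsilon> n t = t / qh powi (2 * n + \<epsilon>)"
proof -
  have "qh powi (2 * n + \<epsilon>) = exp (of_int (2 * n + \<epsilon>) * (LQ / 2))"
    using exp_power_int[of "LQ / 2" "2 * n + \<epsilon>"] by (simp only: exp_half_LQ)
  also have "\<dots> = exp ((of_int n + of_int \<epsilon> / 2) * LQ)"
    by (rule arg_cong[where f = exp]) (simp add: field_simps)
  finally have "qh powi (2 * n + \<epsilon>) = exp ((of_int n + of_int \<epsilon> / 2) * LQ)" .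
  moreover have "exp (- (of_int n + of_int \<epsilon> / 2) * LQ) = inverse (exp ((of_int n + of_int \<epsilon> / 2) * LQ))"
    by (simp only: mult_minus_left exp_minus)
  ultimately show ?thesis by (simp only: tau_def divide_inverse)
qed

lemma A_args_tau: "A_args qh \<epsilon> n t = (\<chi> a. tau \<epsilon> (n $ a) (t $ a))"
  by (simp add: A_args_def tau_qh)

lemma norm_scale_at: "0 < norm (v $ a) \<Longrightarrow> norm (v $ a) < 1 \<Longrightarrow> 0 < norm (scale_at p i v $ a) \<and> norm (scale_at p i v $ a) < 1"
  using p_lt p_nz mult_strict_mono[of "norm p" 1 "norm (v $ a)" 1] by (auto simp: scale_at_def norm_mult)

lemma integrand_scale_at:
  assumes v: "\<And>a. 0 < norm (v $ a)" "\<And>a. norm (v $ a) < 1" and z: "norm z = 1"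
  shows "integrand \<epsilon> (dec_at i n) (scale_at p i v) m z
     = kap \<epsilon> (n $ i) (v $ i) * YY \<epsilon> m z * th2 (q ^ r) (tau \<epsilon> (n $ i) (v $ i)) (tau \<epsilon> m z) * integrand \<epsilon> n v m z"
proof -
  define c where "c = kap \<epsilon> (n $ i) (v $ i) * YY \<epsilon> m z * th2 (q ^ r) (tau \<epsilon> (n $ i) (v $ i)) (tau \<epsilon> m z)"
  have z0: "z \<noteq> 0" using z by auto
  have sh: "pairg (p * v $ i) (n $ i - 1) \<epsilon> m z = c * pairg (v $ i) (n $ i) \<epsilon> m z"
    unfolding c_def using v[of i] z z0 by (intro pairg_shift) (auto simp: norm_mult norm_divide)
  have "(\<Prod>a\<in>UNIV. pairg (scale_at p i v $ a) (dec_at i n $ a) \<epsilon> m z) = (\<Prod>a\<in>UNIV. (if a = i then c else 1) * pairg (v $ a) (n $ a) \<epsilon> m z)"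
    by (rule prod.cong) (auto simp: scale_at_def dec_at_def sh)
  also have "\<dots> = c * (\<Prod>a\<in>UNIV. pairg (v $ a) (n $ a) \<epsilon> m z)" by (rule prod_factor_at)
  finally show ?thesis unfolding integrand_def c_def by simp
qed

text \<open>The addition formula under the integral sign. After division by \<open>kap\<close>, each
  integrand is \<open>th2\<close> of its own parameter times a factor common to all three.\<close>

lemma Vint_contiguous:
  fixes v :: "complex ^ 8" and n :: "int ^ 8" and \<epsilon> :: int
  defines "T a \<equiv> tau \<epsilon> (n $ a) (v $ a)" and "\<kappa> a \<equiv> kap \<epsilon> (n $ a) (v $ a)"
  assumes v: "\<And>a. 0 < norm (v $ a)" "\<And>a. norm (v $ a) < 1"
    and gen: "theta ((T k)\<^sup>2) (q ^ r) \<noteq> 0" "theta (T k * T j) (q ^ r) \<noteq> 0" "theta (T k / T j) (q ^ r) \<noteq> 0"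
  shows "Vint \<epsilon> (dec_at i n) (scale_at p i v) / \<kappa> i * th2 (q ^ r) (T j) (T k)
      - Vint \<epsilon> (dec_at j n) (scale_at p j v) / \<kappa> j * th2 (q ^ r) (T i) (T k)
     = - (T j / T k) * th2 (q ^ r) (T i) (T j) * (Vint \<epsilon> (dec_at k n) (scale_at p k v) / \<kappa> k)"
proof -
  have v0: "v $ a \<noteq> 0" for a using v(1)[of a] by auto
  have T0: "T a \<noteq> 0" and k0: "\<kappa> a \<noteq> 0" for a unfolding T_def \<kappa>_def using tau_nz kap_nz v0 by blast+
  let ?J = "\<lambda>i m. integrand \<epsilon> (dec_at i n) (scale_at p i v) m"
  have cJ: "continuous_on (sphere 0 1) (?J i m)" for i m
    by (rule integrand_cont) (use norm_scale_at v in blast)+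
  define ci where "ci = th2 (q ^ r) (T j) (T k) / \<kappa> i"
  define cj where "cj = - (th2 (q ^ r) (T i) (T k) / \<kappa> j)"
  define ck where "ck = (T j / T k) * th2 (q ^ r) (T i) (T j) / \<kappa> k"
  have pw: "ci * ?J i m z + cj * ?J j m z + ck * ?J k m z = 0" if z: "norm z = 1" for m z
  proof -
    have x: "tau \<epsilon> m z \<noteq> 0" using z by (intro tau_nz) auto
    define G where "G = YY \<epsilon> m z * integrand \<epsilon> n v m z"
    have J: "?J a m z = \<kappa> a * th2 (q ^ r) (T a) (tau \<epsilon> m z) * G" for a
      unfolding integrand_scale_at[OF v z] G_def T_def \<kappa>_def by simp
    have "ci * ?J i m z + cj * ?J j m z + ck * ?J k m z
      = G * (th2 (q ^ r) (T i) (tau \<epsilon> m z) * th2 (q ^ r) (T j) (T k) - th2 (q ^ r) (T j) (tau \<epsilon> m z) * th2 (q ^ r) (T i) (T k)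
          + (T j / T k) * th2 (q ^ r) (T i) (T j) * th2 (q ^ r) (T k) (tau \<epsilon> m z))"
      unfolding J ci_def cj_def ck_def using k0 by (simp add: algebra_simps)
    also have "\<dots> = 0" unfolding theta_addition[OF qr_lt qr_nz T0 T0 T0 x gen] by simp
    finally show ?thesis .
  qed
  have "ci * CM (?J i m) + cj * CM (?J j m) + ck * CM (?J k m) = 0" for m
  proof -
    have "ci * CM (?J i m) + cj * CM (?J j m) + ck * CM (?J k m) = CM (\<lambda>z. ci * ?J i m z + cj * ?J j m z + ck * ?J k m z)"
      using cJ by (simp add: CM_add CM_cmult continuous_on_add continuous_on_mult_left)
    also have "\<dots> = CM (\<lambda>z. 0 * 0)" by (rule CM_cong) (use pw in simp)
    also have "\<dots> = 0" unfolding CM_cmult by simp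
    finally show ?thesis .
  qed
  then have "(\<Sum>m<r. ci * CM (?J i (int m)) + cj * CM (?J j (int m)) + ck * CM (?J k (int m))) = 0" by simp
  then have "ci * Vint \<epsilon> (dec_at i n) (scale_at p i v) + cj * Vint \<epsilon> (dec_at j n) (scale_at p j v) + ck * Vint \<epsilon> (dec_at k n) (scale_at p k v) = 0"
    by (simp add: Vint_def sum.distrib sum_distrib_left)
  moreover have "ci * Vint \<epsilon> (dec_at i n) (scale_at p i v) = Vint \<epsilon> (dec_at i n) (scale_at p i v) / \<kappa> i * th2 (q ^ r) (T j) (T k)"
    "cj * Vint \<epsilon> (dec_at j n) (scale_at p j v) = - (Vint \<epsilon> (dec_at j n) (scale_at p j v) / \<kappa> j * th2 (q ^ r) (T i) (T k))"
    "ck * Vint \<epsilon> (dec_at k n) (scale_at p k v) = (T j / T k) * th2 (q ^ r) (T i) (T j) * (Vint \<epsilon> (dec_at k n) (scale_at p k v) / \<kappa> k)"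
    unfolding ci_def cj_def ck_def by simp_all
  ultimately show ?thesis by (simp add: algebra_simps)
qed

text \<open>With \<open>c = p * q / q ^ r\<close>, one period or an inversion simplifies the theta
  functions of \<open>A_fun\<close>, and what remains apart from a quotient of \<open>th2\<close> is
  a ratio of interpolation coefficients. That quotient of \<open>th2\<close> is cancelled by the one
  on the left, which is the factor produced by \<open>U_difference\<close>.\<close>

lemma A_fun_coefficient:
  fixes w :: "complex ^ 8"
  defines "P \<equiv> p * q" and "Q \<equiv> q ^ r"
  assumes w: "(\<Prod>a\<in>UNIV. w $ a) = 1"
    and gen: "th2 Q (P * w $ 1) (w $ 2) \<noteq> 0" "th2 Q (P * w $ 1) (w $ 3) \<noteq> 0" "theta (w $ 2 / w $ 3) Q \<noteq> 0"
  shows "A_fun r p q (upd12 (P * w $ 1) (P * w $ 2) w) * (- (w $ 2 / w $ 3)) * th2 Q (P * w $ 1) (w $ 2) / th2 Q (P * w $ 1) (w $ 3)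
     = theta_coeff Q w 2 1 3 / theta_coeff Q w 3 1 2"
proof -
  note Q = qr_lt[folded Q_def] qr_nz[folded Q_def]
  have P: "P \<noteq> 0" using pq_nz by (simp add: P_def)
  have w0: "w $ a \<noteq> 0" for a
  proof
    assume "w $ a = 0"
    then have "(\<Prod>a\<in>UNIV. w $ a) = 0" by (intro prod_zero) auto
    then show False using w by simp
  qed
  define c where "c = p * q powi (1 - int r)"
  have c: "c = P / Q" unfolding c_def P_def Q_def using q_nz by (simp add: power_int_diff)
  define A where "A = (\<Prod>a\<in>{4,5,6,7,8}. theta (w $ 2 * w $ a) Q)"
  define B where "B = (\<Prod>a\<in>{4,5,6,7,8}. theta (w $ 3 * w $ a) Q)"
  have i: "1 \<noteq> (2::8)" "1 \<noteq> (3::8)" "2 \<noteq> (3::8)" by simp_all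
  have e1: "theta (P * w $ 1 / (c * w $ 3)) Q = - theta (w $ 1 / w $ 3) Q / (w $ 1 / w $ 3)"
  proof -
    have "P * w $ 1 / (c * w $ 3) = Q * (w $ 1 / w $ 3)" unfolding c using P Q by simp
    then show ?thesis using theta_shift[OF Q, of "w $ 1 / w $ 3"] w0 by simp
  qed
  have e2: "theta (w $ 3 / (P * w $ 1)) Q = - theta (P * w $ 1 / w $ 3) Q / (P * w $ 1 / w $ 3)"
    using theta_recip[OF Q, of "P * w $ 1 / w $ 3"] w0 P by simp
  have e3: "theta (P * w $ 2 / (c * (P * w $ 1))) Q = theta (P * w $ 1 / w $ 2) Q"
  proof -
    have "P * w $ 2 / (c * (P * w $ 1)) = Q / (P * w $ 1 / w $ 2)" unfolding c using P Q by simp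
    then show ?thesis using theta_inv[OF Q(2), of "P * w $ 1 / w $ 2"] by (simp only:)
  qed
  have e4: "theta (P * w $ 1 * (P * w $ 2) / c) Q = - theta (P * w $ 1 * w $ 2) Q / (P * w $ 1 * w $ 2)"
  proof -
    have "P * w $ 1 * (P * w $ 2) / c = Q * (P * w $ 1 * w $ 2)" unfolding c using P Q by simp
    then show ?thesis using theta_shift[OF Q, of "P * w $ 1 * w $ 2"] w0 P by simp
  qed
  have e5: "theta (P * w $ 2 * w $ a / c) Q = - (1 / (w $ 2 * w $ a)) * theta (w $ 2 * w $ a) Q" for a
  proof -
    have "P * w $ 2 * w $ a / c = Q * (w $ 2 * w $ a)" unfolding c using P Q by simp
    then show ?thesis using theta_shift[OF Q, of "w $ 2 * w $ a"] w0 P by simp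
  qed
  have e6: "theta (w $ 3 / w $ 2) Q = - theta (w $ 2 / w $ 3) Q / (w $ 2 / w $ 3)"
    using theta_recip[OF Q, of "w $ 2 / w $ 3"] w0 by simp
  have e7: "theta (P * w $ 1 / (P * w $ 2)) Q = theta (w $ 1 / w $ 2) Q" using P by simp
  have pr: "(\<Prod>a\<in>{4,5,6,7,8}. theta (P * w $ 2 * upd12 (P * w $ 1) (P * w $ 2) w $ a / c) Q / theta (w $ 3 * upd12 (P * w $ 1) (P * w $ 2) w $ a) Q)
     = - (w $ 1 * w $ 3 / w $ 2 ^ 4) * (A / B)"
  proof -
    have "(\<Prod>a\<in>{4,5,6,7,8::8}. theta (P * w $ 2 * upd12 (P * w $ 1) (P * w $ 2) w $ a / c) Q / theta (w $ 3 * upd12 (P * w $ 1) (P * w $ 2) w $ a) Q)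
       = (\<Prod>a\<in>{4,5,6,7,8}. - (1 / (w $ 2 * w $ a)) * (theta (w $ 2 * w $ a) Q / theta (w $ 3 * w $ a) Q))"
      by (rule prod.cong) (auto simp: upd12_nth e5)
    also have "\<dots> = (\<Prod>a\<in>{4,5,6,7,8}. - (1 / (w $ 2 * w $ a))) * (A / B)"
      unfolding A_def B_def by (simp only: prod.distrib prod_dividef)
    also have "(\<Prod>a\<in>{4,5,6,7,8}. - (1 / (w $ 2 * w $ a))) = - (1 / (w $ 2 ^ 5 * (\<Prod>a\<in>{4,5,6,7,8}. w $ a)))"
      by (simp add: power_def mult_ac)
    \<comment> \<open>The monomials left over from five periods collapse because the
      \<open>w $ a\<close> have product 1.\<close>
    also have "\<dots> = - (w $ 1 * w $ 3 / w $ 2 ^ 4)"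
    proof -
      have "w $ 1 * w $ 2 * w $ 3 * (\<Prod>a\<in>{4,5,6,7,8}. w $ a) = 1" using w unfolding prod_8 .
      then have "(\<Prod>a\<in>{4,5,6,7,8}. w $ a) * (w $ 1 * w $ 2 * w $ 3) = 1" by (simp only: mult.commute)
      then have "(\<Prod>a\<in>{4,5,6,7,8}. w $ a) = 1 / (w $ 1 * w $ 2 * w $ 3)"
        using w0[of 1] w0[of 2] w0[of 3] by (intro iffD2[OF eq_divide_eq]) simp
      show ?thesis unfolding \<open>(\<Prod>a\<in>{4,5,6,7,8}. w $ a) = 1 / (w $ 1 * w $ 2 * w $ 3)\<close>
        using w0[of 1] w0[of 2] w0[of 3] by (simp add: field_simps eval_nat_numeral)
    qed
    finally show ?thesis .
  qed
  have Afun: "A_fun r p q (upd12 (P * w $ 1) (P * w $ 2) w)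
     = (- theta (w $ 1 / w $ 3) Q / (w $ 1 / w $ 3) * theta (w $ 3 * (P * w $ 1)) Q * (- theta (P * w $ 1 / w $ 3) Q / (P * w $ 1 / w $ 3)))
      / (theta (w $ 1 / w $ 2) Q * theta (P * w $ 1 / w $ 2) Q * (- theta (P * w $ 1 * w $ 2) Q / (P * w $ 1 * w $ 2)))
      * (- (w $ 1 * w $ 3 / w $ 2 ^ 4) * (A / B))"
  proof -
    have u: "upd12 (P * w $ 1) (P * w $ 2) w $ 1 = P * w $ 1" "upd12 (P * w $ 1) (P * w $ 2) w $ 2 = P * w $ 2" "upd12 (P * w $ 1) (P * w $ 2) w $ 3 = w $ 3"
      by (simp_all add: upd12_nth)
    show ?thesis unfolding A_fun_def Let_def c_def[symmetric] Q_def[symmetric] u e1 e2 e3 e4 e7 pr ..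
  qed
  \<comment> \<open>Stated for independent variables, to keep the theta functions out of the field
    arithmetic.\<close>
  have alg: "(- a / (x1 / x3) * t13 * (- s13 / (x / x3))) / (b * s12 * (- t12 / (x * x2))) * (- (x1 * x3 / x2 ^ 4) * R) * (- (x2 / x3)) * (t12 * s12) / (t13 * s13)
     = - (a / b) * (x3 / x2)\<^sup>2 * R"
    if "x \<noteq> 0" "x1 \<noteq> 0" "x2 \<noteq> 0" "x3 \<noteq> 0" "t12 \<noteq> 0" "s12 \<noteq> 0" "t13 \<noteq> 0" "s13 \<noteq> 0"
    for a b R x x1 x2 x3 t12 s12 t13 s13 :: complex
    using that by (cases "b = 0") (simp_all add: field_simps eval_nat_numeral)
  have nz: "theta (P * w $ 1 * w $ 2) Q \<noteq> 0" "theta (P * w $ 1 / w $ 2) Q \<noteq> 0" "theta (P * w $ 1 * w $ 3) Q \<noteq> 0" "theta (P * w $ 1 / w $ 3) Q \<noteq> 0"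
    using gen unfolding th2_def by auto
  have "A_fun r p q (upd12 (P * w $ 1) (P * w $ 2) w) * (- (w $ 2 / w $ 3)) * th2 Q (P * w $ 1) (w $ 2) / th2 Q (P * w $ 1) (w $ 3)
     = - (theta (w $ 1 / w $ 3) Q / theta (w $ 1 / w $ 2) Q) * (w $ 3 / w $ 2)\<^sup>2 * (A / B)"
    unfolding Afun th2_def mult.commute[of "w $ 3" "P * w $ 1"]
    by (rule alg) (use nz w0 P in auto)
  also have "\<dots> = theta_coeff Q w 2 1 3 / theta_coeff Q w 3 1 2"
  proof -
    have alg2: "- (a / b) * (x3 / x2)\<^sup>2 * (A' / B') = (x2 powi (-3) * A' / (b * (- g / (x2 / x3)))) / (x3 powi (-3) * B' / (a * g))"
      if "x2 \<noteq> 0" "x3 \<noteq> 0" "g \<noteq> 0" for a b g x2 x3 A' B' :: complex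
      using that by (cases "a = 0"; cases "b = 0"; cases "B' = 0") (simp_all add: power_int_minus field_simps eval_nat_numeral)
    have "theta_coeff Q w 2 1 3 = w $ 2 powi (-3) * A / (theta (w $ 1 / w $ 2) Q * (- theta (w $ 2 / w $ 3) Q / (w $ 2 / w $ 3)))"
      unfolding theta_coeff_def A_def e6 by (simp only: mult.commute)
    moreover have "theta_coeff Q w 3 1 2 = w $ 3 powi (-3) * B / (theta (w $ 1 / w $ 3) Q * theta (w $ 2 / w $ 3) Q)"
      unfolding theta_coeff_def B_def by (simp only: mult.commute)
    ultimately show ?thesis using alg2[OF w0 w0 gen(3)] by simp
  qed
  finally show ?thesis .
qed

text \<open>The gamma factors that divide \<open>V_fun\<close> are \<open>pairg\<close> at
  \<open>m = n $ 3\<close>, \<open>z = t $ 3\<close>. Hence \<open>pairg_shift\<close> governs them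
  as well, with the \<open>tau\<close> variable of index 3 in the role of the integration
  variable.\<close>

lemma U_fun_Vint:
  assumes "t \<in> balanced p q" "\<And>a. norm (t $ a) < 1"
  shows "U_fun r p q \<epsilon> n t = qpoch_inf (p ^ r) (p ^ r) * qpoch_inf (q ^ r) (q ^ r) / (4 * of_real pi * \<i>) * Vint \<epsilon> n t
      / (pairg (t $ 1) (n $ 1) \<epsilon> (n $ 3) (t $ 3) * pairg (t $ 2) (n $ 2) \<epsilon> (n $ 3) (t $ 3))"
proof -
  have k: "k + n $ 3 + \<epsilon> = k + \<epsilon> + n $ 3" for k by simp
  have "(\<Prod>k\<in>{1, 2}. rg (t $ k * t $ 3) (n $ k + n $ 3 + \<epsilon>) * rg (t $ k / t $ 3) (n $ k - n $ 3))
     = pairg (t $ 1) (n $ 1) \<epsilon> (n $ 3) (t $ 3) * pairg (t $ 2) (n $ 2) \<epsilon> (n $ 3) (t $ 3)"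
    unfolding pairg_def k by simp
  then show ?thesis unfolding U_fun_def V_fun_props(2)[OF assms] V_integral_Vint by simp
qed

end

context rarefied_shifted
begin

lemma shift2_scale_at: "i \<noteq> j \<Longrightarrow> shift2 i j = scale_at p j (scale_at p i u)"
  by (auto simp: vec_eq_iff shift2_def scale_at_def)

lemma nshift2_dec_at: "i \<noteq> j \<Longrightarrow> nshift2 i j = dec_at j (dec_at i \<nu>)"
  by (auto simp: vec_eq_iff nshift2_def dec_at_def)

lemma prod_u: "(\<Prod>a\<in>UNIV. u $ a) = q\<^sup>2"
proof -
  have "(\<Prod>a\<in>UNIV. u $ a) = exp (2 * LQ)" unfolding u l_sum[symmetric] by (simp only: exp_sum[OF finite])
  then show ?thesis by (simp add: exp_double exp_LQ)
qed

lemma scaled_balanced: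
  "scale_at p j (scale_at p i u) \<in> balanced p q" "norm (scale_at p j (scale_at p i u) $ a) < 1"
proof -
  have pr: "(\<Prod>a\<in>UNIV. scale_at c k v $ a) = c * (\<Prod>a\<in>UNIV. v $ a)" for c k and v :: "complex ^ 8"
    unfolding scale_at_def prod_factor_at[of k, symmetric] by (rule prod.cong) auto
  show "scale_at p j (scale_at p i u) \<in> balanced p q"
    unfolding balanced_def by (simp add: pr prod_u power2_eq_square)
  show "norm (scale_at p j (scale_at p i u) $ a) < 1"
    using norm_scale_at[of "scale_at p i u" a j] norm_scale_at[of u a i] u_nz[of a] u_lt[of a] by simp
qed

abbreviation "\<kappa> a \<equiv> kap \<epsilon> (\<nu> $ a) (u $ a)"

text \<open>In the two terms, \<open>u $ i\<close> is shifted once and then either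
  \<open>u $ i\<close> again or \<open>u $ j\<close>. The contiguous relation at
  \<open>scale_at p i u\<close> with third index 3 turns their difference into the integral with
  \<open>i\<close> and 3 shifted. The denominators of \<open>U_fun\<close> contribute precisely the
  coefficients of that relation. The conditions \<open>norm (u $ i) < norm (u $ 3)\<close> and
  \<open>norm (u $ j) < norm (u $ 3)\<close> keep the quotients in the disc where
  \<open>pairg_shift\<close> holds.\<close>

lemma U_difference:
  assumes ij: "i \<noteq> j" "i \<noteq> 3" "j \<noteq> 3"
    and lt: "norm (u $ i) < norm (u $ 3)" "norm (u $ j) < norm (u $ 3)"
    and gen: "theta ((tv 3)\<^sup>2) (q ^ r) \<noteq> 0" "theta (tv 3 * tv j) (q ^ r) \<noteq> 0" "theta (tv 3 / tv j) (q ^ r) \<noteq> 0"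
    and t2: "th2 (q ^ r) (tv i) (tv 3) \<noteq> 0" "th2 (q ^ r) (tv j) (tv 3) \<noteq> 0" "th2 (q ^ r) (p * q * tv i) (tv 3) \<noteq> 0"
    and d: "pairg (u $ i) (\<nu> $ i) \<epsilon> (\<nu> $ 3) (u $ 3) \<noteq> 0" "pairg (u $ j) (\<nu> $ j) \<epsilon> (\<nu> $ 3) (u $ 3) \<noteq> 0"
  defines "den v m \<equiv> pairg (v $ i) (m $ i) \<epsilon> (m $ 3) (v $ 3) * pairg (v $ j) (m $ j) \<epsilon> (m $ 3) (v $ 3)"
    and "S \<equiv> \<kappa> i * \<kappa> j * \<kappa> 3 * (YY \<epsilon> (\<nu> $ 3) (u $ 3))\<^sup>2 * (pairg (u $ i) (\<nu> $ i) \<epsilon> (\<nu> $ 3) (u $ 3) * pairg (u $ j) (\<nu> $ j) \<epsilon> (\<nu> $ 3) (u $ 3))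
      * (th2 (q ^ r) (tv i) (tv 3) * th2 (q ^ r) (tv j) (tv 3))"
  shows "Vint \<epsilon> (nshift2 i j) (shift2 i j) / den (shift2 i j) (nshift2 i j) = \<kappa> 3 * Vint \<epsilon> (nshift2 i j) (shift2 i j) / S"
    and "Vint \<epsilon> (dec_at i (dec_at i \<nu>)) (scale_at p i (scale_at p i u)) / den (scale_at p i (scale_at p i u)) (dec_at i (dec_at i \<nu>))
        - Vint \<epsilon> (nshift2 i j) (shift2 i j) / den (shift2 i j) (nshift2 i j)
      = - (tv j / tv 3) * th2 (q ^ r) (p * q * tv i) (tv j) / th2 (q ^ r) (p * q * tv i) (tv 3) * (\<kappa> j * Vint \<epsilon> (nshift2 i 3) (shift2 i 3)) / S"
proof -
  define Q where "Q = q ^ r"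
  define y where "y = YY \<epsilon> (\<nu> $ 3) (u $ 3)"
  define D where "D = (\<lambda>a. pairg (u $ a) (\<nu> $ a) \<epsilon> (\<nu> $ 3) (u $ 3))"
  \<comment> \<open>The \<open>kap\<close> factor of coordinate \<open>i\<close> after its first
    shift.\<close>
  define \<kappa>' where "\<kappa>' = kap \<epsilon> (\<nu> $ i - 1) (p * u $ i)"
  have y0: "y \<noteq> 0" and k0: "\<kappa> a \<noteq> 0" "\<kappa>' \<noteq> 0" for a
    unfolding y_def \<kappa>'_def using YY_nz kap_nz u_nz p_nz by auto
  have lt': "norm (u $ a * u $ 3) < 1" "norm (u $ a / u $ 3) < 1" "norm (p * u $ a * u $ 3) < 1" "norm (p * u $ a / u $ 3) < 1"
    if "a = i \<or> a = j" for a
  proof -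
    have a: "norm (u $ a) < norm (u $ 3)" using that lt by auto
    have 1: "norm (u $ a) * norm (u $ 3) < 1" using mult_strict_mono[OF u_lt[of a] u_lt[of 3]] by simp
    have 2: "norm (u $ a) / norm (u $ 3) < 1" using a u_nz[of 3] by simp
    show "norm (u $ a * u $ 3) < 1" "norm (u $ a / u $ 3) < 1" using 1 2 by (simp_all add: norm_mult norm_divide)
    have "norm p * (norm (u $ a) * norm (u $ 3)) < 1" "norm p * (norm (u $ a) / norm (u $ 3)) < 1"
      using mult_strict_mono[OF p_lt 1] mult_strict_mono[OF p_lt 2] by simp_all
    then show "norm (p * u $ a * u $ 3) < 1" "norm (p * u $ a / u $ 3) < 1" by (simp_all add: norm_mult norm_divide mult.assoc)
  qed
  have p1: "pairg (p * u $ a) (\<nu> $ a - 1) \<epsilon> (\<nu> $ 3) (u $ 3) = \<kappa> a * y * th2 Q (tv a) (tv 3) * D a" if "a = i \<or> a = j" for a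
    unfolding y_def D_def Q_def by (rule pairg_shift) (use that u_nz lt' in auto)
  have p2: "pairg (p * (p * u $ i)) (\<nu> $ i - 1 - 1) \<epsilon> (\<nu> $ 3) (u $ 3) = \<kappa>' * y * th2 Q (p * q * tv i) (tv 3) * (\<kappa> i * y * th2 Q (tv i) (tv 3) * D i)"
  proof -
    have "pairg (p * (p * u $ i)) (\<nu> $ i - 1 - 1) \<epsilon> (\<nu> $ 3) (u $ 3)
      = \<kappa>' * y * th2 Q (tau \<epsilon> (\<nu> $ i - 1) (p * u $ i)) (tv 3) * pairg (p * u $ i) (\<nu> $ i - 1) \<epsilon> (\<nu> $ 3) (u $ 3)"
      unfolding y_def \<kappa>'_def Q_def by (rule pairg_shift) (use p_nz u_nz lt' in auto)
    moreover have "pairg (p * u $ i) (\<nu> $ i - 1) \<epsilon> (\<nu> $ 3) (u $ 3) = \<kappa> i * y * th2 Q (tv i) (tv 3) * D i" by (rule p1) simp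
    ultimately show ?thesis by (simp only: tau_shift)
  qed
  have den1: "den (shift2 i j) (nshift2 i j) = (\<kappa> i * y * th2 Q (tv i) (tv 3) * D i) * (\<kappa> j * y * th2 Q (tv j) (tv 3) * D j)"
    using ij p1[of i] p1[of j] by (simp add: den_def shift2_def nshift2_def)
  have den2: "den (scale_at p i (scale_at p i u)) (dec_at i (dec_at i \<nu>)) = (\<kappa>' * y * th2 Q (p * q * tv i) (tv 3) * (\<kappa> i * y * th2 Q (tv i) (tv 3) * D i)) * D j"
    using ij p2 by (simp add: den_def scale_at_def dec_at_def D_def)
  have S: "S = \<kappa> 3 * ((\<kappa> i * y * th2 Q (tv i) (tv 3) * D i) * (\<kappa> j * y * th2 Q (tv j) (tv 3) * D j))"
    unfolding S_def y_def[symmetric] Q_def[symmetric] D_def by (simp add: power2_eq_square)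
  show 1: "Vint \<epsilon> (nshift2 i j) (shift2 i j) / den (shift2 i j) (nshift2 i j) = \<kappa> 3 * Vint \<epsilon> (nshift2 i j) (shift2 i j) / S"
    unfolding den1 S using k0(1)[of 3] by simp
  define V1 where "V1 = Vint \<epsilon> (dec_at i (dec_at i \<nu>)) (scale_at p i (scale_at p i u))"
  define V2 where "V2 = Vint \<epsilon> (nshift2 i j) (shift2 i j)"
  define V3 where "V3 = Vint \<epsilon> (nshift2 i 3) (shift2 i 3)"
  have c: "V1 / \<kappa>' * th2 Q (tv j) (tv 3) - V2 / \<kappa> j * th2 Q (p * q * tv i) (tv 3)
     = - (tv j / tv 3) * th2 Q (p * q * tv i) (tv j) * (V3 / \<kappa> 3)"
  proof -
    have v: "0 < norm (scale_at p i u $ a)" "norm (scale_at p i u $ a) < 1" for a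
      using norm_scale_at[of u a i] u_nz[of a] u_lt[of a] by simp_all
    have T: "tau \<epsilon> (dec_at i \<nu> $ i) (scale_at p i u $ i) = p * q * tv i" "kap \<epsilon> (dec_at i \<nu> $ i) (scale_at p i u $ i) = \<kappa>'"
      "a \<noteq> i \<Longrightarrow> tau \<epsilon> (dec_at i \<nu> $ a) (scale_at p i u $ a) = tv a" "a \<noteq> i \<Longrightarrow> kap \<epsilon> (dec_at i \<nu> $ a) (scale_at p i u $ a) = \<kappa> a" for a
      by (simp_all add: scale_at_def dec_at_def tau_shift \<kappa>'_def)
    note T' = T(1,2) T(3,4)[OF ij(1)[symmetric]] T(3,4)[OF ij(2)[symmetric]]
    from Vint_contiguous[OF v, where k = 3 and j = j and i = i and n = "dec_at i \<nu>" and \<epsilon> = \<epsilon>, unfolded T', OF gen]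
    show ?thesis unfolding V1_def V2_def V3_def Q_def shift2_scale_at[OF ij(1)] nshift2_dec_at[OF ij(1)]
      shift2_scale_at[OF ij(2)] nshift2_dec_at[OF ij(2)] .
  qed
  have alg: "V1 / (k' * y * t' * (ki * y * ti * Di) * Dj) - V2 / ((ki * y * ti * Di) * (kj * y * tj * Dj))
     = (V1 / k' * tj - V2 / kj * t') / (ki * y * ti * Di * y * Dj * t' * tj)"
    if "k' \<noteq> 0" "y \<noteq> 0" "t' \<noteq> 0" "ki \<noteq> 0" "ti \<noteq> 0" "Di \<noteq> 0" "Dj \<noteq> 0" "kj \<noteq> 0" "tj \<noteq> 0"
    for V1 V2 k' y t' ki ti Di Dj kj tj :: complex
    using that by (simp add: field_simps)
  have alg2: "X * t12 * (V3 / k3) / (ki * y * ti * Di * y * Dj * t' * tj)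
     = X * t12 / t' * (kj * V3) / (k3 * ((ki * y * ti * Di) * (kj * y * tj * Dj)))" if "kj \<noteq> 0"
    for X t12 V3 k3 ki y ti Di Dj t' tj kj :: complex
    using that by (simp add: field_simps)
  have nz: "D i \<noteq> 0" "D j \<noteq> 0" "th2 Q (tv i) (tv 3) \<noteq> 0" "th2 Q (tv j) (tv 3) \<noteq> 0" "th2 Q (p * q * tv i) (tv 3) \<noteq> 0"
    using d t2 by (simp_all add: D_def Q_def)
  show "V1 / den (scale_at p i (scale_at p i u)) (dec_at i (dec_at i \<nu>)) - V2 / den (shift2 i j) (nshift2 i j)
      = - (tv j / tv 3) * th2 (q ^ r) (p * q * tv i) (tv j) / th2 (q ^ r) (p * q * tv i) (tv 3) * (\<kappa> j * V3) / S"
    unfolding den1 den2 S Q_def[symmetric]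
    unfolding alg[OF k0(2) y0 nz(5) k0(1) nz(3) nz(1) nz(2) k0(1) nz(4)] c
    by (rule alg2) (rule k0(1))
qed

text \<open>Seen from \<open>u\<close>, the three values of \<open>U_fun\<close> belong to the
  shifts of 1 twice, of 1 and 2, and of 2 twice. Both differences become integrals with 3 shifted,
  and \<open>three_term\<close>, divided by the coefficient of the integral with 1 and 2 shifted,
  closes the relation.\<close>

lemma equation_on_region:
  defines "t \<equiv> shift2 1 2" and "n \<equiv> nshift2 1 2"
  assumes lt: "norm (u $ 1) < norm (u $ 3)" "norm (u $ 2) < norm (u $ 3)"
    and gen: "\<And>i. i \<in> {1,2,3} \<Longrightarrow> theta ((tv i)\<^sup>2) (q ^ r) \<noteq> 0"
       "\<And>i j. i \<in> {1,2,3} \<Longrightarrow> j \<in> {1,2,3} \<Longrightarrow> i \<noteq> j \<Longrightarrow> theta (tv i * tv j) (q ^ r) \<noteq> 0 \<and> theta (tv i / tv j) (q ^ r) \<noteq> 0"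
       "\<And>a. a \<in> {4,5,6,7,8} \<Longrightarrow> theta (tv a * tv 3) (q ^ r) \<noteq> 0"
       "\<And>i j. (i, j) \<in> {(1,2), (1,3), (2,1), (2,3)} \<Longrightarrow> th2 (q ^ r) (p * q * tv i) (tv j) \<noteq> 0"
    and d: "\<And>i. i \<in> {1,2} \<Longrightarrow> pairg (u $ i) (\<nu> $ i) \<epsilon> (\<nu> $ 3) (u $ 3) \<noteq> 0"
  shows "A_fun r p q (A_args qh \<epsilon> n t)
           * (U_fun r p q \<epsilon> (upd12 (n $ 1 - 1) (n $ 2 + 1) n) (upd12 (p * t $ 1) (inverse p * t $ 2) t)
              - U_fun r p q \<epsilon> n t)
       + A_fun r p q (upd12 (A_args qh \<epsilon> n t $ 2) (A_args qh \<epsilon> n t $ 1) (A_args qh \<epsilon> n t))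
           * (U_fun r p q \<epsilon> (upd12 (n $ 1 + 1) (n $ 2 - 1) n) (upd12 (inverse p * t $ 1) (p * t $ 2) t)
              - U_fun r p q \<epsilon> n t)
       + U_fun r p q \<epsilon> n t = 0"
proof -
  define Q where "Q = q ^ r"
  define K where "K = qpoch_inf (p ^ r) (p ^ r) * qpoch_inf (q ^ r) (q ^ r) / (4 * of_real pi * \<i>)"
  define w :: "complex ^ 8" where "w = (\<chi> a. tv a)"
  define w' where "w' = upd12 (w $ 2) (w $ 1) w"
  define den where "den = (\<lambda>(i::8) (j::8) (v :: complex ^ 8) (m :: int ^ 8). pairg (v $ i) (m $ i) \<epsilon> (m $ 3) (v $ 3) * pairg (v $ j) (m $ j) \<epsilon> (m $ 3) (v $ 3))"
  have den_swap: "den 2 1 v m = den 1 2 v m" for v m by (simp add: den_def mult.commute)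
  define S where "S = \<kappa> 1 * \<kappa> 2 * \<kappa> 3 * (YY \<epsilon> (\<nu> $ 3) (u $ 3))\<^sup>2 * (pairg (u $ 1) (\<nu> $ 1) \<epsilon> (\<nu> $ 3) (u $ 3) * pairg (u $ 2) (\<nu> $ 2) \<epsilon> (\<nu> $ 3) (u $ 3))
      * (th2 Q (tv 1) (tv 3) * th2 Q (tv 2) (tv 3))"
  define V12 where "V12 = Vint \<epsilon> n t"
  define V13 where "V13 = Vint \<epsilon> (nshift2 1 3) (shift2 1 3)"
  define V23 where "V23 = Vint \<epsilon> (nshift2 2 3) (shift2 2 3)"
  define c1 where "c1 = theta_coeff Q w 1 2 3"
  define c2 where "c2 = theta_coeff Q w 2 1 3"
  define c3 where "c3 = theta_coeff Q w 3 1 2"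
  have k0: "\<kappa> a \<noteq> 0" for a using kap_nz u_nz by blast
  have wn: "w $ a = tv a" for a by (simp add: w_def)
  have w0: "w $ a \<noteq> 0" for a unfolding wn using tau_nz u_nz by blast
  have prw: "(\<Prod>a\<in>UNIV. w $ a) = 1" using prod_tv unfolding w_def .
  have prw': "(\<Prod>a\<in>UNIV. w' $ a) = 1"
    using prw unfolding prod_8 w'_def by (simp add: upd12_nth mult_ac)
  have ne: "1 \<noteq> (2::8)" "1 \<noteq> (3::8)" "2 \<noteq> (3::8)" by simp_all
  have tn: "t = scale_at p 2 (scale_at p 1 u)" "n = dec_at 2 (dec_at 1 \<nu>)"
    unfolding t_def n_def shift2_scale_at[OF ne(1)] nshift2_dec_at[OF ne(1)] by (rule refl)+
  have sym: "shift2 2 1 = t" "nshift2 2 1 = n"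
    unfolding t_def n_def by (auto simp: shift2_def nshift2_def vec_eq_iff)
  have t1: "upd12 (n $ 1 - 1) (n $ 2 + 1) n = dec_at 1 (dec_at 1 \<nu>)" "upd12 (p * t $ 1) (inverse p * t $ 2) t = scale_at p 1 (scale_at p 1 u)"
    "upd12 (n $ 1 + 1) (n $ 2 - 1) n = dec_at 2 (dec_at 2 \<nu>)" "upd12 (inverse p * t $ 1) (p * t $ 2) t = scale_at p 2 (scale_at p 2 u)"
    unfolding tn using p_nz by (auto simp: vec_eq_iff upd12_nth scale_at_def dec_at_def)
  have U: "U_fun r p q \<epsilon> m (scale_at p j (scale_at p i u)) = K * (Vint \<epsilon> m (scale_at p j (scale_at p i u)) / den 1 2 (scale_at p j (scale_at p i u)) m)" for i j m
    unfolding U_fun_Vint[OF scaled_balanced] K_def den_def by simp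
  have Ut: "U_fun r p q \<epsilon> n t = K * (V12 / den 1 2 t n)" unfolding V12_def tn U ..
  have t2nz: "th2 Q (tv 1) (tv 3) \<noteq> 0" "th2 Q (tv 2) (tv 3) \<noteq> 0" "th2 Q (p * q * tv 1) (tv 3) \<noteq> 0" "th2 Q (p * q * tv 2) (tv 3) \<noteq> 0"
    "th2 Q (p * q * tv 1) (tv 2) \<noteq> 0" "th2 Q (p * q * tv 2) (tv 1) \<noteq> 0"
    using gen(2)[of 1 3] gen(2)[of 2 3] gen(4)[of 1 3] gen(4)[of 2 3] gen(4)[of 1 2] gen(4)[of 2 1] by (auto simp: th2_def Q_def)
  have S0: "S \<noteq> 0" unfolding S_def using k0 t2nz d YY_nz[OF u_nz] by auto
  have U12: "V12 / den 1 2 t n = \<kappa> 3 * V12 / S"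
    and U1: "Vint \<epsilon> (dec_at 1 (dec_at 1 \<nu>)) (scale_at p 1 (scale_at p 1 u)) / den 1 2 (scale_at p 1 (scale_at p 1 u)) (dec_at 1 (dec_at 1 \<nu>)) - V12 / den 1 2 t n
      = - (w $ 2 / w $ 3) * th2 Q (p * q * w $ 1) (w $ 2) / th2 Q (p * q * w $ 1) (w $ 3) * (\<kappa> 2 * V13) / S"
  proof -
    have a: "theta ((tv 3)\<^sup>2) (q ^ r) \<noteq> 0" "theta (tv 3 * tv 2) (q ^ r) \<noteq> 0" "theta (tv 3 / tv 2) (q ^ r) \<noteq> 0"
      using gen(1)[of 3] gen(2)[of 3 2] by auto
    have d': "pairg (u $ 1) (\<nu> $ 1) \<epsilon> (\<nu> $ 3) (u $ 3) \<noteq> 0" "pairg (u $ 2) (\<nu> $ 2) \<epsilon> (\<nu> $ 3) (u $ 3) \<noteq> 0" using d by auto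
    note X = U_difference[OF ne(1-3) lt a t2nz(1,2,3)[unfolded Q_def] d', folded Q_def]
    show "V12 / den 1 2 t n = \<kappa> 3 * V12 / S" using X(1) unfolding V12_def t_def n_def den_def S_def .
    show "Vint \<epsilon> (dec_at 1 (dec_at 1 \<nu>)) (scale_at p 1 (scale_at p 1 u)) / den 1 2 (scale_at p 1 (scale_at p 1 u)) (dec_at 1 (dec_at 1 \<nu>)) - V12 / den 1 2 t n
      = - (w $ 2 / w $ 3) * th2 Q (p * q * w $ 1) (w $ 2) / th2 Q (p * q * w $ 1) (w $ 3) * (\<kappa> 2 * V13) / S"
      using X(2) unfolding V12_def V13_def t_def n_def den_def S_def wn .
  qed
  have U2: "Vint \<epsilon> (dec_at 2 (dec_at 2 \<nu>)) (scale_at p 2 (scale_at p 2 u)) / den 1 2 (scale_at p 2 (scale_at p 2 u)) (dec_at 2 (dec_at 2 \<nu>)) - V12 / den 1 2 t n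
      = - (w $ 1 / w $ 3) * th2 Q (p * q * w $ 2) (w $ 1) / th2 Q (p * q * w $ 2) (w $ 3) * (\<kappa> 1 * V23) / S"
  proof -
    have a: "theta ((tv 3)\<^sup>2) (q ^ r) \<noteq> 0" "theta (tv 3 * tv 1) (q ^ r) \<noteq> 0" "theta (tv 3 / tv 1) (q ^ r) \<noteq> 0"
      using gen(1)[of 3] gen(2)[of 3 1] by auto
    have d': "pairg (u $ 1) (\<nu> $ 1) \<epsilon> (\<nu> $ 3) (u $ 3) \<noteq> 0" "pairg (u $ 2) (\<nu> $ 2) \<epsilon> (\<nu> $ 3) (u $ 3) \<noteq> 0" using d by auto
    have ne': "2 \<noteq> (1::8)" by simp
    note X = U_difference(2)[OF ne' ne(3,2) lt(2,1) a t2nz(2,1,4)[unfolded Q_def] d'(2,1), folded Q_def]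
    have S': "\<kappa> 2 * \<kappa> 1 * \<kappa> 3 * (YY \<epsilon> (\<nu> $ 3) (u $ 3))\<^sup>2 * (pairg (u $ 2) (\<nu> $ 2) \<epsilon> (\<nu> $ 3) (u $ 3) * pairg (u $ 1) (\<nu> $ 1) \<epsilon> (\<nu> $ 3) (u $ 3))
      * (th2 Q (tv 2) (tv 3) * th2 Q (tv 1) (tv 3)) = S"
      unfolding S_def by (simp only: mult_ac)
    show ?thesis using X unfolding S' unfolding sym den_swap[unfolded den_def] V12_def V23_def den_def wn .
  qed
  have args: "A_args qh \<epsilon> n t = upd12 (p * q * w $ 1) (p * q * w $ 2) w"
    unfolding A_args_tau tn by (auto simp: vec_eq_iff upd12_nth scale_at_def dec_at_def tau_shift w_def)
  have args': "upd12 (A_args qh \<epsilon> n t $ 2) (A_args qh \<epsilon> n t $ 1) (A_args qh \<epsilon> n t) = upd12 (p * q * w' $ 1) (p * q * w' $ 2) w'"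
    unfolding args w'_def by (auto simp: vec_eq_iff upd12_nth)
  have A1: "A_fun r p q (A_args qh \<epsilon> n t) * (- (w $ 2 / w $ 3)) * th2 Q (p * q * w $ 1) (w $ 2) / th2 Q (p * q * w $ 1) (w $ 3) = c2 / c3"
    unfolding args c2_def c3_def Q_def
    by (rule A_fun_coefficient[OF prw]) (use t2nz gen(2)[of 2 3] in \<open>auto simp: wn Q_def\<close>)
  \<comment> \<open>The second coefficient is the first with the indices 1 and 2 exchanged, hence
    the swapped vector \<open>w'\<close>.\<close>
  have A2: "A_fun r p q (upd12 (A_args qh \<epsilon> n t $ 2) (A_args qh \<epsilon> n t $ 1) (A_args qh \<epsilon> n t)) * (- (w $ 1 / w $ 3)) * th2 Q (p * q * w $ 2) (w $ 1) / th2 Q (p * q * w $ 2) (w $ 3) = c1 / c3"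
  proof -
    have w'n: "w' $ 1 = w $ 2" "w' $ 2 = w $ 1" "w' $ 3 = w $ 3" by (simp_all add: w'_def upd12_nth)
    have "(\<Prod>a\<in>{4,5,6,7,8}. theta (w' $ a * y) Q) = (\<Prod>a\<in>{4,5,6,7,8}. theta (w $ a * y) Q)" for y
      by (rule prod.cong) (auto simp: w'_def upd12_nth)
    then have c: "theta_coeff Q w' 2 1 3 = c1" "theta_coeff Q w' 3 1 2 = c3"
      unfolding theta_coeff_def c1_def c3_def w'n by (simp_all add: mult.commute)
    have "A_fun r p q (upd12 (p * q * w' $ 1) (p * q * w' $ 2) w') * (- (w' $ 2 / w' $ 3)) * th2 Q (p * q * w' $ 1) (w' $ 2) / th2 Q (p * q * w' $ 1) (w' $ 3)
       = theta_coeff Q w' 2 1 3 / theta_coeff Q w' 3 1 2"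
      unfolding Q_def by (rule A_fun_coefficient[OF prw']) (use t2nz gen(2)[of 1 3] in \<open>auto simp: w'n wn Q_def\<close>)
    then show ?thesis unfolding args' c w'n .
  qed
  have c30: "c3 \<noteq> 0"
  proof -
    have "(\<Prod>a\<in>{4,5,6,7,8}. theta (w $ a * w $ 3) Q) \<noteq> 0" using gen(3) by (auto simp: wn Q_def)
    moreover have "theta (w $ 1 / w $ 3) Q \<noteq> 0" "theta (w $ 2 / w $ 3) Q \<noteq> 0" using gen(2)[of 1 3] gen(2)[of 2 3] by (auto simp: wn Q_def)
    ultimately show ?thesis unfolding c3_def theta_coeff_def using w0[of 3] by simp
  qed
  have tt: "c1 / (\<kappa> 2 * \<kappa> 3) * V23 + c2 / (\<kappa> 1 * \<kappa> 3) * V13 + c3 / (\<kappa> 1 * \<kappa> 2) * V12 = 0"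
    using three_term[OF gen(1,2)] unfolding V12_def V13_def V23_def t_def n_def c1_def c2_def c3_def Q_def w_def .
  have alg: "A1 * (K * (b1 * (k2 * V13) / S)) + A2 * (K * (b2 * (k1 * V23) / S)) + K * (k3 * V12 / S)
     = K / S * ((A1 * b1) * k2 * V13 + (A2 * b2) * k1 * V23 + k3 * V12)" for A1 A2 b1 b2 k1 k2 k3 :: complex
    by (simp add: field_simps add_divide_distrib)
  have b1: "A_fun r p q (A_args qh \<epsilon> n t) * (- (w $ 2 / w $ 3) * th2 Q (p * q * w $ 1) (w $ 2) / th2 Q (p * q * w $ 1) (w $ 3)) = c2 / c3"
    unfolding A1[symmetric] by simp
  have b2: "A_fun r p q (upd12 (A_args qh \<epsilon> n t $ 2) (A_args qh \<epsilon> n t $ 1) (A_args qh \<epsilon> n t)) * (- (w $ 1 / w $ 3) * th2 Q (p * q * w $ 2) (w $ 1) / th2 Q (p * q * w $ 2) (w $ 3)) = c1 / c3"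
    unfolding A2[symmetric] by simp
  have "c2 / c3 * \<kappa> 2 * V13 + c1 / c3 * \<kappa> 1 * V23 + \<kappa> 3 * V12
     = \<kappa> 1 * \<kappa> 2 * \<kappa> 3 / c3 * (c1 / (\<kappa> 2 * \<kappa> 3) * V23 + c2 / (\<kappa> 1 * \<kappa> 3) * V13 + c3 / (\<kappa> 1 * \<kappa> 2) * V12)"
    using k0[of 1] k0[of 2] k0[of 3] c30 by (simp add: field_simps)
  then have fin: "c2 / c3 * \<kappa> 2 * V13 + c1 / c3 * \<kappa> 1 * V23 + \<kappa> 3 * V12 = 0" unfolding tt by simp
  have r1: "U_fun r p q \<epsilon> (dec_at 1 (dec_at 1 \<nu>)) (scale_at p 1 (scale_at p 1 u)) - U_fun r p q \<epsilon> n t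
     = K * (- (w $ 2 / w $ 3) * th2 Q (p * q * w $ 1) (w $ 2) / th2 Q (p * q * w $ 1) (w $ 3) * (\<kappa> 2 * V13) / S)"
    unfolding U Ut right_diff_distrib[symmetric] U1 ..
  have r2: "U_fun r p q \<epsilon> (dec_at 2 (dec_at 2 \<nu>)) (scale_at p 2 (scale_at p 2 u)) - U_fun r p q \<epsilon> n t
     = K * (- (w $ 1 / w $ 3) * th2 Q (p * q * w $ 2) (w $ 1) / th2 Q (p * q * w $ 2) (w $ 3) * (\<kappa> 1 * V23) / S)"
    unfolding U Ut right_diff_distrib[symmetric] U2 ..
  have r3: "U_fun r p q \<epsilon> n t = K * (\<kappa> 3 * V12 / S)" unfolding Ut U12 ..
  show ?thesis unfolding t1 r1 r2 unfolding r3 alg b1 b2 fin by simp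
qed

end

section \<open>A generic point\<close>

lemma dpoch_eq_0D:
  assumes "norm p < 1" "norm q < 1" "dpoch z p q = 0"
  shows "\<exists>i j. z * p ^ i * q ^ j = 1"
proof -
  have "\<exists>i. qpoch_inf (z * p ^ i) q = 0"
    using assms(3) unfolding dpoch_def by (subst (asm) eprod_eq_0_iff) (use assms in \<open>auto intro!: qpoch_holo\<close>)
  then show ?thesis using qpoch_eq_0_iff[OF assms(2)] by blast
qed

text \<open>As \<open>e \<noteq> 0\<close>, the value \<open>K * exp (e * s)\<close> determines
  \<open>s\<close>, so each exclusion removes only countably many points of an uncountable
  interval.\<close>

lemma exists_exp_avoiding:
  fixes B :: "real set"
  assumes B: "countable B" and L: "finite L" "\<And>K e. (K, e) \<in> L \<Longrightarrow> K > 0 \<and> e \<noteq> 0" and \<delta>: "\<delta> > 0"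
  shows "\<exists>s. 0 < s \<and> s < \<delta> \<and> (\<forall>(K, e)\<in>L. K * exp (e * s) \<notin> B)"
proof -
  let ?bad = "\<Union>(K, e)\<in>L. (\<lambda>y. ln (y / K) / e) ` B"
  have "countable ?bad" using B L(1) by (intro countable_UN) (auto simp: countable_finite)
  moreover have "uncountable {0<..<\<delta>}" using \<delta> by (simp add: uncountable_open_interval)
  ultimately have "\<not> {0<..<\<delta>} \<subseteq> ?bad" using countable_subset by blast
  then obtain s where "s \<in> {0<..<\<delta>}" and bad: "s \<notin> ?bad" by blast
  then have s: "0 < s" "s < \<delta>" by auto
  have "K * exp (e * s) \<notin> B" if "(K, e) \<in> L" for K e
  proof
    assume "K * exp (e * s) \<in> B"
    moreover have "s = ln (K * exp (e * s) / K) / e" using L(2)[OF that] by simp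
    ultimately have "s \<in> (\<lambda>y. ln (y / K) / e) ` B" by (rule rev_image_eqI)
    then show False using bad that by blast
  qed
  then show ?thesis using s by blast
qed

lemma eventually_nz_nhds:
  fixes f :: "'a::t2_space \<Rightarrow> complex"
  assumes "isCont f x" "f x \<noteq> 0"
  shows "\<forall>\<^sub>F y in nhds x. f y \<noteq> 0"
  using tendsto_imp_eventually_ne[OF assms(1)[unfolded isCont_def] assms(2)] assms(2)
  by (simp add: eventually_nhds_conv_at)

lemma eventually_less_nhds:
  fixes f g :: "'a::t2_space \<Rightarrow> real"
  assumes "isCont f x" "isCont g x" "f x < g x"
  shows "\<forall>\<^sub>F y in nhds x. f y < g y"
proof -
  have "((\<lambda>y. g y - f y) \<longlongrightarrow> g x - f x) (at x)" using assms(1,2) unfolding isCont_def by (rule tendsto_diff[rotated])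
  then have "\<forall>\<^sub>F y in at x. 0 < g y - f y" by (rule order_tendstoD) (use assms(3) in simp)
  then show ?thesis using assms(3) by (simp add: eventually_nhds_conv_at)
qed

context rarefied
begin

text \<open>Zeros of theta functions and of \<open>\<Gamma>\<^sup>(\<^sup>r\<^sup>)\<close> have absolute value in this countable group.\<close>

definition moduli :: "real set" where
  "moduli = range (\<lambda>(i, j). norm p powi i * norm qh powi j)"

lemma qh_nz: "qh \<noteq> 0" using qh q_nz by auto

lemma countable_moduli: "countable moduli" by (simp add: moduli_def)

lemma moduliI: "norm p powi i * norm qh powi j \<in> moduli" unfolding moduli_def by (rule range_eqI[of _ _ "(i, j)"]) simp

lemma moduliE: assumes "x \<in> moduli" obtains i j where "x = norm p powi i * norm qh powi j"
  using assms unfolding moduli_def by auto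

lemma moduli_p: "norm p \<in> moduli" and moduli_qh: "norm qh \<in> moduli"
  using moduliI[of 1 0] moduliI[of 0 1] by simp_all

lemma moduli_mult: assumes "x \<in> moduli" "y \<in> moduli" shows "x * y \<in> moduli"
proof -
  obtain i j i' j' where "x = norm p powi i * norm qh powi j" "y = norm p powi i' * norm qh powi j'"
    using assms by (metis moduliE)
  then have "x * y = norm p powi (i + i') * norm qh powi (j + j')" using p_nz qh_nz by (simp add: power_int_add)
  then show ?thesis using moduliI by simp
qed

lemma moduli_powi: assumes "x \<in> moduli" shows "x powi k \<in> moduli"
proof -
  obtain i j where "x = norm p powi i * norm qh powi j" using assms by (rule moduliE)
  then have "x powi k = norm p powi (i * k) * norm qh powi (j * k)"
    by (simp add: power_int_mult_distrib power_int_mult)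
  then show ?thesis using moduliI by simp
qed

lemma moduli_nz: "x \<in> moduli \<Longrightarrow> x \<noteq> 0" using p_nz qh_nz by (auto elim!: moduliE)

lemma moduli_power: "x \<in> moduli \<Longrightarrow> x ^ k \<in> moduli" using moduli_powi[of x "int k"] by simp

lemma moduli_inverse: "x \<in> moduli \<Longrightarrow> 1 / x \<in> moduli"
  using moduli_powi[of x "-1"] by (simp add: power_int_minus inverse_eq_divide)

lemma moduli_q: "norm q \<in> moduli"
  using moduli_power[OF moduli_qh, of 2] qh by (simp add: norm_power[symmetric])

lemma moduli_1: "1 \<in> moduli" using moduliI[of 0 0] by simp

lemma moduli_cancel: assumes "x \<in> moduli" "x * y \<in> moduli" shows "y \<in> moduli"
  using moduli_mult[OF moduli_inverse[OF assms(1)] assms(2)] moduli_nz[OF assms(1)] by simp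

lemmas moduli_intros = moduli_mult moduli_power moduli_powi moduli_inverse moduli_p moduli_q moduli_qh moduli_1

lemma theta_nz: assumes "y \<noteq> 0" "norm y \<notin> moduli" shows "theta y (q ^ r) \<noteq> 0"
proof
  assume "theta y (q ^ r) = 0"
  then obtain j where "y = (q ^ r) powi j" using theta_eq_0_iff[OF qr_lt qr_nz assms(1)] by blast
  then have "norm y = (norm q ^ r) powi j" by (simp add: norm_power_int norm_power)
  then show False using assms(2) moduli_intros by metis
qed

lemma EE_eq_0D: assumes "EE m y = 0" shows "norm y \<in> moduli"
proof -
  from assms consider i j where "(y * p ^ m) * (p ^ r) ^ i * (p * q) ^ j = 1" | i j where "(y * q ^ (r - m)) * (q ^ r) ^ i * (p * q) ^ j = 1"
  proof -
    have "Dp (y * p ^ m) = 0 \<or> Dq (y * q ^ (r - m)) = 0" using assms by (simp add: EE_def)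
    then show thesis using dpoch_eq_0D[OF pr_lt pq_lt] dpoch_eq_0D[OF qr_lt pq_lt] that by blast
  qed
  then have "\<exists>c. norm c \<in> moduli \<and> c * y = 1"
  proof cases
    case 1
    moreover have "norm (p ^ m * (p ^ r) ^ i * (p * q) ^ j) \<in> moduli"
      unfolding norm_mult norm_power by (intro moduli_intros)
    ultimately show ?thesis by (intro exI[of _ "p ^ m * (p ^ r) ^ i * (p * q) ^ j"]) (simp add: mult_ac)
  next
    case 2
    moreover have "norm (q ^ (r - m) * (q ^ r) ^ i * (p * q) ^ j) \<in> moduli"
      unfolding norm_mult norm_power by (intro moduli_intros)
    ultimately show ?thesis by (intro exI[of _ "q ^ (r - m) * (q ^ r) ^ i * (p * q) ^ j"]) (simp add: mult_ac)
  qed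
  then obtain c where c: "norm c \<in> moduli" "c * y = 1" by blast
  have "norm c * norm y = 1" using c(2) by (simp add: norm_mult[symmetric])
  then show ?thesis using moduli_cancel[OF c(1)] moduli_1 by simp
qed

text \<open>Poles have to be avoided along with zeros, since \<open>rg\<close> takes the value 0 at
  both.\<close>

lemma rg_nz: assumes "y \<noteq> 0" "norm y \<notin> moduli" shows "rg y m \<noteq> 0"
proof
  assume 0: "rg y m = 0"
  obtain C k m0 where c: "C \<noteq> 0" "\<And>z. z \<noteq> 0 \<Longrightarrow> rg z m = C * z powi k * EE (r - m0) (p * q / z) / EE m0 z"
    using rg_canonical[of m] by blast
  have "EE (r - m0) (p * q / y) = 0 \<or> EE m0 y = 0" using 0 c assms(1) by auto
  then have "norm (p * q / y) \<in> moduli \<or> norm y \<in> moduli" using EE_eq_0D by blast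
  moreover have "norm (p * q) * (1 / norm (p * q / y)) = norm y" using pq_nz by (simp add: norm_divide)
  moreover have "norm (p * q) \<in> moduli" unfolding norm_mult by (intro moduli_intros)
  ultimately show False using assms(2) moduli_mult moduli_inverse by metis
qed

lemma tau_moduli: "\<exists>c. norm c \<in> moduli \<and> (\<forall>t. tau \<epsilon> n t = c * t)"
proof (intro exI conjI allI)
  show "norm (1 / qh powi (2 * n + \<epsilon>)) \<in> moduli"
    unfolding norm_divide norm_power_int norm_one by (intro moduli_intros)
qed (simp add: tau_qh)

text \<open>The hypotheses of \<open>equation_on_region\<close>, gathered into one predicate of
  \<open>u\<close> and written so that each condition is visibly open.\<close>

definition good :: "int \<Rightarrow> int ^ 8 \<Rightarrow> complex ^ 8 \<Rightarrow> bool" where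
  "good \<epsilon> \<nu> u \<longleftrightarrow> (let T = (\<lambda>a. tau \<epsilon> (\<nu> $ a) (u $ a)); Q = q ^ r in
     (\<forall>a. u $ a \<noteq> 0) \<and> (\<forall>a. norm (u $ a) < 1) \<and> norm (u $ 1) < norm (u $ 3) \<and> norm (u $ 2) < norm (u $ 3) \<and>
     (\<forall>i\<in>{1,2,3}. theta ((T i)\<^sup>2) Q \<noteq> 0) \<and>
     (\<forall>(i, j)\<in>{(1,2),(1,3),(2,1),(2,3),(3,1),(3,2)}. theta (T i * T j) Q \<noteq> 0 \<and> theta (T i / T j) Q \<noteq> 0) \<and>
     (\<forall>a\<in>{4,5,6,7,8}. theta (T a * T 3) Q \<noteq> 0) \<and>
     (\<forall>(i, j)\<in>{(1,2),(1,3),(2,1),(2,3)}. theta (p * q * T i * T j) Q \<noteq> 0 \<and> theta (p * q * T i / T j) Q \<noteq> 0) \<and>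
     (\<forall>i\<in>{1,2}. rg (u $ i * u $ 3) (\<nu> $ i + \<epsilon> + \<nu> $ 3) \<noteq> 0 \<and> rg (u $ i / u $ 3) (\<nu> $ i - \<nu> $ 3) \<noteq> 0))"

lemma isCont_theta_comp: "isCont f x \<Longrightarrow> f x \<noteq> 0 \<Longrightarrow> isCont (\<lambda>y. theta (f y) (q ^ r)) x"
  by (rule isCont_o2[OF _ isCont_theta[OF qr_lt]])

lemma isCont_rg_comp: "isCont f x \<Longrightarrow> f x \<noteq> 0 \<Longrightarrow> norm (f x) < 1 \<Longrightarrow> isCont (\<lambda>y. rg (f y) m) x"
  by (rule isCont_o2[OF _ isCont_rg]) auto

text \<open>The gamma factors are continuous here because the norm conditions on
  \<open>u $ 1\<close>, \<open>u $ 2\<close>, \<open>u $ 3\<close> place their arguments in the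
  punctured unit disc.\<close>

lemma good_eventually:
  assumes "good \<epsilon> \<nu> u0"
  shows "\<forall>\<^sub>F u in nhds u0. good \<epsilon> \<nu> u"
proof -
  note g = assms[unfolded good_def Let_def]
  have nz: "u0 $ a \<noteq> 0" and T0: "tau \<epsilon> (\<nu> $ a) (u0 $ a) \<noteq> 0" for a using g tau_nz by auto
  have c: "isCont (\<lambda>u :: complex ^ 8. u $ a) u0" for a by (intro continuous_intros)
  have T: "isCont (\<lambda>u :: complex ^ 8. tau \<epsilon> (\<nu> $ a) (u $ a)) u0" for a unfolding tau_def by (intro continuous_intros)
  have lt: "norm (u0 $ a * u0 $ 3) < 1" "norm (u0 $ a / u0 $ 3) < 1" if "a \<in> {1, 2}" for a
  proof -
    have a: "norm (u0 $ a) < 1" "norm (u0 $ 3) < 1" "norm (u0 $ a) < norm (u0 $ 3)" using g that by auto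
    show "norm (u0 $ a * u0 $ 3) < 1" using mult_strict_mono[OF a(1,2)] by (simp add: norm_mult)
    show "norm (u0 $ a / u0 $ 3) < 1" using a(3) nz[of 3] by (simp add: norm_divide)
  qed
  have fin: "\<forall>\<^sub>F u in nhds u0. \<forall>i\<in>A. P i u" if "finite A" "\<And>i. i \<in> A \<Longrightarrow> \<forall>\<^sub>F u in nhds u0. P i u"
    for A and P :: "'b \<Rightarrow> complex ^ 8 \<Rightarrow> bool"
    using that by (simp add: eventually_ball_finite)
  have fin2: "\<forall>\<^sub>F u in nhds u0. \<forall>(i, j)\<in>A. P i j u" if "finite A" "\<And>i j. (i, j) \<in> A \<Longrightarrow> \<forall>\<^sub>F u in nhds u0. P i j u"
    for A and P :: "8 \<Rightarrow> 8 \<Rightarrow> complex ^ 8 \<Rightarrow> bool"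
  proof -
    have "\<forall>\<^sub>F u in nhds u0. \<forall>x\<in>A. P (fst x) (snd x) u" using that by (intro fin) auto
    then show ?thesis by (simp add: case_prod_beta)
  qed
  have e1: "\<forall>\<^sub>F u in nhds u0. \<forall>a. u $ a \<noteq> 0" using nz c eventually_nz_nhds by (intro eventually_all_finite) blast
  have e2: "\<forall>\<^sub>F u in nhds u0. \<forall>a. norm (u $ a) < 1"
    using g by (intro eventually_all_finite eventually_less_nhds continuous_intros) auto
  have e3: "\<forall>\<^sub>F u in nhds u0. norm (u $ 1) < norm (u $ 3)" "\<forall>\<^sub>F u in nhds u0. norm (u $ 2) < norm (u $ 3)"
    using g by (auto intro!: eventually_less_nhds continuous_intros)
  let ?T = "\<lambda>u a. tau \<epsilon> (\<nu> $ a) (u $ a)"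
  have e4: "\<forall>\<^sub>F u in nhds u0. \<forall>i\<in>{1,2,3}. theta ((?T u i)\<^sup>2) (q ^ r) \<noteq> 0"
    using g T0 by (intro fin eventually_nz_nhds isCont_theta_comp continuous_intros T) auto
  have e5: "\<forall>\<^sub>F u in nhds u0. \<forall>(i, j)\<in>{(1,2),(1,3),(2,1),(2,3),(3,1),(3,2)}. theta (?T u i * ?T u j) (q ^ r) \<noteq> 0 \<and> theta (?T u i / ?T u j) (q ^ r) \<noteq> 0"
    using g T0 by (intro fin2 eventually_conj eventually_nz_nhds isCont_theta_comp continuous_intros T) auto
  have e6: "\<forall>\<^sub>F u in nhds u0. \<forall>a\<in>{4,5,6,7,8}. theta (?T u a * ?T u 3) (q ^ r) \<noteq> 0"
    using g T0 by (intro fin eventually_nz_nhds isCont_theta_comp continuous_intros T) auto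
  have e7: "\<forall>\<^sub>F u in nhds u0. \<forall>(i, j)\<in>{(1,2),(1,3),(2,1),(2,3)}. theta (p * q * ?T u i * ?T u j) (q ^ r) \<noteq> 0 \<and> theta (p * q * ?T u i / ?T u j) (q ^ r) \<noteq> 0"
    using g T0 p_nz q_nz by (intro fin2 eventually_conj eventually_nz_nhds isCont_theta_comp continuous_intros T) auto
  have e8: "\<forall>\<^sub>F u in nhds u0. \<forall>i\<in>{1,2}. rg (u $ i * u $ 3) (\<nu> $ i + \<epsilon> + \<nu> $ 3) \<noteq> 0 \<and> rg (u $ i / u $ 3) (\<nu> $ i - \<nu> $ 3) \<noteq> 0"
    using g nz lt by (intro fin eventually_conj eventually_nz_nhds isCont_rg_comp continuous_intros c) auto
  show ?thesis unfolding good_def Let_def by (intro eventually_conj e1 e2 e3 e4 e5 e6 e7 e8)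
qed

lemma good_exists: "\<exists>u. good \<epsilon> \<nu> u \<and> (\<Prod>a\<in>UNIV. u $ a) = q\<^sup>2"
proof -
  \<comment> \<open>One eighth of \<open>ln (norm (q\<^sup>2))\<close>, the share of each
    parameter.\<close>
  define k where "k = ln (norm q) / 4"
  have k: "k < 0" using q_lt q_nz by (simp add: k_def)
  have ReLQ: "Re LQ = 4 * k"
  proof -
    have "exp (Re LQ) = norm q" using exp_LQ norm_exp_eq_Re by metis
    then show ?thesis by (metis k_def ln_exp nonzero_mult_div_cancel_left times_divide_eq_right zero_neq_numeral)
  qed
  \<comment> \<open>These exponents sum to \<open>0\<close>, and no monomial that has to avoid \<open>moduli\<close> has exponent \<open>0\<close>.\<close>
  define E :: "8 \<Rightarrow> real" where "E a = (if a = 1 then -1 else if a = 2 then -3 else if a = 3 then 9 else if a = 8 then -5 else 0)" for a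
  \<comment> \<open>\<open>K = 1\<close> covers quotients of two parameters and
    \<open>K = exp (2 * k)\<close> covers products; \<open>e\<close> is the difference or sum of
    their exponents.\<close>
  define L where "L = (\<lambda>(K, e). (K, real_of_int e)) ` ({1, exp (2 * k)} \<times> ({-20..20} - {0}))"
  \<comment> \<open>The largest exponent is 9, so \<open>s < - k / 9\<close> keeps every
    \<open>k + E a * s\<close> negative and every norm below 1.\<close>
  obtain s where s: "0 < s" "s < - k / 9" and sL: "\<forall>(K, e)\<in>L. K * exp (e * s) \<notin> moduli"
  proof -
    have "finite L" by (simp add: L_def)
    moreover have "K > 0 \<and> e \<noteq> 0" if "(K, e) \<in> L" for K e using that by (auto simp: L_def)
    ultimately show thesis using exists_exp_avoiding[OF countable_moduli, of L "- k / 9"] k that by auto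
  qed
  have av: "exp (of_int e * s) \<notin> moduli" "exp (2 * k + of_int e * s) \<notin> moduli" if "e \<in> {-20..20} - {0}" for e :: int
  proof -
    have "(1, of_int e) \<in> L" "(exp (2 * k), of_int e) \<in> L" unfolding L_def using that by force+
    then show "exp (of_int e * s) \<notin> moduli" "exp (2 * k + of_int e * s) \<notin> moduli"
      using sL by (auto simp: exp_add)
  qed
  \<comment> \<open>The correction at index 8 is purely imaginary since
    \<open>Re (2 * LQ) = 8 * k\<close>; it adjusts the argument of the product without affecting any
    norm.\<close>
  define l :: "8 \<Rightarrow> complex" where "l a = of_real (k + E a * s) + (if a = 8 then 2 * LQ - of_real (8 * k) else 0)" for a
  have ne8: "1 \<noteq> (8::8)" "2 \<noteq> (8::8)" "3 \<noteq> (8::8)" "4 \<noteq> (8::8)" "5 \<noteq> (8::8)" "6 \<noteq> (8::8)" "7 \<noteq> (8::8)" by simp_all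
  have lsum: "(\<Sum>a\<in>UNIV. l a) = 2 * LQ"
  proof -
    have "(\<Sum>a\<in>UNIV. E a) = 0" unfolding UNIV_8 by (simp add: E_def)
    then have "(\<Sum>a\<in>UNIV. k + E a * s) = 8 * k" by (simp add: sum.distrib sum_distrib_right[symmetric])
    then have "(\<Sum>a\<in>UNIV. complex_of_real (k + E a * s)) = of_real (8 * k)" by (simp only: of_real_sum[symmetric])
    then show ?thesis unfolding l_def sum.distrib by simp
  qed
  have Rel: "Re (l a) = k + E a * s" for a by (simp add: l_def ReLQ)
  define u :: "complex ^ 8" where "u = (\<chi> a. exp (l a))"
  have nu: "norm (u $ a) = exp (k + E a * s)" for a by (simp add: u_def Rel)
  have u0: "u $ a \<noteq> 0" for a by (simp add: u_def)
  have pr: "(\<Prod>a\<in>UNIV. u $ a) = q\<^sup>2"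
    unfolding u_def vec_lambda_beta exp_sum[OF finite, symmetric] lsum by (simp add: exp_double exp_LQ)
  have E9: "E a \<le> 9" for a by (simp add: E_def)
  have ult: "norm (u $ a) < 1" for a
  proof -
    have "E a * s \<le> 9 * s" using E9[of a] s by (intro mult_right_mono) auto
    then have "k + E a * s < 0" using s by linarith
    then show ?thesis by (simp add: nu)
  qed
  have M: "norm (u $ a * u $ b) \<notin> moduli" if "E a + E b = of_int e" "e \<in> {-20..20} - {0}" for a b e
  proof -
    have "norm (u $ a * u $ b) = exp (2 * k + (E a + E b) * s)" by (simp add: norm_mult nu exp_add[symmetric] algebra_simps)
    then show ?thesis using av(2)[OF that(2)] that(1) by simp
  qed
  have D: "norm (u $ a / u $ b) \<notin> moduli" if "E a - E b = of_int e" "e \<in> {-20..20} - {0}" for a b e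
  proof -
    have "norm (u $ a / u $ b) = exp ((E a - E b) * s)" by (simp add: norm_divide nu exp_diff[symmetric] algebra_simps)
    then show ?thesis using av(1)[OF that(2)] that(1) by simp
  qed
  let ?T = "\<lambda>a. tau \<epsilon> (\<nu> $ a) (u $ a)"
  have tm: "norm (x * (?T a * ?T b)) \<notin> moduli" if "norm x \<in> moduli" "norm (u $ a * u $ b) \<notin> moduli" for a b x
  proof
    obtain c d where c: "norm c \<in> moduli" "norm d \<in> moduli" "?T a = c * u $ a" "?T b = d * u $ b" using tau_moduli by metis
    assume "norm (x * (?T a * ?T b)) \<in> moduli"
    moreover have "norm (x * (?T a * ?T b)) = (norm x * norm c * norm d) * norm (u $ a * u $ b)" unfolding c by (simp add: norm_mult)
    moreover have "norm x * norm c * norm d \<in> moduli" using c that moduli_mult by blast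
    ultimately show False using that moduli_cancel by metis
  qed
  have td: "norm (x * (?T a / ?T b)) \<notin> moduli" if "norm x \<in> moduli" "norm (u $ a / u $ b) \<notin> moduli" for a b x
  proof
    obtain c d where c: "norm c \<in> moduli" "norm d \<in> moduli" "?T a = c * u $ a" "?T b = d * u $ b" using tau_moduli by metis
    assume "norm (x * (?T a / ?T b)) \<in> moduli"
    moreover have "norm (x * (?T a / ?T b)) = (norm x * norm c * (1 / norm d)) * norm (u $ a / u $ b)" unfolding c by (simp add: norm_mult norm_divide)
    moreover have "norm x * norm c * (1 / norm d) \<in> moduli" using c that moduli_mult moduli_inverse by blast
    ultimately show False using that moduli_cancel by metis
  qed
  have T0: "?T a \<noteq> 0" for a using tau_nz u0 by blast
  have pq: "norm (p * q) \<in> moduli" "norm (1::complex) \<in> moduli" by (simp_all add: norm_mult moduli_intros)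
  have thM: "theta (?T a * ?T b) (q ^ r) \<noteq> 0" "theta (p * q * ?T a * ?T b) (q ^ r) \<noteq> 0" if "norm (u $ a * u $ b) \<notin> moduli" for a b
  proof -
    show "theta (?T a * ?T b) (q ^ r) \<noteq> 0" using tm[OF pq(2) that] T0 by (intro theta_nz) simp_all
    have "theta (p * q * (?T a * ?T b)) (q ^ r) \<noteq> 0" using tm[OF pq(1) that] T0 pq_nz by (intro theta_nz) simp_all
    then show "theta (p * q * ?T a * ?T b) (q ^ r) \<noteq> 0" unfolding mult.assoc .
  qed
  have thD: "theta (?T a / ?T b) (q ^ r) \<noteq> 0" "theta (p * q * ?T a / ?T b) (q ^ r) \<noteq> 0" if "norm (u $ a / u $ b) \<notin> moduli" for a b
  proof -
    show "theta (?T a / ?T b) (q ^ r) \<noteq> 0" using td[OF pq(2) that] T0 by (intro theta_nz) simp_all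
    have "theta (p * q * (?T a / ?T b)) (q ^ r) \<noteq> 0" using td[OF pq(1) that] T0 pq_nz by (intro theta_nz) simp_all
    then show "theta (p * q * ?T a / ?T b) (q ^ r) \<noteq> 0" unfolding times_divide_eq_right .
  qed
  have m: "norm (u $ 1 * u $ 1) \<notin> moduli" "norm (u $ 2 * u $ 2) \<notin> moduli" "norm (u $ 3 * u $ 3) \<notin> moduli"
    "norm (u $ 1 * u $ 2) \<notin> moduli" "norm (u $ 1 * u $ 3) \<notin> moduli" "norm (u $ 2 * u $ 3) \<notin> moduli"
    "norm (u $ 2 * u $ 1) \<notin> moduli" "norm (u $ 3 * u $ 1) \<notin> moduli" "norm (u $ 3 * u $ 2) \<notin> moduli"
    by (rule M[where e = "-2"] M[where e = "-6"] M[where e = 18] M[where e = "-4"] M[where e = 8] M[where e = 6]; simp add: E_def; fail)+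
  have d: "norm (u $ 1 / u $ 2) \<notin> moduli" "norm (u $ 1 / u $ 3) \<notin> moduli" "norm (u $ 2 / u $ 3) \<notin> moduli"
    "norm (u $ 2 / u $ 1) \<notin> moduli" "norm (u $ 3 / u $ 1) \<notin> moduli" "norm (u $ 3 / u $ 2) \<notin> moduli"
    by (rule D[where e = 2] D[where e = "-10"] D[where e = "-12"] D[where e = "-2"] D[where e = 10] D[where e = 12]; simp add: E_def; fail)+
  have m3: "norm (u $ a * u $ 3) \<notin> moduli" if "a \<in> {4,5,6,7,8}" for a
  proof (cases "a = 8")
    case True
    show ?thesis unfolding True by (rule M[where e = 4]) (simp_all add: E_def)
  next
    case False
    then show ?thesis using that by (intro M[where e = 9]) (auto simp: E_def)
  qed
  have "good \<epsilon> \<nu> u"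
  proof -
    have g1: "theta ((?T i)\<^sup>2) (q ^ r) \<noteq> 0" if "i \<in> {1,2,3}" for i
      using thM(1)[OF m(1)] thM(1)[OF m(2)] thM(1)[OF m(3)] that by (auto simp: power2_eq_square)
    have g2: "theta (?T i * ?T j) (q ^ r) \<noteq> 0 \<and> theta (?T i / ?T j) (q ^ r) \<noteq> 0"
      if "(i, j) \<in> {(1,2),(1,3),(2,1),(2,3),(3,1),(3,2)}" for i j
      using that m d thM(1) thD(1) by auto
    have g3: "theta (p * q * ?T i * ?T j) (q ^ r) \<noteq> 0 \<and> theta (p * q * ?T i / ?T j) (q ^ r) \<noteq> 0"
      if "(i, j) \<in> {(1,2),(1,3),(2,1),(2,3)}" for i j
      using that m d thM(2) thD(2) by auto
    have g4: "theta (?T a * ?T 3) (q ^ r) \<noteq> 0" if "a \<in> {4,5,6,7,8}" for a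
      using thM(1)[OF m3[OF that]] .
    have g5: "rg (u $ i * u $ 3) (\<nu> $ i + \<epsilon> + \<nu> $ 3) \<noteq> 0 \<and> rg (u $ i / u $ 3) (\<nu> $ i - \<nu> $ 3) \<noteq> 0" if "i \<in> {1,2}" for i
      using that m d u0 rg_nz by auto
    have g6: "norm (u $ 1) < norm (u $ 3)" "norm (u $ 2) < norm (u $ 3)"
      using s by (simp_all add: nu E_def)
    have g2': "\<forall>(i, j)\<in>{(1,2),(1,3),(2,1),(2,3),(3,1),(3,2)}. theta (?T i * ?T j) (q ^ r) \<noteq> 0 \<and> theta (?T i / ?T j) (q ^ r) \<noteq> 0"
      by (intro ballI case_prodI2) (rule g2, simp only:)
    have g3': "\<forall>(i, j)\<in>{(1,2),(1,3),(2,1),(2,3)}. theta (p * q * ?T i * ?T j) (q ^ r) \<noteq> 0 \<and> theta (p * q * ?T i / ?T j) (q ^ r) \<noteq> 0"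
      by (intro ballI case_prodI2) (rule g3, simp only:)
    show ?thesis unfolding good_def Let_def
      by (intro conjI g2' g3' g6; (intro allI ballI u0 ult g1 g4 g5; assumption)?)
  qed
  then show ?thesis using pr by blast
qed

lemma good_equation:
  assumes g: "good \<epsilon> \<nu> u" and pr: "(\<Prod>a\<in>UNIV. u $ a) = q\<^sup>2" and nu: "(\<Sum>a\<in>UNIV. \<nu> $ a) + 4 * \<epsilon> = 2"
  defines "t \<equiv> scale_at p 2 (scale_at p 1 u)" and "n \<equiv> dec_at 2 (dec_at 1 \<nu>)"
  shows "A_fun r p q (A_args qh \<epsilon> n t)
           * (U_fun r p q \<epsilon> (upd12 (n $ 1 - 1) (n $ 2 + 1) n) (upd12 (p * t $ 1) (inverse p * t $ 2) t)
              - U_fun r p q \<epsilon> n t)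
       + A_fun r p q (upd12 (A_args qh \<epsilon> n t $ 2) (A_args qh \<epsilon> n t $ 1) (A_args qh \<epsilon> n t))
           * (U_fun r p q \<epsilon> (upd12 (n $ 1 + 1) (n $ 2 - 1) n) (upd12 (inverse p * t $ 1) (p * t $ 2) t)
              - U_fun r p q \<epsilon> n t)
       + U_fun r p q \<epsilon> n t = 0"
proof -
  have "u \<in> surf (exp (2 * LQ))" using pr by (simp add: surf_def exp_double exp_LQ)
  \<comment> \<open>\<open>Exv_onto\<close> supplies logarithms with sum exactly
    \<open>2 * LQ\<close>, as the locale demands.\<close>
  then obtain l where l: "l \<in> hyp (2 * LQ)" "Exv l = u" using Exv_onto by blast
  note G = g[unfolded good_def Let_def]
  interpret S: rarefied_shifted r p q qh u l \<nu> \<epsilon>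
  proof
    show "u $ a = exp (l $ a)" for a using l(2) by auto
    show "norm (u $ a) < 1" for a using G by blast
    show "(\<Sum>a\<in>UNIV. l $ a) = 2 * LQ" using l(1) by (simp add: hyp_def)
  qed (rule nu)
  have ne: "1 \<noteq> (2::8)" by simp
  have tn: "S.shift2 1 2 = t" "S.nshift2 1 2 = n"
    unfolding t_def n_def S.shift2_scale_at[OF ne] S.nshift2_dec_at[OF ne] by (rule refl)+
  show ?thesis
  proof (rule S.equation_on_region[unfolded tn])
    show "norm (u $ 1) < norm (u $ 3)" "norm (u $ 2) < norm (u $ 3)" using G by blast+
    show "theta ((tau \<epsilon> (\<nu> $ i) (u $ i))\<^sup>2) (q ^ r) \<noteq> 0" if "i \<in> {1,2,3}" for i using G that by blast
    show "theta (tau \<epsilon> (\<nu> $ i) (u $ i) * tau \<epsilon> (\<nu> $ j) (u $ j)) (q ^ r) \<noteq> 0 \<and> theta (tau \<epsilon> (\<nu> $ i) (u $ i) / tau \<epsilon> (\<nu> $ j) (u $ j)) (q ^ r) \<noteq> 0"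
      if "i \<in> {1,2,3}" "j \<in> {1,2,3}" "i \<noteq> j" for i j
    proof -
      have "(i, j) \<in> {(1,2),(1,3),(2,1),(2,3),(3,1),(3,2)}" using that by auto
      then show ?thesis using G by blast
    qed
    show "theta (tau \<epsilon> (\<nu> $ a) (u $ a) * tau \<epsilon> (\<nu> $ 3) (u $ 3)) (q ^ r) \<noteq> 0" if "a \<in> {4,5,6,7,8}" for a using G that by blast
    show "th2 (q ^ r) (p * q * tau \<epsilon> (\<nu> $ i) (u $ i)) (tau \<epsilon> (\<nu> $ j) (u $ j)) \<noteq> 0" if "(i, j) \<in> {(1,2),(1,3),(2,1),(2,3)}" for i j
    proof -
      have "theta (p * q * tau \<epsilon> (\<nu> $ i) (u $ i) * tau \<epsilon> (\<nu> $ j) (u $ j)) (q ^ r) \<noteq> 0 \<and> theta (p * q * tau \<epsilon> (\<nu> $ i) (u $ i) / tau \<epsilon> (\<nu> $ j) (u $ j)) (q ^ r) \<noteq> 0"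
        using G that by blast
      then show ?thesis by (simp add: th2_def)
    qed
    show "pairg (u $ i) (\<nu> $ i) \<epsilon> (\<nu> $ 3) (u $ 3) \<noteq> 0" if "i \<in> {1,2}" for i
    proof -
      have "rg (u $ i * u $ 3) (\<nu> $ i + \<epsilon> + \<nu> $ 3) \<noteq> 0 \<and> rg (u $ i / u $ 3) (\<nu> $ i - \<nu> $ 3) \<noteq> 0" using G that by blast
      then show ?thesis by (simp add: pairg_def)
    qed
  qed
qed

section \<open>Meromorphic continuation of the equation\<close>

lemma mero_several_cong:
  assumes "mero_several f S" "\<And>t. t \<in> S \<Longrightarrow> f t = g t"
  shows "mero_several g S"
proof (rule mero_severalI)
  fix t assume "t \<in> S"
  obtain U a b where "open U" "t \<in> U" "holo_several a U" "holo_several b U" "S \<inter> U \<subseteq> closure {s \<in> S \<inter> U. b s \<noteq> 0}"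
    and ab: "\<forall>s\<in>S \<inter> U. b s \<noteq> 0 \<longrightarrow> f s = a s / b s"
    using mero_severalE[OF assms(1) \<open>t \<in> S\<close>] by blast
  moreover have "\<forall>s\<in>S \<inter> U. b s \<noteq> 0 \<longrightarrow> g s = a s / b s" using ab assms(2) by auto
  ultimately show "\<exists>U a b. open U \<and> t \<in> U \<and> holo_several a U \<and> holo_several b U \<and>
        S \<inter> U \<subseteq> closure {s \<in> S \<inter> U. b s \<noteq> 0} \<and> (\<forall>s\<in>S \<inter> U. b s \<noteq> 0 \<longrightarrow> g s = a s / b s)"
    by blast
qed

text \<open>An ambient open set that contains the hypersurface and on which the arguments of all
  theta and gamma functions stay nonzero.\<close>

definition torus :: "(complex ^ 8) set" where "torus = {t. \<forall>a. t $ a \<noteq> 0}"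

lemma open_torus: "open torus"
proof -
  have "torus = (\<Inter>a. {t. t $ a \<noteq> 0})" by (auto simp: torus_def)
  moreover have "open (\<Inter>a. {t :: complex ^ 8. t $ a \<noteq> 0})"
    by (intro open_INT finite ballI open_Collect_neq continuous_intros)
  ultimately show ?thesis by simp
qed

lemma balanced_torus: "balanced p q \<subseteq> torus" using balanced_nz by (auto simp: torus_def)

lemma mero_holo_comp:
  assumes "holo_several f torus" "\<And>t. t \<in> torus \<Longrightarrow> f t \<noteq> 0" "F holomorphic_on - {0}"
  shows "mero_several (\<lambda>t. F (f t)) (balanced p q)"
  by (rule mero_several_holo[OF holo_several_comp[OF assms(1,3)] open_torus balanced_torus]) (use assms(2) in auto)

lemma mero_divide: "mero_several f (balanced p q) \<Longrightarrow> mero_several g (balanced p q) \<Longrightarrow> mero_several (\<lambda>t. f t / g t) (balanced p q)"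
  unfolding balanced_surf by (rule mero_several_divide)

lemma mero_theta:
  assumes "holo_several f torus" "\<And>t. t \<in> torus \<Longrightarrow> f t \<noteq> 0"
  shows "mero_several (\<lambda>t. theta (f t) (q ^ r)) (balanced p q)"
  by (rule mero_holo_comp[OF assms theta_holo[OF qr_lt]]) auto

text \<open>The canonical form is a quotient of functions holomorphic on the punctured plane and
  agrees with \<open>rg\<close> at every nonzero point, so no exceptional set has to be
  tracked.\<close>

lemma mero_rg:
  assumes f: "holo_several f torus" "\<And>t. t \<in> torus \<Longrightarrow> f t \<noteq> 0"
  shows "mero_several (\<lambda>t. rg (f t) m) (balanced p q)"
proof -
  obtain C k m0 where c: "\<And>z. z \<noteq> 0 \<Longrightarrow> rg z m = C * z powi k * EE (r - m0) (p * q / z) / EE m0 z"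
    using rg_canonical[of m] by blast
  have 1: "(\<lambda>z. C * z powi k * EE (r - m0) (p * q / z)) holomorphic_on - {0}"
    by (intro holomorphic_intros holomorphic_on_compose_gen[OF _ EE_holo[of _ UNIV], unfolded o_def]) auto
  show ?thesis
    by (rule mero_several_cong[OF mero_divide[OF mero_holo_comp[OF f 1] mero_holo_comp[OF f EE_holo[of m0]]]])
       (use c f(2) balanced_torus in auto)
qed

lemma mero_A_fun:
  assumes x: "\<And>a. holo_several (\<lambda>t. x t $ a) torus" "\<And>t a. t \<in> torus \<Longrightarrow> x t $ a \<noteq> 0"
  shows "mero_several (\<lambda>t. A_fun r p q (x t)) (balanced p q)"
proof -
  have c: "p * q powi (1 - int r) \<noteq> 0" using p_nz q_nz by simp
  have m: "holo_several (\<lambda>t. x t $ a * x t $ b) torus" for a b by (intro holo_several_mult x)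
  have d: "holo_several (\<lambda>t. x t $ a / x t $ b) torus" for a b by (intro holo_several_divide x)
  have mc: "holo_several (\<lambda>t. x t $ a * x t $ b / (p * q powi (1 - int r))) torus" for a b
    by (intro holo_several_divide holo_several_mult holo_several_const x c)
  have dc: "holo_several (\<lambda>t. x t $ a / (p * q powi (1 - int r) * x t $ b)) torus" for a b
    by (intro holo_several_divide holo_several_mult holo_several_const x) (use c x(2) in auto)
  show ?thesis unfolding A_fun_def Let_def
    by (intro mero_several_mult mero_divide mero_several_prod mero_theta m d mc dc) (use c x(2) in auto)
qed

lemma mero_U_fun: "mero_several (U_fun r p q \<epsilon> n) (balanced p q)"
proof -
  have "mero_several (\<lambda>t. U_fun r p q \<epsilon> n t) (balanced p q)"
    unfolding U_fun_def
    by (intro mero_divide mero_several_prod mero_several_mult mero_rg V_fun_props(1) holo_several_mult holo_several_divide holo_several_nth)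
       (auto simp: torus_def)
  then show ?thesis .
qed

lemma mero_upd12:
  assumes "mero_several f (balanced p q)" "a * b = 1"
  shows "mero_several (\<lambda>t. f (upd12 (a * t $ 1) (b * t $ 2) t)) (balanced p q)"
proof -
  define c :: "complex ^ 8" where "c = upd12 a b 1"
  have "(\<Prod>i\<in>UNIV. c $ i) = 1" unfolding prod_8 c_def using assms(2) by (simp add: upd12_nth)
  moreover have "(\<chi> i. c $ i * t $ i) = upd12 (a * t $ 1) (b * t $ 2) t" for t by (auto simp: vec_eq_iff c_def upd12_nth)
  ultimately show ?thesis using mero_several_scale[OF assms(1)[unfolded balanced_surf], of c] unfolding balanced_surf by simp
qed

end

theorem mainTheorem9:
  fixes r :: nat and p q qh :: complex and \<epsilon> :: int and n :: "int ^ 8"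
  assumes "r > 0"
    and "p \<noteq> 0" and "norm p < 1" and "q \<noteq> 0" and "norm q < 1"
    and "\<epsilon> \<in> {0, 1}"
    and "(\<Sum>a\<in>UNIV. n $ a) + 4 * \<epsilon> = 0"
    and "qh\<^sup>2 = q"
  shows "mero_eq_on (balanced p q)
    (\<lambda>t. A_fun r p q (A_args qh \<epsilon> n t)
           * (U_fun r p q \<epsilon> (upd12 (n $ 1 - 1) (n $ 2 + 1) n) (upd12 (p * t $ 1) (inverse p * t $ 2) t)
              - U_fun r p q \<epsilon> n t)
       + A_fun r p q (upd12 (A_args qh \<epsilon> n t $ 2) (A_args qh \<epsilon> n t $ 1) (A_args qh \<epsilon> n t))
           * (U_fun r p q \<epsilon> (upd12 (n $ 1 + 1) (n $ 2 - 1) n) (upd12 (inverse p * t $ 1) (p * t $ 2) t)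
              - U_fun r p q \<epsilon> n t)
       + U_fun r p q \<epsilon> n t)
    (\<lambda>t. 0)"
proof -
  interpret rarefied r p q qh by standard (use assms in auto)
  let ?f = "\<lambda>t. A_fun r p q (A_args qh \<epsilon> n t)
           * (U_fun r p q \<epsilon> (upd12 (n $ 1 - 1) (n $ 2 + 1) n) (upd12 (p * t $ 1) (inverse p * t $ 2) t)
              - U_fun r p q \<epsilon> n t)
       + A_fun r p q (upd12 (A_args qh \<epsilon> n t $ 2) (A_args qh \<epsilon> n t $ 1) (A_args qh \<epsilon> n t))
           * (U_fun r p q \<epsilon> (upd12 (n $ 1 + 1) (n $ 2 - 1) n) (upd12 (inverse p * t $ 1) (p * t $ 2) t)
              - U_fun r p q \<epsilon> n t)
       + U_fun r p q \<epsilon> n t"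
  have A1: "mero_several (\<lambda>t. A_fun r p q (A_args qh \<epsilon> n t)) (balanced p q)"
    unfolding A_args_tau tau_def
    by (rule mero_A_fun) (auto simp: torus_def intro!: holo_several_mult holo_several_const holo_several_nth)
  have A2: "mero_several (\<lambda>t. A_fun r p q (upd12 (A_args qh \<epsilon> n t $ 2) (A_args qh \<epsilon> n t $ 1) (A_args qh \<epsilon> n t))) (balanced p q)"
  proof (rule mero_A_fun)
    fix a :: 8
    define b :: 8 where "b = (if a = 1 then 2 else if a = 2 then 1 else a)"
    have b: "upd12 (A_args qh \<epsilon> n t $ 2) (A_args qh \<epsilon> n t $ 1) (A_args qh \<epsilon> n t) $ a = t $ b * exp (- (of_int (n $ b) + of_int \<epsilon> / 2) * LQ)" for t
      by (simp add: upd12_nth b_def A_args_tau tau_def)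
    show "holo_several (\<lambda>t. upd12 (A_args qh \<epsilon> n t $ 2) (A_args qh \<epsilon> n t $ 1) (A_args qh \<epsilon> n t) $ a) torus"
      unfolding b by (intro holo_several_mult holo_several_const holo_several_nth)
    show "upd12 (A_args qh \<epsilon> n t $ 2) (A_args qh \<epsilon> n t $ 1) (A_args qh \<epsilon> n t) $ a \<noteq> 0" if "t \<in> torus" for t
      unfolding b using that by (simp add: torus_def)
  qed
  have mero: "mero_several ?f (balanced p q)"
    by (intro mero_several_add mero_several_mult mero_several_diff A1 A2 mero_U_fun mero_upd12) (use p_nz in auto)
  \<comment> \<open>Undoes the two decrements, which raises the sum from
    \<open>- 4 * \<epsilon>\<close> to \<open>2 - 4 * \<epsilon>\<close>.\<close>
  define \<nu> :: "int ^ 8" where "\<nu> = (\<chi> a. if a = 1 \<or> a = 2 then n $ a + 1 else n $ a)"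
  have n: "n = dec_at 2 (dec_at 1 \<nu>)" by (auto simp: vec_eq_iff dec_at_def \<nu>_def)
  have nu: "(\<Sum>a\<in>UNIV. \<nu> $ a) + 4 * \<epsilon> = 2"
  proof -
    have "(\<Sum>a\<in>UNIV. \<nu> $ a) = (\<Sum>a\<in>UNIV. n $ a) + 2" unfolding UNIV_8 by (simp add: \<nu>_def)
    then show ?thesis using assms(7) by simp
  qed
  \<comment> \<open>The passage from \<open>t\<close> back to \<open>u\<close>; the preimage of a
    neighbourhood of good parameters is the open set on which the equation is known.\<close>
  define D where "D = (\<lambda>t :: complex ^ 8. scale_at (1 / p) 2 (scale_at (1 / p) 1 t))"
  have D: "scale_at p 2 (scale_at p 1 (D t)) = t" "D (scale_at p 2 (scale_at p 1 t)) = t" for t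
    using p_nz by (auto simp: D_def vec_eq_iff scale_at_def)
  have prD: "(\<Prod>a\<in>UNIV. D t $ a) = (\<Prod>a\<in>UNIV. t $ a) / p\<^sup>2" for t
    unfolding prod_8 by (simp add: D_def scale_at_def power2_eq_square)
  obtain u0 where u0: "good \<epsilon> \<nu> u0" "(\<Prod>a\<in>UNIV. u0 $ a) = q\<^sup>2" using good_exists by blast
  obtain M' where M': "open M'" "u0 \<in> M'" "\<And>u. u \<in> M' \<Longrightarrow> good \<epsilon> \<nu> u"
    using good_eventually[OF u0(1)] unfolding eventually_nhds by blast
  define t0 where "t0 = scale_at p 2 (scale_at p 1 u0)"
  have "continuous_on UNIV D"
  proof -
    have "continuous_on UNIV (\<lambda>t. D t $ a)" for a
      unfolding D_def scale_at_def by (cases "a = 1"; cases "a = 2") (auto intro!: continuous_intros simp: p_nz)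
    then have "continuous_on UNIV (\<lambda>t. \<chi> a. D t $ a)" by (intro continuous_on_vec_lambda)
    then show ?thesis by simp
  qed
  then have op: "open (D -` M')" using M'(1) by (rule open_vimage[rotated])
  have t0: "t0 \<in> surf (exp Lb) \<inter> D -` M'"
  proof -
    have "(\<Prod>a\<in>UNIV. t0 $ a) / p\<^sup>2 = q\<^sup>2" using prD[of t0] u0(2) by (simp add: t0_def D(2))
    then have "(\<Prod>a\<in>UNIV. t0 $ a) = (p * q)\<^sup>2" using p_nz by (simp add: field_simps)
    then show ?thesis using M'(2) by (simp add: balanced_surf[symmetric] balanced_def D(2) t0_def)
  qed
  have "?f t = 0" if t: "t \<in> surf (exp Lb) \<inter> D -` M'" for t
  proof -
    have g: "good \<epsilon> \<nu> (D t)" using t M'(3) by auto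
    have "(\<Prod>a\<in>UNIV. D t $ a) = q\<^sup>2"
      unfolding prD using t p_nz by (simp add: balanced_surf[symmetric] balanced_def power_mult_distrib)
    from good_equation[OF g this nu, folded n, unfolded D(1)] show ?thesis .
  qed
  then show ?thesis using mero op t0 unfolding balanced_surf by (intro mero_eq_on_identity)
qed

end
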